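(* Let $m<\infty$ and let $\vartheta:\mathcal{R}_m\to\mathbb{C}$ be a $\mathbb{C}$-algebra homomorphism. Consider the specialised cyclotomic Yokonuma--Hecke algebra $\mathrm{Y}_\vartheta:=\mathbb{C}\otimes_{\mathcal{R}_m}\mathrm{Y}(d,m,n)$, defined via $\vartheta$ (that is, $\mathbb{C}$ is an $\mathcal{R}_m$-module via $\vartheta$). The algebra $\mathrm{Y}_\vartheta$ is (split) semisimple if and only if $\vartheta(P)\neq0$, where $$P=\prod_{1\leq k\leq n}\bigl(1+q^2+\cdots+q^{2(k-1)}\bigr)\prod_{1\leq s<t\leq m}\ \prod_{-n<l<n}\bigl(q^{2l}v_s-v_t\bigr).$$
   Context: Let $d,n,m\in\mathbb{Z}_{>0}$. Let $q,v_1,\ldots,v_m$ be indeterminates and $\mathcal{R}_m:=\mathbb{C}[q^{\pm1},v_1^{\pm1},\ldots,v_m^{\pm1}]$. The cyclotomic Yokonuma--Hecke algebra $\mathrm{Y}(d,m,n)$ is the associative $\mathcal{R}_m$-algebra generated by $t_1,\ldots,t_n,g_1,\ldots,g_{n-1},X_1^{\pm1}$ with relations: $g_ig_j=g_jg_i$ if $|i-j|>1$; $g_ig_{i+1}g_i=g_{i+1}g_ig_{i+1}$; $t_it_j=t_jt_i$; $t_jg_i=g_it_{s_i(j)}$ with $s_i=(i,i+1)$; $t_j^d=1$; $g_i^2=1+(q-q^{-1})e_ig_i$ with $e_i:=\frac1d\sum_{s=0}^{d-1}t_i^st_{i+1}^{-s}$; $X_1g_1X_1g_1=g_1X_1g_1X_1$;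 $X_1g_i=g_iX_1$ for $i\ge2$; $X_1t_j=t_jX_1$ for all $j$; and $(X_1-v_1)\cdots(X_1-v_m)=0$. *)

theory Defs
  imports
    "HOL-Library.Poly_Mapping"
    "HOL-Combinatorics.Transposition"
    "HOL-Algebra.QuotRing"
    "HOL-Algebra.Module"
    "HOL-Algebra.Algebraic_Closure_Type"
    "Jordan_Normal_Form.Matrix"
begin

(* These would shadow the record fields of the same names. *)
hide_const (open) Multiset.mult Polynomial.smult

text \<open>
  Laurent polynomials over the complex numbers are finitely supported functions on integer
  exponent vectors, with the convolution product of \<^theory>\<open>HOL-Library.Poly_Mapping\<close>.
  Index 0 stands for the variable q, index i with i > 0 for the variable v_i.
\<close>

type_synonym laurent = "(nat \<Rightarrow>\<^sub>0 int) \<Rightarrow>\<^sub>0 complex"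

definition laurent_ring :: "nat \<Rightarrow> laurent ring" where
  "laurent_ring m =
     ring_of_type_algebra
       \<lparr>carrier := {f. \<forall>e\<in>Poly_Mapping.keys f. Poly_Mapping.keys e \<subseteq> {0..m}}\<rparr>"

definition laurent_const :: "complex \<Rightarrow> laurent" where
  "laurent_const c = Poly_Mapping.single 0 c"

definition qpow :: "int \<Rightarrow> laurent" where
  "qpow k = Poly_Mapping.single (Poly_Mapping.single 0 k) 1"

definition vvar :: "nat \<Rightarrow> laurent" where
  "vvar i = Poly_Mapping.single (Poly_Mapping.single i 1) 1"

text \<open>
  Algebras are records of type \<^type>\<open>module\<close>, i.e. rings together with a scalar multiplication.
  (The locale \<^locale>\<open>algebra\<close> covers only commutative algebras.)

  The free algebra on a set G over a coefficient ring is the monoid algebra of the monoid of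
  words in G, whose operation (concatenation) is written additively so that the convolution
  product on finitely supported functions applies.
\<close>

datatype 'g word = Word (letters: "'g list")

instantiation word :: (type) monoid_add
begin

definition zero_word :: "'g word" where
  "zero_word = Word []"

definition plus_word :: "'g word \<Rightarrow> 'g word \<Rightarrow> 'g word" where
  "plus_word u w = Word (letters u @ letters w)"

instance
  by standard (simp_all add: zero_word_def plus_word_def)

end

definition gen :: "'g \<Rightarrow> 'g word \<Rightarrow>\<^sub>0 'r::comm_ring_1" where
  "gen x = Poly_Mapping.single (Word [x]) 1"

definition scal :: "'r::comm_ring_1 \<Rightarrow> 'g word \<Rightarrow>\<^sub>0 'r" where
  "scal r = Poly_Mapping.single 0 r"

definition free_algebra ::
  "'r::comm_ring_1 set \<Rightarrow> 'g set \<Rightarrow> ('r, 'g word \<Rightarrow>\<^sub>0 'r) module" where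
  "free_algebra R G =
     \<lparr>carrier = {f. \<forall>w\<in>Poly_Mapping.keys f. letters w \<in> lists G \<and> Poly_Mapping.lookup f w \<in> R},
      mult = (*), one = 1, zero = 0, add = (+), smult = (\<lambda>r f. scal r * f)\<rparr>"

definition quot_algebra :: "('r, 'a) module \<Rightarrow> 'a set \<Rightarrow> ('r, 'a set) module" where
  "quot_algebra A I =
     ring.extend (A Quot I) (module.fields (\<lambda>r U. \<Union>x\<in>U. (I +>\<^bsub>A\<^esub> (r \<odot>\<^bsub>A\<^esub> x))))"

definition presented_algebra ::
  "'r::comm_ring_1 set \<Rightarrow> 'g set \<Rightarrow> (('g word \<Rightarrow>\<^sub>0 'r) \<times> ('g word \<Rightarrow>\<^sub>0 'r)) set
     \<Rightarrow> ('r, ('g word \<Rightarrow>\<^sub>0 'r) set) module" where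
  "presented_algebra R G rels =
     (let F = free_algebra R G in quot_algebra F (Idl\<^bsub>F\<^esub> {a - b |a b. (a, b) \<in> rels}))"

datatype yh_gen = GT nat | GG nat | GX | GXinv

abbreviation yt :: "nat \<Rightarrow> yh_gen word \<Rightarrow>\<^sub>0 laurent" where "yt j \<equiv> gen (GT j)"
abbreviation yg :: "nat \<Rightarrow> yh_gen word \<Rightarrow>\<^sub>0 laurent" where "yg i \<equiv> gen (GG i)"
abbreviation yX :: "yh_gen word \<Rightarrow>\<^sub>0 laurent" where "yX \<equiv> gen GX"
abbreviation yXinv :: "yh_gen word \<Rightarrow>\<^sub>0 laurent" where "yXinv \<equiv> gen GXinv"

definition yh_gens :: "nat \<Rightarrow> yh_gen set" where
  "yh_gens n = GT ` {1..n} \<union> GG ` {1..<n} \<union> {GX, GXinv}"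

text \<open>
  In the idempotents e_i, the negative power of t with exponent -s, for 0 \<le> s < d, is written
  with the exponent d - s; the two agree modulo the relation that t has d-th power 1.
\<close>

definition yh_e :: "nat \<Rightarrow> nat \<Rightarrow> yh_gen word \<Rightarrow>\<^sub>0 laurent" where
  "yh_e d i = scal (laurent_const (1 / of_nat d)) * (\<Sum>s<d. yt i ^ s * yt (i + 1) ^ (d - s))"

definition yh_rels ::
  "nat \<Rightarrow> nat \<Rightarrow> nat \<Rightarrow> ((yh_gen word \<Rightarrow>\<^sub>0 laurent) \<times> (yh_gen word \<Rightarrow>\<^sub>0 laurent)) set" where
  "yh_rels d m n =
     {(yg i * yg j, yg j * yg i) |i j. i \<in> {1..<n} \<and> j \<in> {1..<n} \<and> \<bar>int i - int j\<bar> > 1}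
   \<union> {(yg i * yg (i + 1) * yg i, yg (i + 1) * yg i * yg (i + 1)) |i. 1 \<le> i \<and> i + 1 < n}
   \<union> {(yt i * yt j, yt j * yt i) |i j. i \<in> {1..n} \<and> j \<in> {1..n}}
   \<union> {(yt j * yg i, yg i * yt (transpose i (i + 1) j)) |i j. i \<in> {1..<n} \<and> j \<in> {1..n}}
   \<union> {(yt j ^ d, 1) |j. j \<in> {1..n}}
   \<union> {(yg i ^ 2, 1 + scal (qpow 1 - qpow (- 1)) * yh_e d i * yg i) |i. i \<in> {1..<n}}
   \<union> {(yX * yXinv, 1), (yXinv * yX, 1)}
   \<union> {(yX * yg 1 * yX * yg 1, yg 1 * yX * yg 1 * yX) |i::nat. i = 1 \<and> i \<in> {1..<n}}
   \<union> {(yX * yg i, yg i * yX) |i. i \<in> {2..<n}}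
   \<union> {(yX * yt j, yt j * yX) |j. j \<in> {1..n}}
   \<union> {(prod_list (map (\<lambda>k. yX - scal (vvar k)) [1..<m + 1]), 0)}"

definition yokonuma_hecke ::
  "nat \<Rightarrow> nat \<Rightarrow> nat \<Rightarrow> (laurent, (yh_gen word \<Rightarrow>\<^sub>0 laurent) set) module" where
  "yokonuma_hecke d m n =
     presented_algebra (carrier (laurent_ring m)) (yh_gens n) (yh_rels d m n)"

text \<open>
  Extension of scalars of an R-algebra B along a ring homomorphism \<phi> from R to S, i.e. the tensor
  product of S and B over R. The free abelian group on the pairs (s, b) is a ring (the monoid ring
  of the multiplicative monoid S \<times> B); the bilinearity and balancing relations generate an ideal,
  which is also just the additive subgroup they generate because the set of these relations is
  stable under multiplication by pairs.
\<close>

definition pair_ring :: "('s, 'c) ring_scheme \<Rightarrow> ('b, 'e) ring_scheme \<Rightarrow> ('s \<times> 'b \<Rightarrow>\<^sub>0 int) ring" where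
  "pair_ring S B =
     \<lparr>carrier = {x. Poly_Mapping.keys x \<subseteq> carrier S \<times> carrier B},
      mult = (\<lambda>x y. frag_extend (\<lambda>(s, b). frag_extend (\<lambda>(s', b').
                frag_of (s \<otimes>\<^bsub>S\<^esub> s', b \<otimes>\<^bsub>B\<^esub> b')) y) x),
      one = frag_of (\<one>\<^bsub>S\<^esub>, \<one>\<^bsub>B\<^esub>), zero = 0, add = (+)\<rparr>"

definition tensor_rels ::
  "('r, 'd) ring_scheme \<Rightarrow> ('s, 'c) ring_scheme \<Rightarrow> ('r \<Rightarrow> 's) \<Rightarrow> ('r, 'b) module
     \<Rightarrow> ('s \<times> 'b \<Rightarrow>\<^sub>0 int) set" where
  "tensor_rels R S \<phi> B =
     {frag_of (s \<oplus>\<^bsub>S\<^esub> s', b) - frag_of (s, b) - frag_of (s', b) |s s' b.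
        s \<in> carrier S \<and> s' \<in> carrier S \<and> b \<in> carrier B}
   \<union> {frag_of (s, b \<oplus>\<^bsub>B\<^esub> b') - frag_of (s, b) - frag_of (s, b') |s b b'.
        s \<in> carrier S \<and> b \<in> carrier B \<and> b' \<in> carrier B}
   \<union> {frag_of (s \<otimes>\<^bsub>S\<^esub> \<phi> r, b) - frag_of (s, r \<odot>\<^bsub>B\<^esub> b) |s r b.
        s \<in> carrier S \<and> r \<in> carrier R \<and> b \<in> carrier B}"

definition base_change ::
  "('r, 'd) ring_scheme \<Rightarrow> ('s, 'c) ring_scheme \<Rightarrow> ('r \<Rightarrow> 's) \<Rightarrow> ('r, 'b) module
     \<Rightarrow> ('s, ('s \<times> 'b \<Rightarrow>\<^sub>0 int) set) module" where
  "base_change R S \<phi> B =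
     (let F = pair_ring S B; I = Idl\<^bsub>F\<^esub> (tensor_rels R S \<phi> B); Q = F Quot I
      in ring.extend Q (module.fields (\<lambda>s U. (I +>\<^bsub>F\<^esub> frag_of (s, \<one>\<^bsub>B\<^esub>)) \<otimes>\<^bsub>Q\<^esub> U)))"

definition specialised_yokonuma_hecke ::
  "nat \<Rightarrow> nat \<Rightarrow> nat \<Rightarrow> (laurent \<Rightarrow> complex)
     \<Rightarrow> (complex, (complex \<times> (yh_gen word \<Rightarrow>\<^sub>0 laurent) set \<Rightarrow>\<^sub>0 int) set) module" where
  "specialised_yokonuma_hecke d m n \<theta> =
     base_change (laurent_ring m) (ring_of_type_algebra :: complex ring) \<theta> (yokonuma_hecke d m n)"

definition left_ideal :: "'a set \<Rightarrow> ('a, 'b) ring_scheme \<Rightarrow> bool" where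
  "left_ideal I A \<longleftrightarrow>
     additive_subgroup I A \<and> (\<forall>a\<in>carrier A. \<forall>x\<in>I. a \<otimes>\<^bsub>A\<^esub> x \<in> I)"

definition simple_left_ideal :: "'a set \<Rightarrow> ('a, 'b) ring_scheme \<Rightarrow> bool" where
  "simple_left_ideal L A \<longleftrightarrow>
     left_ideal L A \<and> L \<noteq> {\<zero>\<^bsub>A\<^esub>} \<and> (\<forall>J. left_ideal J A \<and> J \<subseteq> L \<longrightarrow> J = {\<zero>\<^bsub>A\<^esub>} \<or> J = L)"

text \<open>
  Semisimplicity: the left regular module is a direct sum of simple submodules. As it is generated
  by 1, finitely many summands always suffice. The case of the zero ring is included.
\<close>

definition semisimple_ring :: "('a, 'b) ring_scheme \<Rightarrow> bool" where
  "semisimple_ring A \<longleftrightarrow>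
     (\<exists>\<L>. finite \<L> \<and> (\<forall>L\<in>\<L>. simple_left_ideal L A) \<and>
        (\<forall>a\<in>carrier A. \<exists>!f. f \<in> (\<Pi>\<^sub>E L\<in>\<L>. L) \<and> finsum A f \<L> = a))"

text \<open>
  Split semisimple over the field k: isomorphic, as a k-algebra, to a finite product of matrix
  algebras over k. An element of the product is the list of its components.
\<close>

definition matrix_algebra_product :: "nat list \<Rightarrow> ('k::field, 'k mat list) module" where
  "matrix_algebra_product ks =
     \<lparr>carrier = {Ms. list_all2 (\<lambda>M k. M \<in> carrier_mat k k) Ms ks},
      mult = map2 (*), one = map 1\<^sub>m ks, zero = map (\<lambda>k. 0\<^sub>m k k) ks, add = map2 (+),
      smult = (\<lambda>c. map (\<lambda>M. c \<cdot>\<^sub>m M))\<rparr>"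

definition split_semisimple :: "('k::field, 'a) module \<Rightarrow> bool" where
  "split_semisimple A \<longleftrightarrow>
     (\<exists>ks. (\<forall>k\<in>set ks. k > 0) \<and>
        (\<exists>h\<in>ring_iso A (matrix_algebra_product ks :: ('k, 'k mat list) module).
           \<forall>c. \<forall>a\<in>carrier A.
             h (c \<odot>\<^bsub>A\<^esub> a) = c \<odot>\<^bsub>(matrix_algebra_product ks :: ('k, 'k mat list) module)\<^esub> h a))"

definition ss_poly :: "nat \<Rightarrow> nat \<Rightarrow> laurent" where
  "ss_poly m n =
     (\<Prod>k=1..n. \<Sum>i<k. qpow (2 * int i)) *
     (\<Prod>(s, t)\<in>{(s, t). 1 \<le> s \<and> s < t \<and> t \<le> m}.
        \<Prod>l\<in>{- int n<..<int n}. qpow (2 * l) * vvar s - vvar t)"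

end

theory Submission
  imports Defs
begin

text \<open>
  Suppose that P does not vanish. Splitting 1 by the joint eigenspaces of the commuting elements
  \<open>t\<^sub>1, \<dots>, t\<^sub>n\<close> and of the Jucys--Murphy elements (the multiplicative ones rescaled to
  \<open>(X - 1) / (q - 1 / q)\<close>, or the additive ones if \<open>q\<^sup>2 = 1\<close>) gives orthogonal idempotents indexed by
  weights, which behave like standard tableaux: adjacent entries differ, and the separation of the
  parameters makes the Jucys--Murphy elements diagonalisable step by step. The intertwiners between
  weight spaces satisfy the braid relations, and a product of intertwiners that returns to its weight
  is a scalar because it cannot interchange equal entries. Hence the idempotents are primitive with
  one-dimensional corners, they are either unlinked or isomorphic, and they yield matrix units.

  Conversely, each notion of semisimplicity writes 1 as a sum of generators of minimal left ideals.
  Each factor of P that vanishes contradicts this: two equal parameters give a representation in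
  which X has a Jordan block; a vanishing quantum factorial makes the q-symmetrizer square to zero
  although it acts non-trivially on words; and \<open>v\<^sub>t = q\<^sup>2\<^sup>l v\<^sub>s\<close> makes the character \<open>g \<mapsto> q, X \<mapsto> v\<^sub>s\<close> a
  quotient, but not a direct summand, of a representation on words in two letters.
\<close>

text \<open>The shape of the proof is dictated by q^2 = 1, where the multiplicative contents v
  q^(2c) no longer separate anything. With h = q - 1/q and X = 1 + h Y, conjugating X by the
  generators becomes the recursion Y_(i+1) = g_i Y_i g_i + e_i g_i, which keeps its meaning at h =
  0, and in both cases a content moves by y \<mapsto> q^2 y + q. One weight calculus therefore
  serves both cases. At h = 0 the elements Y_j forget X; but there the conjugates of X are permuted
  by the g_i exactly as the t_j are, so their eigenvalues can be added to the colours.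

  No basis theorem or dimension count enters. For sufficiency it is enough that normal forms span:
  linear independence is replaced by the fact that a non-vanishing product of intertwiners can be
  undone. For the same reason weights are never classified by tableaux; only those properties of
  tableaux are derived that an occurring weight must have, and whether a given weight occurs is
  never decided.

  For necessity, the t_j act by 1 in every representation that is used, so all obstructions already
  live in the quotient with one colour.\<close>

class complex_algebra = ring_1 +
  fixes cscale :: "complex \<Rightarrow> 'a \<Rightarrow> 'a" (infixr "\<star>" 75)
  assumes cscale_add_right: "c \<star> (x + y) = c \<star> x + c \<star> y"
    and cscale_add_left: "(c + c') \<star> x = c \<star> x + c' \<star> x"
    and cscale_cscale [simp]: "c \<star> c' \<star> x = (c * c') \<star> x"
    and cscale_one [simp]: "1 \<star> x = x"
    and cscale_mult_left [simp]: "(c \<star> x) * y = c \<star> (x * y)"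
    and cscale_mult_right [simp]: "x * (c \<star> y) = c \<star> (x * y)"
begin

lemma cscale_zero_left [simp]: "0 \<star> x = 0"
  using cscale_add_left[of 0 0 x] by simp

lemma cscale_zero_right [simp]: "c \<star> 0 = 0"
  using cscale_add_right[of c 0 0] by simp

lemma cscale_minus_left [simp]: "(- c) \<star> x = - (c \<star> x)"
  using cscale_add_left[of c "- c" x] by (simp add: eq_neg_iff_add_eq_0 add.commute)

lemma cscale_minus_right [simp]: "c \<star> (- x) = - (c \<star> x)"
  using cscale_add_right[of c x "- x"] by (simp add: eq_neg_iff_add_eq_0 add.commute)

lemma cscale_diff_right: "c \<star> (x - y) = c \<star> x - c \<star> y"
  using cscale_add_right[of c x "- y"] by simp

lemma cscale_diff_left: "(c - c') \<star> x = c \<star> x - c' \<star> x"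
  using cscale_add_left[of c "- c'" x] by simp

lemma cscale_sum_right: "c \<star> (\<Sum>i\<in>I. f i) = (\<Sum>i\<in>I. c \<star> f i)"
  by (induction I rule: infinite_finite_induct) (auto simp: cscale_add_right)

lemma cscale_sum_left: "(\<Sum>i\<in>I. f i) \<star> x = (\<Sum>i\<in>I. f i \<star> x)"
  by (induction I rule: infinite_finite_induct) (auto simp: cscale_add_left)

lemma cscale_eq_0_iff [simp]: "c \<star> x = 0 \<longleftrightarrow> c = 0 \<or> x = 0"
proof
  assume a: "c \<star> x = 0"
  show "c = 0 \<or> x = 0"
  proof (rule disjCI)
    assume "x \<noteq> 0"
    show "c = 0"
    proof (rule ccontr)
      assume "c \<noteq> 0"
      then have "x = inverse c \<star> (c \<star> x)" by simp
      with a \<open>x \<noteq> 0\<close> show False by simp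
    qed
  qed
qed auto

lemma cscale_cancel_right: "x \<noteq> 0 \<Longrightarrow> c \<star> x = c' \<star> x \<longleftrightarrow> c = c'"
  using cscale_eq_0_iff[of "c - c'" x] by (auto simp: cscale_diff_left)

end

lemmas cscale_distribs = cscale_add_right cscale_add_left cscale_diff_right cscale_diff_left

text \<open>Characters are treated as algebra homomorphisms into this instance.\<close>

instantiation complex :: complex_algebra
begin
definition cscale_complex :: "complex \<Rightarrow> complex \<Rightarrow> complex" where "cscale_complex = (*)"
instance by standard (auto simp: cscale_complex_def algebra_simps)
end

section \<open>Polynomials in an element and Lagrange projections\<close>

text \<open>Horner evaluation in which the coefficients act as central scalars, so that it makes
  sense at an element of a noncommutative algebra.\<close>

definition peval :: "'a::complex_algebra \<Rightarrow> complex poly \<Rightarrow> 'a" where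
  "peval z f = fold_coeffs (\<lambda>c r. c \<star> 1 + z * r) f 0"

lemma peval_0 [simp]: "peval z 0 = 0"
  by (simp add: peval_def)

lemma peval_pCons [simp]: "peval z (pCons c f) = c \<star> 1 + z * peval z f"
  by (cases "c = 0 \<and> f = 0") (auto simp: peval_def)

lemma peval_1 [simp]: "peval z 1 = 1"
  by (simp add: one_pCons)

lemma peval_add [simp]: "peval z (f + g) = peval z f + peval z g"
  by (induction f g rule: poly_induct2) (simp_all add: algebra_simps cscale_add_left)

lemma peval_smult [simp]: "peval z (Polynomial.smult c f) = c \<star> peval z f"
  by (induction f) (simp_all add: algebra_simps cscale_add_right)

lemma peval_minus [simp]: "peval z (- f) = - peval z f"
  using peval_add[of z f "- f"] by (simp add: eq_neg_iff_add_eq_0 add.commute)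

lemma peval_mult [simp]: "peval z (f * g) = peval z f * peval z g"
  by (induction f) (simp_all add: algebra_simps)

lemma peval_sum: "peval z (\<Sum>i\<in>I. f i) = (\<Sum>i\<in>I. peval z (f i))"
  by (induction I rule: infinite_finite_induct) auto

lemma peval_commute: "peval z f * peval z g = peval z g * peval z f"
  by (metis mult.commute peval_mult)

text \<open>Used with equal \<open>z\<close> and \<open>z'\<close> for commuting elements, and with
  different ones when a generator carries one Jucys--Murphy element, or one \<open>t j\<close>, to
  the next.\<close>

lemma peval_intertwine:
  assumes "x * z = z' * x"
  shows "x * peval z f = peval z' f * x"
proof (induction f)
  case (pCons c f)
  have "x * peval z (pCons c f) = c \<star> x + (x * z) * peval z f"
    by (simp add: distrib_left mult.assoc)
  also have "\<dots> = c \<star> x + z' * (x * peval z f)"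
    by (simp add: assms mult.assoc)
  also have "\<dots> = peval z' (pCons c f) * x"
    by (simp add: pCons.IH distrib_right mult.assoc)
  finally show ?case .
qed simp

lemma peval_eigen:
  assumes "z * a = y \<star> a"
  shows "peval z f * a = poly f y \<star> a"
proof (induction f)
  case (pCons c f)
  show ?case
    by (simp add: distrib_right mult.assoc pCons.IH assms cscale_add_left mult.commute)
qed simp

text \<open>Diagonalisability of z is always expressed as \<open>peval z (lin B) = 0\<close> for a
  finite B, and its local version, that a is a sum of eigenvectors of z, as
  \<open>peval z (lin B) * a = 0\<close>.\<close>

definition lin :: "complex set \<Rightarrow> complex poly" where
  "lin B = (\<Prod>b\<in>B. [:-b, 1:])"

lemma poly_lin_eq_0_iff: "finite B \<Longrightarrow> poly (lin B) x = 0 \<longleftrightarrow> x \<in> B"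
  by (auto simp: lin_def poly_prod prod_zero_iff)

lemma lin_insert: "finite B \<Longrightarrow> b \<notin> B \<Longrightarrow> lin (insert b B) = [:-b, 1:] * lin B"
  by (simp add: lin_def)

lemma lin_remove: "finite B \<Longrightarrow> b \<in> B \<Longrightarrow> lin B = [:-b, 1:] * lin (B - {b})"
  by (simp add: lin_def prod.remove)

lemma lin_empty [simp]: "lin {} = 1"
  by (simp add: lin_def)

lemma degree_lin: "finite B \<Longrightarrow> degree (lin B) = card B"
  by (simp add: lin_def degree_prod_eq_sum_degree)

lemma lin_dvd: "finite C \<Longrightarrow> B \<subseteq> C \<Longrightarrow> lin B dvd lin C"
  by (simp add: lin_def prod_dvd_prod_subset)

lemma peval_lin_subset:
  assumes "finite C" "B \<subseteq> C" "peval z (lin B) * a = 0"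
  shows "peval z (lin C) * a = 0"
proof -
  obtain r where "lin C = lin B * r" using lin_dvd[OF assms(1,2)] by (auto simp: dvd_def)
  then have "peval z (lin C) * a = peval z r * (peval z (lin B) * a)"
    by (simp add: mult.assoc[symmetric] peval_commute)
  then show ?thesis using assms(3) by simp
qed

definition lagr :: "complex set \<Rightarrow> complex \<Rightarrow> complex poly" where
  "lagr B b = Polynomial.smult (1 / poly (lin (B - {b})) b) (lin (B - {b}))"

lemma poly_lagr:
  assumes "finite B" "b \<in> B" "x \<in> B"
  shows "poly (lagr B b) x = (if x = b then 1 else 0)"
  using assms poly_lin_eq_0_iff[of "B - {b}" x] by (auto simp: lagr_def)

text \<open>Both sides have degree below \<open>card B\<close> and agree at the points of B.\<close>

lemma sum_lagr:
  assumes "finite B" "B \<noteq> {}"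
  shows "(\<Sum>b\<in>B. lagr B b) = 1"
proof (rule poly_eqI_degree[of B])
  show "poly (\<Sum>b\<in>B. lagr B b) x = poly 1 x" if "x \<in> B" for x
    using assms that by (simp add: poly_sum poly_lagr)
  have "degree (lagr B b) < card B" if "b \<in> B" for b
  proof -
    have "degree (lagr B b) \<le> card (B - {b})"
      unfolding lagr_def using degree_smult_le degree_lin[of "B - {b}"] assms by (metis finite_Diff)
    also have "\<dots> < card B" using assms that by (intro psubset_card_mono) auto
    finally show ?thesis .
  qed
  then show "degree (\<Sum>b\<in>B. lagr B b) < card B"
    using assms by (intro degree_sum_less) (auto simp: card_gt_0_iff)
  show "degree (1 :: complex poly) < card B" using assms by (simp add: card_gt_0_iff)
qed

lemma lagr_eigen:
  assumes "finite B" "b \<in> B" "peval z (lin B) * a = 0"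
  shows "z * (peval z (lagr B b) * a) = b \<star> (peval z (lagr B b) * a)"
proof -
  have "peval z [:-b, 1:] * (peval z (lin (B - {b})) * a) = 0"
    using assms lin_remove[OF assms(1,2)] by (simp only: peval_mult mult.assoc)
  then show ?thesis
    by (simp add: lagr_def algebra_simps)
qed

lemma lagr_decomp:
  assumes "finite B" "peval z (lin B) * a = 0"
  shows "a = (\<Sum>b\<in>B. peval z (lagr B b) * a)"
proof (cases "B = {}")
  case True
  then show ?thesis using assms by simp
next
  case False
  have "(\<Sum>b\<in>B. peval z (lagr B b) * a) = peval z (\<Sum>b\<in>B. lagr B b) * a"
    by (simp add: peval_sum sum_distrib_right)
  then show ?thesis using sum_lagr[OF assms(1) False] by simp
qed

text \<open>The defect u = z a - y a is an eigenvector for y. A squarefree polynomial in z, freed of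
  the factor z - y if it has one, kills u and at the same time acts on it by a non-zero scalar; so u
  = 0.\<close>

lemma no_jordan_block:
  assumes B: "finite B" "peval z (lin B) * a = 0"
    and sq: "z * (z * a - y \<star> a) = y \<star> (z * a - y \<star> a)"
  shows "z * a = y \<star> a"
proof -
  define u where "u = z * a - y \<star> a"
  have zu: "z * u = y \<star> u" using sq by (simp add: u_def)
  have u: "u = peval z [:-y, 1:] * a" by (simp add: u_def algebra_simps)
  have "u = 0"
  proof (cases "y \<in> B")
    case True
    have "0 = peval z (lin (B - {y})) * u"
      using B lin_remove[OF B(1) True] unfolding u mult.assoc[symmetric] peval_mult[symmetric]
      by (simp only: mult.commute)
    also have "\<dots> = poly (lin (B - {y})) y \<star> u" by (rule peval_eigen[OF zu])
    finally show ?thesis using poly_lin_eq_0_iff[of "B - {y}" y] B by auto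
  next
    case False
    have "0 = peval z [:-y, 1:] * (peval z (lin B) * a)" using B by simp
    also have "\<dots> = peval z (lin B) * u"
      by (simp add: u mult.assoc[symmetric] peval_commute del: peval_pCons)
    also have "\<dots> = poly (lin B) y \<star> u" by (rule peval_eigen[OF zu])
    finally show ?thesis using poly_lin_eq_0_iff[of B y] B False by auto
  qed
  then show ?thesis by (simp add: u_def)
qed

section \<open>Jucys--Murphy elements and weights\<close>

lemma mult_assoc_rule: "a * b = c \<Longrightarrow> a * (b * x) = c * (x::'a::semigroup_mult)"
  by (simp add: mult.assoc[symmetric])

lemma mult_commute3: "a * b = b * a \<Longrightarrow> a * c = c * a \<Longrightarrow> a * (b * c) = b * c * (a::'a::semigroup_mult)"
  by (metis mult.assoc)

text \<open>The elements t_j enter only through their spectral projections \<open>p j c\<close>, and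
  \<open>ee i j\<close> projects onto equal colours at i and j. The set of colours is left abstract
  because it is used twice: with d-th roots of unity, and, when h = 0, with pairs of such a root and
  an eigenvalue of X.\<close>

locale colored_hecke =
  fixes n :: nat and h :: complex and C :: "'c set"
    and p :: "nat \<Rightarrow> 'c \<Rightarrow> 'a::complex_algebra" and g :: "nat \<Rightarrow> 'a" and ee :: "nat \<Rightarrow> nat \<Rightarrow> 'a"
  defines "ee i j \<equiv> (\<Sum>c\<in>C. p i c * p j c)"
  assumes finite_C: "finite C"
    and p_idem: "\<lbrakk>i \<in> {1..n}; c \<in> C; c' \<in> C\<rbrakk> \<Longrightarrow> p i c * p i c' = (if c = c' then p i c else 0)"
    and p_comm: "\<lbrakk>i \<in> {1..n}; j \<in> {1..n}; c \<in> C; c' \<in> C\<rbrakk> \<Longrightarrow> p i c * p j c' = p j c' * p i c"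
    and p_sum: "i \<in> {1..n} \<Longrightarrow> (\<Sum>c\<in>C. p i c) = 1"
    and p_g: "\<lbrakk>1 \<le> i; i < n; j \<in> {1..n}; c \<in> C\<rbrakk> \<Longrightarrow> p j c * g i = g i * p (transpose i (Suc i) j) c"
    and g_far: "\<lbrakk>1 \<le> i; Suc i < j; j < n\<rbrakk> \<Longrightarrow> g i * g j = g j * g i"
    and g_braid: "\<lbrakk>1 \<le> i; Suc i < n\<rbrakk> \<Longrightarrow> g i * (g (Suc i) * g i) = g (Suc i) * (g i * g (Suc i))"
    and g_quad: "\<lbrakk>1 \<le> i; i < n\<rbrakk> \<Longrightarrow> g i * g i = 1 + h \<star> (ee i (Suc i) * g i)"
begin

lemma ee_g: "\<lbrakk>1 \<le> i; i < n; j \<in> {1..n}; k \<in> {1..n}\<rbrakk> \<Longrightarrow>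
    ee j k * g i = g i * ee (transpose i (Suc i) j) (transpose i (Suc i) k)"
  unfolding ee_def sum_distrib_left sum_distrib_right
proof (rule sum.cong[OF refl])
  fix c assume *: "1 \<le> i" "i < n" "j \<in> {1..n}" "k \<in> {1..n}" "c \<in> C"
  have "transpose i (Suc i) j \<in> {1..n}" using * by (auto simp: transpose_def)
  then show "p j c * p k c * g i = g i * (p (transpose i (Suc i) j) c * p (transpose i (Suc i) k) c)"
    using * p_g[of i k c] p_g[of i j c] by (simp add: mult.assoc) (simp add: mult.assoc[symmetric])
qed

lemma ee_sym: "\<lbrakk>j \<in> {1..n}; k \<in> {1..n}\<rbrakk> \<Longrightarrow> ee j k = ee k j"
  unfolding ee_def by (intro sum.cong) (auto simp: p_comm)

lemma p_ee: "\<lbrakk>i \<in> {1..n}; j \<in> {1..n}; k \<in> {1..n}; c \<in> C\<rbrakk> \<Longrightarrow> p i c * ee j k = ee j k * p i c"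
  unfolding ee_def sum_distrib_left sum_distrib_right
  by (intro sum.cong refl mult_commute3) (auto simp: p_comm)

lemma p_ee_same:
  assumes "i \<in> {1..n}" "j \<in> {1..n}" "c \<in> C"
  shows "ee i j * p i c = p i c * p j c" "ee i j * p j c = p i c * p j c"
proof -
  have *: "p i c' * p j c' * p i c = (if c' = c then p i c * p j c else 0)"
    "p i c' * p j c' * p j c = (if c' = c then p i c * p j c else 0)" if "c' \<in> C" for c'
  proof -
    have "p i c' * p j c' * p i c = p i c' * p i c * p j c'"
      using assms that p_comm[of j i c' c] by (simp add: mult.assoc)
    then show "p i c' * p j c' * p i c = (if c' = c then p i c * p j c else 0)"
      using assms that by (simp add: p_idem)
    show "p i c' * p j c' * p j c = (if c' = c then p i c * p j c else 0)"
      using assms that by (simp add: p_idem mult.assoc)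
  qed
  show "ee i j * p i c = p i c * p j c" "ee i j * p j c = p i c * p j c"
    unfolding ee_def sum_distrib_right using assms finite_C by (simp_all add: * sum.delta')
qed

text \<open>Either product is the projection onto equal colours at all three positions.\<close>

lemma ee_ee:
  assumes "i \<in> {1..n}" "j \<in> {1..n}" "k \<in> {1..n}"
  shows "ee i j * ee j k = ee j k * ee i k"
proof -
  have "ee i j * ee j k = (\<Sum>c\<in>C. p i c * p j c * p k c)"
    unfolding ee_def[of j k] sum_distrib_left
    using assms by (intro sum.cong refl) (simp add: mult.assoc[symmetric] p_ee_same(2))
  moreover have "ee j k * ee i k = (\<Sum>c\<in>C. p i c * p j c * p k c)"
    unfolding ee_def[of i k] sum_distrib_left
  proof (intro sum.cong refl)
    fix c assume c: "c \<in> C"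
    have "ee j k * (p i c * p k c) = (ee j k * p k c) * p i c"
      using assms c p_comm[of i k c c] by (simp add: mult.assoc)
    also have "\<dots> = p i c * (p j c * p k c)"
      using assms c mult_commute3[of "p i c" "p j c" "p k c"] by (simp add: p_ee_same p_comm[of i])
    finally show "ee j k * (p i c * p k c) = p i c * p j c * p k c" by (simp add: mult.assoc)
  qed
  ultimately show ?thesis by simp
qed

lemma g_far': "\<lbrakk>1 \<le> i; i < n; 1 \<le> j; j < n; Suc i < j \<or> Suc j < i\<rbrakk> \<Longrightarrow> g i * g j = g j * g i"
  using g_far[of i j] g_far[of j i] by auto

end

text \<open>Jucys--Murphy type sequences; both the multiplicative (\<open>\<kappa> = 0\<close>) and the additive
  (\<open>\<kappa> = 1\<close>) recursion occur below.\<close>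

locale jucys_murphy = colored_hecke n h C p g ee
  for n h C and p :: "nat \<Rightarrow> 'c \<Rightarrow> 'a::complex_algebra" and g ee +
  fixes \<kappa> :: complex and Z :: "nat \<Rightarrow> 'a"
  assumes Z1_p: "\<lbrakk>j \<in> {1..n}; c \<in> C\<rbrakk> \<Longrightarrow> Z (Suc 0) * p j c = p j c * Z (Suc 0)"
    and Z1_g: "\<lbrakk>2 \<le> i; i < n\<rbrakk> \<Longrightarrow> Z (Suc 0) * g i = g i * Z (Suc 0)"
    and Z_Suc: "\<lbrakk>1 \<le> i; i < n\<rbrakk> \<Longrightarrow> Z (Suc i) = g i * (Z i * g i) + \<kappa> \<star> (ee i (Suc i) * g i)"
    and Z1_Z2: "1 < n \<Longrightarrow> Z (Suc 0) * Z 2 = Z 2 * Z (Suc 0)"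
begin

lemma Z_p: "\<lbrakk>1 \<le> j; j \<le> n; k \<in> {1..n}; c \<in> C\<rbrakk> \<Longrightarrow> Z j * p k c = p k c * Z j"
proof (induction j arbitrary: k rule: nat_induct_at_least)
  case base
  then show ?case using Z1_p by simp
next
  case (Suc j)
  define k' where "k' = transpose j (Suc j) k"
  have k': "k' \<in> {1..n}" using Suc by (auto simp: k'_def transpose_def)
  have 1: "p k c * g j = g j * p k' c" "p k' c * g j = g j * p k c"
    using p_g[of j k c] p_g[of j k' c] Suc k' by (auto simp: k'_def)
  note 2 = 1[THEN mult_assoc_rule]
  have 3: "p k' c * Z j = Z j * p k' c" using Suc k' by simp
  note 4 = 3[THEN mult_assoc_rule]
  have 5: "p k c * ee j (Suc j) = ee j (Suc j) * p k c" using Suc by (intro p_ee) auto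
  have 6: "ee j (Suc j) * g j = g j * ee j (Suc j)"
    using ee_g[of j j "Suc j"] ee_sym[of j "Suc j"] Suc by simp
  have 8: "p k' c * ee j (Suc j) = ee j (Suc j) * p k' c" using Suc k' by (intro p_ee) auto
  \<comment> \<open>On the image of \<open>ee j (Suc j)\<close> the colours at j and j + 1 agree, so
    exchanging these positions in \<open>p\<close> has no effect.\<close>
  have 7: "ee j (Suc j) * p k c = ee j (Suc j) * p k' c"
    using Suc.hyps Suc.prems p_ee_same[of j "Suc j" c] by (cases "k = j"; cases "k = Suc j") (auto simp: k'_def)
  show ?case
    using Suc.hyps Suc.prems
    by (simp add: Z_Suc distrib_left distrib_right mult.assoc 1 2 3 4 5 8 6 7 5[THEN mult_assoc_rule] 6[THEN mult_assoc_rule])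
qed

lemma Z_ee: "\<lbrakk>1 \<le> j; j \<le> n; k \<in> {1..n}; l \<in> {1..n}\<rbrakk> \<Longrightarrow> Z j * ee k l = ee k l * Z j"
  unfolding ee_def sum_distrib_left sum_distrib_right
  by (intro sum.cong refl mult_commute3) (auto simp: Z_p)

text \<open>Writing g, g' for the two generators and e, e' for their idempotents, Z_(i+2) is g' g
  Z_i g g' plus \<kappa> times g' e g g' + e' g'. The first part commutes with g by the braid
  relation. In the second, the quadratic relation produces the same h-term whether g stands on the
  left or on the right, and the two remaining terms are exchanged.\<close>

lemma Z_g_step:
  assumes i: "1 \<le> i" "Suc (Suc i) \<le> n" and Zg: "Z i * g (Suc i) = g (Suc i) * Z i"
  shows "Z (Suc (Suc i)) * g i = g i * Z (Suc (Suc i))"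
proof -
  let ?g = "g i" and ?g' = "g (Suc i)"
  let ?e = "ee i (Suc i)" and ?e' = "ee (Suc i) (Suc (Suc i))" and ?e'' = "ee i (Suc (Suc i))"
  have e: "?e * ?g = ?g * ?e" "?e' * ?g' = ?g' * ?e'" "?e * ?g' = ?g' * ?e''"
    "?e' * ?g = ?g * ?e''" "?e'' * ?g = ?g * ?e'" "?e'' * ?g' = ?g' * ?e"
    using ee_g[of i i "Suc i"] ee_g[of "Suc i" "Suc i" "Suc (Suc i)"] ee_g[of "Suc i" i "Suc i"]
      ee_g[of i "Suc i" "Suc (Suc i)"] ee_g[of i i "Suc (Suc i)"] ee_g[of "Suc i" i "Suc (Suc i)"]
      ee_sym[of "Suc i" i] ee_sym[of "Suc (Suc i)" "Suc i"] i
    by (simp_all add: transpose_def)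
  note e' = e[THEN mult_assoc_rule]
  have q: "?g' * ?g' = 1 + h \<star> (?g' * ?e')" using g_quad[of "Suc i"] i e by simp
  have b: "?g * (?g' * ?g) = ?g' * (?g * ?g')" using g_braid[of i] i by simp
  have b': "?g * (?g' * (?g * x)) = ?g' * (?g * (?g' * x))" for x
    using b by (metis mult.assoc)
  have ee: "?e' * ?e'' = ?e * ?e'" using ee_ee[of i "Suc i" "Suc (Suc i)"] i by simp
  have 1: "?g * (?g' * (?g * (Z i * (?g * ?g')))) = ?g' * (?g * (Z i * (?g * (?g' * ?g))))"
    by (simp only: b b' Zg mult_assoc_rule[OF Zg] mult.assoc)
  have "?g' * (?e * (?g * (?g' * ?g))) = ?g' * ?g' * (?g * (?g' * ?e'))"
    by (simp add: e e' b b' mult.assoc mult_assoc_rule[OF b, simplified mult.assoc])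
  also have "\<dots> = ?g * (?g' * ?e') + h \<star> (?g' * (?g * (?g' * (?e * ?e'))))"
    by (simp add: q e e' distrib_right mult.assoc)
  finally have 3: "?g' * (?e * (?g * (?g' * ?g))) = \<dots>" .
  have "?g * (?g' * (?e * (?g * ?g'))) = ?g * (?g' * (?g * (?g' * ?e'')))"
    by (simp add: e e' mult.assoc)
  also have "\<dots> = ?g' * (?g * ((?g' * ?g') * ?e''))" by (simp only: b' mult.assoc)
  also have "\<dots> = ?g' * (?g * ?e'') + h \<star> (?g' * (?g * (?g' * (?e * ?e'))))"
    by (simp add: q ee distrib_right distrib_left mult.assoc)
  finally have 4: "?g * (?g' * (?e * (?g * ?g'))) = \<dots>" .
  have 2: "?g * (?g' * (?e * (?g * ?g')) + ?e' * ?g') = (?g' * (?e * (?g * ?g')) + ?e' * ?g') * ?g"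
    unfolding distrib_left distrib_right mult.assoc 3 4 by (simp add: e e' mult.assoc)
  show ?thesis
    using i 1 arg_cong[OF 2, of "cscale \<kappa>"] by (simp add: Z_Suc[of "Suc i"] Z_Suc[of i] distrib_left distrib_right mult.assoc cscale_distribs)
qed

lemma Z_g: "\<lbrakk>1 \<le> j; j \<le> n; 1 \<le> i; i < n; i \<noteq> j; Suc i \<noteq> j\<rbrakk> \<Longrightarrow> Z j * g i = g i * Z j"
proof (induction j arbitrary: i rule: less_induct)
  case (less j)
  show ?case
  proof (cases "j = 1")
    case True
    then show ?thesis using Z1_g less.prems by simp
  next
    case False
    then obtain k where k: "j = Suc k" "1 \<le> k" using less.prems by (cases j) auto
    show ?thesis
    proof (cases "Suc i = k")
      case True
      have "Z i * g k = g k * Z i" using less.IH[of i k] less.prems k True by simp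
      then show ?thesis using Z_g_step[of i] less.prems k True by simp
    next
      case False
      have 1: "g k * g i = g i * g k" using k less.prems False by (intro g_far') auto
      have 2: "Z k * g i = g i * Z k" using k less.prems False by (intro less.IH) auto
      have 3: "ee k (Suc k) * g i = g i * ee k (Suc k)"
        using ee_g[of i k "Suc k"] k less.prems False by (simp add: transpose_def)
      note 4 = 1 2 3 1[THEN mult_assoc_rule] 2[THEN mult_assoc_rule] 3[THEN mult_assoc_rule]
      show ?thesis using k less.prems by (simp add: Z_Suc distrib_left distrib_right mult.assoc 4)
    qed
  qed
qed

text \<open>Only the pair 1, 2 has to be assumed: \<open>Z 1\<close> passes through all later
  generators, and each further element is built from factors that already commute with
  \<open>Z j\<close>.\<close>

lemma Z_commute_less: "\<lbrakk>1 \<le> i; i < j; j \<le> n\<rbrakk> \<Longrightarrow> Z i * Z j = Z j * Z i"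
proof (induction i rule: nat_induct_at_least)
  case base
  have "1 < j \<Longrightarrow> j \<le> n \<Longrightarrow> Z 1 * Z j = Z j * Z 1"
  proof (induction j rule: less_induct)
    case (less j)
    show ?case
    proof (cases "j = 2")
      case True
      then show ?thesis using Z1_Z2 less.prems by simp
    next
      case False
      then obtain k where k: "j = Suc k" "2 \<le> k" using less.prems by (cases j) auto
      have 1: "Z 1 * g k = g k * Z 1" using k less.prems by (intro Z_g) auto
      have 2: "Z 1 * Z k = Z k * Z 1" using k less.prems by (intro less.IH) auto
      have 3: "Z 1 * ee k (Suc k) = ee k (Suc k) * Z 1" using k less.prems by (intro Z_ee) auto
      note 4 = 1 2 3 1[THEN mult_assoc_rule] 2[THEN mult_assoc_rule] 3[THEN mult_assoc_rule]
      show ?thesis using k less.prems 4 by (simp add: Z_Suc distrib_left distrib_right mult.assoc)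
    qed
  qed
  then show ?case using base by simp
next
  case (Suc i)
  have 1: "g i * Z j = Z j * g i" using Suc by (intro Z_g[symmetric]) auto
  have 2: "Z i * Z j = Z j * Z i" using Suc by simp
  have 3: "ee i (Suc i) * Z j = Z j * ee i (Suc i)" using Suc by (intro Z_ee[symmetric]) auto
  note 4 = 1 2 3 1[THEN mult_assoc_rule] 2[THEN mult_assoc_rule] 3[THEN mult_assoc_rule]
  show ?case using Suc 4 by (simp add: Z_Suc distrib_left distrib_right mult.assoc)
qed

lemma Z_commute: "\<lbrakk>1 \<le> i; i \<le> n; 1 \<le> j; j \<le> n\<rbrakk> \<Longrightarrow> Z i * Z j = Z j * Z i"
  using Z_commute_less[of i j] Z_commute_less[of j i] by (cases i j rule: linorder_cases) auto

end

text \<open>The term \<open>ee i (Suc i) * g i\<close> of the recursion is exactly what the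
  quadratic relation requires for 1 + h Y_(i+1) = g_i (1 + h Y_i) g_i. The map \<sigma> raises a
  content by one: 1 + h \<sigma>(y) = q^2 (1 + h y), and \<sigma>(y) = y + q if h = 0. The set
  \<open>Rt\<close> contains the contents at which a component may start; \<open>Rt_sep\<close>
  includes the case y = y' and so also separates a root from its own iterates.\<close>

locale weight_setting = jucys_murphy n h C p g ee 1 Y
  for n h C and p :: "nat \<Rightarrow> 'c \<Rightarrow> 'a::complex_algebra" and g ee Y +
  fixes q :: complex and Rt :: "complex set" and \<sigma> \<tau> :: "complex \<Rightarrow> complex"
  defines "\<sigma> y \<equiv> q^2 * y + q" and "\<tau> y \<equiv> (y - q) / q^2"
  assumes n_pos: "n > 0" and q_nz: "q \<noteq> 0" and h_q: "h = q - inverse q"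
    and finite_Rt: "finite Rt" and Y1_roots: "peval (Y (Suc 0)) (lin Rt) = 0"
    and Y1_inv: "\<exists>z. z * (1 + h \<star> Y (Suc 0)) = 1"
    and q_int_nz: "\<lbrakk>1 \<le> k; k \<le> n\<rbrakk> \<Longrightarrow> (\<Sum>i<k. q ^ (2 * i)) \<noteq> 0"
    and Rt_sep: "\<lbrakk>y \<in> Rt; y' \<in> Rt; 1 \<le> N; N < n\<rbrakk> \<Longrightarrow> (\<sigma> ^^ N) y \<noteq> y'"
begin

lemma \<sigma>_\<tau> [simp]: "\<sigma> (\<tau> y) = y" and \<tau>_\<sigma> [simp]: "\<tau> (\<sigma> y) = y"
  using q_nz by (auto simp: \<sigma>_def \<tau>_def)

lemma inj_\<sigma>: "inj \<sigma>"
  by (metis \<tau>_\<sigma> injI)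

text \<open>The displacement after k steps carries the k-th quantum integer as a factor. This turns
  \<open>q_int_nz\<close> into distinctness of contents at distance at most n, without a case
  distinction on h.\<close>

lemma sigma_pow: "(\<sigma> ^^ k) y - y = q * (\<Sum>i<k. q ^ (2 * i)) * (1 + h * y)"
proof (induction k)
  case (Suc k)
  define S where "S = (\<Sum>i<k. q ^ (2 * i))"
  have S: "S * (q^2 - 1) = q ^ (2*k) - 1"
    unfolding S_def using geometric_sum[of "q^2" k] by (cases "q^2 = 1") (simp_all add: power_mult)
  have "(\<sigma> ^^ k) y = y + q * S * (1 + h * y)" using Suc by (simp add: S_def algebra_simps)
  then have "(\<sigma> ^^ Suc k) y = q^2 * (y + q * S * (1 + h * y)) + q" by (simp add: \<sigma>_def)
  also have "\<dots> = y + (q^2 - 1) * y + q + q * (1 + h * y) * (S + S * (q^2 - 1))" by (simp add: algebra_simps)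
  also have "\<dots> = y + q * (S + q^(2*k)) * (1 + h * y) + ((q^2 - 1) * y + q - q * (1 + h * y))"
    unfolding S by (simp add: algebra_simps)
  also have "(q^2 - 1) * y + q - q * (1 + h * y) = 0"
    using q_nz by (simp add: h_q field_simps power2_eq_square)
  finally show ?case by (simp add: S_def algebra_simps)
qed simp

lemma sigma_pow_neq:
  assumes "1 + h * y \<noteq> 0" "1 \<le> k" "k \<le> n"
  shows "(\<sigma> ^^ k) y \<noteq> y"
  using sigma_pow[of k y] q_nz q_int_nz[of k] assms by auto

lemma Y_Suc: "\<lbrakk>1 \<le> i; i < n\<rbrakk> \<Longrightarrow> Y (Suc i) = g i * (Y i * g i) + ee i (Suc i) * g i"
  using Z_Suc[of i] by simp

lemma ee_idem: assumes "1 \<le> i" "i < n" shows "ee i (Suc i) * ee i (Suc i) = ee i (Suc i)"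
proof -
  have "ee i (Suc i) * ee i (Suc i) = (\<Sum>c\<in>C. ee i (Suc i) * p i c * p (Suc i) c)"
    by (subst (2) ee_def) (simp add: sum_distrib_left mult.assoc)
  also have "\<dots> = (\<Sum>c\<in>C. p i c * p (Suc i) c)"
    using assms by (intro sum.cong refl) (simp add: p_ee_same mult.assoc p_idem)
  finally show ?thesis by (simp add: ee_def)
qed

lemma ee_g_self: "\<lbrakk>1 \<le> i; i < n\<rbrakk> \<Longrightarrow> ee i (Suc i) * g i = g i * ee i (Suc i)"
  using ee_g[of i i "Suc i"] ee_sym[of i "Suc i"] by simp

lemma Y_ee: "\<lbrakk>1 \<le> i; i < n; 1 \<le> j; j \<le> n\<rbrakk> \<Longrightarrow> ee i (Suc i) * Y j = Y j * ee i (Suc i)"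
  using Z_ee[of j i "Suc i"] by simp

text \<open>Bernstein's relation for X = 1 + h Y with one factor h cancelled; the correction term
  survives at h = 0, where it becomes \<open>ee i (Suc i)\<close>.\<close>

lemma Yg:
  assumes "1 \<le> i" "i < n"
  shows "Y (Suc i) * g i = g i * Y i + ee i (Suc i) * (1 + h \<star> Y (Suc i))"
    and "g i * Y (Suc i) = Y i * g i + ee i (Suc i) * (1 + h \<star> Y (Suc i))"
proof -
  note c = ee_g_self[OF assms] Y_ee[OF assms, of i] ee_idem[OF assms] g_quad[OF assms]
  note c' = c[THEN mult_assoc_rule]
  have i: "1 \<le> i" "i \<le> n" "1 \<le> Suc i" "Suc i \<le> n" using assms by auto
  show "Y (Suc i) * g i = g i * Y i + ee i (Suc i) * (1 + h \<star> Y (Suc i))"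
    using assms c c' i by (simp add: Y_Suc distrib_left distrib_right mult.assoc cscale_distribs)
  show "g i * Y (Suc i) = Y i * g i + ee i (Suc i) * (1 + h \<star> Y (Suc i))"
    using assms c c' i by (simp add: Y_Suc distrib_left distrib_right mult.assoc cscale_distribs)
qed

text \<open>Invertibility propagates through 1 + h Y_(i+1) = g_i (1 + h Y_i) g_i. It serves to
  exclude, in \<open>wv_pos\<close>, the content with 1 + h y = 0, which \<sigma> would fix.\<close>

lemma Y_inv: "\<lbrakk>1 \<le> j; j \<le> n\<rbrakk> \<Longrightarrow> \<exists>z. z * (1 + h \<star> Y j) = 1"
proof (induction j rule: nat_induct_at_least)
  case base
  then show ?case using Y1_inv by simp
next
  case (Suc i)
  then obtain z where z: "z * (1 + h \<star> Y i) = 1" by auto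
  have i: "1 \<le> i" "i < n" using Suc by auto
  define g' where "g' = g i - h \<star> ee i (Suc i)"
  have g': "g' * g i = 1" using g_quad[OF i] by (simp add: g'_def left_diff_distrib)
  have "1 + h \<star> Y (Suc i) = g i * ((1 + h \<star> Y i) * g i)"
    using g_quad[OF i] by (simp add: Y_Suc[OF i] cscale_distribs algebra_simps)
  then have "(g' * (z * g')) * (1 + h \<star> Y (Suc i)) = g' * (z * ((g' * g i) * ((1 + h \<star> Y i) * g i)))"
    by (simp add: mult.assoc)
  also have "\<dots> = g' * ((z * (1 + h \<star> Y i)) * g i)" by (simp add: g' mult.assoc)
  also have "\<dots> = 1" by (simp add: z g')
  finally show ?case by blast
qed

text \<open>The ambient module is the algebra itself under left multiplication. All colours are
  prescribed but only the first k eigenvalues of Jucys--Murphy elements, because these are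
  diagonalised one at a time; beyond k the second components of w are arbitrary.\<close>

definition wv :: "nat \<Rightarrow> (nat \<Rightarrow> 'c \<times> complex) \<Rightarrow> 'a \<Rightarrow> bool" where
  "wv k w a \<longleftrightarrow> (\<forall>j\<in>{1..n}. fst (w j) \<in> C \<and> p j (fst (w j)) * a = a) \<and>
     (\<forall>j\<in>{1..k}. Y j * a = snd (w j) \<star> a)"

definition wts :: "nat \<Rightarrow> (nat \<Rightarrow> 'c \<times> complex) set" where
  "wts k = {w. \<exists>a. a \<noteq> 0 \<and> wv k w a}"

abbreviation sw :: "nat \<Rightarrow> (nat \<Rightarrow> 'c \<times> complex) \<Rightarrow> nat \<Rightarrow> 'c \<times> complex" where
  "sw i w \<equiv> \<lambda>j. w (transpose i (Suc i) j)"

text \<open>The scalar that must be subtracted from \<open>g i\<close> to obtain an intertwiner on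
  the weight w. The denominator vanishes only if the adjacent entries are equal, which
  \<open>wts_adjacent\<close> rules out.\<close>

definition rc :: "nat \<Rightarrow> (nat \<Rightarrow> 'c \<times> complex) \<Rightarrow> complex" where
  "rc i w = (if fst (w i) = fst (w (Suc i)) then (1 + h * snd (w (Suc i))) / (snd (w (Suc i)) - snd (w i)) else 0)"

lemma wv_mult_right: "wv k w a \<Longrightarrow> wv k w (a * b)"
  by (auto simp: wv_def mult.assoc[symmetric])

lemma wv_p: "\<lbrakk>wv k w a; j \<in> {1..n}; c \<in> C\<rbrakk> \<Longrightarrow> p j c * a = (if c = fst (w j) then a else 0)"
proof -
  assume *: "wv k w a" "j \<in> {1..n}" "c \<in> C"
  then have "p j c * a = p j c * p j (fst (w j)) * a" by (simp add: wv_def mult.assoc)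
  also have "\<dots> = (if c = fst (w j) then p j (fst (w j)) * a else 0)"
    using * by (simp add: p_idem wv_def)
  finally show ?thesis using * by (simp add: wv_def)
qed

lemma wv_ee: 
  assumes "wv k w a" "i \<in> {1..n}" "j \<in> {1..n}"
  shows "ee i j * a = (if fst (w i) = fst (w j) then a else 0)"
proof -
  have "ee i j * a = (\<Sum>c\<in>C. if c = fst (w j) then (if c = fst (w i) then a else 0) else 0)"
    unfolding ee_def sum_distrib_right
    using wv_p[OF assms(1,2)] wv_p[OF assms(1,3)] by (intro sum.cong refl) (auto simp: mult.assoc)
  also have "\<dots> = (if fst (w i) = fst (w j) then a else 0)"
    using assms finite_C by (auto simp: wv_def sum.delta)
  finally show ?thesis .
qed

lemma wv_pos: "wv k w a \<Longrightarrow> a \<noteq> 0 \<Longrightarrow> 1 \<le> j \<Longrightarrow> j \<le> k \<Longrightarrow> k \<le> n \<Longrightarrow> 1 + h * snd (w j) \<noteq> 0"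
proof
  assume *: "wv k w a" "a \<noteq> 0" "1 \<le> j" "j \<le> k" "k \<le> n" "1 + h * snd (w j) = 0"
  obtain z where z: "z * (1 + h \<star> Y j) = 1" using Y_inv[of j] * by auto
  have "(1 + h \<star> Y j) * a = (1 + h * snd (w j)) \<star> a"
    using *(1,3,4) by (simp add: wv_def distrib_right cscale_distribs)
  then have "(z * (1 + h \<star> Y j)) * a = 0" using * by (simp add: mult.assoc)
  then show False using z * by simp
qed

lemma rc_sum:
  assumes "fst (w i) = fst (w (Suc i))" "w i \<noteq> w (Suc i)"
  shows "rc i w + rc i (sw i w) = h"
proof -
  have "snd (w i) \<noteq> snd (w (Suc i))" using assms by (metis prod.collapse)
  then have ne: "snd (w (Suc i)) - snd (w i) \<noteq> 0" by simp
  have "(1 + h * snd (w i)) / (snd (w i) - snd (w (Suc i))) = - ((1 + h * snd (w i)) / (snd (w (Suc i)) - snd (w i)))"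
    by (metis minus_diff_eq minus_divide_right)
  then have "(1 + h * snd (w (Suc i))) / (snd (w (Suc i)) - snd (w i)) + (1 + h * snd (w i)) / (snd (w i) - snd (w (Suc i)))
      = (h * (snd (w (Suc i)) - snd (w i))) / (snd (w (Suc i)) - snd (w i))"
    by (simp add: diff_divide_distrib[symmetric] right_diff_distrib)
  also have "\<dots> = h" using ne by simp
  finally have "(1 + h * snd (w (Suc i))) / (snd (w (Suc i)) - snd (w i)) + (1 + h * snd (w i)) / (snd (w i) - snd (w (Suc i))) = h" .
  then show ?thesis using assms by (simp add: rc_def)
qed

text \<open>The numerator factors: q^2 ((y' - y)^2 - (1 + h y)(1 + h y')) is -(\<sigma> y' -
  y)(\<sigma> y - y'). Hence the square of the intertwiner can vanish only between neighbouring
  contents.\<close>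

lemma rc_prod:
  assumes "fst (w i) = fst (w (Suc i))" "w i \<noteq> w (Suc i)"
    "snd (w (Suc i)) \<noteq> \<sigma> (snd (w i))" "snd (w i) \<noteq> \<sigma> (snd (w (Suc i)))"
  shows "1 + rc i w * rc i (sw i w) \<noteq> 0"
proof -
  define y y' where "y = snd (w i)" and "y' = snd (w (Suc i))"
  have ne: "y \<noteq> y'" using assms by (metis prod.collapse y_def y'_def)
  have "rc i w * rc i (sw i w) = - ((1 + h * y) * (1 + h * y') / (y' - y)^2)"
    using assms(1) ne by (simp add: rc_def y_def y'_def divide_simps) (simp add: algebra_simps power2_eq_square)
  moreover have "q^2 * ((y' - y)^2 - (1 + h * y) * (1 + h * y')) = - ((\<sigma> y' - y) * (\<sigma> y - y'))"
  proof -
    have "q * (1 + h * z) = q + (q^2 - 1) * z" for z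
      using q_nz by (simp add: h_q power2_eq_square algebra_simps)
    then have "q^2 * ((1 + h * y) * (1 + h * y')) = (q + (q^2 - 1) * y) * (q + (q^2 - 1) * y')"
      by (metis (no_types, lifting) mult.assoc mult.left_commute power2_eq_square)
    then show ?thesis unfolding right_diff_distrib \<sigma>_def by (simp add: power2_eq_square algebra_simps)
  qed
  moreover have "(\<sigma> y' - y) * (\<sigma> y - y') \<noteq> 0" using assms by (auto simp: y_def y'_def)
  ultimately have A: "rc i w * rc i (sw i w) = - ((1 + h * y) * (1 + h * y') / (y' - y)^2)"
    and B: "(y' - y)^2 - (1 + h * y) * (1 + h * y') \<noteq> 0" by auto
  show ?thesis
  proof
    assume "1 + rc i w * rc i (sw i w) = 0"
    then have "(1 + h * y) * (1 + h * y') / (y' - y)^2 = 1" unfolding A by simp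
    then show False using B ne by simp
  qed
qed

text \<open>By \<open>Yg\<close>, both Y_i and Y_(i+1) act triangularly on a and
  \<open>g i * a\<close>, with common off-diagonal coefficient up to sign; subtracting
  \<open>rc i w \<star> a\<close> diagonalises them simultaneously. The second claim combines
  \<open>g_quad\<close> with \<open>rc_sum\<close>.\<close>

lemma wv_sw:
  assumes wv: "wv k w a" and i: "1 \<le> i" "Suc i \<le> k" "k \<le> n" and ne: "w i \<noteq> w (Suc i)"
  shows "wv k (sw i w) (g i * a - rc i w \<star> a)"
    and "g i * (g i * a - rc i w \<star> a) - rc i (sw i w) \<star> (g i * a - rc i w \<star> a)
      = (1 + rc i w * rc i (sw i w)) \<star> a"
proof -
  have i': "1 \<le> i" "i < n" using i by auto
  let ?y = "snd (w i)" and ?y' = "snd (w (Suc i))" and ?r = "rc i w"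
  have Ya: "Y i * a = ?y \<star> a" "Y (Suc i) * a = ?y' \<star> a"
    using wv i by (auto simp: wv_def)
  have ea: "ee i (Suc i) * a = (if fst (w i) = fst (w (Suc i)) then a else 0)"
    using wv_ee[OF wv, of i "Suc i"] i by auto
  have r: "(if fst (w i) = fst (w (Suc i)) then 1 + h * ?y' else 0) = ?r * (?y' - ?y)"
    using ne by (auto simp: rc_def prod_eq_iff)
  have e1: "ee i (Suc i) * (1 + h \<star> Y (Suc i)) * a = (?r * (?y' - ?y)) \<star> a"
    unfolding r[symmetric] by (simp add: distrib_left distrib_right mult.assoc Ya ea cscale_distribs)
  have Y1: "Y (Suc i) * (g i * a) = ?y \<star> (g i * a) + (?r * (?y' - ?y)) \<star> a"
    using arg_cong[OF Yg(1)[OF i'], of "\<lambda>x. x * a"] Ya e1 by (simp add: distrib_right mult.assoc)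
  have Y2: "Y i * (g i * a) = ?y' \<star> (g i * a) - (?r * (?y' - ?y)) \<star> a"
    using arg_cong[OF Yg(2)[OF i'], of "\<lambda>x. x * a"] Ya e1 by (simp add: distrib_right mult.assoc eq_diff_eq)
  show "wv k (sw i w) (g i * a - ?r \<star> a)"
    unfolding wv_def
  proof (intro conjI ballI)
    fix j assume j: "j \<in> {1..n}"
    have j': "transpose i (Suc i) j \<in> {1..n}" using j i by (auto simp: transpose_def)
    show c: "fst (sw i w j) \<in> C" using wv j' by (auto simp: wv_def)
    have "p j (fst (sw i w j)) * (g i * a) = g i * (p (transpose i (Suc i) j) (fst (sw i w j)) * a)"
      using p_g[OF i' j c] by (metis mult.assoc)
    also have "\<dots> = g i * a" using wv j' by (simp add: wv_def)
    moreover have "p j (fst (sw i w j)) * (?r \<star> a) = ?r \<star> a"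
      using wv_p[OF wv j c] by (auto simp: rc_def transpose_def)
    ultimately show "p j (fst (sw i w j)) * (g i * a - ?r \<star> a) = g i * a - ?r \<star> a"
      by (simp add: right_diff_distrib)
  next
    fix j assume j: "j \<in> {1..k}"
    consider "j = i" | "j = Suc i" | "j \<noteq> i" "j \<noteq> Suc i" by blast
    then show "Y j * (g i * a - ?r \<star> a) = snd (sw i w j) \<star> (g i * a - ?r \<star> a)"
    proof cases
      case 1
      then show ?thesis using Ya Y2 by (simp add: right_diff_distrib cscale_distribs algebra_simps)
    next
      case 2
      then show ?thesis using Ya Y1 by (simp add: right_diff_distrib cscale_distribs algebra_simps)
    next
      case 3
      have "Y j * g i = g i * Y j" using 3 j i by (intro Z_g) auto
      then have "Y j * (g i * a) = snd (w j) \<star> (g i * a)"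
        using wv j by (simp add: mult_assoc_rule mult.assoc wv_def)
      then show ?thesis using 3 wv j by (simp add: right_diff_distrib cscale_distribs wv_def mult.commute)
    qed
  qed
  have gg: "g i * (g i * a) = a + h \<star> (ee i (Suc i) * (g i * a))"
    using arg_cong[OF g_quad[OF i'], of "\<lambda>x. x * a"] by (simp add: distrib_right mult.assoc)
  have eg: "ee i (Suc i) * (g i * a) = g i * (ee i (Suc i) * a)"
    using ee_g_self[OF i'] by (metis mult.assoc)
  show "g i * (g i * a - ?r \<star> a) - rc i (sw i w) \<star> (g i * a - ?r \<star> a) = (1 + ?r * rc i (sw i w)) \<star> a"
  proof (cases "fst (w i) = fst (w (Suc i))")
    case True
    have h: "h \<star> (g i * a) = ?r \<star> (g i * a) + rc i (sw i w) \<star> (g i * a)"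
      using cscale_add_left[of ?r "rc i (sw i w)" "g i * a"] rc_sum[OF True ne] by simp
    show ?thesis
      using True by (simp add: right_diff_distrib gg eg ea h cscale_distribs) (simp add: mult.commute)
  next
    case False
    then show ?thesis by (simp add: right_diff_distrib gg eg ea cscale_distribs rc_def)
  qed
qed

end

section \<open>Weights as sequences of contents: adjacency, neighbours and roots\<close>

context weight_setting
begin

definition diagz :: "nat \<Rightarrow> bool" where
  "diagz k \<longleftrightarrow> (\<forall>j\<in>{1..k}. \<exists>B. finite B \<and> peval (Y j) (lin B) = 0)"

lemma diagzD: "diagz k \<Longrightarrow> 1 \<le> j \<Longrightarrow> j \<le> k \<Longrightarrow> \<exists>B. finite B \<and> peval (Y j) (lin B) = 0"
  by (simp add: diagz_def)

lemma wtsI: "wv k w a \<Longrightarrow> a \<noteq> 0 \<Longrightarrow> w \<in> wts k"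
  by (auto simp: wts_def)

text \<open>With equal entries, \<open>Yg\<close> makes \<open>Y i\<close> act on
  \<open>g i * a\<close> with the off-diagonal term -(1 + h y) a. As \<open>Y i\<close> is
  diagonalisable, \<open>no_jordan_block\<close> forces this term to vanish, contrary to
  \<open>wv_pos\<close>.\<close>

lemma wts_adjacent:
  assumes D: "diagz k" and w: "w \<in> wts k" and i: "1 \<le> i" "Suc i \<le> k" "k \<le> n"
  shows "w i \<noteq> w (Suc i)"
proof
  assume eq: "w i = w (Suc i)"
  obtain a where a: "a \<noteq> 0" "wv k w a" using w by (auto simp: wts_def)
  obtain B where B: "finite B" "peval (Y i) (lin B) = 0" using diagzD[OF D, of i] i by auto
  have i': "1 \<le> i" "i < n" using i by auto
  let ?y = "snd (w i)"
  have Ya: "Y i * a = ?y \<star> a" "Y (Suc i) * a = ?y \<star> a"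
    using a i eq by (auto simp: wv_def)
  have ea: "ee i (Suc i) * a = a" using wv_ee[OF a(2), of i "Suc i"] i eq by auto
  have "ee i (Suc i) * (1 + h \<star> Y (Suc i)) * a = (1 + h * ?y) \<star> a"
    by (simp add: distrib_left distrib_right mult.assoc Ya ea cscale_distribs)
  then have 1: "Y i * (g i * a) = ?y \<star> (g i * a) - (1 + h * ?y) \<star> a"
    using arg_cong[OF Yg(2)[OF i'], of "\<lambda>x. x * a"] Ya by (simp add: distrib_right mult.assoc eq_diff_eq)
  have "Y i * (g i * a) = ?y \<star> (g i * a)"
  proof (rule no_jordan_block[OF B(1)])
    show "peval (Y i) (lin B) * (g i * a) = 0" by (simp add: B)
    show "Y i * (Y i * (g i * a) - ?y \<star> (g i * a)) = ?y \<star> (Y i * (g i * a) - ?y \<star> (g i * a))"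
      by (simp add: 1 Ya mult.commute)
  qed
  then have "(1 + h * ?y) \<star> a = 0" unfolding 1 by simp
  moreover have "1 + h * ?y \<noteq> 0" using wv_pos[OF a(2,1), of i] i by auto
  ultimately show False using a by simp
qed

text \<open>The intertwiner does not kill a, since by \<open>rc_prod\<close> its square is a
  non-zero scalar there.\<close>

lemma wts_swap:
  assumes D: "diagz k" and w: "w \<in> wts k" and i: "1 \<le> i" "Suc i \<le> k" "k \<le> n"
    and ne: "fst (w i) \<noteq> fst (w (Suc i)) \<or>
      snd (w (Suc i)) \<noteq> \<sigma> (snd (w i)) \<and> snd (w i) \<noteq> \<sigma> (snd (w (Suc i)))"
  shows "sw i w \<in> wts k"
proof -
  obtain a where a: "a \<noteq> 0" "wv k w a" using w by (auto simp: wts_def)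
  have w': "w i \<noteq> w (Suc i)" by (rule wts_adjacent[OF D w i])
  note s = wv_sw[OF a(2) i w']
  have "1 + rc i w * rc i (sw i w) \<noteq> 0"
    using rc_prod[OF _ w'] ne by (cases "fst (w i) = fst (w (Suc i))") (auto simp: rc_def)
  then have "g i * a - rc i w \<star> a \<noteq> 0" using s(2) a(1) by auto
  then show ?thesis by (rule wtsI[OF s(1)])
qed

text \<open>If the entries at positions \<open>i\<close> and \<open>i + 2\<close> agreed, both intertwiners would lead to
  weights with equal adjacent entries and hence vanish; the braid relation then forces \<open>q\<^sup>2 = -1\<close>.\<close>

lemma wts_two_apart:
  assumes D: "diagz k" and w: "w \<in> wts k" and i: "1 \<le> i" "Suc (Suc i) \<le> k" "k \<le> n"
  shows "w i \<noteq> w (Suc (Suc i))"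
proof
  assume eq: "w i = w (Suc (Suc i))"
  obtain a where a: "a \<noteq> 0" "wv k w a" using w by (auto simp: wts_def)
  have i1: "1 \<le> i" "Suc i \<le> k" "k \<le> n" and i2: "1 \<le> Suc i" "Suc (Suc i) \<le> k" "k \<le> n" using i by auto
  have ne1: "w i \<noteq> w (Suc i)" and ne2: "w (Suc i) \<noteq> w (Suc (Suc i))"
    using wts_adjacent[OF D w i1] wts_adjacent[OF D w i2] by auto
  note s1 = wv_sw[OF a(2) i1 ne1] and s2 = wv_sw[OF a(2) i2 ne2]
  have z1: "g i * a = rc i w \<star> a"
  proof (rule ccontr)
    assume "g i * a \<noteq> rc i w \<star> a"
    then have "sw i w \<in> wts k" using s1(1) by (intro wtsI) auto
    from wts_adjacent[OF D this i2] show False using eq by (simp add: transpose_def)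
  qed
  have z2: "g (Suc i) * a = rc (Suc i) w \<star> a"
  proof (rule ccontr)
    assume "g (Suc i) * a \<noteq> rc (Suc i) w \<star> a"
    then have "sw (Suc i) w \<in> wts k" using s2(1) by (intro wtsI) auto
    from wts_adjacent[OF D this i1] show False using eq by (simp add: transpose_def)
  qed
  have sum: "1 + rc i w * rc i (sw i w) = 0" using s1(2) z1 a(1) by simp
  then have same: "fst (w i) = fst (w (Suc i))" by (auto simp: rc_def split: if_splits)
  define r where "r = rc i w"
  have r': "rc (Suc i) w = rc i (sw i w)" using eq same by (simp add: rc_def transpose_def)
  have rh: "rc i (sw i w) = h - r" using rc_sum[OF same ne1] by (simp add: r_def eq_diff_eq add.commute)
  have rr: "1 + r * (h - r) = 0" using sum rh by (simp add: r_def)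
  \<comment> \<open>The two generators act on a by r and by h - r, whose product is -1; the braid
    relation then leaves only r = h - r.\<close>
  have "g i * (g (Suc i) * (g i * a)) = g (Suc i) * (g i * (g (Suc i) * a))"
    using arg_cong[OF g_braid[of i], of "\<lambda>x. x * a"] i by (simp add: mult.assoc)
  then have "(r * (h - r) * r) \<star> a = ((h - r) * r * (h - r)) \<star> a"
    by (simp add: z1 z2 r' rh r_def[symmetric] mult.commute mult.left_commute)
  then have "r * (h - r) * r = (h - r) * r * (h - r)" using a by (simp add: cscale_cancel_right)
  then have "r * (h - r) * (2 * r - h) = 0" by (simp add: algebra_simps)
  then have "h = 2 * r" using rr by auto
  then have "r^2 = -1" using rr by (simp add: power2_eq_square algebra_simps eq_neg_iff_add_eq_0)
  then have "h^2 = -4" using \<open>h = 2 * r\<close> by (simp add: power_mult_distrib)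
  moreover have "h^2 * q^2 = (q^2 - 1)^2" using q_nz
    by (simp add: h_q power2_eq_square field_simps)
  ultimately have "(q^2 - 1)^2 + 4 * q^2 = 0" by (metis add.left_inverse mult_minus_left)
  then have "(q^2 + 1)^2 = 0" by (simp add: power2_eq_square algebra_simps)
  then have "1 + q^2 = 0" by (simp add: add.commute)
  moreover have "(\<Sum>i<2. q ^ (2 * i)) \<noteq> 0" using q_int_nz[of 2] i by simp
  ultimately show False by (simp add: numeral_2_eq_2)
qed

text \<open>The standard fact that between two boxes on the same diagonal both adjacent diagonals
  are met. In a shortest counterexample the entries next to the two ends are neighbours of a, since
  others could be swapped out of the interval. Both ends must then carry the same neighbour b, and
  two consecutive occurrences of b enclose \<sigma> b and \<tau> b, one of which is a.\<close>

lemma neighbours_between: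
  assumes D: "diagz k" and k: "k \<le> n"
  shows "w \<in> wts k \<Longrightarrow> 1 \<le> i \<Longrightarrow> i < j \<Longrightarrow> j \<le> k \<Longrightarrow> w i = (c, a) \<Longrightarrow> w j = (c, a) \<Longrightarrow>
    (\<And>l. i < l \<Longrightarrow> l < j \<Longrightarrow> w l \<noteq> (c, a)) \<Longrightarrow>
    (\<exists>l. i < l \<and> l < j \<and> w l = (c, \<sigma> a)) \<and> (\<exists>l. i < l \<and> l < j \<and> w l = (c, \<tau> a))"
proof (induction "j - i" arbitrary: i j w a rule: less_induct)
  case less
  let ?Q = "\<lambda>w i j. (\<exists>l. i < l \<and> l < j \<and> w l = (c, \<sigma> a)) \<and> (\<exists>l. i < l \<and> l < j \<and> w l = (c, \<tau> a))"
  have far: "Suc (Suc i) < j \<or> j = Suc (Suc i)"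
    using wts_adjacent[OF D less.prems(1), of i] less.prems k by (cases "j = Suc i") auto
  have nt: "j \<noteq> Suc (Suc i)" using wts_two_apart[OF D less.prems(1), of i] less.prems k by auto
  have lt: "Suc (Suc i) < j" using far nt by auto
  show ?case
  proof (rule ccontr)
    assume no: "\<not> ?Q w i j"
    have l: "w (Suc i) \<in> {(c, \<sigma> a), (c, \<tau> a)}"
    proof (rule ccontr)
      assume n: "w (Suc i) \<notin> {(c, \<sigma> a), (c, \<tau> a)}"
      have "sw i w \<in> wts k"
      proof (rule wts_swap[OF D less.prems(1)])
        show "fst (w i) \<noteq> fst (w (Suc i)) \<or>
          snd (w (Suc i)) \<noteq> \<sigma> (snd (w i)) \<and> snd (w i) \<noteq> \<sigma> (snd (w (Suc i)))"
          using n less.prems(5) by (cases "w (Suc i)") auto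
      qed (use less.prems lt k in auto)
      then have "?Q (sw i w) (Suc i) j"
        using less.prems lt by (intro less.hyps) (auto simp: transpose_def)
      then have "?Q w i j" using lt by (force dest: Suc_lessD simp: transpose_def split: if_splits)
      then show False using no by blast
    qed
    obtain j' where j': "j = Suc j'" using lt by (cases j) auto
    have r: "w j' \<in> {(c, \<sigma> a), (c, \<tau> a)}"
    proof (rule ccontr)
      assume n: "w j' \<notin> {(c, \<sigma> a), (c, \<tau> a)}"
      have "sw j' w \<in> wts k"
      proof (rule wts_swap[OF D less.prems(1)])
        show "fst (w j') \<noteq> fst (w (Suc j')) \<or>
          snd (w (Suc j')) \<noteq> \<sigma> (snd (w j')) \<and> snd (w j') \<noteq> \<sigma> (snd (w (Suc j')))"
          using n less.prems(6) j' by (cases "w j'") auto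
      qed (use less.prems lt k j' in auto)
      then have "?Q (sw j' w) i j'"
        using less.prems lt j' by (intro less.hyps) (auto simp: transpose_def)
      moreover have "sw j' w l = w l" if "l < j'" for l using that by (simp add: transpose_def)
      ultimately have "?Q w i j" using j' by (metis less_SucI)
      then show False using no by blast
    qed
    have eq: "w (Suc i) = w j'"
    proof (rule ccontr)
      assume "w (Suc i) \<noteq> w j'"
      moreover have "i < Suc i" "Suc i < j" "i < j'" "j' < j" using lt j' by auto
      ultimately have "?Q w i j" using l r by auto
      then show False using no by blast
    qed
    obtain b where b: "w j' = (c, b)" "b = \<sigma> a \<or> b = \<tau> a" using r by auto
    \<comment> \<open>Taking the last occurrence of b before \<open>j'\<close> makes the two
      occurrences consecutive, as the induction hypothesis demands.\<close>
    define P where "P = {l. Suc i \<le> l \<and> l < j' \<and> w l = (c, b)}"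
    have P: "finite P" "Suc i \<in> P" using eq b j' lt by (auto simp: P_def)
    define m where "m = Max P"
    have "m \<in> P" using Max_in[OF P(1)] P(2) unfolding m_def by blast
    then have m: "Suc i \<le> m" "m < j'" "w m = (c, b)" by (auto simp: P_def)
    have "w l \<noteq> (c, b)" if "m < l" "l < j'" for l
    proof
      assume "w l = (c, b)"
      then have "l \<in> P" using that m by (simp add: P_def)
      then show False using Max_ge[OF P(1), of l] that by (simp add: m_def)
    qed
    then have "(\<exists>l. m < l \<and> l < j' \<and> w l = (c, \<sigma> b)) \<and> (\<exists>l. m < l \<and> l < j' \<and> w l = (c, \<tau> b))"
      using m b less.prems j' by (intro less.hyps) auto
    then obtain l where "m < l" "l < j'" "w l = (c, a)" using b by (metis \<sigma>_\<tau> \<tau>_\<sigma>)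
    then show False using less.prems(7)[of l] m j' by auto
  qed
qed

text \<open>Without an earlier neighbour the entry can be swapped step by step to the front, where
  it is an eigenvalue of \<open>Y (Suc 0)\<close>.\<close>

lemma wts_root:
  assumes D: "diagz k" and k: "k \<le> n"
  shows "w \<in> wts k \<Longrightarrow> 1 \<le> j \<Longrightarrow> j \<le> k \<Longrightarrow> w j = (c, a) \<Longrightarrow>
    (\<And>l. 1 \<le> l \<Longrightarrow> l < j \<Longrightarrow> w l \<noteq> (c, \<sigma> a) \<and> w l \<noteq> (c, \<tau> a)) \<Longrightarrow> a \<in> Rt"
proof (induction j arbitrary: w)
  case (Suc j)
  show ?case
  proof (cases "j = 0")
    case True
    obtain x where x: "x \<noteq> 0" "wv k w x" using Suc.prems by (auto simp: wts_def)
    have "Y (Suc 0) * x = a \<star> x" using x Suc.prems True by (auto simp: wv_def)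
    from peval_eigen[OF this, of "lin Rt"] have "poly (lin Rt) a \<star> x = 0" using Y1_roots by simp
    then show ?thesis using x poly_lin_eq_0_iff[OF finite_Rt] by auto
  next
    case False
    have "sw j w \<in> wts k"
    proof (rule wts_swap[OF D Suc.prems(1)])
      show "fst (w j) \<noteq> fst (w (Suc j)) \<or>
          snd (w (Suc j)) \<noteq> \<sigma> (snd (w j)) \<and> snd (w j) \<noteq> \<sigma> (snd (w (Suc j)))"
        using Suc.prems(5)[of j] False Suc.prems(4) by (cases "w j") auto
    qed (use Suc.prems False k in auto)
    then show ?thesis
      using Suc.prems False by (intro Suc.IH[of "sw j w"]) (auto simp: transpose_def)
  qed
qed simp

text \<open>Following neighbours downwards to a root; stated for a shift \<open>f\<close> with inverse \<open>f'\<close>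
  because it is used for \<open>\<sigma>\<close> and for \<open>\<tau>\<close>.\<close>

lemma root_chain:
  assumes D: "diagz k" and k: "k \<le> n" and f: "(f, f') = (\<sigma>, \<tau>) \<or> (f, f') = (\<tau>, \<sigma>)"
    and w: "w \<in> wts k"
  shows "1 \<le> j \<Longrightarrow> j \<le> k \<Longrightarrow> w j = (c, a) \<Longrightarrow>
    (\<And>l. 1 \<le> l \<Longrightarrow> l < j \<Longrightarrow> w l \<noteq> (c, a) \<and> w l \<noteq> (c, f a)) \<Longrightarrow>
    \<exists>y\<in>Rt. \<exists>r. a = (f ^^ r) y \<and> (\<forall>i<r. \<exists>l. 1 \<le> l \<and> l < j \<and> w l = (c, (f ^^ i) y))"
proof (induction j arbitrary: a rule: less_induct)
  case (less j)
  have ff: "f (f' x) = x" "f' (f x) = x" for x using f by auto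
  define P where "P = (\<lambda>l. 1 \<le> l \<and> l < j \<and> w l = (c, f' a))"
  show ?case
  proof (cases "\<exists>l. P l")
    case False
    have "a \<in> Rt"
      using less.prems False f by (intro wts_root[OF D k w, of j c]) (auto simp: P_def)
    then show ?thesis by (intro bexI[of _ a] exI[of _ 0]) auto
  next
    case True
    \<comment> \<open>The first occurrence is needed for the induction hypothesis: before it there
      is no f' a by minimality, and no a = f (f' a) by assumption.\<close>
    define i where "i = (LEAST l. P l)"
    have i: "P i" "\<And>l. l < i \<Longrightarrow> \<not> P l" using LeastI_ex[OF True] not_less_Least by (auto simp: i_def)
    have "\<exists>y\<in>Rt. \<exists>r. f' a = (f ^^ r) y \<and> (\<forall>i'<r. \<exists>l. 1 \<le> l \<and> l < i \<and> w l = (c, (f ^^ i') y))"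
    proof (rule less.IH)
      fix l assume l: "1 \<le> l" "l < i"
      then show "w l \<noteq> (c, f' a) \<and> w l \<noteq> (c, f (f' a))"
        using i(2)[of l] i(1) less.prems(4)[of l] by (auto simp: P_def ff)
    qed (use i less.prems in \<open>auto simp: P_def\<close>)
    then obtain y r where y: "y \<in> Rt" "f' a = (f ^^ r) y"
      "\<And>i'. i' < r \<Longrightarrow> \<exists>l. 1 \<le> l \<and> l < i \<and> w l = (c, (f ^^ i') y)" by blast
    have "a = (f ^^ Suc r) y" using y(2) ff by (metis funpow.simps(2) comp_apply)
    moreover have "\<exists>l. 1 \<le> l \<and> l < j \<and> w l = (c, (f ^^ i') y)" if "i' < Suc r" for i'
      using y(3)[of i'] y(2) i(1) that by (cases "i' = r") (auto simp: P_def dest: less_trans)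
    ultimately show ?thesis using y(1) by blast
  qed
qed

lemma sigma_tau_pow: "(\<sigma> ^^ k) ((\<tau> ^^ k) y) = y" "(\<tau> ^^ k) ((\<sigma> ^^ k) y) = y"
  by (induction k arbitrary: y) (simp_all add: funpow_swap1)

text \<open>In terms of multipartitions: a box of content \<open>a\<close> and a box of content \<open>\<sigma> a\<close> are never
  both addable.\<close>

lemma not_both_addable:
  assumes D: "diagz k" and k: "1 \<le> k" "k < n" and w: "w \<in> wts k" and w': "w' \<in> wts k"
    and eq: "\<And>j. 1 \<le> j \<Longrightarrow> j < k \<Longrightarrow> w j = w' j"
    and wk: "w k = (c, a)" and wk': "w' k = (c, \<sigma> a)"
  shows False
proof -
  have kn: "k \<le> n" using k by simp
  \<comment> \<open>Otherwise the last earlier occurrence of a or of \<sigma> a, together with the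
    entry at k of w or of w', bounds an interval in which \<open>neighbours_between\<close> places
    the other content, contrary to the choice of the last occurrence.\<close>
  have u: "w l \<noteq> (c, a) \<and> w l \<noteq> (c, \<sigma> a)" if "1 \<le> l" "l < k" for l
  proof (rule ccontr)
    assume no: "\<not> (w l \<noteq> (c, a) \<and> w l \<noteq> (c, \<sigma> a))"
    define P where "P = {l. 1 \<le> l \<and> l < k \<and> (w l = (c, a) \<or> w l = (c, \<sigma> a))}"
    have P: "finite P" "l \<in> P" using no that by (auto simp: P_def)
    define m where "m = Max P"
    have m: "m \<in> P" "\<And>l. l \<in> P \<Longrightarrow> l \<le> m" using Max_in[OF P(1)] P(2) Max_ge[OF P(1)] unfolding m_def by blast+
    then have mk: "1 \<le> m" "m < k" by (auto simp: P_def)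
    have btw: "w l \<noteq> (c, a) \<and> w l \<noteq> (c, \<sigma> a)" if "m < l" "l < k" for l
      using m(2)[of l] that mk by (auto simp: P_def)
    have "w m = (c, a) \<or> w m = (c, \<sigma> a)" using m by (auto simp: P_def)
    then show False
    proof
      assume wm: "w m = (c, a)"
      have "\<exists>l. m < l \<and> l < k \<and> w l = (c, \<sigma> a)"
        using neighbours_between[OF D kn w mk(1,2) order_refl wm wk] btw by blast
      then show False using btw by blast
    next
      assume wm: "w m = (c, \<sigma> a)"
      then have wm': "w' m = (c, \<sigma> a)" using eq mk by simp
      have btw': "w' l \<noteq> (c, a) \<and> w' l \<noteq> (c, \<sigma> a)" if "m < l" "l < k" for l
        using btw[OF that] eq[of l] that mk by simp
      have "\<exists>l. m < l \<and> l < k \<and> w' l = (c, \<tau> (\<sigma> a))"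
        using neighbours_between[OF D kn w' mk(1,2) order_refl wm' wk'] btw' by blast
      then show False using btw' by auto
    qed
  qed
  have "\<exists>y\<in>Rt. \<exists>r. a = (\<sigma> ^^ r) y \<and> (\<forall>i<r. \<exists>l. 1 \<le> l \<and> l < k \<and> w l = (c, (\<sigma> ^^ i) y))"
    using u k wk by (intro root_chain[OF D kn _ w, of \<sigma> \<tau>]) auto
  then obtain y r where y: "y \<in> Rt" "a = (\<sigma> ^^ r) y"
    "\<And>i. i < r \<Longrightarrow> \<exists>l. 1 \<le> l \<and> l < k \<and> w l = (c, (\<sigma> ^^ i) y)" by blast
  have "\<exists>y\<in>Rt. \<exists>r. \<sigma> a = (\<tau> ^^ r) y \<and> (\<forall>i<r. \<exists>l. 1 \<le> l \<and> l < k \<and> w' l = (c, (\<tau> ^^ i) y))"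
    using u k wk' eq by (intro root_chain[OF D kn _ w', of \<tau> \<sigma>]) auto
  then obtain y' r' where y': "y' \<in> Rt" "\<sigma> a = (\<tau> ^^ r') y'"
    "\<And>i. i < r' \<Longrightarrow> \<exists>l. 1 \<le> l \<and> l < k \<and> w' l = (c, (\<tau> ^^ i) y')" by blast
  \<comment> \<open>One chain climbs from the root y to a, the other descends from the root y' to
    \<sigma> a, so y' lies N steps above y.\<close>
  define N where "N = r + 1 + r'"
  have yN: "(\<sigma> ^^ N) y = y'"
  proof -
    have "(\<sigma> ^^ N) y = (\<sigma> ^^ r') (\<sigma> a)"
      unfolding N_def y(2) by (metis add.commute funpow_add comp_apply plus_1_eq_Suc funpow.simps(2))
    then show ?thesis using y'(2) sigma_tau_pow by simp
  qed
  show False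
  proof (cases "N < n")
    case True
    then show False using Rt_sep[OF y(1) y'(1), of N] yN by (simp add: N_def)
  next
    case False
    have occ: "\<exists>l. 1 \<le> l \<and> l < k \<and> w l = (c, (\<sigma> ^^ i) y)" if "i \<le> N" "i \<noteq> r" "i \<noteq> Suc r" for i
    proof (cases "i < r")
      case True
      then show ?thesis using y(3) by blast
    next
      case False
      then have i: "N - i < r'" using that by (auto simp: N_def)
      have "(\<tau> ^^ (N - i)) y' = (\<sigma> ^^ i) y"
      proof -
        have "y' = (\<sigma> ^^ (N - i)) ((\<sigma> ^^ i) y)"
          using yN that by (metis comp_apply funpow_add le_add_diff_inverse2)
        then show ?thesis using sigma_tau_pow by simp
      qed
      then show ?thesis using y'(3)[OF i] eq by metis
    qed
    \<comment> \<open>A window of n + 1 consecutive steps of the chain that contains r and r + 1.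
      Its contents are pairwise distinct because \<open>sigma_pow_neq\<close> reaches exactly to
      distance n. Apart from a and \<sigma> a there are n - 1 of them, and all occur among the k - 1
      < n - 1 positions before k.\<close>
    define i0 where "i0 = min r (N - n)"
    have i0: "i0 \<le> r" "Suc r \<le> i0 + n" "i0 + n \<le> N" using False k by (auto simp: i0_def N_def min_def)
    define I where "I = {i0..i0+n} - {r, Suc r}"
    have I: "card I = n - 1" using i0 k by (simp add: I_def card_Diff_subset)
    have y_pos: "1 + h * y \<noteq> 0"
    proof -
      obtain l v where lv: "1 \<le> l" "l \<le> k" "w l = (c, v)" "\<exists>i. v = (\<sigma> ^^ i) y"
        using wk y(2) k by blast
      then obtain i where i: "v = (\<sigma> ^^ i) y" by blast
      obtain x where x: "x \<noteq> 0" "wv k w x" using w by (auto simp: wts_def)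
      have v: "1 + h * v \<noteq> 0" using wv_pos[OF x(2,1) lv(1,2) kn] lv by simp
      have "v = y" if "1 + h * y = 0" using sigma_pow[of i y] that i by simp
      then show ?thesis using v by auto
    qed
    have inj: "inj_on (\<lambda>i. (\<sigma> ^^ i) y) {i0..i0+n}"
    proof (rule linorder_inj_onI)
      fix i j assume ij: "i < j" "i \<in> {i0..i0+n}" "j \<in> {i0..i0+n}"
      show "(\<sigma> ^^ i) y \<noteq> (\<sigma> ^^ j) y"
      proof
        assume "(\<sigma> ^^ i) y = (\<sigma> ^^ j) y"
        also have "j = i + (j - i)" using ij by simp
        also have "(\<sigma> ^^ (i + (j - i))) y = (\<sigma> ^^ i) ((\<sigma> ^^ (j - i)) y)" by (simp only: funpow_add comp_apply)
        finally have "y = (\<sigma> ^^ (j - i)) y" by (metis sigma_tau_pow(2))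
        moreover have "1 \<le> j - i" "j - i \<le> n" using ij by auto
        ultimately show False using sigma_pow_neq[OF y_pos, of "j - i"] by metis
      qed
    qed auto
    have "\<forall>i\<in>I. \<exists>l. l \<in> {1..<k} \<and> w l = (c, (\<sigma> ^^ i) y)"
      using occ i0 by (auto simp: I_def)
    then obtain L where L: "\<And>i. i \<in> I \<Longrightarrow> L i \<in> {1..<k} \<and> w (L i) = (c, (\<sigma> ^^ i) y)" by metis
    have "inj_on L I"
      using inj L by (intro inj_onI) (metis (no_types, lifting) DiffD1 I_def inj_onD prod.inject)
    then have "card I \<le> card {1..<k}" using L by (intro card_inj_on_le[of L]) auto
    then show False using I k by simp
  qed
qed

end

section \<open>Diagonalisability of the Jucys--Murphy elements, one after the other\<close>

context weight_setting
begin

lemma wv_Y_component: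
  assumes w: "wv i w a" and i: "Suc i \<le> n"
  shows "wv i w (peval (Y (Suc i)) f * a)"
  unfolding wv_def
proof (intro conjI ballI)
  fix j assume j: "j \<in> {1..n}"
  show "fst (w j) \<in> C" using w j by (simp add: wv_def)
  then have "p j (fst (w j)) * Y (Suc i) = Y (Suc i) * p j (fst (w j))"
    using Z_p[of "Suc i" j] i j by simp
  from peval_intertwine[OF this, of f]
  have "p j (fst (w j)) * (peval (Y (Suc i)) f * a) = peval (Y (Suc i)) f * (p j (fst (w j)) * a)"
    by (metis mult.assoc)
  then show "p j (fst (w j)) * (peval (Y (Suc i)) f * a) = peval (Y (Suc i)) f * a"
    using w j by (simp add: wv_def)
next
  fix j assume j: "j \<in> {1..i}"
  have "Y j * Y (Suc i) = Y (Suc i) * Y j" using i j by (intro Z_commute) auto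
  from peval_intertwine[OF this, of f]
  have "Y j * (peval (Y (Suc i)) f * a) = peval (Y (Suc i)) f * (Y j * a)"
    by (metis mult.assoc)
  then show "Y j * (peval (Y (Suc i)) f * a) = snd (w j) \<star> (peval (Y (Suc i)) f * a)"
    using w j by (simp add: wv_def)
qed

lemma wv_extend:
  assumes w: "wv i w a" and i: "Suc i \<le> n" and B: "finite B" "b \<in> B" "peval (Y (Suc i)) (lin B) * a = 0"
  shows "wv (Suc i) (w(Suc i := (fst (w (Suc i)), b))) (peval (Y (Suc i)) (lagr B b) * a)"
proof -
  have *: "{1..Suc i} = insert (Suc i) {1..i}" by auto
  show ?thesis
    using wv_Y_component[OF w i, of "lagr B b"] lagr_eigen[OF B]
    unfolding wv_def * by auto
qed

lemma sum_closed:
  assumes "R 0" "\<And>a b. R a \<Longrightarrow> R b \<Longrightarrow> R (a + b)" "\<And>i. i \<in> I \<Longrightarrow> R (f i)"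
  shows "R (\<Sum>i\<in>I. f i :: 'a)"
  using assms by (induction I rule: infinite_finite_induct) auto

text \<open>Every element is a sum of weight vectors: split it by the colour projections, then by
  the Lagrange projections of Y_1, ..., Y_k. The form of an induction rule avoids naming the
  summands.\<close>

lemma wv_decompose:
  assumes D: "diagz k" and k: "k \<le> n"
    and R: "R 0" "\<And>a b. R a \<Longrightarrow> R b \<Longrightarrow> R (a + b)" "\<And>w a. wv k w a \<Longrightarrow> R a"
  shows "R a"
proof -
  \<comment> \<open>Here i counts the Jucys--Murphy elements by which a has not yet been
    split.\<close>
  have "\<forall>w a. wv (k - i) w a \<longrightarrow> R a" if "i \<le> k" for i
    using that
  proof (induction i)
    case 0
    then show ?case using R by auto
  next
    case (Suc i)
    define l where "l = k - Suc i"
    have l: "k - i = Suc l" "Suc l \<le> k" using Suc.prems by (auto simp: l_def)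
    show ?case
    proof (intro allI impI)
      fix w a assume w: "wv (k - Suc i) w a"
      obtain B where B: "finite B" "peval (Y (Suc l)) (lin B) = 0" using diagzD[OF D, of "Suc l"] l by auto
      have a: "a = (\<Sum>b\<in>B. peval (Y (Suc l)) (lagr B b) * a)" by (rule lagr_decomp) (simp_all add: B)
      have "R (peval (Y (Suc l)) (lagr B b) * a)" if "b \<in> B" for b
        using wv_extend[of l w a B b] w B that l k Suc by (auto simp: l_def)
      then show "R a" by (subst a) (rule sum_closed[OF R(1,2)])
    qed
  qed
  from this[of k] have col: "R a" if "\<forall>j\<in>{1..n}. fst (w j) \<in> C \<and> p j (fst (w j)) * a = a"
    for w :: "nat \<Rightarrow> 'c \<times> complex" and a using that by (auto simp: wv_def)
  have "\<forall>w a. (\<forall>j\<in>{1..n - i}. w j \<in> C \<and> p j (w j) * a = a) \<longrightarrow> R a" if "i \<le> n" for i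
    using that
  proof (induction i)
    case 0
    have "R a" if "\<forall>j\<in>{1..n}. w j \<in> C \<and> p j (w j) * a = a" for w a
      by (rule col[of "\<lambda>j. (w j, 0)"]) (use that in auto)
    then show ?case by auto
  next
    case (Suc i)
    define l where "l = n - Suc i"
    have l: "n - i = Suc l" "Suc l \<le> n" using Suc.prems by (auto simp: l_def)
    show ?case
    proof (intro allI impI)
      fix w a assume w: "\<forall>j\<in>{1..n - Suc i}. w j \<in> C \<and> p j (w j) * a = a"
      have a: "a = (\<Sum>c\<in>C. p (Suc l) c * a)"
        using p_sum[of "Suc l"] l by (simp add: sum_distrib_right[symmetric])
      have "R (p (Suc l) c * a)" if c: "c \<in> C" for c
      proof -
        have "\<forall>j\<in>{1..n - i}. (w(Suc l := c)) j \<in> C \<and> p j ((w(Suc l := c)) j) * (p (Suc l) c * a) = p (Suc l) c * a"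
        proof
          fix j assume j: "j \<in> {1..n - i}"
          show "(w(Suc l := c)) j \<in> C \<and> p j ((w(Suc l := c)) j) * (p (Suc l) c * a) = p (Suc l) c * a"
          proof (cases "j = Suc l")
            case True
            then show ?thesis using c l by (simp add: mult.assoc[symmetric] p_idem)
          next
            case False
            then have j': "j \<in> {1..n - Suc i}" "j \<in> {1..n}" using j l by (auto simp: l_def)
            then have wj: "w j \<in> C" "p j (w j) * a = a" using w by auto
            have "p j (w j) * (p (Suc l) c * a) = p (Suc l) c * (p j (w j) * a)"
              using p_comm[of j "Suc l" "w j" c] j' wj(1) c l by (metis atLeastAtMost_iff le_add1 mult.assoc plus_1_eq_Suc)
            then show ?thesis using False wj by simp
          qed
        qed
        then show ?thesis using Suc by auto
      qed
      then show "R a" by (subst a) (rule sum_closed[OF R(1,2)])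
    qed
  qed
  from this[of n] show ?thesis by auto
qed

text \<open>The intertwiner of \<open>wv_sw\<close> multiplied by its denominator. The earlier form
  needs the eigenvalue of Y_(i+1), which is not at hand while that element is still to be
  diagonalised.\<close>

definition intertw :: "nat \<Rightarrow> 'a" where
  "intertw i = (g i * (Y i - Y (Suc i)) + (1 + h \<star> Y (Suc i))) * ee i (Suc i)"

lemma intertw:
  assumes i: "1 \<le> i" "i < n"
  shows "intertw i * Y i = Y (Suc i) * intertw i" "intertw i * Y (Suc i) = Y i * intertw i"
    and "intertw i * intertw i = ((1 + h \<star> Y i) * (1 + h \<star> Y (Suc i)) - (Y i - Y (Suc i)) * (Y i - Y (Suc i))) * ee i (Suc i)"
proof -
  let ?y = "Y i" and ?y' = "Y (Suc i)" and ?e = "ee i (Suc i)" and ?g = "g i"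
  have c: "?y' * ?y = ?y * ?y'" using Z_commute[of i "Suc i"] i by simp
  have e: "?e * ?y = ?y * ?e" "?e * ?y' = ?y' * ?e" "?e * ?g = ?g * ?e" "?e * ?e = ?e"
    using Y_ee[OF i, of i] Y_ee[OF i, of "Suc i"] ee_g_self[OF i] ee_idem[OF i] i by auto
  have yg: "?y' * ?g = ?g * ?y + (1 + h \<star> ?y') * ?e" "?y * ?g = ?g * ?y' - (1 + h \<star> ?y') * ?e"
    using Yg[OF i] e by (simp_all add: distrib_left distrib_right cscale_distribs)
  have gg: "?g * ?g = 1 + h \<star> (?g * ?e)" using g_quad[OF i] e by simp
  note r = c e yg gg
  note r' = r[THEN mult_assoc_rule]
  note dist = distrib_left distrib_right left_diff_distrib right_diff_distrib mult.assoc mult_1_left mult_1_right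
    cscale_mult_left cscale_mult_right cscale_distribs cscale_cscale
  show 1: "intertw i * ?y = ?y' * intertw i"
    unfolding intertw_def by (simp only: dist r r') (simp add: algebra_simps)
  show 2: "intertw i * ?y' = ?y * intertw i"
    unfolding intertw_def by (simp only: dist r r') (simp add: algebra_simps)
  show "intertw i * intertw i = ((1 + h \<star> ?y) * (1 + h \<star> ?y') - (?y - ?y') * (?y - ?y')) * ?e"
    unfolding intertw_def by (simp only: dist r r') (simp add: algebra_simps)
qed

text \<open>On the part with different colours g_k is an involution that conjugates Y_k into
  Y_(k+1), so a polynomial killing the one kills the other on a.\<close>

lemma diagz_step_differ:
  assumes D: "diagz k" and k: "1 \<le> k" "k < n" and w: "wv k w a" and ne: "fst (w k) \<noteq> fst (w (Suc k))"
  shows "\<exists>B. finite B \<and> peval (Y (Suc k)) (lin B) * a = 0"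
proof -
  obtain B where B: "finite B" "peval (Y k) (lin B) = 0" using diagzD[OF D, of k] k by auto
  let ?e = "ee k (Suc k)"
  have ea: "?e * a = 0" using wv_ee[OF w, of k "Suc k"] k ne by auto
  have e: "?e * Y k = Y k * ?e" "?e * Y (Suc k) = Y (Suc k) * ?e" "?e * g k = g k * ?e" "?e * ?e = ?e"
    using Y_ee[of k k] Y_ee[of k "Suc k"] ee_g_self[of k] ee_idem[of k] k by auto
  define x where "x = g k * (1 - ?e)"
  have "x * Y k = Y (Suc k) * x"
    unfolding x_def using e e[THEN mult_assoc_rule] Yg(1)[of k] k
    by (simp add: right_diff_distrib left_diff_distrib mult.assoc[symmetric])
      (simp add: algebra_simps cscale_distribs)
  from peval_intertwine[OF this, of "lin B"] have "peval (Y (Suc k)) (lin B) * x = 0" by (simp add: B)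
  moreover have "x * (g k * a) = a"
  proof -
    have eg: "?e * (g k * a) = 0" using e(3) ea by (metis mult.assoc mult_zero_right)
    then have "g k * (g k * a) = a"
      using arg_cong[OF g_quad[of k], of "\<lambda>x. x * a"] k by (simp add: distrib_right mult.assoc)
    then show ?thesis by (simp add: x_def mult.assoc left_diff_distrib eg)
  qed
  ultimately have "peval (Y (Suc k)) (lin B) * a = 0" by (metis mult.assoc mult_zero_left)
  then show ?thesis using B by blast
qed

text \<open>Let \<phi> be the cleared intertwiner. The vector \<phi> a keeps the first k - 1 entries
  of w, so Y_k has on it only eigenvalues b that can replace the entry at k in a weight. Transported
  back by \<phi>, the polynomial with these roots, taken at Y_(k+1), kills \<phi> \<phi> a, which is
  -(Y_(k+1) - \<sigma> y)(Y_(k+1) - \<tau> y) a. The resulting annihilator is squarefree, because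
  \<open>not_both_addable\<close> keeps \<sigma> y and \<tau> y out of the set of b, and \<sigma> y
  = \<tau> y would contradict the second quantum integer.\<close>

lemma diagz_step_same:
  assumes D: "diagz k" and k: "1 \<le> k" "k < n" and w: "wv k w a" and a: "a \<noteq> 0"
    and same: "fst (w k) = fst (w (Suc k))"
  shows "\<exists>B. finite B \<and> peval (Y (Suc k)) (lin B) * a = 0"
proof -
  obtain B where B: "finite B" "peval (Y k) (lin B) = 0" using diagzD[OF D, of k] k by auto
  define c y where "c = fst (w k)" and "y = snd (w k)"
  let ?e = "ee k (Suc k)" and ?\<phi> = "intertw k"
  have ea: "?e * a = a" using wv_ee[OF w, of k "Suc k"] k same by auto
  define Bu where "Bu = {b\<in>B. w(k := (c, b)) \<in> wts k}"
  have Bu: "finite Bu" using B by (simp add: Bu_def)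
  have wk: "w \<in> wts k" using w a by (rule wtsI)
  have y: "w k = (c, y)" by (simp add: c_def y_def)
  have \<sigma>y: "\<sigma> y \<notin> Bu"
  proof
    assume "\<sigma> y \<in> Bu"
    then have "w(k := (c, \<sigma> y)) \<in> wts k" by (simp add: Bu_def)
    from not_both_addable[OF D k wk this, of c y] show False using y by simp
  qed
  have \<tau>y: "\<tau> y \<notin> Bu"
  proof
    assume "\<tau> y \<in> Bu"
    then have "w(k := (c, \<tau> y)) \<in> wts k" by (simp add: Bu_def)
    from not_both_addable[OF D k this wk, of c "\<tau> y"] show False using y by simp
  qed
  have ypos: "1 + h * y \<noteq> 0" using wv_pos[OF w a, of k] k by (simp add: y_def)
  have \<sigma>\<tau>: "\<sigma> y \<noteq> \<tau> y"
  proof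
    assume "\<sigma> y = \<tau> y"
    then have "(\<sigma> ^^ 2) y = y" by (simp add: numeral_2_eq_2)
    then show False using sigma_pow_neq[OF ypos, of 2] k by simp
  qed
  have \<phi>: "?\<phi> * a = g k * (Y k * a) - g k * (Y (Suc k) * a) + (a + h \<star> (Y (Suc k) * a))"
    by (simp add: intertw_def mult.assoc ea distrib_right right_diff_distrib left_diff_distrib)
  have "wv (k - 1) w (?\<phi> * a)"
    unfolding wv_def
  proof (intro conjI ballI)
    fix j assume j: "j \<in> {1..n}"
    show c: "fst (w j) \<in> C" using w j by (simp add: wv_def)
    define j' where "j' = transpose k (Suc k) j"
    have fj: "fst (w j') = fst (w j)" using same by (auto simp: j'_def transpose_def)
    have j': "j' \<in> {1..n}" using j k by (auto simp: j'_def transpose_def)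
    let ?p = "p j (fst (w j))"
    have pg: "?p * (g k * x) = g k * (p j' (fst (w j)) * x)" for x
      using p_g[of k j "fst (w j)"] k j c unfolding j'_def by (metis mult.assoc)
    have pY: "p l (fst (w j)) * (Y m * a) = Y m * (p l (fst (w j)) * a)" if "l \<in> {1..n}" "1 \<le> m" "m \<le> n" for l m
      using Z_p[OF that(2,3,1) c] by (metis mult.assoc)
    have "p j' (fst (w j')) * a = a" "?p * a = a"
      using w j j' unfolding wv_def by blast+
    then have pa: "p j' (fst (w j)) * a = a" "?p * a = a" by (simp_all only: fj)
    have pY': "p j' (fst (w j)) * (Y k * a) = Y k * a" "p j' (fst (w j)) * (Y (Suc k) * a) = Y (Suc k) * a"
      "?p * (Y (Suc k) * a) = Y (Suc k) * a"
      using pY[OF j', of k] pY[OF j', of "Suc k"] pY[OF j, of "Suc k"] k pa by auto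
    show "?p * (?\<phi> * a) = ?\<phi> * a"
      by (simp add: \<phi> distrib_left right_diff_distrib pg pY' pa)
  next
    fix j assume j: "j \<in> {1..k - 1}"
    have jk: "1 \<le> j" "j \<le> n" "j \<noteq> k" "Suc k \<noteq> j" using j k by auto
    have "Y j * g k = g k * Y j" using jk k by (intro Z_g) auto
    moreover have "Y j * Y k = Y k * Y j" "Y j * Y (Suc k) = Y (Suc k) * Y j"
      using jk k by (auto intro!: Z_commute)
    ultimately have c: "Y j * (g k * x) = g k * (Y j * x)" "Y j * (Y k * x) = Y k * (Y j * x)"
      "Y j * (Y (Suc k) * x) = Y (Suc k) * (Y j * x)" for x
      by (metis mult.assoc)+
    have "Y j * a = snd (w j) \<star> a" using w j by (auto simp: wv_def)
    then show "Y j * (?\<phi> * a) = snd (w j) \<star> (?\<phi> * a)"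
      by (simp add: \<phi> distrib_left right_diff_distrib c cscale_distribs mult.commute)
  qed
  moreover obtain l where l: "k = Suc l" using k by (cases k) auto
  ultimately have \<phi>a: "wv l w (?\<phi> * a)" by simp
  have "peval (Y k) (lin Bu) * (peval (Y k) (lagr B b) * (?\<phi> * a)) = 0" if b: "b \<in> B" for b
  proof (cases "peval (Y k) (lagr B b) * (?\<phi> * a) = 0")
    case False
    have v: "wv k (w(k := (c, b))) (peval (Y k) (lagr B b) * (?\<phi> * a))"
      using wv_extend[OF \<phi>a, of B b] k b B unfolding l by (simp add: c_def l)
    have "b \<in> Bu" using wtsI[OF v False] b by (simp add: Bu_def)
    moreover have "Y k * (peval (Y k) (lagr B b) * (?\<phi> * a)) = b \<star> (peval (Y k) (lagr B b) * (?\<phi> * a))"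
      using v k by (auto simp: wv_def)
    ultimately show ?thesis using peval_eigen[of "Y k" "peval (Y k) (lagr B b) * (?\<phi> * a)" b "lin Bu"]
      poly_lin_eq_0_iff[OF Bu, of b] by simp
  qed simp
  then have "peval (Y k) (lin Bu) * (?\<phi> * a) = 0"
    by (subst lagr_decomp[of B "Y k"]) (simp_all add: B sum_distrib_left)
  moreover have "?\<phi> * peval (Y k) (lin Bu) = peval (Y (Suc k)) (lin Bu) * ?\<phi>"
    using intertw(1)[of k] k by (intro peval_intertwine) auto
  ultimately have 0: "peval (Y (Suc k)) (lin Bu) * (?\<phi> * (?\<phi> * a)) = 0"
    by (metis mult.assoc mult_zero_right)
  have Yk: "Y k * a = y \<star> a" using w k by (auto simp: wv_def y_def)
  let ?x = "Y (Suc k)"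
  have cm: "Y k * ?x = ?x * Y k" using Z_commute[of k "Suc k"] k by simp
  have Yx: "Y k * (?x * a) = y \<star> (?x * a)" by (metis cm Yk cscale_mult_right mult.assoc)
  have "?\<phi> * (?\<phi> * a) = ((1 + h \<star> Y k) * (1 + h \<star> ?x) - (Y k - ?x) * (Y k - ?x)) * a"
    using arg_cong[OF intertw(3)[of k], of "\<lambda>x. x * a"] k by (simp add: mult.assoc ea)
  also have "\<dots> = (1 + h * y - y^2) \<star> a + ((h * (1 + h * y)) \<star> (?x * a) + (y \<star> (?x * a) + y \<star> (?x * a))) - ?x * (?x * a)"
    by (simp add: algebra_simps cscale_distribs Yk Yx power2_eq_square)
  also have "\<dots> = - (peval ?x ([:-\<sigma> y, 1:] * [:-\<tau> y, 1:]) * a)"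
  proof -
    \<comment> \<open>Expressing y through t removes the division by q^2 from \<tau>, so that the
      coefficients can be compared as polynomials.\<close>
    define t where "t = \<tau> y"
    have y': "y = q^2 * t + q" using \<sigma>_\<tau>[of y] by (simp add: \<sigma>_def t_def)
    have hq: "h * q = q^2 - 1" using q_nz by (simp add: h_q power2_eq_square left_diff_distrib)
    have "h * y = (h * q) * (q * t + 1)" by (simp add: y' power2_eq_square algebra_simps)
    then have hy: "h * y = (q^2 - 1) * (q * t + 1)" by (simp only: hq)
    have "h * (1 + h * y) = (h * q) * (q + (q^2 - 1) * t)"
      unfolding hy by (simp add: power2_eq_square algebra_simps)
    then have hhy: "h * (1 + h * y) = (q^2 - 1) * (q + (q^2 - 1) * t)" by (simp only: hq)
    have 1: "1 + h * y - y^2 = - (\<sigma> y * \<tau> y)"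
      unfolding hy t_def[symmetric] \<sigma>_def unfolding y' by (simp add: power2_eq_square algebra_simps)
    have 2: "h * (1 + h * y) + (y + y) = \<sigma> y + \<tau> y"
      unfolding hhy t_def[symmetric] \<sigma>_def unfolding y' by (simp add: power2_eq_square algebra_simps)
    have 3: "(h * (1 + h * y)) \<star> z + (y \<star> z + y \<star> z) = (\<sigma> y + \<tau> y) \<star> z" for z :: 'a
      unfolding 2[symmetric] cscale_add_left ..
    show ?thesis unfolding 1 3 by (simp add: algebra_simps cscale_distribs)
  qed
  finally have "peval ?x (lin Bu) * (peval ?x ([:-\<sigma> y, 1:] * [:-\<tau> y, 1:]) * a) = 0"
    using 0 by simp
  moreover have "lin (insert (\<sigma> y) (insert (\<tau> y) Bu)) = lin Bu * ([:-\<sigma> y, 1:] * [:-\<tau> y, 1:])"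
    using Bu \<sigma>y \<tau>y \<sigma>\<tau> by (simp add: lin_insert del: mult_pCons_left mult_pCons_right)
  ultimately have "peval ?x (lin (insert (\<sigma> y) (insert (\<tau> y) Bu))) * a = 0"
    by (simp only: peval_mult mult.assoc)
  moreover have "finite (insert (\<sigma> y) (insert (\<tau> y) Bu))" using Bu by simp
  ultimately show ?thesis by (intro exI conjI)
qed

lemma squarefree_killed_add:
  fixes z a b :: 'a
  assumes "\<exists>B. finite B \<and> peval z (lin B) * a = 0" "\<exists>B. finite B \<and> peval z (lin B) * b = 0"
  shows "\<exists>B. finite B \<and> peval z (lin B) * (a + b) = 0"
proof -
  obtain B1 B2 where B: "finite B1" "peval z (lin B1) * a = 0" "finite B2" "peval z (lin B2) * b = 0"
    using assms by blast
  have "peval z (lin (B1 \<union> B2)) * a = 0" by (rule peval_lin_subset[OF _ _ B(2)]) (use B in auto)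
  moreover have "peval z (lin (B1 \<union> B2)) * b = 0" by (rule peval_lin_subset[OF _ _ B(4)]) (use B in auto)
  ultimately show ?thesis using B by (intro exI[of _ "B1 \<union> B2"]) (simp add: distrib_left)
qed

text \<open>Being killed by a squarefree polynomial in the next element is additive, so
  \<open>wv_decompose\<close> passes it from weight vectors to 1.\<close>

lemma diagz_all: "k \<le> n \<Longrightarrow> diagz k"
proof (induction k)
  case 0
  then show ?case by (simp add: diagz_def)
next
  case (Suc k)
  have D: "diagz k" using Suc by simp
  have "\<exists>B. finite B \<and> peval (Y (Suc k)) (lin B) = 0"
  proof (cases "k = 0")
    case True
    then show ?thesis using Y1_roots finite_Rt by auto
  next
    case False
    have "\<exists>B. finite B \<and> peval (Y (Suc k)) (lin B) * 1 = 0"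
    proof (rule wv_decompose[OF D, where R = "\<lambda>a. \<exists>B. finite B \<and> peval (Y (Suc k)) (lin B) * a = 0"])
      show "\<exists>B. finite B \<and> peval (Y (Suc k)) (lin B) * 0 = 0" by (intro exI[of _ "{}"]) simp
      show "\<exists>B. finite B \<and> peval (Y (Suc k)) (lin B) * (a + b) = 0"
        if "\<exists>B. finite B \<and> peval (Y (Suc k)) (lin B) * a = 0"
          "\<exists>B. finite B \<and> peval (Y (Suc k)) (lin B) * b = 0" for a b
        using that by (rule squarefree_killed_add)
      show "\<exists>B. finite B \<and> peval (Y (Suc k)) (lin B) * a = 0" if "wv k w a" for w a
      proof (cases "a = 0")
        case True
        then show ?thesis by (intro exI[of _ "{}"]) simp
      next
        case a: False
        have k: "1 \<le> k" "k < n" using False Suc.prems by auto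
        show ?thesis
          using diagz_step_same[OF D k that a] diagz_step_differ[OF D k that] by blast
      qed
    qed (use Suc in simp)
    then show ?thesis by simp
  qed
  then show ?case using D by (auto simp: diagz_def le_Suc_eq)
qed

end

section \<open>Weight idempotents and the intertwiners between them\<close>

context weight_setting
begin

lemma wv_cong: "(\<And>j. j \<in> {1..n} \<Longrightarrow> w j = w' j) \<Longrightarrow> wv n w a \<longleftrightarrow> wv n w' a"
  by (simp add: wv_def)

lemma wv_add: "wv n w a \<Longrightarrow> wv n w b \<Longrightarrow> wv n w (a + b)"
  by (simp add: wv_def distrib_left cscale_add_right)

text \<open>A product of colour projections and Lagrange polynomials over the positions, with 0 as
  the factor wherever the entry of v cannot occur.\<close>

lemma weight_projection:
  "\<exists>\<pi>. \<forall>w a. wv n w a \<longrightarrow> \<pi> * a = (if \<forall>j\<in>{1..n}. v j = w j then a else 0)"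
proof -
  have "\<exists>\<pi>. \<forall>w a. wv n w a \<longrightarrow> \<pi> * a = (if \<forall>j\<in>{1..k}. v j = w j then a else 0)" if "k \<le> n" for k
    using that
  proof (induction k)
    case 0
    then show ?case by (intro exI[of _ 1]) auto
  next
    case (Suc k)
    then obtain \<pi> where \<pi>: "\<And>w a. wv n w a \<Longrightarrow> \<pi> * a = (if \<forall>j\<in>{1..k}. v j = w j then a else 0)" by auto
    have k: "Suc k \<in> {1..n}" using Suc by simp
    obtain B where B: "finite B" "peval (Y (Suc k)) (lin B) = 0"
      using diagzD[OF diagz_all[OF order_refl], of "Suc k"] Suc by auto
    define \<rho> where "\<rho> = (if fst (v (Suc k)) \<in> C \<and> snd (v (Suc k)) \<in> B
      then p (Suc k) (fst (v (Suc k))) * peval (Y (Suc k)) (lagr B (snd (v (Suc k)))) else 0)"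
    have \<rho>: "\<rho> * a = (if v (Suc k) = w (Suc k) then a else 0)" if w: "wv n w a" for w a
    proof (cases "a = 0")
      case False
      have Ya: "Y (Suc k) * a = snd (w (Suc k)) \<star> a" and wC: "fst (w (Suc k)) \<in> C"
        using w k by (auto simp: wv_def)
      have "poly (lin B) (snd (w (Suc k))) \<star> a = 0" using peval_eigen[OF Ya, of "lin B"] B by simp
      then have wB: "snd (w (Suc k)) \<in> B" using False poly_lin_eq_0_iff[OF B(1)] by simp
      show ?thesis
      proof (cases "fst (v (Suc k)) \<in> C \<and> snd (v (Suc k)) \<in> B")
        case True
        then have "\<rho> * a = p (Suc k) (fst (v (Suc k))) * (poly (lagr B (snd (v (Suc k)))) (snd (w (Suc k))) \<star> a)"
          by (simp add: \<rho>_def mult.assoc peval_eigen[OF Ya])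
        then show ?thesis
          using True wB B wv_p[OF w k, of "fst (v (Suc k))"] by (auto simp: poly_lagr prod_eq_iff)
      next
        case no: False
        then show ?thesis using wB wC by (auto simp: \<rho>_def)
      qed
    qed simp
    have *: "{1..Suc k} = insert (Suc k) {1..k}" by auto
    show ?case
      unfolding * using \<pi> \<rho> by (intro exI[of _ "\<pi> * \<rho>"]) (auto simp: mult.assoc)
  qed
  then show ?thesis by blast
qed

text \<open>Weights matter only on the positions 1 to n; fixing them outside makes the set finite
  and different members distinguishable.\<close>

definition wset :: "(nat \<Rightarrow> 'c \<times> complex) set" where
  "wset = wts n \<inter> extensional {1..n}"

text \<open>Write 1 as a sum of weight vectors. Multiplying by the projection \<pi> for w gives
  \<pi> = \<pi> * 1, the component of 1 at w, so the components themselves act as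
  projections.\<close>

lemma weight_idempotents:
  "\<exists>\<epsilon>. finite wset \<and> (\<forall>w\<in>wset. wv n w (\<epsilon> w) \<and> \<epsilon> w \<noteq> 0) \<and> (\<Sum>w\<in>wset. \<epsilon> w) = 1 \<and>
    (\<forall>w\<in>wset. \<forall>v\<in>extensional {1..n}. \<forall>a. wv n v a \<longrightarrow> \<epsilon> w * a = (if w = v then a else 0))"
proof -
  let ?R = "\<lambda>a. \<exists>W \<epsilon>. finite W \<and> W \<subseteq> extensional {1..n} \<and> (\<forall>w\<in>W. wv n w (\<epsilon> w)) \<and> a = (\<Sum>w\<in>W. \<epsilon> w)"
  have "?R 1"
  proof (rule wv_decompose[OF diagz_all[OF order_refl] order_refl, where R = ?R])
    show "?R 0" by (intro exI[of _ "{}"]) auto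
    show "?R (a + b)" if a: "?R a" and b: "?R b" for a b
    proof -
      obtain W1 \<epsilon>1 where 1: "finite W1" "W1 \<subseteq> extensional {1..n}" "\<forall>w\<in>W1. wv n w (\<epsilon>1 w)" "a = (\<Sum>w\<in>W1. \<epsilon>1 w)"
        using a by blast
      obtain W2 \<epsilon>2 where 2: "finite W2" "W2 \<subseteq> extensional {1..n}" "\<forall>w\<in>W2. wv n w (\<epsilon>2 w)" "b = (\<Sum>w\<in>W2. \<epsilon>2 w)"
        using b by blast
      define \<epsilon> where "\<epsilon> w = (if w \<in> W1 then \<epsilon>1 w else 0) + (if w \<in> W2 then \<epsilon>2 w else 0)" for w
      have "a + b = (\<Sum>w\<in>W1 \<union> W2. \<epsilon> w)"
        using 1 2 by (simp add: \<epsilon>_def sum.distrib sum.inter_restrict[symmetric] Int_absorb1)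
      moreover have "\<forall>w\<in>W1 \<union> W2. wv n w (\<epsilon> w)"
        using 1(3) 2(3) unfolding \<epsilon>_def by (auto intro: wv_add)
      ultimately show ?thesis using 1(1,2) 2(1,2) by (intro exI[of _ "W1 \<union> W2"] exI[of _ \<epsilon>]) auto
    qed
    show "?R a" if "wv n w a" for w a
      using that wv_cong[of "restrict w {1..n}" w a]
      by (intro exI[of _ "{restrict w {1..n}}"] exI[of _ "\<lambda>_. a"]) auto
  qed
  then obtain W \<epsilon> where W: "finite W" "W \<subseteq> extensional {1..n}" "\<forall>w\<in>W. wv n w (\<epsilon> w)" "1 = (\<Sum>w\<in>W. \<epsilon> w)"
    by blast
  have eqv: "(\<forall>j\<in>{1..n}. v j = w j) \<longleftrightarrow> v = w" if "v \<in> extensional {1..n}" "w \<in> extensional {1..n}"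
    for v w :: "nat \<Rightarrow> 'c \<times> complex" using that by (auto intro: extensionalityI)
  have \<epsilon>: "\<epsilon> w * a = (if w = v then a else 0)"
    if w: "w \<in> W" and v: "v \<in> extensional {1..n}" "wv n v a" for w v a
  proof -
    obtain \<pi> where \<pi>: "\<And>u a. wv n u a \<Longrightarrow> \<pi> * a = (if \<forall>j\<in>{1..n}. w j = u j then a else 0)"
      using weight_projection[of w] by blast
    have "\<pi> = (\<Sum>u\<in>W. \<pi> * \<epsilon> u)" using W(4) by (simp add: sum_distrib_left[symmetric])
    also have "\<dots> = (\<Sum>u\<in>W. if u = w then \<epsilon> u else 0)"
      using W w \<pi> eqv by (intro sum.cong refl) (auto simp: subset_iff)
    also have "\<dots> = \<epsilon> w" using W w by simp
    finally show ?thesis using \<pi>[OF v(2)] eqv[of w v] w W v by auto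
  qed
  have *: "wset = {w\<in>W. \<epsilon> w \<noteq> 0}"
  proof (intro Set.set_eqI iffI)
    fix v assume "v \<in> wset"
    then obtain a where a: "a \<noteq> 0" "wv n v a" and v: "v \<in> extensional {1..n}" by (auto simp: wset_def wts_def)
    have "a = (\<Sum>w\<in>W. \<epsilon> w * a)" using W(4) by (simp add: sum_distrib_right[symmetric])
    also have "\<dots> = (\<Sum>w\<in>W. if w = v then a else 0)" using \<epsilon>[OF _ v a(2)] by (intro sum.cong) auto
    finally have "v \<in> W" using a W by (auto split: if_splits)
    moreover have "\<epsilon> v \<noteq> 0" using \<epsilon>[OF \<open>v \<in> W\<close> v a(2)] a by auto
    ultimately show "v \<in> {w\<in>W. \<epsilon> w \<noteq> 0}" by simp
  next
    fix v assume "v \<in> {w\<in>W. \<epsilon> w \<noteq> 0}"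
    then show "v \<in> wset" using W by (auto simp: wset_def intro: wtsI)
  qed
  have "(\<Sum>w\<in>wset. \<epsilon> w) = (\<Sum>w\<in>W. \<epsilon> w)"
    unfolding * using W by (intro sum.mono_neutral_left) auto
  then show ?thesis using W \<epsilon> * by (intro exI[of _ \<epsilon>]) auto
qed

definition eps :: "(nat \<Rightarrow> 'c \<times> complex) \<Rightarrow> 'a" where
  "eps = (SOME \<epsilon>. finite wset \<and> (\<forall>w\<in>wset. wv n w (\<epsilon> w) \<and> \<epsilon> w \<noteq> 0) \<and> (\<Sum>w\<in>wset. \<epsilon> w) = 1 \<and>
    (\<forall>w\<in>wset. \<forall>v\<in>extensional {1..n}. \<forall>a. wv n v a \<longrightarrow> \<epsilon> w * a = (if w = v then a else 0)))"

lemma finite_wset: "finite wset"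
  and eps_wv: "w \<in> wset \<Longrightarrow> wv n w (eps w)"
  and eps_nz: "w \<in> wset \<Longrightarrow> eps w \<noteq> 0"
  and sum_eps: "(\<Sum>w\<in>wset. eps w) = 1"
  and eps_mult: "\<lbrakk>w \<in> wset; v \<in> extensional {1..n}; wv n v a\<rbrakk> \<Longrightarrow> eps w * a = (if w = v then a else 0)"
  using someI_ex[OF weight_idempotents, folded eps_def] by blast+

lemma wset_ext: "w \<in> wset \<Longrightarrow> w \<in> extensional {1..n}" and wset_wts: "w \<in> wset \<Longrightarrow> w \<in> wts n"
  by (auto simp: wset_def)

lemma wsetI: "\<lbrakk>v \<in> extensional {1..n}; wv n v a; a \<noteq> 0\<rbrakk> \<Longrightarrow> v \<in> wset"
  by (auto simp: wset_def intro: wtsI)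

lemma eps_eps: "\<lbrakk>w \<in> wset; v \<in> wset\<rbrakk> \<Longrightarrow> eps w * eps v = (if w = v then eps v else 0)"
  using eps_mult[OF _ wset_ext eps_wv, of w v] by simp

lemma eps_same: "\<lbrakk>w \<in> wset; wv n w a\<rbrakk> \<Longrightarrow> eps w * a = a"
  using eps_mult[OF _ wset_ext, of w w a] by simp

lemma eq_on_eps: "(\<And>w. w \<in> wset \<Longrightarrow> x * eps w = y * eps w) \<Longrightarrow> x = y"
  by (metis (no_types, lifting) sum.cong sum_distrib_left mult.right_neutral sum_eps)

lemma ext_perm: "v \<in> extensional {1..n} \<Longrightarrow> \<rho> permutes {1..n} \<Longrightarrow> (\<lambda>j. v (\<rho> j)) \<in> extensional {1..n}"
  by (auto simp: extensional_def permutes_not_in)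

lemma transpose_permutes: "1 \<le> i \<Longrightarrow> i < n \<Longrightarrow> transpose i (Suc i) permutes {1..n}"
  by (rule permutes_swap_id) auto

lemma sw_ext: "v \<in> extensional {1..n} \<Longrightarrow> 1 \<le> i \<Longrightarrow> i < n \<Longrightarrow> sw i v \<in> extensional {1..n}"
  by (rule ext_perm[OF _ transpose_permutes])

lemma wset_adjacent: "\<lbrakk>v \<in> wset; 1 \<le> i; i < n\<rbrakk> \<Longrightarrow> v i \<noteq> v (Suc i)"
  using wts_adjacent[OF diagz_all[OF order_refl] wset_wts, of v i] by auto

text \<open>Elements acting by a scalar on each weight space. The \<open>p j c\<close>,
  \<open>Y (Suc 0)\<close> and the squares of the intertwiners have this form, which keeps the span
  \<open>nspan\<close> below closed under multiplication.\<close>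

definition diag :: "((nat \<Rightarrow> 'c \<times> complex) \<Rightarrow> complex) \<Rightarrow> 'a" where
  "diag f = (\<Sum>w\<in>wset. f w \<star> eps w)"

lemma diag_wv: "v \<in> extensional {1..n} \<Longrightarrow> wv n v a \<Longrightarrow> diag f * a = f v \<star> a"
proof -
  assume v: "v \<in> extensional {1..n}" "wv n v a"
  have "diag f * a = (\<Sum>w\<in>wset. if w = v then f v \<star> a else 0)"
    unfolding diag_def sum_distrib_right using v by (intro sum.cong) (auto simp: eps_mult)
  then show ?thesis using finite_wset wsetI[OF v] by (cases "a = 0") auto
qed

lemma diag_eps: "w \<in> wset \<Longrightarrow> diag f * eps w = f w \<star> eps w"
  by (rule diag_wv[OF wset_ext eps_wv])

lemma diagI:
  assumes "\<And>w a. wv n w a \<Longrightarrow> x * a = f w \<star> a"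
  shows "x = diag f"
  by (rule eq_on_eps) (simp add: diag_eps assms[OF eps_wv])

definition tau :: "nat \<Rightarrow> 'a" where
  "tau i = g i - diag (rc i)"

lemma tau_wv: "v \<in> extensional {1..n} \<Longrightarrow> wv n v a \<Longrightarrow> tau i * a = g i * a - rc i v \<star> a"
  by (simp add: tau_def left_diff_distrib diag_wv)

lemma tau_step:
  assumes "v \<in> extensional {1..n}" "wv n v a" "1 \<le> i" "i < n"
  shows "wv n (sw i v) (tau i * a)"
    and "tau i * (tau i * a) = (1 + rc i v * rc i (sw i v)) \<star> a"
proof -
  have *: "wv n (sw i v) (tau i * a) \<and> tau i * (tau i * a) = (1 + rc i v * rc i (sw i v)) \<star> a"
  proof (cases "a = 0")
    case True
    have "transpose i (Suc i) j \<in> {1..n}" if "j \<in> {1..n}" for j using that assms by (auto simp: transpose_def)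
    then show ?thesis using True assms by (auto simp: wv_def)
  next
    case False
    have ne: "v i \<noteq> v (Suc i)" by (rule wset_adjacent[OF wsetI[OF assms(1,2) False] assms(3,4)])
    have i: "1 \<le> i" "Suc i \<le> n" "n \<le> n" using assms by auto
    note s = wv_sw[OF assms(2) i ne, folded tau_wv[OF assms(1,2)]]
    then show ?thesis using tau_wv[OF sw_ext[OF assms(1,3,4)] s(1)] by simp
  qed
  then show "wv n (sw i v) (tau i * a)"
    "tau i * (tau i * a) = (1 + rc i v * rc i (sw i v)) \<star> a" by auto
qed

lemma g_tau: "v \<in> extensional {1..n} \<Longrightarrow> wv n v a \<Longrightarrow> g i * a = tau i * a + rc i v \<star> a"
  by (simp add: tau_wv)

lemma sw_sw [simp]: "sw i (sw i v) = v"
  by (simp add: fun_eq_iff)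

lemma tau_far:
  assumes "1 \<le> i" "Suc i < j" "j < n"
  shows "tau i * tau j = tau j * tau i"
proof (rule eq_on_eps)
  fix w assume w: "w \<in> wset"
  note e = wset_ext[OF w] and v = eps_wv[OF w]
  have ij: "1 \<le> i" "i < n" "1 \<le> j" "j < n" using assms by auto
  note si = sw_ext[OF e ij(1,2)] tau_step(1)[OF e v ij(1,2)]
  note sj = sw_ext[OF e ij(3,4)] tau_step(1)[OF e v ij(3,4)]
  have rc: "rc i (sw j w) = rc i w" "rc j (sw i w) = rc j w" using assms by (simp_all add: rc_def transpose_def)
  have "g i * (g j * eps w) = g j * (g i * eps w)" using g_far[OF assms] by (metis mult.assoc)
  then have "tau i * (tau j * eps w) = tau j * (tau i * eps w)"
    unfolding tau_wv[OF si] tau_wv[OF sj] unfolding tau_wv[OF e v] rc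
    by (simp add: right_diff_distrib cscale_distribs mult.commute)
  then show "tau i * tau j * eps w = tau j * tau i * eps w" by (simp add: mult.assoc)
qed

lemma tau_far': "\<lbrakk>1 \<le> i; i < n; 1 \<le> j; j < n; Suc i < j \<or> Suc j < i\<rbrakk> \<Longrightarrow> tau i * tau j = tau j * tau i"
  using tau_far[of i j] tau_far[of j i] by auto

text \<open>Sandwiching a word \<open>g\<^sub>i g\<^sub>j g\<^sub>i\<close> between weight idempotents singles out the word in the
  intertwiners, so these inherit the braid relation.\<close>

lemma eps_ggg:
  assumes v: "v \<in> wset" and i: "1 \<le> i" "i < n" "1 \<le> j" "j < n"
    and w: "sw i (sw j (sw i v)) \<in> wset"
    and ne: "sw i (sw j (sw i v)) \<notin> {sw j (sw i v), sw i (sw i v), sw i v, sw i (sw j v), sw j v, v}"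
  shows "eps (sw i (sw j (sw i v))) * (g i * (g j * (g i * eps v))) = tau i * (tau j * (tau i * eps v))"
proof -
  note e0 = wset_ext[OF v] and v0 = eps_wv[OF v]
  note e1 = sw_ext[OF e0 i(1,2)] and v1 = tau_step(1)[OF e0 v0 i(1,2)]
  note e2 = sw_ext[OF e1 i(3,4)] and v2 = tau_step(1)[OF e1 v1 i(3,4)]
  note e3 = sw_ext[OF e2 i(1,2)] and v3 = tau_step(1)[OF e2 v2 i(1,2)]
  note f1 = sw_ext[OF e0 i(3,4)] and u1 = tau_step(1)[OF e0 v0 i(3,4)]
  note f2 = sw_ext[OF f1 i(1,2)] and u2 = tau_step(1)[OF f1 u1 i(1,2)]
  note h1 = sw_ext[OF e1 i(1,2)] and v11 = tau_step(1)[OF e1 v1 i(1,2)]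
  let ?E = "eps (sw i (sw j (sw i v)))"
  have ggg: "g i * (g j * (g i * eps v)) = tau i * (tau j * (tau i * eps v)) + rc i (sw j (sw i v)) \<star> (tau j * (tau i * eps v))
     + rc j (sw i v) \<star> (tau i * (tau i * eps v) + rc i (sw i v) \<star> (tau i * eps v))
     + rc i v \<star> (tau i * (tau j * eps v) + rc i (sw j v) \<star> (tau j * eps v)
        + rc j v \<star> (tau i * eps v + rc i v \<star> eps v))"
    by (simp add: g_tau[OF e0 v0] g_tau[OF e1 v1] g_tau[OF e2 v2] g_tau[OF f1 u1] distrib_left cscale_add_right
        mult.commute mult.left_commute add.assoc)
  have z: "?E * (tau j * (tau i * eps v)) = 0" "?E * (tau i * (tau i * eps v)) = 0" "?E * (tau i * eps v) = 0"
    "?E * (tau i * (tau j * eps v)) = 0" "?E * (tau j * eps v) = 0" "?E * eps v = 0"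
    using eps_mult[OF w e2 v2] eps_mult[OF w h1 v11] eps_mult[OF w e1 v1] eps_mult[OF w f2 u2]
      eps_mult[OF w f1 u1] eps_mult[OF w e0 v0] ne by auto
  show ?thesis unfolding ggg by (simp add: distrib_left z eps_same[OF w v3])
qed

lemma tau_braid:
  assumes i: "1 \<le> i" "Suc i < n"
  shows "tau i * (tau (Suc i) * tau i) = tau (Suc i) * (tau i * tau (Suc i))"
proof (rule eq_on_eps)
  fix v assume v: "v \<in> wset"
  let ?j = "Suc i" and ?k = "Suc (Suc i)"
  have ij: "1 \<le> i" "i < n" "1 \<le> ?j" "?j < n" using i by auto
  have d: "v i \<noteq> v ?j" "v ?j \<noteq> v ?k" "v i \<noteq> v ?k"
    using wset_adjacent[OF v, of i] wset_adjacent[OF v, of ?j]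
      wts_two_apart[OF diagz_all[OF order_refl] wset_wts[OF v], of i] i by auto
  define w where "w = sw i (sw ?j (sw i v))"
  have w': "w = sw ?j (sw i (sw ?j v))"
    unfolding w_def by (rule ext) (auto simp: transpose_def)
  have wijk: "w i = v ?k" "w ?j = v ?j" "w ?k = v i" by (simp_all add: w_def transpose_def)
  note e0 = wset_ext[OF v] and v0 = eps_wv[OF v]
  note e1 = sw_ext[OF e0 ij(1,2)] and v1 = tau_step(1)[OF e0 v0 ij(1,2)]
  note e2 = sw_ext[OF e1 ij(3,4)] and v2 = tau_step(1)[OF e1 v1 ij(3,4)]
  note e3 = sw_ext[OF e2 ij(1,2)] and v3 = tau_step(1)[OF e2 v2 ij(1,2)]
  note f1 = sw_ext[OF e0 ij(3,4)] and u1 = tau_step(1)[OF e0 v0 ij(3,4)]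
  note f2 = sw_ext[OF f1 ij(1,2)] and u2 = tau_step(1)[OF f1 u1 ij(1,2)]
  note f3 = sw_ext[OF f2 ij(3,4)] and u3 = tau_step(1)[OF f2 u2 ij(3,4)]
  have "tau i * (tau ?j * (tau i * eps v)) = tau ?j * (tau i * (tau ?j * eps v))"
  proof (cases "w \<in> wset")
    case False
    then show ?thesis
      using wsetI[OF e3 v3] wsetI[OF f3 u3] unfolding w_def[symmetric] w'[symmetric] by metis
  next
    case True
    \<comment> \<open>The three entries involved are pairwise different, so the rearrangement by the
      full word differs from those reached by the shorter words.\<close>
    have n1: "w \<notin> {sw ?j (sw i v), sw i (sw i v), sw i v, sw i (sw ?j v), sw ?j v, v}"
    proof -
      have "w i \<noteq> v i" "w i \<noteq> v ?j" using d wijk by auto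
      moreover have "w ?j \<noteq> v i" "w ?j \<noteq> v ?k" using d wijk by auto
      moreover have "(sw ?j (sw i v)) i = v ?j" "(sw i v) i = v ?j" "(sw i (sw ?j v)) i = v ?k"
        "(sw i (sw ?j v)) ?j = v i" "(sw ?j v) i = v i"
        by (simp_all add: transpose_def)
      ultimately show ?thesis by auto
    qed
    then have n2: "w \<notin> {sw i (sw ?j v), sw ?j (sw ?j v), sw ?j v, sw ?j (sw i v), sw i v, v}" by auto
    have "eps w * (g i * (g ?j * (g i * eps v))) = tau i * (tau ?j * (tau i * eps v))"
      using eps_ggg[OF v ij True[unfolded w_def] n1[unfolded w_def]] by (simp only: w_def)
    moreover have "eps w * (g ?j * (g i * (g ?j * eps v))) = tau ?j * (tau i * (tau ?j * eps v))"
      using eps_ggg[OF v ij(3,4,1,2) True[unfolded w'] n2[unfolded w']] by (simp only: w')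
    moreover have "g i * (g ?j * (g i * eps v)) = g ?j * (g i * (g ?j * eps v))"
      using g_braid[OF i] by (metis mult.assoc)
    ultimately show ?thesis by simp
  qed
  then show "tau i * (tau ?j * tau i) * eps v = tau ?j * (tau i * tau ?j) * eps v"
    by (simp add: mult.assoc)
qed

text \<open>If v and its swap both occur, truncate them after position i: they agree before i and
  end in the two entries in question, which by \<open>not_both_addable\<close> are not
  neighbours.\<close>

lemma tau_sq_nz:
  assumes v: "v \<in> wset" and sv: "sw i v \<in> wset" and i: "1 \<le> i" "i < n"
  shows "1 + rc i v * rc i (sw i v) \<noteq> 0"
proof (cases "fst (v i) = fst (v (Suc i))")
  case False
  then show ?thesis by (simp add: rc_def)
next
  case True
  have D: "diagz i" using i by (intro diagz_all) simp
  have sub: "u \<in> wts i" if "u \<in> wset" for u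
    using wset_wts[OF that] i by (auto simp: wts_def wv_def)
  have ne: "v i \<noteq> v (Suc i)" by (rule wset_adjacent[OF v i])
  define c where "c = fst (v i)"
  obtain a b where ab: "v i = (c, a)" "v (Suc i) = (c, b)" using True by (metis c_def prod.collapse)
  then have sab: "sw i v i = (c, b)" by simp
  have eq: "v j = sw i v j" "sw i v j = v j" if "1 \<le> j" "j < i" for j using that by (auto simp: transpose_def)
  show ?thesis
  proof (rule rc_prod[OF True ne])
    show "snd (v (Suc i)) \<noteq> \<sigma> (snd (v i))"
      using not_both_addable[OF D i sub[OF v] sub[OF sv] eq(1) ab(1)] ab sab by auto
    show "snd (v i) \<noteq> \<sigma> (snd (v (Suc i)))"
      using not_both_addable[OF D i sub[OF sv] sub[OF v] eq(2) sab] ab by auto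
  qed
qed

end

section \<open>Paths between weights and normal forms of products of intertwiners\<close>

context weight_setting
begin

definition order_ok :: "(nat \<Rightarrow> 'c \<times> complex) \<Rightarrow> (nat \<Rightarrow> nat) \<Rightarrow> bool" where
  "order_ok v \<rho> \<longleftrightarrow> (\<forall>j\<in>{1..n}. \<forall>j'\<in>{1..n}. j < j' \<and> v (\<rho> j) = v (\<rho> j') \<longrightarrow> \<rho> j < \<rho> j')"

text \<open>The element \<open>x\<close> moves the weight \<open>v\<close> to \<open>v \<circ> \<rho>\<close>, and whenever it does not vanish there,
  it is invertible and never interchanges equal entries.\<close>

definition path :: "'a \<Rightarrow> (nat \<Rightarrow> nat) \<Rightarrow> bool" where
  "path x \<rho> \<longleftrightarrow> \<rho> permutes {1..n} \<and> (\<forall>v\<in>wset. wv n (\<lambda>j. v (\<rho> j)) (x * eps v) \<and>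
     (x * eps v \<noteq> 0 \<longrightarrow> order_ok v \<rho> \<and> (\<exists>x' c. c \<noteq> 0 \<and> x' * (x * eps v) = c \<star> eps v)))"

lemma path_id: "path 1 id"
  unfolding path_def order_ok_def
  by (auto simp: permutes_id[unfolded id_def] id_def eps_wv intro: exI[of _ 1] permutes_id[unfolded id_def])
    (intro exI[of _ 1], simp)

lemma path_tau:
  assumes x: "path x \<rho>" and i: "1 \<le> i" "i < n"
  shows "path (x * tau i) (transpose i (Suc i) \<circ> \<rho>)"
  unfolding path_def
proof (intro conjI ballI impI)
  let ?s = "transpose i (Suc i)"
  have \<rho>: "\<rho> permutes {1..n}" using x by (simp add: path_def)
  show "?s \<circ> \<rho> permutes {1..n}" by (rule permutes_compose[OF \<rho> transpose_permutes[OF i]])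
  fix v assume v: "v \<in> wset"
  note e = wset_ext[OF v] and v0 = eps_wv[OF v]
  let ?b = "tau i * eps v" and ?v' = "sw i v"
  note e1 = sw_ext[OF e i] and b = tau_step[OF e v0 i]
  have v': "?v' \<in> wset" if "?b \<noteq> 0" using wsetI[OF e1 b(1) that] .
  have xb: "x * tau i * eps v = (x * eps ?v') * ?b" if "?b \<noteq> 0"
    using eps_same[OF v'[OF that] b(1)] by (simp add: mult.assoc)
  show "wv n (\<lambda>j. v ((?s \<circ> \<rho>) j)) (x * tau i * eps v)"
  proof (cases "?b = 0")
    case True
    have "(?s \<circ> \<rho>) j \<in> {1..n}" if "j \<in> {1..n}" for j
      using that permutes_in_image[OF \<rho>] permutes_in_image[OF transpose_permutes[OF i]] by simp
    then show ?thesis using True v0 by (auto simp: wv_def mult.assoc)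
  next
    case False
    have "\<forall>v\<in>wset. wv n (\<lambda>j. v (\<rho> j)) (x * eps v)" using x by (simp add: path_def)
    from bspec[OF this v'[OF False]] have "wv n (\<lambda>j. ?v' (\<rho> j)) (x * eps ?v')" .
    from wv_mult_right[OF this, of ?b] show ?thesis unfolding xb[OF False] by (simp add: comp_def)
  qed
  assume nz: "x * tau i * eps v \<noteq> 0"
  then have bnz: "?b \<noteq> 0" by (auto simp: mult.assoc)
  have xv': "x * eps ?v' \<noteq> 0" using nz unfolding xb[OF bnz] by auto
  then have o: "order_ok ?v' \<rho>" and "\<exists>x' c. c \<noteq> 0 \<and> x' * (x * eps ?v') = c \<star> eps ?v'"
    using x v'[OF bnz] by (auto simp: path_def)
  then obtain x' c where x': "c \<noteq> 0" "x' * (x * eps ?v') = c \<star> eps ?v'" by blast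
  show "order_ok v (?s \<circ> \<rho>)"
    unfolding order_ok_def
  proof (intro ballI impI)
    fix j j' assume j: "j \<in> {1..n}" "j' \<in> {1..n}" and jj: "j < j' \<and> v ((?s \<circ> \<rho>) j) = v ((?s \<circ> \<rho>) j')"
    then have lt: "\<rho> j < \<rho> j'" using o by (simp add: order_ok_def)
    \<comment> \<open>Among increasing pairs the transposition reverses only i < i + 1, and a weight
      has different entries there.\<close>
    have "\<not> (\<rho> j = i \<and> \<rho> j' = Suc i)"
      using jj wset_adjacent[OF v i] by auto
    then show "(?s \<circ> \<rho>) j < (?s \<circ> \<rho>) j'" using lt by (auto simp: transpose_def)
  qed
  have nz': "1 + rc i v * rc i ?v' \<noteq> 0" by (rule tau_sq_nz[OF v v'[OF bnz] i])
  have "(tau i * x') * (x * tau i * eps v) = tau i * ((x' * (x * eps ?v')) * ?b)"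
    unfolding xb[OF bnz] by (simp add: mult.assoc)
  also have "\<dots> = c \<star> (tau i * (eps ?v' * ?b))" by (simp add: x')
  also have "\<dots> = (c * (1 + rc i v * rc i ?v')) \<star> eps v"
    by (simp add: eps_same[OF v'[OF bnz] b(1)] b(2))
  finally show "\<exists>x' c. c \<noteq> 0 \<and> x' * (x * tau i * eps v) = c \<star> eps v"
    using nz' x'(1) by (metis mult_eq_0_iff)
qed

text \<open>The product of l factors with indices descending from k. Its permutation
  \<open>tperm k l\<close> sends k + 1 to k + 1 - l, so the length can be read off.\<close>

fun tword :: "nat \<Rightarrow> nat \<Rightarrow> 'a" where
  "tword k 0 = 1"
| "tword k (Suc l) = tword k l * tau (k - l)"

fun tperm :: "nat \<Rightarrow> nat \<Rightarrow> nat \<Rightarrow> nat" where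
  "tperm k 0 = id"
| "tperm k (Suc l) = transpose (k - l) (Suc (k - l)) \<circ> tperm k l"

text \<open>The normal forms \<open>(\<tau>\<^sub>1)(\<tau>\<^sub>2 \<tau>\<^sub>1)(\<tau>\<^sub>3 \<tau>\<^sub>2 \<tau>\<^sub>1)\<dots>\<close>, each factor being truncated on the right.\<close>

fun nforms :: "nat \<Rightarrow> ('a \<times> (nat \<Rightarrow> nat)) set" where
  "nforms 0 = {(1, id)}"
| "nforms (Suc k) = {(x * tword (Suc k) l, tperm (Suc k) l \<circ> \<rho>) | x \<rho> l. (x, \<rho>) \<in> nforms k \<and> l \<le> Suc k}"

lemma path_tword: "path x \<rho> \<Longrightarrow> k < n \<Longrightarrow> l \<le> k \<Longrightarrow> path (x * tword k l) (tperm k l \<circ> \<rho>)"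
proof (induction l)
  case (Suc l)
  then have "path (x * tword k l * tau (k - l)) (transpose (k - l) (Suc (k - l)) \<circ> (tperm k l \<circ> \<rho>))"
    by (intro path_tau Suc.IH) auto
  then show ?case unfolding tword.simps tperm.simps mult.assoc comp_assoc .
qed simp

lemma nforms_SucE:
  assumes "(x, \<rho>) \<in> nforms (Suc k)"
  obtains x0 \<rho>0 l where "x = x0 * tword (Suc k) l" "\<rho> = tperm (Suc k) l \<circ> \<rho>0" "(x0, \<rho>0) \<in> nforms k" "l \<le> Suc k"
  using assms by (auto simp only: nforms.simps)

lemma path_nforms: "k < n \<Longrightarrow> (x, \<rho>) \<in> nforms k \<Longrightarrow> path x \<rho>"
  by (induction k arbitrary: x \<rho>) (auto simp: path_id path_tword)

lemma tperm_top: "l \<le> k \<Longrightarrow> tperm k l (Suc k) = Suc k - l"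
  by (induction l) (auto simp: transpose_def Suc_diff_le)

lemma tperm_above: "l \<le> k \<Longrightarrow> Suc k < j \<Longrightarrow> tperm k l j = j"
  by (induction l) (auto simp: transpose_def)

lemma nforms_above: "(x, \<rho>) \<in> nforms k \<Longrightarrow> Suc k < j \<Longrightarrow> \<rho> j = j"
proof (induction k arbitrary: x \<rho>)
  case (Suc k)
  from Suc.prems(1) obtain x0 \<rho>0 l where "\<rho> = tperm (Suc k) l \<circ> \<rho>0" "(x0, \<rho>0) \<in> nforms k" "l \<le> Suc k"
    by (rule nforms_SucE)
  then show ?case using Suc.IH[of x0 \<rho>0] Suc.prems(2) tperm_above[of l "Suc k" j] by simp
qed simp

text \<open>The inner factors fix the top index, which the last factor lowers by its length l; for
  the identity this gives l = 0, level by level.\<close>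

lemma nforms_id: "(x, \<rho>) \<in> nforms k \<Longrightarrow> \<forall>j. \<rho> j = j \<Longrightarrow> x = 1"
proof (induction k arbitrary: x \<rho>)
  case (Suc k)
  from Suc.prems(1) obtain x0 \<rho>0 l where x: "x = x0 * tword (Suc k) l" "\<rho> = tperm (Suc k) l \<circ> \<rho>0"
    "(x0, \<rho>0) \<in> nforms k" "l \<le> Suc k" by (rule nforms_SucE)
  have "tperm (Suc k) l (\<rho>0 (Suc (Suc k))) = Suc (Suc k)" using Suc.prems(2) x by simp
  then have "Suc (Suc k) - l = Suc (Suc k)"
    using nforms_above[OF x(3), of "Suc (Suc k)"] tperm_top[OF x(4)] by simp
  then have "l = 0" by simp
  then show ?case using Suc.IH[OF x(3)] Suc.prems(2) x by simp
qed simp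

lemma one_nforms: "(1, id) \<in> nforms k"
proof (induction k)
  case (Suc k)
  then have "(1 * tword (Suc k) 0, tperm (Suc k) 0 \<circ> id) \<in> nforms (Suc k)" unfolding nforms.simps by blast
  then show ?case by (simp only: tword.simps tperm.simps mult_1_left comp_id)
qed (simp add: id_def)

inductive_set nspan :: "nat \<Rightarrow> 'a set" for k where
  zero: "0 \<in> nspan k"
| add: "a \<in> nspan k \<Longrightarrow> b \<in> nspan k \<Longrightarrow> a + b \<in> nspan k"
| base: "(x, \<rho>) \<in> nforms k \<Longrightarrow> x * diag f \<in> nspan k"

lemma diag_tau:
  assumes "1 \<le> i" "i < n"
  shows "diag f * tau i = tau i * diag (\<lambda>w. f (sw i w))"
proof (rule eq_on_eps)
  fix v assume v: "v \<in> wset"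
  note e = wset_ext[OF v] and v0 = eps_wv[OF v]
  have "diag f * (tau i * eps v) = f (sw i v) \<star> (tau i * eps v)"
    by (rule diag_wv[OF sw_ext[OF e assms] tau_step(1)[OF e v0 assms]])
  then show "diag f * tau i * eps v = tau i * diag (\<lambda>w. f (sw i w)) * eps v"
    by (simp add: mult.assoc diag_eps[OF v])
qed

lemma diag_diag: "diag f * diag f' = diag (\<lambda>w. f w * f' w)"
  by (rule eq_on_eps) (simp add: mult.assoc diag_eps mult.commute)

lemma tau_tau: "1 \<le> i \<Longrightarrow> i < n \<Longrightarrow> tau i * tau i = diag (\<lambda>w. 1 + rc i w * rc i (sw i w))"
  by (rule eq_on_eps) (simp add: mult.assoc diag_eps tau_step(2)[OF wset_ext eps_wv])

lemma diag_tword: "k < n \<Longrightarrow> l \<le> k \<Longrightarrow> \<exists>f'. diag f * tword k l = tword k l * diag f'"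
proof (induction l arbitrary: f)
  case (Suc l)
  then obtain f' where "diag f * tword k l = tword k l * diag f'" by fastforce
  then have "diag f * tword k (Suc l) = tword k (Suc l) * diag (\<lambda>w. f' (sw (k - l) w))"
    using diag_tau[of "k - l" f'] Suc by (simp add: mult.assoc[symmetric]) (simp add: mult.assoc)
  then show ?case by blast
qed auto

lemma nspan_diag: "a \<in> nspan k \<Longrightarrow> a * diag f \<in> nspan k"
  by (induction rule: nspan.induct)
    (auto intro: nspan.intros simp: distrib_right mult.assoc diag_diag)

lemma nspan_tword: "a \<in> nspan k \<Longrightarrow> Suc k < n \<Longrightarrow> l \<le> Suc k \<Longrightarrow> a * tword (Suc k) l \<in> nspan (Suc k)"
proof (induction rule: nspan.induct)
  case (base x \<rho> f)
  obtain f' where "diag f * tword (Suc k) l = tword (Suc k) l * diag f'"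
    using diag_tword[OF base(2,3)] by blast
  then have "x * diag f * tword (Suc k) l = x * tword (Suc k) l * diag f'" by (simp add: mult.assoc)
  moreover have "(x * tword (Suc k) l, tperm (Suc k) l \<circ> \<rho>) \<in> nforms (Suc k)"
    using base unfolding nforms.simps by blast
  ultimately show ?case using nspan.base by metis
qed (auto intro: nspan.intros simp: distrib_right)

lemma tword_far: "k < n \<Longrightarrow> l \<le> k \<Longrightarrow> 1 \<le> i \<Longrightarrow> Suc i \<le> k - l \<Longrightarrow> tword k l * tau i = tau i * tword k l"
proof (induction l)
  case (Suc l)
  have 1: "tau (k - l) * tau i = tau i * tau (k - l)" using Suc.prems by (intro tau_far') auto
  have 2: "tword k l * tau i = tau i * tword k l" using Suc by simp
  show ?case unfolding tword.simps mult.assoc 1 mult_assoc_rule[OF 2] ..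
qed simp

text \<open>A generator inside the range of a descending word passes to the left with its index
  lowered by one; the braid relation is used once and far commutation otherwise.\<close>

lemma tword_shift:
  "k < n \<Longrightarrow> l \<le> k \<Longrightarrow> Suc k - l < i \<Longrightarrow> i \<le> k \<Longrightarrow> tword k l * tau i = tau (i - 1) * tword k l"
proof (induction l)
  case (Suc l)
  define j where "j = k - Suc l"
  have j: "k - l = Suc j" "Suc k - l = Suc (Suc j)" "Suc k - Suc l = Suc j" using Suc.prems by (auto simp: j_def)
  show ?case
  proof (cases "i = Suc (Suc j)")
    case True
    obtain l' where l': "l = Suc l'" using True Suc.prems j by (cases l) auto
    have kl': "k - l' = i" "1 \<le> Suc j" "i < n" using True l' j Suc.prems by auto
    have 1: "tword k l' * tau (Suc j) = tau (Suc j) * tword k l'"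
      using Suc.prems l' j kl' True by (intro tword_far) auto
    have 2: "tau i * (tau (Suc j) * tau i) = tau (Suc j) * (tau i * tau (Suc j))"
      unfolding True using kl' True by (intro tau_braid[symmetric]) auto
    have "tword k l' * tau i * tau (Suc j) * tau i = tau (Suc j) * (tword k l' * tau i * tau (Suc j))"
      by (simp only: mult.assoc 2 mult_assoc_rule[OF 1])
    then show ?thesis using l' kl' j True by simp
  next
    case False
    have 1: "tau (k - l) * tau i = tau i * tau (k - l)" using False Suc.prems j by (intro tau_far') auto
    have 2: "tword k l * tau i = tau (i - 1) * tword k l" using False Suc.prems j by (intro Suc.IH) auto
    have "tword k (Suc l) * tau i = tword k l * tau i * tau (k - l)"
      unfolding tword.simps mult.assoc 1 ..
    then show ?thesis unfolding 2 tword.simps mult.assoc .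
  qed
qed simp

text \<open>Relative to the last descending factor the new generator commutes with it, extends it,
  cancels its final letter into a diagonal element, or crosses it by \<open>tword_shift\<close>.
  When it crosses, it reaches the shorter normal form, to which the induction on k applies.\<close>

lemma nspan_tau: "a \<in> nspan k \<Longrightarrow> k < n \<Longrightarrow> 1 \<le> i \<Longrightarrow> i \<le> k \<Longrightarrow> a * tau i \<in> nspan k"
proof (induction k arbitrary: a i)
  case (Suc k)
  from Suc.prems(1) show ?case
  proof (induction rule: nspan.induct)
    case (base y \<rho> f)
    from base(1) obtain x \<rho>0 l where x: "y = x * tword (Suc k) l" "\<rho> = tperm (Suc k) l \<circ> \<rho>0"
      "(x, \<rho>0) \<in> nforms k" "l \<le> Suc k" by (rule nforms_SucE)
    have xs: "x \<in> nspan k"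
    proof -
      have "diag (\<lambda>_. 1) = 1" by (rule eq_on_eps) (simp add: diag_eps)
      then show ?thesis using nspan.base[OF x(3), of "\<lambda>_. 1"] by simp
    qed
    have i: "1 \<le> i" "i < n" using Suc.prems by auto
    have "x * tword (Suc k) l * tau i \<in> nspan (Suc k)"
    proof -
      define d where "d = Suc k - l"
      have d: "Suc k - l = d" "Suc (Suc k) - l = Suc d" "Suc k = l + d" using x(4) by (auto simp: d_def)
      have "i \<le> l + d" using Suc.prems(4) d(3) by simp
      then consider "Suc i \<le> d" | "i = d" | "i = Suc d" "1 \<le> l" | "Suc d < i"
        by linarith
      then consider "Suc i \<le> Suc k - l" | "i = Suc k - l" | "i = Suc (Suc k) - l" "1 \<le> l" | "Suc (Suc k) - l < i"
        unfolding d(1,2) by cases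
      then show ?thesis
      proof cases
        case 1
        have "x * tword (Suc k) l * tau i = (x * tau i) * tword (Suc k) l"
          using tword_far[of "Suc k" l i] 1 x Suc.prems i by (simp add: mult.assoc)
        moreover have "x * tau i \<in> nspan k" using xs 1 Suc.prems i by (intro Suc.IH) auto
        ultimately show ?thesis using nspan_tword Suc.prems x by simp
      next
        case 2
        then have "x * tword (Suc k) l * tau i = x * tword (Suc k) (Suc l)" by (simp add: mult.assoc)
        then show ?thesis using nspan_tword[OF xs _, of "Suc l"] Suc.prems 2 i by auto
      next
        case 3
        then obtain l' where l': "l = Suc l'" by (cases l) auto
        have "x * tword (Suc k) l * tau i = x * tword (Suc k) l' * (tau i * tau i)"
          using 3 l' by (simp add: mult.assoc Suc_diff_le)
        then show ?thesis
          unfolding tau_tau[OF i] using nspan_tword[OF xs, of l'] Suc.prems x l'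
          by (auto intro: nspan_diag)
      next
        case 4
        have "x * tword (Suc k) l * tau i = (x * tau (i - 1)) * tword (Suc k) l"
          using tword_shift[of "Suc k" l i] 4 x Suc.prems by (simp add: mult.assoc)
        moreover have "x * tau (i - 1) \<in> nspan k" using xs 4 Suc.prems x by (intro Suc.IH) auto
        ultimately show ?thesis using nspan_tword Suc.prems x by simp
      qed
    qed
    then show ?case
      unfolding x(1) mult.assoc diag_tau[OF i] by (metis mult.assoc nspan_diag)
  qed (auto intro: nspan.intros simp: distrib_right)
qed simp

end

section \<open>Corners of the weight idempotents and links between them\<close>

locale generated_weight_setting = weight_setting n h C p g ee Y q Rt \<sigma> \<tau>
  for n h C and p :: "nat \<Rightarrow> 'c \<Rightarrow> 'a::complex_algebra" and g ee Y q Rt \<sigma> \<tau> +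
  assumes generated: "\<And>Q a. \<lbrakk>\<And>c. Q (c \<star> 1); \<And>a b. Q a \<Longrightarrow> Q b \<Longrightarrow> Q (a + b); \<And>a b. Q a \<Longrightarrow> Q b \<Longrightarrow> Q (a * b);
    \<And>i. 1 \<le> i \<Longrightarrow> i < n \<Longrightarrow> Q (g i); \<And>j c. j \<in> {1..n} \<Longrightarrow> c \<in> C \<Longrightarrow> Q (p j c); Q (Y (Suc 0))\<rbrakk> \<Longrightarrow> Q a"
begin

text \<open>The property passed to \<open>generated\<close> is stability of the span under right
  multiplication, not membership: stability is evidently closed under products, and applied to 1 it
  yields membership.\<close>

lemma nspan_all: "a \<in> nspan (n - 1)"
proof -
  have diag1: "c \<star> 1 = diag (\<lambda>_. c)" for c by (rule diagI) simp
  have "\<forall>s\<in>nspan (n - 1). s * a \<in> nspan (n - 1)"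
  proof (rule generated[where Q = "\<lambda>a. \<forall>s\<in>nspan (n - 1). s * a \<in> nspan (n - 1)"])
    show "\<forall>s\<in>nspan (n - 1). s * (c \<star> 1) \<in> nspan (n - 1)" for c
      unfolding diag1 by (auto intro: nspan_diag)
    show "\<forall>s\<in>nspan (n - 1). s * g i \<in> nspan (n - 1)" if i: "1 \<le> i" "i < n" for i
    proof
      fix s assume s: "s \<in> nspan (n - 1)"
      have "s * g i = s * tau i + s * diag (rc i)" by (simp add: tau_def right_diff_distrib)
      then show "s * g i \<in> nspan (n - 1)"
        using nspan_tau[OF s, of i] nspan_diag[OF s] i by (auto intro: nspan.add)
    qed
    show "\<forall>s\<in>nspan (n - 1). s * p j c \<in> nspan (n - 1)" if "j \<in> {1..n}" "c \<in> C" for j c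
    proof -
      have "p j c = diag (\<lambda>w. if c = fst (w j) then 1 else 0)"
        by (rule diagI) (use wv_p that in auto)
      then show ?thesis by (auto intro: nspan_diag)
    qed
    show "\<forall>s\<in>nspan (n - 1). s * Y (Suc 0) \<in> nspan (n - 1)"
    proof -
      have "Y (Suc 0) = diag (\<lambda>w. snd (w (Suc 0)))"
        by (rule diagI) (use n_pos in \<open>auto simp: wv_def\<close>)
      then show ?thesis by (auto intro: nspan_diag)
    qed
  qed (auto simp: distrib_left mult.assoc[symmetric] intro: nspan.add)
  moreover have "1 \<in> nspan (n - 1)"
    using nspan.base[OF one_nforms[of "n - 1"], of "\<lambda>_. 1"] diag1[of 1] by simp
  ultimately show ?thesis by fastforce
qed

lemma eps_nform_eps:
  assumes x: "(x, \<rho>) \<in> nforms (n - 1)" and w: "w \<in> wset" "w' \<in> wset" and nz: "eps w' * (x * eps w) \<noteq> 0"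
  shows "w' = (\<lambda>j. w (\<rho> j))" "x * eps w \<noteq> 0" "eps w' * (x * eps w) = x * eps w"
proof -
  have p: "path x \<rho>" using path_nforms[OF _ x] n_pos by simp
  then have v: "wv n (\<lambda>j. w (\<rho> j)) (x * eps w)" and \<rho>: "\<rho> permutes {1..n}" using w by (auto simp: path_def)
  have "(\<lambda>j. w (\<rho> j)) \<in> extensional {1..n}" by (rule ext_perm[OF wset_ext[OF w(1)] \<rho>])
  from eps_mult[OF w(2) this v] nz
  show "w' = (\<lambda>j. w (\<rho> j))" "x * eps w \<noteq> 0" "eps w' * (x * eps w) = x * eps w" by (auto split: if_splits)
qed

text \<open>The least moved index i satisfies i < \<rho> i, and i = \<rho> k for some k > i. The
  positions \<rho> i and \<rho> k carry equal entries, so order preservation gives \<rho> i < \<rho>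
  k = i.\<close>

lemma order_preserving_id:
  assumes \<rho>: "\<rho> permutes {1..n}" and o: "order_ok w \<rho>" and w: "w = (\<lambda>j. w (\<rho> j))"
  shows "\<rho> j = j"
proof (rule ccontr)
  assume "\<rho> j \<noteq> j"
  define i where "i = (LEAST i. \<rho> i \<noteq> i)"
  have i: "\<rho> i \<noteq> i" unfolding i_def by (rule LeastI[of "\<lambda>i. \<rho> i \<noteq> i"]) (rule \<open>\<rho> j \<noteq> j\<close>)
  have least: "\<rho> k = k" if "k < i" for k using not_less_Least[of k "\<lambda>i. \<rho> i \<noteq> i"] that by (auto simp: i_def)
  have inj: "inj \<rho>" using permutes_inj[OF \<rho>] .
  have in1: "i \<in> {1..n}" using i permutes_not_in[OF \<rho>] by blast
  have gt: "i < \<rho> i"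
  proof (rule ccontr)
    assume "\<not> i < \<rho> i"
    then have "\<rho> i < i" using i by simp
    then have "\<rho> (\<rho> i) = \<rho> i" by (rule least)
    then show False using i injD[OF inj] by blast
  qed
  obtain k where k: "i = \<rho> k" using permutes_surj[OF \<rho>] by (metis surjD)
  have "k \<noteq> i" using k i by auto
  moreover have "\<not> k < i" using least[of k] k by auto
  ultimately have ik: "i < k" by simp
  have kn: "k \<in> {1..n}" using k in1 permutes_in_image[OF \<rho>, of k] by simp
  have "w (\<rho> i) = w i" "w (\<rho> k) = w k" using fun_cong[OF w] by metis+
  moreover have "w (\<rho> k) = w i" using k by simp
  ultimately have "w (\<rho> i) = w (\<rho> k)" by simp
  then have "\<rho> i < \<rho> k" using o in1 kn ik by (simp add: order_ok_def)
  then show False using gt k by simp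
qed

text \<open>A normal form that leads from w back to w fixes w without interchanging equal entries,
  so its permutation is the identity and by \<open>nforms_id\<close> the normal form is 1.\<close>

lemma eps_corner: "w \<in> wset \<Longrightarrow> \<exists>c. eps w * (a * eps w) = c \<star> eps w"
proof -
  assume w: "w \<in> wset"
  have "a \<in> nspan (n - 1)" by (rule nspan_all)
  then show ?thesis
  proof (induction rule: nspan.induct)
    case zero
    show ?case by (intro exI[of _ 0]) simp
  next
    case (add a b)
    then obtain c d where "eps w * (a * eps w) = c \<star> eps w" "eps w * (b * eps w) = d \<star> eps w" by blast
    then have "eps w * ((a + b) * eps w) = (c + d) \<star> eps w"
      by (simp add: distrib_left distrib_right cscale_add_left)
    then show ?case by blast
  next
    case (base x \<rho> f)
    have *: "eps w * (x * diag f * eps w) = f w \<star> (eps w * (x * eps w))"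
      by (simp add: mult.assoc diag_eps[OF w])
    show ?case
    proof (cases "eps w * (x * eps w) = 0")
      case True
      then show ?thesis unfolding * by (intro exI[of _ 0]) simp
    next
      case False
      note e = eps_nform_eps[OF base w w False]
      have p: "path x \<rho>" using path_nforms[OF _ base] n_pos by simp
      then have "\<rho> permutes {1..n}" "order_ok w \<rho>" using w e(2) by (auto simp: path_def)
      from order_preserving_id[OF this e(1)] have "x = 1" using nforms_id[OF base] by blast
      then show ?thesis unfolding * using eps_eps[OF w w] by auto
    qed
  qed
qed

text \<open>Some normal form gives a non-zero T from w to w', undone by x' up to a scalar c. The
  corner at w' is one-dimensional, so T x' acts there by the same c. Hence any y from w to w'
  satisfies c y = T x' y, a multiple of T by the corner at w, and x' undoes y as well.\<close>

lemma eps_link: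
  assumes w: "w \<in> wset" and w': "w' \<in> wset" and nz: "eps w' * (a * eps w) \<noteq> 0"
  shows "\<exists>b. b * (eps w' * (a * eps w)) = eps w"
proof -
  have "a \<in> nspan (n - 1)" by (rule nspan_all)
  then have "eps w' * (a * eps w) \<noteq> 0 \<Longrightarrow> \<exists>x \<rho>. (x, \<rho>) \<in> nforms (n - 1) \<and> eps w' * (x * eps w) \<noteq> 0"
  proof (induction rule: nspan.induct)
    case (add a b)
    then have "eps w' * (a * eps w) \<noteq> 0 \<or> eps w' * (b * eps w) \<noteq> 0"
      by (auto simp: distrib_left distrib_right)
    then show ?case using add.IH by blast
  next
    case (base x \<rho> f)
    have "eps w' * (x * diag f * eps w) = f w \<star> (eps w' * (x * eps w))"
      by (simp add: mult.assoc diag_eps[OF w])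
    then show ?case using base by (auto intro!: exI)
  qed simp
  then obtain x \<rho> where x: "(x, \<rho>) \<in> nforms (n - 1)" "eps w' * (x * eps w) \<noteq> 0" using nz by blast
  note e = eps_nform_eps[OF x(1) w w' x(2)]
  define T where "T = x * eps w"
  have "path x \<rho>" using path_nforms[OF _ x(1)] n_pos by simp
  then obtain x' c where x': "c \<noteq> 0" "x' * T = c \<star> eps w"
    unfolding T_def using w e(2) by (auto simp: path_def)
  have T: "T \<noteq> 0" "eps w' * T = T" "T * eps w = T"
    using e eps_eps[OF w w] by (simp_all add: T_def mult.assoc)
  obtain \<mu> where \<mu>: "eps w' * ((T * x') * eps w') = \<mu> \<star> eps w'" using eps_corner[OF w'] by blast
  have "\<mu> \<star> T = eps w' * ((T * x') * eps w') * T" by (simp add: \<mu> T)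
  also have "\<dots> = eps w' * (T * (x' * (eps w' * T)))" by (simp add: mult.assoc)
  also have "\<dots> = c \<star> T" by (simp add: T x')
  finally have "\<mu> = c" using T by (simp add: cscale_cancel_right)
  define y where "y = eps w' * (a * eps w)"
  have y1: "eps w' * y = y" using eps_eps[OF w' w'] by (simp add: y_def mult.assoc[symmetric])
  have y2: "y * eps w = y" using eps_eps[OF w w] by (simp add: y_def mult.assoc)
  note y = y1 y2
  obtain \<kappa> where \<kappa>: "eps w * ((x' * y) * eps w) = \<kappa> \<star> eps w" using eps_corner[OF w] by blast
  have "c \<star> y = eps w' * ((T * x') * eps w') * y" using \<mu> \<open>\<mu> = c\<close> y by simp
  also have "\<dots> = eps w' * (T * eps w * (x' * (eps w' * y)))" by (simp only: mult.assoc T(3))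
  also have "\<dots> = eps w' * (T * (eps w * ((x' * y) * eps w)))" by (simp add: y mult.assoc)
  also have "\<dots> = \<kappa> \<star> T" by (simp add: \<kappa> T)
  finally have "\<kappa> \<noteq> 0" using x'(1) nz by (auto simp: y_def)
  have "((1 / \<kappa>) \<star> (eps w * x')) * y = (1 / \<kappa>) \<star> (eps w * ((x' * y) * eps w))"
    by (simp add: mult.assoc y)
  also have "\<dots> = eps w" using \<open>\<kappa> \<noteq> 0\<close> by (simp add: \<kappa>)
  finally show ?thesis unfolding y_def by blast
qed

end

section \<open>Notions of semisimplicity\<close>

text \<open>Weak form of semisimplicity: \<open>1\<close> is a sum of generators of minimal left ideals.\<close>

definition one_decomposes :: "'a::complex_algebra itself \<Rightarrow> bool" where
  "one_decomposes _ \<longleftrightarrow> (\<exists>(I :: nat set) (e :: nat \<Rightarrow> 'a). finite I \<and> (\<Sum>i\<in>I. e i) = 1 \<and>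
     (\<forall>i\<in>I. \<forall>b. b * e i \<noteq> 0 \<longrightarrow> (\<exists>a. a * (b * e i) = e i)))"

lemma one_decomposesI:
  fixes e :: "'i \<Rightarrow> 'a::complex_algebra"
  assumes "finite I" "(\<Sum>i\<in>I. e i) = 1"
    "\<And>i b. i \<in> I \<Longrightarrow> b * e i \<noteq> 0 \<Longrightarrow> \<exists>a. a * (b * e i) = e i"
  shows "one_decomposes TYPE('a)"
proof -
  obtain f where f: "bij_betw f {..<card I} I" using ex_bij_betw_nat_finite[OF assms(1)]
    by (auto simp: lessThan_atLeast0)
  show ?thesis
    unfolding one_decomposes_def
    using assms f sum.reindex_bij_betw[OF f, of e] bij_betwE[OF f]
    by (intro exI[of _ "{..<card I}"] exI[of _ "e \<circ> f"]) (auto simp: comp_def)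
qed

text \<open>The bridge between the record A, for which semisimplicity is defined, and a type on
  which the computations take place.\<close>

locale algebra_model =
  fixes A :: "(complex, 'x) module" and rep :: "'a::complex_algebra \<Rightarrow> 'x"
  assumes ring_A: "ring A"
    and bij_rep: "bij_betw rep UNIV (carrier A)"
    and rep_mult: "rep (x * y) = rep x \<otimes>\<^bsub>A\<^esub> rep y"
    and rep_add: "rep (x + y) = rep x \<oplus>\<^bsub>A\<^esub> rep y"
    and rep_one: "rep 1 = \<one>\<^bsub>A\<^esub>"
    and rep_scale: "rep (c \<star> x) = c \<odot>\<^bsub>A\<^esub> rep x"
begin

interpretation R: ring A by (rule ring_A)

lemma rep_carrier [simp]: "rep x \<in> carrier A"
  using bij_betwE[OF bij_rep] by simp

lemma rep_eq [simp]: "rep x = rep y \<longleftrightarrow> x = y"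
  using bij_rep by (auto simp: bij_betw_def inj_def)

lemma carrier_rep: "a \<in> carrier A \<Longrightarrow> \<exists>x. a = rep x"
  using bij_rep by (auto simp: bij_betw_def)

lemma rep_zero: "rep 0 = \<zero>\<^bsub>A\<^esub>"
proof -
  have "rep 0 \<oplus>\<^bsub>A\<^esub> rep 0 = rep 0 \<oplus>\<^bsub>A\<^esub> \<zero>\<^bsub>A\<^esub>" using rep_add[of 0 0] by simp
  then show ?thesis by (metis R.add.l_cancel R.zero_closed rep_carrier)
qed

lemma rep_minus: "rep (- x) = \<ominus>\<^bsub>A\<^esub> rep x"
  using rep_add[of x "- x"] by (metis R.add.inv_equality R.add.m_comm add.right_inverse rep_carrier rep_zero)

lemma rep_sum: "finite I \<Longrightarrow> rep (\<Sum>i\<in>I. f i) = (\<Oplus>\<^bsub>A\<^esub>i\<in>I. rep (f i))"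
  by (induction I rule: finite_induct) (auto simp: rep_zero rep_add)

lemma left_idealI:
  assumes "x0 \<in> J" "\<And>x y. x \<in> J \<Longrightarrow> y \<in> J \<Longrightarrow> x + y \<in> J" "\<And>a x. x \<in> J \<Longrightarrow> a * x \<in> J"
  shows "left_ideal (rep ` J) A"
  unfolding left_ideal_def
proof (intro conjI ballI)
  have neg: "- x \<in> J" if "x \<in> J" for x using assms(3)[OF that, of "-1"] by simp
  show "additive_subgroup (rep ` J) A"
  proof (intro additive_subgroup.intro group.subgroupI[OF R.a_group])
    show "inv\<^bsub>add_monoid A\<^esub> a \<in> rep ` J" if "a \<in> rep ` J" for a
      using that neg by (auto simp: a_inv_def[symmetric] rep_minus[symmetric])
    show "a \<otimes>\<^bsub>add_monoid A\<^esub> b \<in> rep ` J" if "a \<in> rep ` J" "b \<in> rep ` J" for a b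
      using that assms(2) by (auto simp: rep_add[symmetric])
  qed (use assms(1) in auto)
  show "a \<otimes>\<^bsub>A\<^esub> x \<in> rep ` J" if a: "a \<in> carrier A" and x: "x \<in> rep ` J" for a x
    using carrier_rep[OF a] x assms(3) by (auto simp: rep_mult[symmetric])
qed

text \<open>Take the components of 1 in the simple summands. A non-zero multiple of a component
  generates a non-zero left ideal inside its summand, hence the whole summand.\<close>

lemma semisimple_imp_one_decomposes:
  assumes "semisimple_ring A"
  shows "one_decomposes TYPE('a)"
proof -
  obtain \<L> where *: "finite \<L> \<and> (\<forall>L\<in>\<L>. simple_left_ideal L A) \<and>
      (\<forall>a\<in>carrier A. \<exists>!f. f \<in> (\<Pi>\<^sub>E L\<in>\<L>. L) \<and> finsum A f \<L> = a)"
    using assms unfolding semisimple_ring_def by (rule exE)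
  then have \<L>: "finite \<L>" "\<And>L. L \<in> \<L> \<Longrightarrow> simple_left_ideal L A" by simp_all
  have "\<exists>!f. f \<in> (\<Pi>\<^sub>E L\<in>\<L>. L) \<and> finsum A f \<L> = \<one>\<^bsub>A\<^esub>"
    using *[THEN conjunct2, THEN conjunct2] R.one_closed by (rule bspec)
  then obtain f where f: "f \<in> (\<Pi>\<^sub>E L\<in>\<L>. L)" "finsum A f \<L> = \<one>\<^bsub>A\<^esub>"
    by (elim ex1E conjE)
  have fL: "f L \<in> L" "f L \<in> carrier A" if "L \<in> \<L>" for L
  proof -
    show 1: "f L \<in> L" using f that by auto
    have "additive_subgroup L A" using \<L>(2)[OF that] by (simp add: simple_left_ideal_def left_ideal_def)
    then show "f L \<in> carrier A" using 1 by (rule additive_subgroup.a_Hcarr)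
  qed
  define e where "e L = the_inv_into UNIV rep (f L)" for L
  have e: "rep (e L) = f L" if "L \<in> \<L>" for L
    unfolding e_def using bij_rep fL(2)[OF that] by (intro f_the_inv_into_f) (auto simp: bij_betw_def)
  show ?thesis
  proof (rule one_decomposesI[OF \<L>(1), of e])
    have "rep (\<Sum>L\<in>\<L>. e L) = (\<Oplus>\<^bsub>A\<^esub>L\<in>\<L>. rep (e L))" by (rule rep_sum[OF \<L>(1)])
    also have "\<dots> = finsum A f \<L>" using e fL by (intro R.finsum_cong') auto
    finally have "rep (\<Sum>L\<in>\<L>. e L) = rep 1" using f by (simp add: rep_one)
    then show "(\<Sum>L\<in>\<L>. e L) = 1" by simp
    fix L b assume L: "L \<in> \<L>" and nz: "b * e L \<noteq> 0"
    define J where "J = rep ` {a * (b * e L) |a. True}"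
    have "left_ideal J A"
      unfolding J_def
    proof (rule left_idealI)
      show "b * e L \<in> {a * (b * e L) |a. True}" by (auto intro: exI[of _ 1])
      show "x + y \<in> {a * (b * e L) |a. True}" if "x \<in> {a * (b * e L) |a. True}" "y \<in> {a * (b * e L) |a. True}" for x y
        using that by (auto simp: distrib_right[symmetric])
      show "c * x \<in> {a * (b * e L) |a. True}" if "x \<in> {a * (b * e L) |a. True}" for c x
        using that by (auto simp: mult.assoc[symmetric])
    qed
    moreover have "J \<subseteq> L"
    proof -
      have "left_ideal L A" using \<L>(2)[OF L] by (simp add: simple_left_ideal_def)
      then have "rep (a * (b * e L)) \<in> L" for a
        using fL(1)[OF L] e[OF L] by (simp add: mult.assoc[symmetric] rep_mult[of "a * b"] left_ideal_def)
      then show ?thesis by (auto simp: J_def)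
    qed
    ultimately have "J = {\<zero>\<^bsub>A\<^esub>} \<or> J = L" using \<L>(2)[OF L] by (auto simp: simple_left_ideal_def)
    moreover have "rep (b * e L) \<in> J" by (auto simp: J_def intro!: imageI exI[of _ 1])
    then have "J \<noteq> {\<zero>\<^bsub>A\<^esub>}" using nz by (auto simp: rep_zero[symmetric])
    ultimately have "rep (e L) \<in> J" using fL(1)[OF L] e[OF L] by simp
    then obtain a where "e L = a * (b * e L)" by (auto simp: J_def)
    then show "\<exists>a. a * (b * e L) = e L" by metis
  qed
qed

end

text \<open>What the weight calculus delivers: orthogonal idempotents with scalar corners such that
  every non-zero element between two of them can be undone from the left. Both notions of
  semisimplicity follow from this alone.\<close>

locale linked_idempotents =
  fixes W :: "'w set" and e :: "'w \<Rightarrow> 'a::complex_algebra"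
  assumes finite_W: "finite W"
    and e_e: "\<lbrakk>w \<in> W; v \<in> W\<rbrakk> \<Longrightarrow> e w * e v = (if w = v then e v else 0)"
    and e_sum: "(\<Sum>w\<in>W. e w) = 1"
    and e_nz: "w \<in> W \<Longrightarrow> e w \<noteq> 0"
    and corner: "w \<in> W \<Longrightarrow> \<exists>c. e w * (a * e w) = c \<star> e w"
    and link: "\<lbrakk>w \<in> W; w' \<in> W; e w' * (a * e w) \<noteq> 0\<rbrakk> \<Longrightarrow> \<exists>b. b * (e w' * (a * e w)) = e w"
begin

lemma e_minimal:
  assumes w: "w \<in> W" and x: "x * e w \<noteq> 0"
  shows "\<exists>b. b * (x * e w) = e w"
proof -
  have "x * e w = (\<Sum>w'\<in>W. e w' * (x * e w))" by (simp add: sum_distrib_right[symmetric] e_sum)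
  then obtain w' where w': "w' \<in> W" "e w' * (x * e w) \<noteq> 0" using x by (metis sum.neutral)
  then obtain b where "b * (e w' * (x * e w)) = e w" using link[OF w] by blast
  then have "(b * e w') * (x * e w) = e w" by (simp add: mult.assoc)
  then show ?thesis by blast
qed

end

lemma (in algebra_model) linked_idempotents_imp_semisimple:
  assumes "linked_idempotents W (e :: 'w \<Rightarrow> 'a)"
  shows "semisimple_ring A"
proof -
  interpret linked_idempotents W e by (rule assms)
  interpret R: ring A by (rule ring_A)
  define L where "L w = {x. x * e w = x}" for w
  have eL: "e w \<in> L w" if "w \<in> W" for w using that by (simp add: L_def e_e)
  have L_other: "x * e v = 0" if "x \<in> L w" "w \<in> W" "v \<in> W" "v \<noteq> w" for x v w
    using that e_e[of w v] by (metis (mono_tags, lifting) L_def mem_Collect_eq mult.assoc mult_zero_right)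
  have simple: "simple_left_ideal (rep ` L w) A" if w: "w \<in> W" for w
    unfolding simple_left_ideal_def
  proof (intro conjI allI impI)
    show "left_ideal (rep ` L w) A"
      by (rule left_idealI[OF eL[OF w]]) (auto simp: L_def distrib_right mult.assoc)
    show "rep ` L w \<noteq> {\<zero>\<^bsub>A\<^esub>}"
      using eL[OF w] e_nz[OF w] by (metis imageI rep_eq rep_zero singletonD)
    fix J assume J: "left_ideal J A \<and> J \<subseteq> rep ` L w"
    show "J = {\<zero>\<^bsub>A\<^esub>} \<or> J = rep ` L w"
    proof (rule disjCI)
      assume ne: "J \<noteq> rep ` L w"
      have J0: "\<zero>\<^bsub>A\<^esub> \<in> J" using J additive_subgroup.zero_closed by (auto simp: left_ideal_def)
      show "J = {\<zero>\<^bsub>A\<^esub>}"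
      proof (rule ccontr)
        assume "J \<noteq> {\<zero>\<^bsub>A\<^esub>}"
        then obtain y where y: "y \<in> J" "y \<noteq> \<zero>\<^bsub>A\<^esub>" using J0 by blast
        then obtain x where x: "y = rep x" "x * e w = x" using J by (auto simp: L_def)
        then have "x * e w \<noteq> 0" using y rep_zero by auto
        then obtain b where b: "b * x = e w" using e_minimal[OF w] x by metis
        have "rep ` L w \<subseteq> J"
        proof
          fix z assume "z \<in> rep ` L w"
          then obtain u where u: "z = rep u" "u * e w = u" by (auto simp: L_def)
          have "u = u * b * x" using b u by (simp add: mult.assoc)
          then have "z = rep (u * b) \<otimes>\<^bsub>A\<^esub> y" using u x by (metis rep_mult)
          then show "z \<in> J" using J y by (auto simp: left_ideal_def)
        qed
        then show False using ne J by blast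
      qed
    qed
  qed
  \<comment> \<open>The decomposition is indexed by a set of ideals, so different idempotents must
    generate different ideals, not merely isomorphic ones.\<close>
  have inj: "inj_on (\<lambda>w. rep ` L w) W"
  proof (rule inj_onI)
    fix v w assume vw: "v \<in> W" "w \<in> W" "rep ` L v = rep ` L w"
    then have "e v \<in> L w" using eL[OF vw(1)] by (metis imageE imageI rep_eq)
    then have "e v * e w = e v" by (simp add: L_def)
    then show "v = w" using e_e[OF vw(1,2)] e_nz[OF vw(1)] by (metis)
  qed
  let ?\<L> = "(\<lambda>w. rep ` L w) ` W"
  have fs: "finsum A f ?\<L> = (\<Oplus>\<^bsub>A\<^esub>w\<in>W. f (rep ` L w))" if "f \<in> ?\<L> \<rightarrow> carrier A" for f
    by (rule R.finsum_reindex[OF that inj])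
  show ?thesis
    unfolding semisimple_ring_def
  proof (intro exI[of _ ?\<L>] conjI ballI)
    show "finite ?\<L>" using finite_W by simp
    show "simple_left_ideal I A" if "I \<in> ?\<L>" for I using that simple by auto
    fix a assume "a \<in> carrier A"
    then obtain x where x: "a = rep x" using carrier_rep by blast
    define f where "f = restrict (\<lambda>I. rep (x * e (the_inv_into W (\<lambda>w. rep ` L w) I))) ?\<L>"
    have fw: "f (rep ` L w) = rep (x * e w)" if "w \<in> W" for w
      using that by (simp add: f_def the_inv_into_f_f[OF inj that])
    have f_ext: "f \<in> extensional ?\<L>" by (simp add: f_def)
    show "\<exists>!f. f \<in> (\<Pi>\<^sub>E L\<in>?\<L>. L) \<and> finsum A f ?\<L> = a"
    proof (rule ex1I[of _ f])
      have "x * e w \<in> L w" if "w \<in> W" for w using that by (simp add: L_def mult.assoc e_e)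
      then have "f \<in> (\<Pi>\<^sub>E L\<in>?\<L>. L)" using fw f_ext by (auto simp: PiE_iff)
      moreover have "finsum A f ?\<L> = a"
      proof -
        have "finsum A f ?\<L> = (\<Oplus>\<^bsub>A\<^esub>w\<in>W. f (rep ` L w))" using fw by (intro fs) auto
        also have "\<dots> = (\<Oplus>\<^bsub>A\<^esub>w\<in>W. rep (x * e w))" using fw by (intro R.finsum_cong') auto
        also have "\<dots> = rep (\<Sum>w\<in>W. x * e w)" by (rule rep_sum[OF finite_W, symmetric])
        finally show ?thesis by (simp add: sum_distrib_left[symmetric] e_sum x)
      qed
      ultimately show "f \<in> (\<Pi>\<^sub>E L\<in>?\<L>. L) \<and> finsum A f ?\<L> = a" ..
      fix f' assume f': "f' \<in> (\<Pi>\<^sub>E L\<in>?\<L>. L) \<and> finsum A f' ?\<L> = a"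
      then have "\<forall>w\<in>W. \<exists>y\<in>L w. f' (rep ` L w) = rep y" by (auto simp: PiE_iff)
      then obtain y where y: "\<And>w. w \<in> W \<Longrightarrow> y w \<in> L w" "\<And>w. w \<in> W \<Longrightarrow> f' (rep ` L w) = rep (y w)" by metis
      have "a = (\<Oplus>\<^bsub>A\<^esub>w\<in>W. f' (rep ` L w))" using f' y by (subst fs[symmetric]) auto
      also have "\<dots> = (\<Oplus>\<^bsub>A\<^esub>w\<in>W. rep (y w))" using y by (intro R.finsum_cong') auto
      also have "\<dots> = rep (\<Sum>w\<in>W. y w)" by (rule rep_sum[OF finite_W, symmetric])
      finally have xs: "x = (\<Sum>w\<in>W. y w)" using x by simp
      have "x * e w = y w" if w: "w \<in> W" for w
      proof -
        have "x * e w = (\<Sum>v\<in>W. if v = w then y w else 0)"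
          unfolding xs sum_distrib_right
          using L_other y w by (intro sum.cong refl) (auto simp: L_def)
        then show ?thesis using w finite_W by simp
      qed
      then have "f' I = f I" if "I \<in> ?\<L>" for I using that fw y by auto
      then show "f' = f" using f' by (intro extensionalityI[of _ ?\<L>]) (auto simp: PiE_iff f_def)
    qed
  qed
qed

text \<open>Block k has a representative idempotent \<open>f k\<close>; \<open>u k i\<close> and
  \<open>v k i\<close> connect it with the i-th idempotent of the block, and the products
  \<open>u k i * v k j\<close> are the matrix units. The factored form lets a coefficient be read
  off as a multiple of \<open>f k\<close>.\<close>

locale matrix_units =
  fixes d :: "nat list" and u v :: "nat \<Rightarrow> nat \<Rightarrow> 'a::complex_algebra" and f :: "nat \<Rightarrow> 'a"
  assumes f_nz: "k < length d \<Longrightarrow> f k \<noteq> 0"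
    and d_pos: "k < length d \<Longrightarrow> 0 < d ! k"
    and v_u: "\<lbrakk>k < length d; i < d ! k; k' < length d; j < d ! k'\<rbrakk> \<Longrightarrow>
      v k i * u k' j = (if k = k' \<and> i = j then f k else 0)"
    and f_v: "\<lbrakk>k < length d; i < d ! k\<rbrakk> \<Longrightarrow> f k * v k i = v k i"
    and u_f: "\<lbrakk>k < length d; i < d ! k\<rbrakk> \<Longrightarrow> u k i * f k = u k i"
    and u_v_sum: "(\<Sum>k<length d. \<Sum>i<d ! k. u k i * v k i) = 1"
    and v_a_u: "\<lbrakk>k < length d; i < d ! k; j < d ! k\<rbrakk> \<Longrightarrow> \<exists>c. v k i * (a * u k j) = c \<star> f k"
    and v_a_u_0: "\<lbrakk>k < length d; i < d ! k; k' < length d; j < d ! k'; k \<noteq> k'\<rbrakk> \<Longrightarrow> v k i * (a * u k' j) = 0"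
begin

definition cf :: "'a \<Rightarrow> nat \<Rightarrow> nat \<Rightarrow> nat \<Rightarrow> complex" where
  "cf a k i j = (SOME c. v k i * (a * u k j) = c \<star> f k)"

lemma cf: "\<lbrakk>k < length d; i < d ! k; j < d ! k\<rbrakk> \<Longrightarrow> v k i * (a * u k j) = cf a k i j \<star> f k"
  unfolding cf_def by (rule someI_ex[OF v_a_u])

lemma cf_eqI: "\<lbrakk>k < length d; i < d ! k; j < d ! k; v k i * (a * u k j) = c \<star> f k\<rbrakk> \<Longrightarrow> cf a k i j = c"
  using cf[of k i j a] f_nz[of k] by (simp add: cscale_cancel_right)

text \<open>Insert 1 as the sum of all \<open>u k i * v k i\<close> on both sides of a; the mixed
  blocks drop out by \<open>v_a_u_0\<close>.\<close>

lemma expand: "a = (\<Sum>k<length d. \<Sum>i<d ! k. \<Sum>j<d ! k. cf a k i j \<star> (u k i * v k j))"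
proof -
  obtain S where S_def: "S = (\<Sum>k<length d. \<Sum>i<d ! k. u k i * v k i)" by simp
  have 1: "a = (\<Sum>k<length d. \<Sum>i<d ! k. u k i * v k i) * (a * S)"
    by (simp add: u_v_sum S_def)
  have 2: "(\<Sum>k<length d. \<Sum>i<d ! k. u k i * v k i) * (a * S) = (\<Sum>k<length d. \<Sum>i<d ! k. u k i * (v k i * (a * S)))"
    by (simp add: sum_distrib_right mult.assoc)
  have 3: "(\<Sum>k<length d. \<Sum>i<d ! k. u k i * (v k i * (a * S))) = (\<Sum>k<length d. \<Sum>i<d ! k. \<Sum>k'<length d. \<Sum>j<d ! k'. u k i * (v k i * (a * u k' j)) * v k' j)"
    by (simp add: S_def sum_distrib_left mult.assoc)
  have 4: "(\<Sum>k<length d. \<Sum>i<d ! k. \<Sum>k'<length d. \<Sum>j<d ! k'. u k i * (v k i * (a * u k' j)) * v k' j)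
      = (\<Sum>k<length d. \<Sum>i<d ! k. \<Sum>j<d ! k. cf a k i j \<star> (u k i * v k j))"
  proof (rule sum.cong[OF refl], rule sum.cong[OF refl])
    fix k i assume k: "k \<in> {..<length d}" "i \<in> {..<d ! k}"
    have "(\<Sum>k'<length d. \<Sum>j<d ! k'. u k i * (v k i * (a * u k' j)) * v k' j)
        = (\<Sum>k'<length d. if k' = k then (\<Sum>j<d ! k. cf a k i j \<star> (u k i * v k j)) else 0)"
      using k by (intro sum.cong refl) (auto simp: v_a_u_0 cf u_f intro!: sum.cong)
    then show "(\<Sum>k'<length d. \<Sum>j<d ! k'. u k i * (v k i * (a * u k' j)) * v k' j)
        = (\<Sum>j<d ! k. cf a k i j \<star> (u k i * v k j))"
      using k by simp
  qed
  show ?thesis by (rule trans[OF 1 trans[OF 2 trans[OF 3 4]]])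
qed

lemma cf_eq: "(\<And>k i j. \<lbrakk>k < length d; i < d ! k; j < d ! k\<rbrakk> \<Longrightarrow> cf a k i j = cf b k i j) \<Longrightarrow> a = b"
  by (subst expand[of a], subst expand[of b]) simp

lemma cf_add: "\<lbrakk>k < length d; i < d ! k; j < d ! k\<rbrakk> \<Longrightarrow> cf (a + b) k i j = cf a k i j + cf b k i j"
  by (rule cf_eqI) (simp_all add: distrib_left distrib_right cf cscale_add_left)

lemma cf_scale: "\<lbrakk>k < length d; i < d ! k; j < d ! k\<rbrakk> \<Longrightarrow> cf (c \<star> a) k i j = c * cf a k i j"
  by (rule cf_eqI) (simp_all add: cf)

lemma cf_one: "\<lbrakk>k < length d; i < d ! k; j < d ! k\<rbrakk> \<Longrightarrow> cf 1 k i j = (if i = j then 1 else 0)"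
  by (rule cf_eqI) (simp_all add: v_u)

lemma cf_mult:
  assumes k: "k < length d" "i < d ! k" "j < d ! k"
  shows "cf (a * b) k i j = (\<Sum>l<d ! k. cf a k i l * cf b k l j)"
proof (rule cf_eqI[OF k])
  have "v k i * (a * b * u k j) = v k i * (a * ((\<Sum>k'<length d. \<Sum>l<d ! k'. u k' l * v k' l) * (b * u k j)))"
    by (simp add: u_v_sum mult.assoc)
  also have "\<dots> = (\<Sum>k'<length d. \<Sum>l<d ! k'. v k i * (a * u k' l) * (v k' l * (b * u k j)))"
    by (simp add: sum_distrib_left sum_distrib_right mult.assoc)
  also have "\<dots> = (\<Sum>k'<length d. if k' = k then \<Sum>l<d ! k. (cf a k i l * cf b k l j) \<star> f k else 0)"
  proof (intro sum.cong refl)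
    fix k' assume k': "k' \<in> {..<length d}"
    have ff: "f k * f k = f k" using f_v[of k i] v_u[of k i k i] k by (metis mult.assoc)
    show "(\<Sum>l<d ! k'. v k i * (a * u k' l) * (v k' l * (b * u k j)))
      = (if k' = k then \<Sum>l<d ! k. (cf a k i l * cf b k l j) \<star> f k else 0)"
      using k k' by (auto simp: cf v_a_u_0 ff mult.commute intro!: sum.cong sum.neutral)
  qed
  also have "\<dots> = (\<Sum>l<d ! k. cf a k i l * cf b k l j) \<star> f k"
    using k by (simp add: cscale_sum_left)
  finally show "v k i * (a * b * u k j) = (\<Sum>l<d ! k. cf a k i l * cf b k l j) \<star> f k" .
qed

definition to_mats :: "'a \<Rightarrow> complex mat list" where
  "to_mats a = map (\<lambda>k. mat (d ! k) (d ! k) (\<lambda>(i, j). cf a k i j)) [0..<length d]"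

lemma to_mats_carrier: "to_mats a \<in> carrier (matrix_algebra_product d)"
  by (auto simp: matrix_algebra_product_def to_mats_def list_all2_conv_all_nth)

lemma mats_eqI:
  assumes "length Ms = length Ns" "\<And>k. k < length Ms \<Longrightarrow> Ms ! k = Ns ! k"
  shows "Ms = Ns"
  using assms by (rule nth_equalityI)

lemma to_mats_mult: "to_mats (a * b) = to_mats a \<otimes>\<^bsub>matrix_algebra_product d\<^esub> to_mats b"
  by (rule mats_eqI) (auto simp: matrix_algebra_product_def to_mats_def cf_mult scalar_prod_def lessThan_atLeast0 intro!: eq_matI sum.cong)

lemma to_mats_add: "to_mats (a + b) = to_mats a \<oplus>\<^bsub>matrix_algebra_product d\<^esub> to_mats b"
  by (rule mats_eqI) (auto simp: matrix_algebra_product_def to_mats_def cf_add intro!: eq_matI)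

lemma to_mats_one: "to_mats 1 = \<one>\<^bsub>matrix_algebra_product d\<^esub>"
  by (rule mats_eqI) (auto simp: matrix_algebra_product_def to_mats_def cf_one intro!: eq_matI)

lemma to_mats_scale: "to_mats (c \<star> a) = c \<odot>\<^bsub>matrix_algebra_product d\<^esub> to_mats a"
  by (rule mats_eqI) (auto simp: matrix_algebra_product_def to_mats_def cf_scale intro!: eq_matI)

lemma inj_to_mats: "inj to_mats"
proof (rule injI)
  fix a b assume eq: "to_mats a = to_mats b"
  show "a = b"
  proof (rule cf_eq)
    fix k i j assume k: "k < length d" "i < d ! k" "j < d ! k"
    then have "cf a k i j = (to_mats a ! k) $$ (i, j)" "cf b k i j = (to_mats b ! k) $$ (i, j)"
      by (simp_all add: to_mats_def)
    then show "cf a k i j = cf b k i j" by (simp add: eq)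
  qed
qed

lemma surj_to_mats:
  assumes "Ms \<in> carrier (matrix_algebra_product d)"
  shows "\<exists>a. to_mats a = Ms"
proof -
  have len: "length Ms = length d" and M: "\<And>k. k < length d \<Longrightarrow> Ms ! k \<in> carrier_mat (d ! k) (d ! k)"
    using assms by (auto simp: matrix_algebra_product_def list_all2_conv_all_nth)
  define a where "a = (\<Sum>k<length d. \<Sum>i<d ! k. \<Sum>j<d ! k. ((Ms ! k) $$ (i, j)) \<star> (u k i * v k j))"
  have "cf a k i j = (Ms ! k) $$ (i, j)" if k: "k < length d" "i < d ! k" "j < d ! k" for k i j
  proof (rule cf_eqI[OF k])
    have "v k i * (a * u k j) = (\<Sum>k'<length d. \<Sum>i'<d ! k'. \<Sum>j'<d ! k'. ((Ms ! k') $$ (i', j')) \<star> ((v k i * u k' i') * (v k' j' * u k j)))"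
      by (simp add: a_def sum_distrib_left sum_distrib_right mult.assoc)
    also have "\<dots> = (\<Sum>k'<length d. if k' = k then (\<Sum>i'<d ! k. if i' = i then (\<Sum>j'<d ! k. if j' = j then ((Ms ! k) $$ (i, j)) \<star> f k else 0) else 0) else 0)"
    proof (intro sum.cong refl)
      fix k' assume k': "k' \<in> {..<length d}"
      have ff: "f k * f k = f k" using f_v[of k i] v_u[of k i k i] k by (metis mult.assoc)
      show "(\<Sum>i'<d ! k'. \<Sum>j'<d ! k'. ((Ms ! k') $$ (i', j')) \<star> ((v k i * u k' i') * (v k' j' * u k j)))
        = (if k' = k then (\<Sum>i'<d ! k. if i' = i then (\<Sum>j'<d ! k. if j' = j then ((Ms ! k) $$ (i, j)) \<star> f k else 0) else 0) else 0)"
      proof (cases "k' = k")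
        case True
        have "(\<Sum>i'<d ! k. \<Sum>j'<d ! k. ((Ms ! k) $$ (i', j')) \<star> ((v k i * u k i') * (v k j' * u k j)))
          = (\<Sum>i'<d ! k. if i' = i then (\<Sum>j'<d ! k. if j' = j then ((Ms ! k) $$ (i, j)) \<star> f k else 0) else 0)"
          using k by (intro sum.cong refl) (auto simp: v_u ff if_distrib[of "\<lambda>x. _ * x"] if_distrib[of "\<lambda>x. _ \<star> x"] cong: if_cong)
        then show ?thesis using True by simp
      next
        case False
        then show ?thesis using k k' by (auto simp: v_u intro!: sum.neutral)
      qed
    qed
    also have "\<dots> = ((Ms ! k) $$ (i, j)) \<star> f k" using k by simp
    finally show "v k i * (a * u k j) = ((Ms ! k) $$ (i, j)) \<star> f k" .
  qed
  moreover have "dim_row (Ms ! k) = d ! k" "dim_col (Ms ! k) = d ! k" if "k < length d" for k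
    using M[OF that] by auto
  ultimately have "to_mats a = Ms"
    using len by (intro mats_eqI) (auto simp: to_mats_def intro!: eq_matI)
  then show ?thesis ..
qed

end

lemma (in algebra_model) matrix_units_imp_split:
  assumes "matrix_units d u v (f :: nat \<Rightarrow> 'a)"
  shows "split_semisimple A"
proof -
  interpret matrix_units d u v f by (rule assms)
  define h where "h a = to_mats (the_inv_into UNIV rep a)" for a
  have h: "h (rep x) = to_mats x" for x
    using bij_rep by (simp add: h_def the_inv_into_f_f bij_betw_def)
  let ?M = "matrix_algebra_product d :: (complex, complex mat list) module"
  have "h \<in> ring_iso A ?M"
    unfolding ring_iso_def
  proof (intro CollectI conjI ring_hom_memI)
    show "h x \<in> carrier ?M" for x by (simp add: h_def to_mats_carrier)
    fix a b assume "a \<in> carrier A" "b \<in> carrier A"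
    then obtain x y where xy: "a = rep x" "b = rep y" using carrier_rep by metis
    show "h (a \<otimes>\<^bsub>A\<^esub> b) = h a \<otimes>\<^bsub>?M\<^esub> h b" "h (a \<oplus>\<^bsub>A\<^esub> b) = h a \<oplus>\<^bsub>?M\<^esub> h b"
      unfolding xy rep_mult[symmetric] rep_add[symmetric] h to_mats_mult to_mats_add by simp_all
  next
    show "h \<one>\<^bsub>A\<^esub> = \<one>\<^bsub>?M\<^esub>" unfolding rep_one[symmetric] h to_mats_one ..
    have "bij_betw to_mats UNIV (carrier ?M)"
      unfolding bij_betw_def using inj_to_mats to_mats_carrier surj_to_mats by blast
    then show "bij_betw h (carrier A) (carrier ?M)"
      unfolding h_def using bij_betw_trans[OF bij_betw_the_inv_into[OF bij_rep], of to_mats "carrier ?M"]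
      by (simp add: comp_def)
  qed
  moreover have "\<forall>c. \<forall>a\<in>carrier A. h (c \<odot>\<^bsub>A\<^esub> a) = c \<odot>\<^bsub>?M\<^esub> h a"
  proof (intro allI ballI)
    fix c a assume "a \<in> carrier A"
    then obtain x where x: "a = rep x" using carrier_rep by metis
    show "h (c \<odot>\<^bsub>A\<^esub> a) = c \<odot>\<^bsub>?M\<^esub> h a" unfolding x rep_scale[symmetric] h to_mats_scale ..
  qed
  moreover have "\<forall>k\<in>set d. k > 0" using d_pos by (auto simp: in_set_conv_nth)
  ultimately show ?thesis unfolding split_semisimple_def by blast
qed

section \<open>Matrix units from classes of linked idempotents\<close>

context linked_idempotents
begin

definition linked :: "'w \<Rightarrow> 'w \<Rightarrow> bool" where
  "linked w v \<longleftrightarrow> w \<in> W \<and> v \<in> W \<and> (\<exists>a. e w * (a * e v) \<noteq> 0)"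

lemma linked_refl: "w \<in> W \<Longrightarrow> linked w w"
  using e_e[of w w] e_nz[of w] by (auto simp: linked_def intro!: exI[of _ 1])

lemma linked_sym: "linked w v \<Longrightarrow> linked v w"
proof -
  assume l: "linked w v"
  then obtain a where a: "e w * (a * e v) \<noteq> 0" "w \<in> W" "v \<in> W" by (auto simp: linked_def)
  then obtain b where b: "b * (e w * (a * e v)) = e v" using link by blast
  have "e v * (b * e w) \<noteq> 0"
  proof
    assume "e v * (b * e w) = 0"
    then have "e v * (b * (e w * (a * e v))) = 0" by (metis mult.assoc mult_zero_left)
    then show False using b e_e[of v v] e_nz[of v] a by simp
  qed
  then show ?thesis using a by (auto simp: linked_def)
qed

lemma linked_trans: "linked w v \<Longrightarrow> linked v x \<Longrightarrow> linked w x"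
proof -
  assume "linked w v" "linked v x"
  then obtain a a' where a: "e w * (a * e v) \<noteq> 0" "e v * (a' * e x) \<noteq> 0" "w \<in> W" "v \<in> W" "x \<in> W"
    by (auto simp: linked_def)
  then obtain b where b: "b * (e w * (a * e v)) = e v" using link by blast
  have "e w * ((a * e v * a') * e x) \<noteq> 0"
  proof
    assume "e w * ((a * e v * a') * e x) = 0"
    then have "b * (e w * (a * e v)) * (a' * e x) = 0" by (metis mult.assoc mult_zero_right)
    then show False using b a by simp
  qed
  then show ?thesis using a by (auto simp: linked_def)
qed

text \<open>Linked idempotents have equal predicates \<open>linked w\<close>, so the choice picks
  the same representative throughout a class.\<close>

definition cls :: "'w \<Rightarrow> 'w" where "cls w = (SOME v. linked w v)"

lemma linked_cls: "w \<in> W \<Longrightarrow> linked w (cls w)"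
  unfolding cls_def by (rule someI[of "linked w"], rule linked_refl)

lemma cls_eq: "linked w v \<Longrightarrow> cls w = cls v"
proof -
  assume "linked w v"
  then have "linked w = linked v" using linked_sym linked_trans by (intro ext iffI) blast+
  then show ?thesis by (simp add: cls_def)
qed

lemma cls_cls: "w \<in> W \<Longrightarrow> cls w \<in> W" "w \<in> W \<Longrightarrow> cls (cls w) = cls w"
  using linked_cls[of w] cls_eq[of w "cls w"] by (auto simp: linked_def)

text \<open>The left inverse given by \<open>link\<close>, cut down by the idempotents, is also a
  right inverse: u x is a multiple c of e w by the scalar corner, and u x u = u gives c = 1.\<close>

lemma unit_pair:
  assumes "linked w v"
  shows "\<exists>u x. e w * u = u \<and> u * e v = u \<and> e v * x = x \<and> x * e w = x \<and> x * u = e v \<and> u * x = e w"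
proof -
  obtain a where a: "e w * (a * e v) \<noteq> 0" "w \<in> W" "v \<in> W" using assms by (auto simp: linked_def)
  then obtain b where b: "b * (e w * (a * e v)) = e v" using link by blast
  define u where "u = e w * (a * e v)"
  define x where "x = e v * (b * e w)"
  have ee: "e w * e w = e w" "e v * e v = e v" using e_e a by auto
  have u: "e w * u = u" "u * e v = u" using ee by (simp_all add: u_def mult.assoc) (simp add: mult.assoc[symmetric])
  have x: "e v * x = x" "x * e w = x" using ee by (simp_all add: x_def mult.assoc) (simp add: mult.assoc[symmetric])
  have xu: "x * u = e v" using b u ee unfolding x_def mult.assoc by (simp add: u_def[symmetric])
  obtain c where c: "e w * ((u * x) * e w) = c \<star> e w" using corner a by blast
  have ux: "u * x = c \<star> e w" using c u x by (simp add: mult.assoc) (simp add: mult.assoc[symmetric])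
  have "c \<star> u = u * x * u" unfolding ux using u by simp
  also have "\<dots> = u" using xu u by (simp add: mult.assoc)
  finally have "c = 1" using a cscale_cancel_right[of u c 1] by (simp add: u_def)
  then show ?thesis using u x xu ux by auto
qed

lemma matrix_units_exist: "\<exists>d u v f. matrix_units d u v (f :: nat \<Rightarrow> 'a)"
proof -
  have "\<forall>w\<in>W. \<exists>ux. e w * fst ux = fst ux \<and> fst ux * e (cls w) = fst ux \<and> e (cls w) * snd ux = snd ux \<and>
      snd ux * e w = snd ux \<and> snd ux * fst ux = e (cls w) \<and> fst ux * snd ux = e w"
    using unit_pair[OF linked_cls] by simp
  from bchoice[OF this] obtain F where F: "\<forall>w\<in>W. e w * fst (F w) = fst (F w) \<and> fst (F w) * e (cls w) = fst (F w) \<and>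
      e (cls w) * snd (F w) = snd (F w) \<and> snd (F w) * e w = snd (F w) \<and> snd (F w) * fst (F w) = e (cls w) \<and>
      fst (F w) * snd (F w) = e w" by blast
  define U V where "U w = fst (F w)" and "V w = snd (F w)" for w
  have UX: "\<And>w. w \<in> W \<Longrightarrow> e w * U w = U w" "\<And>w. w \<in> W \<Longrightarrow> U w * e (cls w) = U w"
    "\<And>w. w \<in> W \<Longrightarrow> e (cls w) * V w = V w" "\<And>w. w \<in> W \<Longrightarrow> V w * e w = V w"
    "\<And>w. w \<in> W \<Longrightarrow> V w * U w = e (cls w)" "\<And>w. w \<in> W \<Longrightarrow> U w * V w = e w"
    using F by (simp_all add: U_def V_def)
  obtain rs where rs: "set rs = cls ` W" "distinct rs" using finite_distinct_list[of "cls ` W"] finite_W by auto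
  have "\<forall>r. \<exists>l. set l = {w\<in>W. cls w = r} \<and> distinct l" using finite_W by (intro allI finite_distinct_list) auto
  then obtain cl where cl: "\<And>r. set (cl r) = {w\<in>W. cls w = r}" "\<And>r. distinct (cl r)" by metis
  define d where "d = map (\<lambda>r. length (cl r)) rs"
  define wt where "wt k i = cl (rs ! k) ! i" for k i
  have len: "length d = length rs" by (simp add: d_def)
  have dk: "d ! k = length (cl (rs ! k))" if "k < length d" for k using that by (simp add: d_def)
  have wt: "wt k i \<in> W" "cls (wt k i) = rs ! k" if "k < length d" "i < d ! k" for k i
    using that cl(1)[of "rs ! k"] nth_mem[of i "cl (rs ! k)"] dk by (auto simp: wt_def)
  have rsW: "rs ! k \<in> W" "cls (rs ! k) = rs ! k" if "k < length d" for k
    using that rs(1) nth_mem[of k rs] cls_cls len by (auto simp: image_iff)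
  have wt_eq: "wt k i = wt k' j \<longleftrightarrow> k = k' \<and> i = j" if "k < length d" "i < d ! k" "k' < length d" "j < d ! k'" for k i k' j
  proof
    assume eq: "wt k i = wt k' j"
    then have "rs ! k = rs ! k'" using wt(2)[OF that(1,2)] wt(2)[OF that(3,4)] by simp
    then have "k = k'" using that len rs(2) by (simp add: nth_eq_iff_index_eq)
    then show "k = k' \<and> i = j" using eq that cl(2)[of "rs ! k"] dk by (simp add: wt_def nth_eq_iff_index_eq)
  qed auto
  have "matrix_units d (\<lambda>k i. U (wt k i)) (\<lambda>k i. V (wt k i)) (\<lambda>k. e (rs ! k))"
  proof
    show "e (rs ! k) \<noteq> 0" if "k < length d" for k using e_nz rsW that by simp
    show "0 < d ! k" if k: "k < length d" for k
    proof -
      have "rs ! k \<in> set (cl (rs ! k))" using rsW[OF k] cl by simp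
      then show ?thesis using dk[OF k] by (cases "cl (rs ! k)") auto
    qed
    show "V (wt k i) * U (wt k' j) = (if k = k' \<and> i = j then e (rs ! k) else 0)"
      if "k < length d" "i < d ! k" "k' < length d" "j < d ! k'" for k i k' j
    proof (cases "k = k' \<and> i = j")
      case True
      then show ?thesis using UX(5) wt that by simp
    next
      case False
      have "V (wt k i) * U (wt k' j) = V (wt k i) * (e (wt k i) * e (wt k' j)) * U (wt k' j)"
        using UX(1)[of "wt k' j"] UX(4)[of "wt k i"] wt that by (metis mult.assoc)
      moreover have "wt k i \<noteq> wt k' j" using False wt_eq[OF that] by simp
      then have "e (wt k i) * e (wt k' j) = 0" using e_e wt that by simp
      ultimately show ?thesis using False by auto
    qed
    show "e (rs ! k) * V (wt k i) = V (wt k i)" if "k < length d" "i < d ! k" for k i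
      using UX(3) wt that by metis
    show "U (wt k i) * e (rs ! k) = U (wt k i)" if "k < length d" "i < d ! k" for k i
      using UX(2) wt that by metis
    show "\<exists>c. V (wt k i) * (a * U (wt k j)) = c \<star> e (rs ! k)" if k: "k < length d" "i < d ! k" "j < d ! k" for k i j a
    proof -
      obtain c where c: "e (rs ! k) * ((V (wt k i) * (a * U (wt k j))) * e (rs ! k)) = c \<star> e (rs ! k)"
        using corner[OF rsW(1)[OF k(1)]] by blast
      have "e (rs ! k) * V (wt k i) = V (wt k i)" "U (wt k j) * e (rs ! k) = U (wt k j)"
        using UX(2,3) wt k by metis+
      then have "e (rs ! k) * ((V (wt k i) * (a * U (wt k j))) * e (rs ! k)) = V (wt k i) * (a * U (wt k j))"
        by (metis mult.assoc)
      then show ?thesis using c by metis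
    qed
    show "V (wt k i) * (a * U (wt k' j)) = 0"
      if k: "k < length d" "i < d ! k" "k' < length d" "j < d ! k'" "k \<noteq> k'" for k i k' j a
    proof -
      have "e (wt k i) * (a * e (wt k' j)) = 0"
      proof (rule ccontr)
        assume "e (wt k i) * (a * e (wt k' j)) \<noteq> 0"
        then have "linked (wt k i) (wt k' j)" using wt k by (auto simp: linked_def)
        then have "rs ! k = rs ! k'" using cls_eq wt k by metis
        then show False using k len rs(2) by (simp add: nth_eq_iff_index_eq)
      qed
      moreover have "V (wt k i) * (a * U (wt k' j)) = V (wt k i) * (e (wt k i) * (a * e (wt k' j))) * U (wt k' j)"
        using UX(1)[of "wt k' j"] UX(4)[of "wt k i"] wt k by (metis mult.assoc)
      ultimately show ?thesis by simp
    qed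
    have "(\<Sum>k<length d. \<Sum>i<d ! k. U (wt k i) * V (wt k i)) = (\<Sum>k<length d. \<Sum>i<d ! k. e (wt k i))"
      using UX(6) wt by (intro sum.cong refl) auto
    also have "\<dots> = (\<Sum>(k, i)\<in>(SIGMA k:{..<length d}. {..<d ! k}). e (wt k i))"
      by (rule sum.Sigma) auto
    also have "\<dots> = (\<Sum>p\<in>(SIGMA k:{..<length d}. {..<d ! k}). e (wt (fst p) (snd p)))"
      by (simp add: case_prod_unfold)
    also have "\<dots> = (\<Sum>w\<in>W. e w)"
    proof (rule sum.reindex_bij_betw)
      show "bij_betw (\<lambda>p. wt (fst p) (snd p)) (SIGMA k:{..<length d}. {..<d ! k}) W"
        unfolding bij_betw_def
      proof
        show "inj_on (\<lambda>p. wt (fst p) (snd p)) (SIGMA k:{..<length d}. {..<d ! k})"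
          using wt_eq by (intro inj_onI) auto
        show "(\<lambda>p. wt (fst p) (snd p)) ` (SIGMA k:{..<length d}. {..<d ! k}) = W"
        proof (intro equalityI subsetI)
          fix w assume w: "w \<in> W"
          then have "cls w \<in> set rs" using rs by simp
          then obtain k where k: "k < length rs" "rs ! k = cls w" by (auto simp: in_set_conv_nth)
          have "w \<in> set (cl (rs ! k))" using cl w k by simp
          then obtain i where i: "i < length (cl (rs ! k))" "cl (rs ! k) ! i = w" by (auto simp: in_set_conv_nth)
          show "w \<in> (\<lambda>p. wt (fst p) (snd p)) ` (SIGMA k:{..<length d}. {..<d ! k})"
            by (rule image_eqI[of _ _ "(k, i)"]) (use k i dk len in \<open>auto simp: wt_def\<close>)
        qed (use wt in auto)
      qed
    qed
    finally show "(\<Sum>k<length d. \<Sum>i<d ! k. U (wt k i) * V (wt k i)) = 1" by (simp add: e_sum)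
  qed
  then show ?thesis by blast
qed

end

text \<open>The preimages of the diagonal matrix units add up to 1. A non-zero product b E_jj is a
  column; the matrix unit moving a non-zero entry of it back to position j, suitably rescaled,
  recovers E_jj.\<close>

lemma (in algebra_model) split_imp_one_decomposes:
  assumes "split_semisimple A"
  shows "one_decomposes TYPE('a)"
proof -
  interpret R: ring A by (rule ring_A)
  obtain d h where h: "h \<in> ring_iso A (matrix_algebra_product d :: (complex, complex mat list) module)"
    "\<And>c a. a \<in> carrier A \<Longrightarrow> h (c \<odot>\<^bsub>A\<^esub> a) = c \<odot>\<^bsub>(matrix_algebra_product d :: (complex, complex mat list) module)\<^esub> h a"
    using assms unfolding split_semisimple_def by blast
  define M where "M = (matrix_algebra_product d :: (complex, complex mat list) module)"
  define H where "H x = h (rep x)" for x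
  define ent where "ent x k i j = (H x ! k) $$ (i, j)" for x k i j
  define ok where "ok k i j \<longleftrightarrow> k < length d \<and> i < d ! k \<and> j < d ! k" for k i j :: nat
  have hom: "h \<in> Ring.ring_hom A M" and bij: "bij_betw h (carrier A) (carrier M)"
    using h by (auto simp: ring_iso_def M_def)
  have Hc: "H y \<in> carrier M" for y
    using bij_betwE[OF bij] rep_carrier[of y] by (simp add: H_def)
  have Hl: "length (H y) = length d" for y
    using Hc[of y] by (auto simp: M_def matrix_algebra_product_def list_all2_conv_all_nth)
  have Hm: "H y ! k \<in> carrier_mat (d ! k) (d ! k)" if "k < length d" for y k
    using Hc[of y] that by (auto simp: M_def matrix_algebra_product_def list_all2_conv_all_nth)
  have Hd: "dim_row (H y ! k) = d ! k" "dim_col (H y ! k) = d ! k" if "k < length d" for y k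
    using Hm[OF that, of y] by auto
  have ent_add: "ent (x + y) k i j = ent x k i j + ent y k i j" if "ok k i j" for x y k i j
  proof -
    have "H (x + y) = H x \<oplus>\<^bsub>M\<^esub> H y" unfolding H_def rep_add by (rule ring_hom_add[OF hom]) auto
    then show ?thesis using that by (auto simp: Hl Hd ent_def ok_def M_def matrix_algebra_product_def)
  qed
  have ent_mult: "ent (x * y) k i j = (\<Sum>l<d ! k. ent x k i l * ent y k l j)" if "ok k i j" for x y k i j
  proof -
    have "H (x * y) = H x \<otimes>\<^bsub>M\<^esub> H y" unfolding H_def rep_mult by (rule ring_hom_mult[OF hom]) auto
    then show ?thesis using that
      by (auto simp: Hl Hd ent_def ok_def M_def matrix_algebra_product_def scalar_prod_def lessThan_atLeast0 intro!: sum.cong)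
  qed
  have ent_scale: "ent (c \<star> x) k i j = c * ent x k i j" if "ok k i j" for c x k i j
  proof -
    have "H (c \<star> x) = c \<odot>\<^bsub>M\<^esub> H x" unfolding H_def rep_scale M_def by (rule h(2)) auto
    then show ?thesis using that by (auto simp: Hl Hd ent_def ok_def M_def matrix_algebra_product_def)
  qed
  have ent_one: "ent 1 k i j = (if i = j then 1 else 0)" if "ok k i j" for k i j
  proof -
    have "H 1 = \<one>\<^bsub>M\<^esub>" unfolding H_def rep_one by (rule ring_hom_one[OF hom])
    then show ?thesis using that by (auto simp: ent_def ok_def M_def matrix_algebra_product_def)
  qed
  have ent_zero: "ent 0 k i j = 0" if "ok k i j" for k i j
    using ent_add[OF that, of 0 0] by simp
  have ent_sum: "ent (\<Sum>i\<in>I. F i) k a b = (\<Sum>i\<in>I. ent (F i) k a b)" if "ok k a b" for I k a b and F :: "nat \<times> nat \<Rightarrow> 'a"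
    by (induction I rule: infinite_finite_induct) (simp_all add: ent_zero ent_add that)
  have ent_eqI: "x = y" if "\<And>k i j. ok k i j \<Longrightarrow> ent x k i j = ent y k i j" for x y
  proof -
    have "H x = H y"
    proof (rule nth_equalityI)
      fix k assume "k < length (H x)"
      then have k: "k < length d" by (simp add: Hl)
      show "H x ! k = H y ! k"
        using that k by (intro eq_matI) (auto simp: ent_def ok_def Hd)
    qed (simp add: Hl)
    then have "rep x = rep y"
      unfolding H_def by (rule inj_onD[OF bij_betw_imp_inj_on[OF bij]]) auto
    then show ?thesis by simp
  qed
  have "\<exists>x. \<forall>k' i' j'. ok k' i' j' \<longrightarrow> ent x k' i' j' = (if k' = k \<and> i' = i \<and> j' = j then 1 else 0)" for k i j
  proof -
    define Ms where "Ms = map (\<lambda>k'. mat (d ! k') (d ! k') (\<lambda>(i', j'). if k' = k \<and> i' = i \<and> j' = j then 1 else 0 :: complex)) [0..<length d]"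
    have "Ms \<in> carrier M" by (auto simp: M_def matrix_algebra_product_def Ms_def list_all2_conv_all_nth)
    then obtain a where "a \<in> carrier A" "h a = Ms" using bij by (metis bij_betw_def imageE)
    then obtain x where "H x = Ms" using carrier_rep by (metis H_def)
    then show ?thesis by (intro exI[of _ x]) (auto simp: ent_def Ms_def ok_def)
  qed
  then obtain E where E: "\<And>k i j k' i' j'. ok k' i' j' \<Longrightarrow> ent (E k i j) k' i' j' = (if k' = k \<and> i' = i \<and> j' = j then 1 else 0)"
    by metis
  let ?I = "SIGMA k:{..<length d}. {..<d ! k}"
  show ?thesis
  proof (rule one_decomposesI[of ?I "\<lambda>(k, j). E k j j"])
    show "finite ?I" by auto
    show "(\<Sum>i\<in>?I. case i of (k, j) \<Rightarrow> E k j j) = 1"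
    proof (rule ent_eqI)
      fix k i j assume ok: "ok k i j"
      have "ent (\<Sum>i\<in>?I. case i of (k, j) \<Rightarrow> E k j j) k i j = (\<Sum>p\<in>?I. if p = (k, i) then (if i = j then 1 else 0) else 0)"
        unfolding ent_sum[OF ok] case_prod_unfold E[OF ok] by (intro sum.cong refl) auto
      also have "\<dots> = (if i = j then 1 else 0)" using ok by (subst sum.delta) (auto simp: ok_def)
      finally show "ent (\<Sum>i\<in>?I. case i of (k, j) \<Rightarrow> E k j j) k i j = ent 1 k i j" by (simp add: ent_one[OF ok])
    qed
    fix p b assume p: "p \<in> ?I" and nz: "b * (case p of (k, j) \<Rightarrow> E k j j) \<noteq> 0"
    obtain k j where kj: "p = (k, j)" "k < length d" "j < d ! k" using p by auto
    have be: "ent (b * E k j j) k' i' j' = (if k' = k \<and> j' = j then ent b k i' j else 0)" if ok: "ok k' i' j'" for k' i' j'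
    proof -
      have "ent (b * E k j j) k' i' j' = (\<Sum>l<d ! k'. if l = j then (if k' = k \<and> j' = j then ent b k i' j else 0) else 0)"
        unfolding ent_mult[OF ok] using ok by (intro sum.cong refl) (auto simp: E ok_def)
      then show ?thesis using ok kj by (auto simp: ok_def)
    qed
    obtain i where i: "i < d ! k" "ent b k i j \<noteq> 0"
    proof -
      have "b * E k j j \<noteq> 0" using nz kj by simp
      then obtain k' i' j' where "ok k' i' j'" "ent (b * E k j j) k' i' j' \<noteq> ent 0 k' i' j'" using ent_eqI by metis
      then show ?thesis using that[of i'] be ent_zero by (auto simp: ok_def split: if_splits)
    qed
    have "((1 / ent b k i j) \<star> E k j i) * (b * E k j j) = E k j j"
    proof (rule ent_eqI)
      fix k' i' j' assume ok: "ok k' i' j'"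
      have "ent (E k j i * (b * E k j j)) k' i' j' = (\<Sum>l<d ! k'. if l = i then (if k' = k \<and> i' = j \<and> j' = j then ent b k i j else 0) else 0)"
        unfolding ent_mult[OF ok] using ok by (intro sum.cong refl) (auto simp: E be ok_def)
      also have "\<dots> = (if k' = k \<and> i' = j \<and> j' = j then ent b k i j else 0)" using i by auto
      finally show "ent (((1 / ent b k i j) \<star> E k j i) * (b * E k j j)) k' i' j' = ent (E k j j) k' i' j'"
        using i(2) by (simp add: ent_scale[OF ok] E[OF ok])
    qed
    then show "\<exists>a. a * (b * (case p of (k, j) \<Rightarrow> E k j j)) = (case p of (k, j) \<Rightarrow> E k j j)"
      unfolding kj prod.case by (rule exI)
  qed
qed

section \<open>Monoid algebras, quotients and base change\<close>

text \<open>The coefficient is an argument of \<Psi> rather than a scalar outside it, so that maps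
  which also apply \<theta> to the coefficients are covered.\<close>

definition lin_ext :: "('k \<Rightarrow> 'r \<Rightarrow> 'b) \<Rightarrow> ('k \<Rightarrow>\<^sub>0 'r::zero) \<Rightarrow> 'b::comm_monoid_add" where
  "lin_ext \<Psi> f = (\<Sum>k\<in>Poly_Mapping.keys f. \<Psi> k (Poly_Mapping.lookup f k))"

definition coeffs_in :: "'r::zero set \<Rightarrow> ('k \<Rightarrow>\<^sub>0 'r) set" where
  "coeffs_in R = {f. \<forall>k\<in>Poly_Mapping.keys f. Poly_Mapping.lookup f k \<in> R}"

text \<open>The Laurent polynomials in finitely many variables are only a subset of their type, and
  \<theta> is a homomorphism only there; hence coefficients are confined to a subring.\<close>

definition subring_set :: "'r::comm_ring_1 set \<Rightarrow> bool" where
  "subring_set R \<longleftrightarrow> 1 \<in> R \<and> (\<forall>x\<in>R. \<forall>y\<in>R. x - y \<in> R \<and> x * y \<in> R)"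

lemma subring_setD:
  assumes "subring_set R"
  shows "1 \<in> R" "0 \<in> R" "\<And>x y. x \<in> R \<Longrightarrow> y \<in> R \<Longrightarrow> x * y \<in> R" "\<And>x y. x \<in> R \<Longrightarrow> y \<in> R \<Longrightarrow> x - y \<in> R"
    "\<And>x. x \<in> R \<Longrightarrow> - x \<in> R" "\<And>x y. x \<in> R \<Longrightarrow> y \<in> R \<Longrightarrow> x + y \<in> R"
proof -
  show 1: "1 \<in> R" "\<And>x y. x \<in> R \<Longrightarrow> y \<in> R \<Longrightarrow> x * y \<in> R" and d: "\<And>x y. x \<in> R \<Longrightarrow> y \<in> R \<Longrightarrow> x - y \<in> R"
    using assms by (auto simp: subring_set_def)
  show 0: "0 \<in> R" using d[OF 1(1) 1(1)] by simp
  show m: "- x \<in> R" if "x \<in> R" for x using d[OF 0 that] by simp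
  show "x + y \<in> R" if "x \<in> R" "y \<in> R" for x y using d[OF that(1) m[OF that(2)]] by simp
qed

lemma coeffs_in_lookup: "f \<in> coeffs_in R \<Longrightarrow> 0 \<in> R \<Longrightarrow> Poly_Mapping.lookup f k \<in> R"
  by (cases "k \<in> Poly_Mapping.keys f") (auto simp: coeffs_in_def in_keys_iff)

lemma coeffs_in_iff: "0 \<in> R \<Longrightarrow> f \<in> coeffs_in R \<longleftrightarrow> (\<forall>k. Poly_Mapping.lookup f k \<in> R)"
  using coeffs_in_lookup[of f R] by (auto simp: coeffs_in_def)

lemma poly_mapping_sum_single:
  "f = (\<Sum>k\<in>Poly_Mapping.keys f. Poly_Mapping.single k (Poly_Mapping.lookup f k))"
proof (rule poly_mapping_eqI)
  fix j
  have "Poly_Mapping.lookup (\<Sum>k\<in>Poly_Mapping.keys f. Poly_Mapping.single k (Poly_Mapping.lookup f k)) j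
      = (\<Sum>k\<in>Poly_Mapping.keys f. if k = j then Poly_Mapping.lookup f j else 0)"
    unfolding lookup_sum by (intro sum.cong refl) (simp add: lookup_single when_def)
  then show "Poly_Mapping.lookup f j = Poly_Mapping.lookup (\<Sum>k\<in>Poly_Mapping.keys f. Poly_Mapping.single k (Poly_Mapping.lookup f k)) j"
    by (simp add: in_keys_iff)
qed

locale coeff_action =
  fixes R :: "'r::comm_ring_1 set" and \<Psi> :: "'k \<Rightarrow> 'r \<Rightarrow> 'b::ring_1"
  assumes R: "subring_set R"
    and \<Psi>_add: "r \<in> R \<Longrightarrow> r' \<in> R \<Longrightarrow> \<Psi> k (r + r') = \<Psi> k r + \<Psi> k r'"
begin

lemma \<Psi>_0: "\<Psi> k 0 = 0"
  using \<Psi>_add[of 0 0 k] subring_setD(2)[OF R] by simp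

lemma lin_ext_superset:
  "finite S \<Longrightarrow> Poly_Mapping.keys f \<subseteq> S \<Longrightarrow> lin_ext \<Psi> f = (\<Sum>k\<in>S. \<Psi> k (Poly_Mapping.lookup f k))"
  unfolding lin_ext_def by (intro sum.mono_neutral_left) (auto simp: in_keys_iff \<Psi>_0)

lemma lin_ext_add:
  assumes "f \<in> coeffs_in R" "g \<in> coeffs_in R"
  shows "lin_ext \<Psi> (f + g) = lin_ext \<Psi> f + lin_ext \<Psi> g"
proof -
  let ?S = "Poly_Mapping.keys f \<union> Poly_Mapping.keys g"
  have "lin_ext \<Psi> (f + g) = (\<Sum>k\<in>?S. \<Psi> k (Poly_Mapping.lookup f k + Poly_Mapping.lookup g k))"
    using keys_add[of f g] by (subst lin_ext_superset[of ?S]) (auto simp: lookup_add)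
  also have "\<dots> = (\<Sum>k\<in>?S. \<Psi> k (Poly_Mapping.lookup f k)) + (\<Sum>k\<in>?S. \<Psi> k (Poly_Mapping.lookup g k))"
    using assms subring_setD(2)[OF R] by (simp add: \<Psi>_add coeffs_in_lookup sum.distrib)
  finally show ?thesis using lin_ext_superset[of ?S f] lin_ext_superset[of ?S g] by simp
qed

lemma lin_ext_single: "r \<in> R \<Longrightarrow> lin_ext \<Psi> (Poly_Mapping.single k r) = \<Psi> k r"
  by (simp add: lin_ext_def \<Psi>_0)

lemma coeffs_in_closed:
  shows "0 \<in> coeffs_in R" "f \<in> coeffs_in R \<Longrightarrow> g \<in> coeffs_in R \<Longrightarrow> f + g \<in> coeffs_in R"
    "r \<in> R \<Longrightarrow> Poly_Mapping.single k r \<in> coeffs_in R"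
  using subring_setD[OF R] by (auto simp: coeffs_in_iff lookup_add lookup_single when_def)

lemma coeffs_in_sum: "(\<And>i. i \<in> I \<Longrightarrow> f i \<in> coeffs_in R) \<Longrightarrow> (\<Sum>i\<in>I. f i) \<in> coeffs_in R"
  by (induction I rule: infinite_finite_induct) (auto simp: coeffs_in_closed)

lemma lin_ext_0: "lin_ext \<Psi> 0 = 0"
  by (simp add: lin_ext_def)

lemma lin_ext_sum: "(\<And>i. i \<in> I \<Longrightarrow> f i \<in> coeffs_in R) \<Longrightarrow> lin_ext \<Psi> (\<Sum>i\<in>I. f i) = (\<Sum>i\<in>I. lin_ext \<Psi> (f i))"
  by (induction I rule: infinite_finite_induct) (auto simp: lin_ext_add coeffs_in_sum lin_ext_0)

end

locale monoid_algebra_hom = coeff_action R \<Psi>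
  for R :: "'r::comm_ring_1 set" and \<Psi> :: "'k::monoid_add \<Rightarrow> 'r \<Rightarrow> 'b::ring_1" +
  assumes \<Psi>_mult: "r \<in> R \<Longrightarrow> r' \<in> R \<Longrightarrow> \<Psi> k r * \<Psi> k' r' = \<Psi> (k + k') (r * r')"
begin

lemma mult_sum_singles:
  fixes f g :: "'k \<Rightarrow>\<^sub>0 'r"
  shows "f * g = (\<Sum>k\<in>Poly_Mapping.keys f. \<Sum>k'\<in>Poly_Mapping.keys g.
    Poly_Mapping.single (k + k') (Poly_Mapping.lookup f k * Poly_Mapping.lookup g k'))"
  by (subst poly_mapping_sum_single[of f], subst poly_mapping_sum_single[of g])
    (simp add: sum_distrib_left sum_distrib_right mult_single, subst sum.swap, simp)

lemma coeffs_in_mult: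
  assumes "f \<in> coeffs_in R" "g \<in> coeffs_in R"
  shows "f * (g :: 'k \<Rightarrow>\<^sub>0 'r) \<in> coeffs_in R"
  unfolding mult_sum_singles[of f g]
  using assms subring_setD[OF R] by (intro coeffs_in_sum coeffs_in_closed) (auto simp: coeffs_in_def)

lemma lin_ext_mult:
  assumes "f \<in> coeffs_in R" "g \<in> coeffs_in R"
  shows "lin_ext \<Psi> (f * g) = lin_ext \<Psi> f * lin_ext \<Psi> g"
proof -
  have R': "\<And>k. k \<in> Poly_Mapping.keys f \<Longrightarrow> Poly_Mapping.lookup f k \<in> R" "\<And>k. k \<in> Poly_Mapping.keys g \<Longrightarrow> Poly_Mapping.lookup g k \<in> R"
    using assms by (auto simp: coeffs_in_def)
  have "lin_ext \<Psi> (f * g) = (\<Sum>k\<in>Poly_Mapping.keys f. \<Sum>k'\<in>Poly_Mapping.keys g.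
      lin_ext \<Psi> (Poly_Mapping.single (k + k') (Poly_Mapping.lookup f k * Poly_Mapping.lookup g k')))"
    unfolding mult_sum_singles[of f g] using R' subring_setD[OF R]
    by (subst lin_ext_sum lin_ext_sum, intro coeffs_in_sum coeffs_in_closed, simp)
      (intro sum.cong refl lin_ext_sum coeffs_in_closed, simp)
  also have "\<dots> = (\<Sum>k\<in>Poly_Mapping.keys f. \<Sum>k'\<in>Poly_Mapping.keys g.
      \<Psi> k (Poly_Mapping.lookup f k) * \<Psi> k' (Poly_Mapping.lookup g k'))"
    using R' subring_setD[OF R] by (intro sum.cong refl) (simp add: lin_ext_single \<Psi>_mult)
  also have "\<dots> = lin_ext \<Psi> f * lin_ext \<Psi> g"
    by (simp add: lin_ext_def sum_distrib_left sum_distrib_right) (subst sum.swap, simp)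
  finally show ?thesis .
qed

end

text \<open>The zero action, which exports facts of the locale that do not speak of \<Psi>.\<close>

lemma monoid_algebra_hom_trivial: "subring_set R \<Longrightarrow> monoid_algebra_hom R (\<lambda>k r. 0)"
  by standard auto

lemma coeffs_in_mult':
  assumes "subring_set R" "f \<in> coeffs_in R" "g \<in> coeffs_in R"
  shows "f * (g :: 'k::monoid_add \<Rightarrow>\<^sub>0 'r::comm_ring_1) \<in> coeffs_in R"
proof -
  interpret monoid_algebra_hom R "\<lambda>(k :: 'k) (r :: 'r). 0 :: 'r" by (rule monoid_algebra_hom_trivial[OF assms(1)])
  show ?thesis by (rule coeffs_in_mult[OF assms(2,3)])
qed

definition free_carrier :: "'r::comm_ring_1 set \<Rightarrow> 'g set \<Rightarrow> ('g word \<Rightarrow>\<^sub>0 'r) set" where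
  "free_carrier R G = {f \<in> coeffs_in R. \<forall>w\<in>Poly_Mapping.keys f. letters w \<in> lists G}"

lemma carrier_free_algebra: "carrier (free_algebra R G) = free_carrier R G"
  by (auto simp: free_algebra_def free_carrier_def coeffs_in_def)

lemma letters_plus: "letters (u + w) = letters u @ letters w"
  by (simp add: plus_word_def)

lemma letters_zero: "letters 0 = []"
  by (simp add: zero_word_def)

lemma free_carrier_closed:
  assumes R: "subring_set R"
  shows "0 \<in> free_carrier R G" "1 \<in> free_carrier R G"
    "f \<in> free_carrier R G \<Longrightarrow> g \<in> free_carrier R G \<Longrightarrow> f + g \<in> free_carrier R G"
    "f \<in> free_carrier R G \<Longrightarrow> g \<in> free_carrier R G \<Longrightarrow> f * g \<in> free_carrier R G"
    "f \<in> free_carrier R G \<Longrightarrow> - f \<in> free_carrier R G"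
    "r \<in> R \<Longrightarrow> letters w \<in> lists G \<Longrightarrow> Poly_Mapping.single w r \<in> free_carrier R G"
proof -
  note RD = subring_setD[OF R]
  show s: "r \<in> R \<Longrightarrow> letters w \<in> lists G \<Longrightarrow> Poly_Mapping.single w r \<in> free_carrier R G" for r w
    by (auto simp: free_carrier_def coeffs_in_def)
  show "0 \<in> free_carrier R G" by (simp add: free_carrier_def coeffs_in_def)
  show "1 \<in> free_carrier R G" using s[of 1 0] RD by (simp add: letters_zero single_one)
  show "f \<in> free_carrier R G \<Longrightarrow> - f \<in> free_carrier R G"
    using RD by (simp add: free_carrier_def coeffs_in_def)
  assume f: "f \<in> free_carrier R G"
  { assume g: "g \<in> free_carrier R G"
    have "f + g \<in> coeffs_in R" using f g RD by (simp add: free_carrier_def coeffs_in_iff lookup_add)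
    moreover have "letters w \<in> lists G" if "w \<in> Poly_Mapping.keys (f + g)" for w
      using subsetD[OF keys_add that] f g by (auto simp only: free_carrier_def Un_iff mem_Collect_eq)
    ultimately show "f + g \<in> free_carrier R G" by (simp add: free_carrier_def)
    have "f * g \<in> coeffs_in R" using f g by (intro coeffs_in_mult'[OF R]) (auto simp: free_carrier_def)
    moreover have "letters w \<in> lists G" if wk: "w \<in> Poly_Mapping.keys (f * g)" for w
    proof -
      obtain a b where ab: "w = a + b" "a \<in> Poly_Mapping.keys f" "b \<in> Poly_Mapping.keys g"
        using subsetD[OF keys_mult wk] by blast
      then have "letters a \<in> lists G" "letters b \<in> lists G" using f g by (simp_all only: free_carrier_def mem_Collect_eq)
      then show ?thesis unfolding ab(1) letters_plus by simp
    qed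
    ultimately show "f * g \<in> free_carrier R G" by (simp add: free_carrier_def) }
qed

lemma ring_free_algebra:
  assumes "subring_set R"
  shows "ring (free_algebra R G)"
proof (intro ringI abelian_groupI monoidI)
  note c = free_carrier_closed[OF assms]
  fix x assume "x \<in> carrier (free_algebra R G)"
  then have "- x \<in> free_carrier R G" by (simp add: carrier_free_algebra c)
  then show "\<exists>y\<in>carrier (free_algebra R G). y \<oplus>\<^bsub>free_algebra R G\<^esub> x = \<zero>\<^bsub>free_algebra R G\<^esub>"
    by (intro bexI[of _ "- x"]) (simp_all add: carrier_free_algebra, simp add: free_algebra_def)
qed (use free_carrier_closed[OF assms] in \<open>simp_all add: carrier_free_algebra\<close>,
    simp_all add: free_algebra_def algebra_simps)

lemma a_minus_free_algebra:
  assumes R: "subring_set R" and f: "f \<in> free_carrier R G" and g: "g \<in> free_carrier R G"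
  shows "f \<ominus>\<^bsub>free_algebra R G\<^esub> g = f - g"
proof -
  interpret F: ring "free_algebra R G" by (rule ring_free_algebra[OF R])
  have "\<ominus>\<^bsub>free_algebra R G\<^esub> g = - g"
    using g free_carrier_closed(5)[OF R g]
    by (intro F.add.inv_equality) (auto simp: carrier_free_algebra, auto simp: free_algebra_def)
  then show ?thesis by (simp add: a_minus_def) (simp add: free_algebra_def)
qed

lemma free_carrier_induct [consumes 2, case_names zero add single]:
  assumes R: "subring_set R" and f: "f \<in> free_carrier R G"
    and zero: "P 0" and add: "\<And>f g. f \<in> free_carrier R G \<Longrightarrow> g \<in> free_carrier R G \<Longrightarrow> P f \<Longrightarrow> P g \<Longrightarrow> P (f + g)"
    and single: "\<And>r w. r \<in> R \<Longrightarrow> letters w \<in> lists G \<Longrightarrow> P (Poly_Mapping.single w r)"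
  shows "P f"
proof -
  have "(\<Sum>k\<in>S. Poly_Mapping.single k (Poly_Mapping.lookup f k)) \<in> free_carrier R G \<and>
      P (\<Sum>k\<in>S. Poly_Mapping.single k (Poly_Mapping.lookup f k))"
    if "S \<subseteq> Poly_Mapping.keys f" for S
    using finite_subset[OF that finite_keys] that
  proof (induction S rule: finite_induct)
    case (insert k S)
    then have "Poly_Mapping.lookup f k \<in> R" "letters k \<in> lists G" using f by (auto simp: free_carrier_def coeffs_in_def)
    note s = free_carrier_closed(6)[OF R this] single[OF this]
    have IH: "(\<Sum>k\<in>S. Poly_Mapping.single k (Poly_Mapping.lookup f k)) \<in> free_carrier R G"
      "P (\<Sum>k\<in>S. Poly_Mapping.single k (Poly_Mapping.lookup f k))" using insert by auto
    show ?case
      using free_carrier_closed(3)[OF R s(1) IH(1)] add[OF s(1) IH(1) s(2) IH(2)] insert.hyps by simp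
  qed (auto simp: free_carrier_closed[OF R] zero)
  then have "P (\<Sum>k\<in>Poly_Mapping.keys f. Poly_Mapping.single k (Poly_Mapping.lookup f k))" by blast
  then show ?thesis by (simp only: poly_mapping_sum_single[symmetric])
qed

lemma ring_extend: "ring Q \<Longrightarrow> ring (ring.extend Q x)"
proof -
  assume "ring Q"
  then interpret Q: ring Q .
  show ?thesis
  proof (intro ringI abelian_groupI monoidI)
    fix y assume "y \<in> carrier (ring.extend Q x)"
    then show "\<exists>z\<in>carrier (ring.extend Q x). z \<oplus>\<^bsub>ring.extend Q x\<^esub> y = \<zero>\<^bsub>ring.extend Q x\<^esub>"
      by (intro bexI[of _ "\<ominus>\<^bsub>Q\<^esub> y"]) (auto simp: ring.defs Q.l_neg)
  qed (auto simp: ring.defs Q.m_assoc Q.add.m_assoc Q.l_distr Q.r_distr intro: Q.add.m_comm)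
qed

lemma ring_hom_extend: "f \<in> Ring.ring_hom Q S \<Longrightarrow> f \<in> Ring.ring_hom (ring.extend Q x) S"
  by (auto simp: Ring.ring_hom_def ring.defs)

lemma ring_hom_extend_right: "f \<in> Ring.ring_hom S Q \<Longrightarrow> f \<in> Ring.ring_hom S (ring.extend Q x)"
  by (auto simp: Ring.ring_hom_def ring.defs)

lemma type_algebra_sel:
  "carrier ring_of_type_algebra = UNIV" "mult ring_of_type_algebra = (*)" "add ring_of_type_algebra = (+)"
  "one ring_of_type_algebra = 1" "zero ring_of_type_algebra = (0 :: 'b::ring_1)"
  by (simp_all add: ring_of_type_algebra_def)

lemma ring_type_algebra: "ring (ring_of_type_algebra :: 'b::ring_1 ring)"
proof (intro ringI abelian_groupI monoidI)
  fix x :: 'b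
  show "\<exists>y\<in>carrier (ring_of_type_algebra :: 'b ring). y \<oplus>\<^bsub>ring_of_type_algebra\<^esub> x = \<zero>\<^bsub>ring_of_type_algebra\<^esub>"
    by (rule bexI[of _ "- x"]) (simp_all add: ring_of_type_algebra_def)
qed (simp_all add: ring_of_type_algebra_def algebra_simps)

text \<open>The kernel is an ideal containing S, so \<Phi> is constant on the cosets of the
  generated ideal and may be evaluated at an arbitrary representative.\<close>

lemma ring_hom_factor:
  assumes F: "ring F" and S: "S \<subseteq> carrier F"
    and \<Phi>: "\<Phi> \<in> Ring.ring_hom F (ring_of_type_algebra :: 'b::ring_1 ring)" and kill: "\<And>s. s \<in> S \<Longrightarrow> \<Phi> s = 0"
  shows "\<exists>H\<in>Ring.ring_hom (F Quot (Idl\<^bsub>F\<^esub> S)) (ring_of_type_algebra :: 'b ring).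
    \<forall>x\<in>carrier F. H ((Idl\<^bsub>F\<^esub> S) +>\<^bsub>F\<^esub> x) = \<Phi> x"
proof -
  interpret F: ring F by (rule F)
  interpret T: ring "ring_of_type_algebra :: 'b ring" by (rule ring_type_algebra)
  interpret h: ring_hom_ring F "ring_of_type_algebra :: 'b ring" \<Phi> using \<Phi> by (intro ring_hom_ringI2) unfold_locales
  let ?I = "Idl\<^bsub>F\<^esub> S"
  interpret I: ideal ?I F by (rule F.genideal_ideal[OF S])
  let ?K = "a_kernel F (ring_of_type_algebra :: 'b ring) \<Phi>"
  have K: "x \<in> ?K \<longleftrightarrow> x \<in> carrier F \<and> \<Phi> x = 0" for x
    by (simp only: a_kernel_def' type_algebra_sel mem_Collect_eq)
  have "S \<subseteq> ?K"
  proof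
    fix s assume "s \<in> S"
    then show "s \<in> ?K" unfolding K using S kill by blast
  qed
  then have "?I \<subseteq> ?K" by (rule F.genideal_minimal[OF h.kernel_is_ideal])
  then have ker: "\<Phi> x = 0" if "x \<in> ?I" for x using subsetD[OF _ that, of ?K] unfolding K by blast
  have cong: "\<Phi> x = \<Phi> y" if "x \<in> ?I +>\<^bsub>F\<^esub> y" "y \<in> carrier F" for x y
  proof -
    have "x \<in> (\<Union>h\<in>?I. {h \<oplus>\<^bsub>F\<^esub> y})" using that(1) unfolding a_r_coset_def' .
    then obtain i where i: "i \<in> ?I" "x = i \<oplus>\<^bsub>F\<^esub> y" by (elim UN_E singletonE)
    have "i \<in> carrier F" using i(1) I.a_subset by blast
    then have "\<Phi> x = \<Phi> i + \<Phi> y"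
      unfolding i(2) using ring_hom_add[OF \<Phi> _ that(2), of i] by (simp only: type_algebra_sel)
    then show ?thesis using ker[OF i(1)] by simp
  qed
  define H where "H U = \<Phi> (SOME x. x \<in> U)" for U
  have H: "H (?I +>\<^bsub>F\<^esub> x) = \<Phi> x" if x: "x \<in> carrier F" for x
  proof -
    have "(SOME y. y \<in> ?I +>\<^bsub>F\<^esub> x) \<in> ?I +>\<^bsub>F\<^esub> x" using I.a_rcos_self[OF x] by (rule someI)
    then show ?thesis unfolding H_def by (rule cong[OF _ x])
  qed
  have "H \<in> Ring.ring_hom (F Quot ?I) (ring_of_type_algebra :: 'b ring)"
  proof (rule ring_hom_memI)
    show "H U \<in> carrier (ring_of_type_algebra :: 'b ring)" for U by (simp only: type_algebra_sel UNIV_I)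
    fix U V assume "U \<in> carrier (F Quot ?I)" "V \<in> carrier (F Quot ?I)"
    then obtain x y where xy: "U = ?I +>\<^bsub>F\<^esub> x" "V = ?I +>\<^bsub>F\<^esub> y" "x \<in> carrier F" "y \<in> carrier F"
      by (auto simp: FactRing_def A_RCOSETS_def')
    note rh = I.rcos_ring_hom
    show "H (U \<otimes>\<^bsub>F Quot ?I\<^esub> V) = H U \<otimes>\<^bsub>(ring_of_type_algebra :: 'b ring)\<^esub> H V"
      unfolding xy using ring_hom_mult[OF rh xy(3,4), symmetric] xy(3,4) by (simp add: H)
    show "H (U \<oplus>\<^bsub>F Quot ?I\<^esub> V) = H U \<oplus>\<^bsub>(ring_of_type_algebra :: 'b ring)\<^esub> H V"
      unfolding xy using ring_hom_add[OF rh xy(3,4), symmetric] xy(3,4) by (simp add: H)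
  next
    show "H \<one>\<^bsub>F Quot ?I\<^esub> = \<one>\<^bsub>(ring_of_type_algebra :: 'b ring)\<^esub>"
      using ring_hom_one[OF I.rcos_ring_hom, symmetric] by (simp add: H)
  qed
  then show ?thesis using H by blast
qed

section \<open>The monoid ring of pairs\<close>

lemma frag_cmul_diff_right: "frag_cmul c (a - b) = frag_cmul c a - frag_cmul c b"
  by (rule poly_mapping_eqI) (simp add: lookup_minus right_diff_distrib)

lemma frag_extend_fun_diff: "frag_extend (\<lambda>p. f p - g p) x = frag_extend f x - frag_extend g x"
  unfolding frag_extend_def by (simp add: frag_cmul_diff_right sum_subtractf)

context
  fixes S :: "('s, 'c) ring_scheme" and B :: "('b, 'e) ring_scheme"
  assumes S: "ring S" and B: "ring B"
begin

interpretation S: ring S by (rule S)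
interpretation B: ring B by (rule B)

abbreviation pmult where "pmult \<equiv> mult (pair_ring S B)"
abbreviation pcarrier where "pcarrier \<equiv> carrier S \<times> carrier B"

lemma pmult_of: "pmult (frag_of (s, b)) (frag_of (s', b')) = frag_of (s \<otimes>\<^bsub>S\<^esub> s', b \<otimes>\<^bsub>B\<^esub> b')"
  by (simp add: pair_ring_def)

text \<open>Differences come before sums because \<open>frag_induction\<close> builds elements of a
  free abelian group by differences.\<close>

lemma pmult_diff_left: "pmult (x - x') y = pmult x y - pmult x' y"
  by (simp add: pair_ring_def frag_extend_diff)

lemma pmult_diff_right: "pmult x (y - y') = pmult x y - pmult x y'"
  by (simp add: pair_ring_def frag_extend_diff frag_extend_fun_diff case_prod_unfold)

lemma pmult_zero: "pmult 0 y = 0" "pmult x 0 = 0"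
  by (simp_all add: pair_ring_def case_prod_unfold frag_extend_eq_0)

lemma pmult_add_left: "pmult (x + x') y = pmult x y + pmult x' y"
  using pmult_diff_left[of x "- x'" y] pmult_diff_left[of 0 x' y] by (simp add: pmult_zero)

lemma pmult_add_right: "pmult x (y + y') = pmult x y + pmult x y'"
  using pmult_diff_right[of x y "- y'"] pmult_diff_right[of x 0 y'] by (simp add: pmult_zero)

lemma pmult_closed: "Poly_Mapping.keys x \<subseteq> pcarrier \<Longrightarrow> Poly_Mapping.keys y \<subseteq> pcarrier \<Longrightarrow> Poly_Mapping.keys (pmult x y) \<subseteq> pcarrier"
proof (induction x rule: frag_induction)
  case (one p)
  from one(2) show ?case
  proof (induction y rule: frag_induction)
    case (one p')
    then show ?case using \<open>p \<in> pcarrier\<close> by (cases p; cases p') (auto simp: pmult_of)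
  next
    case (diff a b)
    then show ?case using keys_diff[of "pmult (frag_of p) a" "pmult (frag_of p) b"] by (auto simp: pmult_diff_right)
  qed (simp add: pmult_zero)
next
  case (diff a b)
  then show ?case using keys_diff[of "pmult a y" "pmult b y"] by (auto simp: pmult_diff_left)
qed (simp add: pmult_zero)

lemma pmult_assoc:
  assumes "Poly_Mapping.keys x \<subseteq> pcarrier" "Poly_Mapping.keys y \<subseteq> pcarrier" "Poly_Mapping.keys z \<subseteq> pcarrier"
  shows "pmult (pmult x y) z = pmult x (pmult y z)"
  using assms(1)
proof (induction x rule: frag_induction)
  case (one p)
  note p = one
  from assms(2) show ?case
  proof (induction y rule: frag_induction)
    case (one p')
    note p' = one
    from assms(3) show ?case
    proof (induction z rule: frag_induction)
      case (one p'')
      then show ?case using p p' by (cases p; cases p'; cases p'') (auto simp: pmult_of S.m_assoc B.m_assoc)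
    qed (simp_all add: pmult_zero pmult_diff_right)
  qed (simp_all add: pmult_zero pmult_diff_right pmult_diff_left)
qed (simp_all add: pmult_zero pmult_diff_left)

lemma pmult_one:
  assumes "Poly_Mapping.keys x \<subseteq> pcarrier"
  shows "pmult (frag_of (\<one>\<^bsub>S\<^esub>, \<one>\<^bsub>B\<^esub>)) x = x" "pmult x (frag_of (\<one>\<^bsub>S\<^esub>, \<one>\<^bsub>B\<^esub>)) = x"
  using assms
  by (induction x rule: frag_induction) (auto simp: pmult_zero pmult_of pmult_diff_right pmult_diff_left)

lemma ring_pair_ring: "ring (pair_ring S B)"
proof (intro ringI abelian_groupI monoidI)
  fix x y z assume x: "x \<in> carrier (pair_ring S B)" and y: "y \<in> carrier (pair_ring S B)" and z: "z \<in> carrier (pair_ring S B)"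
  note c = x y z
  have k: "Poly_Mapping.keys x \<subseteq> pcarrier" "Poly_Mapping.keys y \<subseteq> pcarrier" "Poly_Mapping.keys z \<subseteq> pcarrier"
    using c by (auto simp: pair_ring_def)
  show "x \<otimes>\<^bsub>pair_ring S B\<^esub> y \<otimes>\<^bsub>pair_ring S B\<^esub> z = x \<otimes>\<^bsub>pair_ring S B\<^esub> (y \<otimes>\<^bsub>pair_ring S B\<^esub> z)"
    by (rule pmult_assoc[OF k])
  show "(x \<oplus>\<^bsub>pair_ring S B\<^esub> y) \<otimes>\<^bsub>pair_ring S B\<^esub> z = x \<otimes>\<^bsub>pair_ring S B\<^esub> z \<oplus>\<^bsub>pair_ring S B\<^esub> y \<otimes>\<^bsub>pair_ring S B\<^esub> z"
    using pmult_add_left by (simp add: pair_ring_def)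
  show "z \<otimes>\<^bsub>pair_ring S B\<^esub> (x \<oplus>\<^bsub>pair_ring S B\<^esub> y) = z \<otimes>\<^bsub>pair_ring S B\<^esub> x \<oplus>\<^bsub>pair_ring S B\<^esub> z \<otimes>\<^bsub>pair_ring S B\<^esub> y"
    using pmult_add_right by (simp add: pair_ring_def)
next
  fix x y assume "x \<in> carrier (pair_ring S B)" "y \<in> carrier (pair_ring S B)"
  then have k: "Poly_Mapping.keys x \<subseteq> pcarrier" "Poly_Mapping.keys y \<subseteq> pcarrier" by (auto simp: pair_ring_def)
  show "x \<otimes>\<^bsub>pair_ring S B\<^esub> y \<in> carrier (pair_ring S B)"
    using pmult_closed[OF k] by (simp add: pair_ring_def)
  show "x \<oplus>\<^bsub>pair_ring S B\<^esub> y \<in> carrier (pair_ring S B)"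
    using k keys_add[of x y] by (auto simp: pair_ring_def)
next
  fix x assume x: "x \<in> carrier (pair_ring S B)"
  then have k: "Poly_Mapping.keys x \<subseteq> pcarrier" by (simp add: pair_ring_def)
  show "\<one>\<^bsub>pair_ring S B\<^esub> \<otimes>\<^bsub>pair_ring S B\<^esub> x = x" "x \<otimes>\<^bsub>pair_ring S B\<^esub> \<one>\<^bsub>pair_ring S B\<^esub> = x"
    using pmult_one[OF k] by (simp_all add: pair_ring_def)
  show "\<exists>y\<in>carrier (pair_ring S B). y \<oplus>\<^bsub>pair_ring S B\<^esub> x = \<zero>\<^bsub>pair_ring S B\<^esub>"
    using k by (intro bexI[of _ "- x"]) (auto simp: pair_ring_def)
qed (auto simp: pair_ring_def algebra_simps)

end

section \<open>The relations of the algebra, specialised by \<theta>\<close>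

definition yh_idem :: "nat \<Rightarrow> (nat \<Rightarrow> 'a::complex_algebra) \<Rightarrow> nat \<Rightarrow> 'a" where
  "yh_idem d t i = (1 / of_nat d) \<star> (\<Sum>s<d. t i ^ s * t (i + 1) ^ (d - s))"

text \<open>The relations \<open>yh_rels\<close>, clause by clause in the same order, for the images
  of the generators in a complex algebra with the scalars already specialised.\<close>

definition yh_relations ::
  "nat \<Rightarrow> nat \<Rightarrow> nat \<Rightarrow> complex \<Rightarrow> (nat \<Rightarrow> complex) \<Rightarrow> (yh_gen \<Rightarrow> 'a::complex_algebra) \<Rightarrow> bool" where
  "yh_relations d m n q v \<gamma> \<longleftrightarrow> (let t = \<lambda>j. \<gamma> (GT j); g = \<lambda>i. \<gamma> (GG i); x = \<gamma> GX; x' = \<gamma> GXinv in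
     (\<forall>i j. i \<in> {1..<n} \<and> j \<in> {1..<n} \<and> \<bar>int i - int j\<bar> > 1 \<longrightarrow> g i * g j = g j * g i) \<and>
     (\<forall>i. 1 \<le> i \<and> i + 1 < n \<longrightarrow> g i * g (i + 1) * g i = g (i + 1) * g i * g (i + 1)) \<and>
     (\<forall>i j. i \<in> {1..n} \<and> j \<in> {1..n} \<longrightarrow> t i * t j = t j * t i) \<and>
     (\<forall>i j. i \<in> {1..<n} \<and> j \<in> {1..n} \<longrightarrow> t j * g i = g i * t (transpose i (i + 1) j)) \<and>
     (\<forall>j. j \<in> {1..n} \<longrightarrow> t j ^ d = 1) \<and>
     (\<forall>i. i \<in> {1..<n} \<longrightarrow> g i ^ 2 = 1 + (q - inverse q) \<star> (yh_idem d t i * g i)) \<and>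
     (x * x' = 1 \<and> x' * x = 1) \<and>
     (\<forall>i::nat. i = 1 \<and> i \<in> {1..<n} \<longrightarrow> x * g 1 * x * g 1 = g 1 * x * g 1 * x) \<and>
     (\<forall>i. i \<in> {2..<n} \<longrightarrow> x * g i = g i * x) \<and>
     (\<forall>j. j \<in> {1..n} \<longrightarrow> x * t j = t j * x) \<and>
     prod_list (map (\<lambda>k. x - v k \<star> 1) [1..<m + 1]) = 0)"

locale yh_params =
  fixes d m n :: nat and \<theta> :: "laurent \<Rightarrow> complex"
  assumes d_pos: "d > 0" and n_pos: "n > 0" and m_pos: "m > 0"
    and \<theta>_hom: "\<theta> \<in> Ring.ring_hom (laurent_ring m) (ring_of_type_algebra :: complex ring)"
    and \<theta>_const: "\<And>c. \<theta> (laurent_const c) = c"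
begin

definition "RR = carrier (laurent_ring m)"
definition "q = \<theta> (qpow 1)"
definition "v k = \<theta> (vvar k)"

lemma laurent_ring_sel:
  "mult (laurent_ring m) = (*)" "add (laurent_ring m) = (+)" "one (laurent_ring m) = 1" "zero (laurent_ring m) = 0"
  by (simp_all add: laurent_ring_def ring_of_type_algebra_def)

lemma RR_iff: "f \<in> RR \<longleftrightarrow> (\<forall>e\<in>Poly_Mapping.keys f. Poly_Mapping.keys e \<subseteq> {0..m})"
  by (simp add: RR_def laurent_ring_def)

lemma subring_RR: "subring_set RR"
  unfolding subring_set_def
proof (intro conjI ballI)
  show "1 \<in> RR" by (simp add: RR_iff)
  fix x y assume x: "x \<in> RR" and y: "y \<in> RR"
  show "x - y \<in> RR" using x y keys_diff[of x y] by (auto simp only: RR_iff Un_iff dest!: subsetD)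
  have "Poly_Mapping.keys e \<subseteq> {0..m}" if e: "e \<in> Poly_Mapping.keys (x * y)" for e
  proof -
    obtain a b where ab: "e = a + b" "a \<in> Poly_Mapping.keys x" "b \<in> Poly_Mapping.keys y"
      using subsetD[OF keys_mult e] by blast
    then show ?thesis using x y keys_add[of a b] unfolding RR_iff by blast
  qed
  then show "x * y \<in> RR" by (simp add: RR_iff)
qed

lemma const_RR: "laurent_const c \<in> RR" and qpow_RR: "qpow z \<in> RR" and vvar_RR: "1 \<le> k \<Longrightarrow> k \<le> m \<Longrightarrow> vvar k \<in> RR"
  by (auto simp: RR_iff laurent_const_def qpow_def vvar_def)

lemma theta_add: "x \<in> RR \<Longrightarrow> y \<in> RR \<Longrightarrow> \<theta> (x + y) = \<theta> x + \<theta> y"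
  using ring_hom_add[OF \<theta>_hom, of x y] by (simp only: RR_def laurent_ring_sel type_algebra_sel)

lemma theta_mult: "x \<in> RR \<Longrightarrow> y \<in> RR \<Longrightarrow> \<theta> (x * y) = \<theta> x * \<theta> y"
  using ring_hom_mult[OF \<theta>_hom, of x y] by (simp only: RR_def laurent_ring_sel type_algebra_sel)

lemma theta_one: "\<theta> 1 = 1"
  using ring_hom_one[OF \<theta>_hom] by (simp only: laurent_ring_sel type_algebra_sel)

lemma theta_zero: "\<theta> 0 = 0"
  using theta_add[of 0 0] subring_setD(2)[OF subring_RR] by simp

lemma theta_diff: "x \<in> RR \<Longrightarrow> y \<in> RR \<Longrightarrow> \<theta> (x - y) = \<theta> x - \<theta> y"
  using theta_add[of "x - y" y] subring_setD(4)[OF subring_RR] by (simp add: eq_diff_eq)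

lemma qpow_add: "qpow (k + l) = qpow k * qpow l"
  by (simp add: qpow_def mult_single single_add)

lemma qpow_0: "qpow 0 = 1"
  by (simp add: qpow_def)

lemma q_nz: "q \<noteq> 0" and theta_qpow_minus: "\<theta> (qpow (- 1)) = inverse q"
proof -
  have "q * \<theta> (qpow (- 1)) = 1"
    using theta_mult[OF qpow_RR qpow_RR, of 1 "-1"] qpow_add[of 1 "-1"] by (simp add: q_def qpow_0 theta_one)
  then show "q \<noteq> 0" "\<theta> (qpow (- 1)) = inverse q" by (auto simp: inverse_unique)
qed

abbreviation "FC \<equiv> free_carrier RR (yh_gens n)"
abbreviation "FF \<equiv> free_algebra RR (yh_gens n)"

lemmas FC_closed = free_carrier_closed[OF subring_RR]

lemma FF_sel: "mult FF = (*)" "add FF = (+)" "one FF = 1" "zero FF = 0"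
  by (simp_all add: free_algebra_def)

lemma FC_gen: "x \<in> yh_gens n \<Longrightarrow> gen x \<in> FC"
  unfolding gen_def by (rule FC_closed) (auto simp: subring_setD(1)[OF subring_RR])

lemma FC_scal: "r \<in> RR \<Longrightarrow> scal r \<in> FC"
  unfolding scal_def by (rule FC_closed) (auto simp: letters_zero)

lemma FC_diff: "f \<in> FC \<Longrightarrow> g \<in> FC \<Longrightarrow> f - g \<in> FC"
  using FC_closed(3)[of f "yh_gens n" "- g"] FC_closed(5)[of g] by simp

lemma FC_power: "f \<in> FC \<Longrightarrow> f ^ k \<in> FC"
  by (induction k) (auto intro: FC_closed)

lemma FC_sum: "(\<And>i. i \<in> S \<Longrightarrow> f i \<in> FC) \<Longrightarrow> (\<Sum>i\<in>S. f i) \<in> FC"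
  by (induction S rule: infinite_finite_induct) (auto intro: FC_closed)

lemma FC_prod_list: "(\<And>x. x \<in> set xs \<Longrightarrow> f x \<in> FC) \<Longrightarrow> prod_list (map f xs) \<in> FC"
  by (induction xs) (auto intro: FC_closed)

lemma gens_mem: "GT j \<in> yh_gens n \<longleftrightarrow> j \<in> {1..n}" "GG i \<in> yh_gens n \<longleftrightarrow> i \<in> {1..<n}" "GX \<in> yh_gens n" "GXinv \<in> yh_gens n"
  by (auto simp: yh_gens_def)

lemmas FC_intros = FC_closed(2-4) FC_gen FC_scal FC_diff FC_power FC_sum FC_prod_list

end

text \<open>Ring homomorphisms on the free algebra that are semilinear along \<theta>. There are two
  instances: the map to the specialised algebra, and the map induced by prescribed images of the
  generators.\<close>

locale yh_hom = yh_params d m n \<theta> for d m n \<theta> +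
  fixes K :: "(yh_gen word \<Rightarrow>\<^sub>0 laurent) \<Rightarrow> 'b::complex_algebra"
  assumes K_add: "f \<in> FC \<Longrightarrow> g \<in> FC \<Longrightarrow> K (f + g) = K f + K g"
    and K_mult: "f \<in> FC \<Longrightarrow> g \<in> FC \<Longrightarrow> K (f * g) = K f * K g"
    and K_scal: "r \<in> RR \<Longrightarrow> K (scal r) = \<theta> r \<star> 1"
begin

lemma K_zero: "K 0 = 0"
  using K_add[of 0 0] FC_closed(1)[of "yh_gens n"] by simp

lemma K_one: "K 1 = 1"
  using K_scal[of 1] subring_setD(1)[OF subring_RR] by (simp add: scal_def theta_one)

lemma K_diff: "f \<in> FC \<Longrightarrow> g \<in> FC \<Longrightarrow> K (f - g) = K f - K g"
  using K_add[of "f - g" g] FC_diff[of f g] by (simp add: eq_diff_eq)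

lemma K_power: "f \<in> FC \<Longrightarrow> K (f ^ k) = K f ^ k"
  by (induction k) (auto simp: K_one K_mult FC_power)

lemma K_sum: "(\<And>i. i \<in> S \<Longrightarrow> f i \<in> FC) \<Longrightarrow> K (\<Sum>i\<in>S. f i) = (\<Sum>i\<in>S. K (f i))"
  by (induction S rule: infinite_finite_induct) (auto simp: K_zero K_add FC_sum)

lemma K_prod_list: "(\<And>x. x \<in> set xs \<Longrightarrow> f x \<in> FC) \<Longrightarrow> K (prod_list (map f xs)) = prod_list (map (\<lambda>x. K (f x)) xs)"
  by (induction xs) (auto simp: K_one K_mult FC_prod_list)

lemma ball_pairs1: "(\<forall>(a, b)\<in>{(f i, g i) |i. P i}. Q a b) \<longleftrightarrow> (\<forall>i. P i \<longrightarrow> Q (f i) (g i))"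
  by auto

lemma ball_pairs2: "(\<forall>(a, b)\<in>{(f i j, g i j) |i j. P i j}. Q a b) \<longleftrightarrow> (\<forall>i j. P i j \<longrightarrow> Q (f i j) (g i j))"
  by auto

lemma yh_e_FC: "i \<in> {1..<n} \<Longrightarrow> yh_e d i \<in> FC"
  unfolding yh_e_def by (intro FC_intros const_RR) (auto simp: gens_mem)

lemma K_yh_e: "i \<in> {1..<n} \<Longrightarrow> K (yh_e d i) = yh_idem d (\<lambda>j. K (yt j)) i"
proof -
  assume i: "i \<in> {1..<n}"
  have m: "yt i \<in> FC" "yt (i + 1) \<in> FC" using i by (auto intro!: FC_gen simp: gens_mem)
  have "(\<Sum>s<d. yt i ^ s * yt (i + 1) ^ (d - s)) \<in> FC" by (intro FC_sum FC_closed(4) FC_power m)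
  moreover have "K (\<Sum>s<d. yt i ^ s * yt (i + 1) ^ (d - s)) = (\<Sum>s<d. K (yt i) ^ s * K (yt (i + 1)) ^ (d - s))"
    by (subst K_sum, intro FC_closed(4) FC_power m) (simp only: K_mult[OF FC_power[OF m(1)] FC_power[OF m(2)]] K_power[OF m(1)] K_power[OF m(2)])
  ultimately show ?thesis
    by (simp add: yh_e_def yh_idem_def K_mult FC_scal const_RR K_scal \<theta>_const)
qed

text \<open>Both directions are used: the algebra inherits its relations from the quotient map, and
  conversely elements satisfying them define a map that respects the quotient.\<close>

lemma rels_iff: "(\<forall>(a, b)\<in>yh_rels d m n. K a = K b) \<longleftrightarrow> yh_relations d m n q v (\<lambda>x. K (gen x))"
proof -
  note g = FC_gen[of "GG _"] FC_gen[of "GT _"] FC_gen[of GX] FC_gen[of GXinv]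
  have X: "yX \<in> FC" "yXinv \<in> FC" by (auto intro: FC_gen simp: gens_mem)
  have G: "yg i \<in> FC" if "i \<in> {1..<n}" for i using that by (intro FC_gen) (simp add: gens_mem)
  have T: "yt j \<in> FC" if "j \<in> {1..n}" for j using that by (intro FC_gen) (simp add: gens_mem)
  have tr: "transpose i (i + 1) j \<in> {1..n}" if "i \<in> {1..<n}" "j \<in> {1..n}" for i j
    using that by (auto simp: transpose_def)
  have 1: "(K (yg i * yg j) = K (yg j * yg i)) = (K (yg i) * K (yg j) = K (yg j) * K (yg i))"
    if "i \<in> {1..<n} \<and> j \<in> {1..<n} \<and> \<bar>int i - int j\<bar> > 1" for i j using that G by (simp add: K_mult)
  have 2: "(K (yg i * yg (i + 1) * yg i) = K (yg (i + 1) * yg i * yg (i + 1)))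
      = (K (yg i) * K (yg (i + 1)) * K (yg i) = K (yg (i + 1)) * K (yg i) * K (yg (i + 1)))"
    if "1 \<le> i \<and> i + 1 < n" for i using that G[of i] G[of "i + 1"] by (simp add: K_mult FC_intros)
  have 3: "(K (yt i * yt j) = K (yt j * yt i)) = (K (yt i) * K (yt j) = K (yt j) * K (yt i))"
    if "i \<in> {1..n} \<and> j \<in> {1..n}" for i j using that T by (simp add: K_mult)
  have 4: "(K (yt j * yg i) = K (yg i * yt (transpose i (i + 1) j))) = (K (yt j) * K (yg i) = K (yg i) * K (yt (transpose i (i + 1) j)))"
    if "i \<in> {1..<n} \<and> j \<in> {1..n}" for i j using that T[of j] T[OF tr, of i j] G[of i] by (simp add: K_mult)
  have 5: "(K (yt j ^ d) = K 1) = (K (yt j) ^ d = 1)" if "j \<in> {1..n}" for j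
    using T[OF that] by (simp add: K_power K_one)
  have 6: "(K (yg i ^ 2) = K (1 + scal (qpow 1 - qpow (- 1)) * yh_e d i * yg i))
      = (K (yg i) ^ 2 = 1 + (q - inverse q) \<star> (yh_idem d (\<lambda>j. K (yt j)) i * K (yg i)))" if "i \<in> {1..<n}" for i
  proof -
    have r: "qpow 1 - qpow (- 1) \<in> RR" using qpow_RR subring_setD(4)[OF subring_RR] by blast
    have "K (scal (qpow 1 - qpow (- 1))) = (q - inverse q) \<star> 1"
      using r qpow_RR by (simp add: K_scal theta_diff theta_qpow_minus q_def)
    note c = G[OF that] yh_e_FC[OF that] FC_scal[OF r]
    have "K (1 + scal (qpow 1 - qpow (- 1)) * yh_e d i * yg i) = 1 + K (scal (qpow 1 - qpow (- 1))) * K (yh_e d i) * K (yg i)"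
      by (simp only: K_add[OF FC_closed(2) FC_closed(4)[OF FC_closed(4)[OF c(3,2)] c(1)]]
          K_mult[OF FC_closed(4)[OF c(3,2)] c(1)] K_mult[OF c(3,2)] K_one)
    also have "\<dots> = 1 + (q - inverse q) \<star> (yh_idem d (\<lambda>j. K (yt j)) i * K (yg i))"
      unfolding \<open>K (scal (qpow 1 - qpow (- 1))) = (q - inverse q) \<star> 1\<close> K_yh_e[OF that] by (simp add: mult.assoc)
    finally show ?thesis by (simp only: K_power[OF c(1)])
  qed
  have 7: "(\<forall>(a, b)\<in>{(yX * yXinv, 1), (yXinv * yX, 1)}. K a = K b) = (K yX * K yXinv = 1 \<and> K yXinv * K yX = 1)"
    using X by (simp add: K_mult K_one)
  have 8: "(K (yX * yg 1 * yX * yg 1) = K (yg 1 * yX * yg 1 * yX)) = (K yX * K (yg 1) * K yX * K (yg 1) = K (yg 1) * K yX * K (yg 1) * K yX)"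
    if "i = 1 \<and> i \<in> {1..<n}" for i :: nat using that X G[of 1] by (simp add: K_mult FC_intros)
  have 9: "(K (yX * yg i) = K (yg i * yX)) = (K yX * K (yg i) = K (yg i) * K yX)" if "i \<in> {2..<n}" for i
    using that X G[of i] by (simp add: K_mult)
  have 10: "(K (yX * yt j) = K (yt j * yX)) = (K yX * K (yt j) = K (yt j) * K yX)" if "j \<in> {1..n}" for j
    using X T[OF that] by (simp add: K_mult)
  have 11: "(K (prod_list (map (\<lambda>k. yX - scal (vvar k)) [1..<m + 1])) = K 0) = (prod_list (map (\<lambda>k. K yX - v k \<star> 1) [1..<m + 1]) = 0)"
  proof -
    have "K (prod_list (map (\<lambda>k. yX - scal (vvar k)) [1..<m + 1])) = prod_list (map (\<lambda>k. K (yX - scal (vvar k))) [1..<m + 1])"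
      using X by (intro K_prod_list FC_diff FC_scal vvar_RR) auto
    also have "map (\<lambda>k. K (yX - scal (vvar k))) [1..<m + 1] = map (\<lambda>k. K yX - v k \<star> 1) [1..<m + 1]"
    proof (intro map_cong refl)
      fix k assume "k \<in> set [1..<m + 1]"
      then have "vvar k \<in> RR" by (intro vvar_RR) auto
      then show "K (yX - scal (vvar k)) = K yX - v k \<star> 1" using X by (simp add: K_diff FC_scal K_scal v_def)
    qed
    finally show ?thesis by (simp add: K_zero)
  qed
  show ?thesis
    unfolding yh_rels_def ball_Un ball_pairs1 ball_pairs2 yh_relations_def Let_def 7
    using 1 2 3 4 5 6 8 9 10 11
    by (simp only: conj_assoc ball_simps prod.case simp_thms cong: imp_cong)
qed

end

lemma coset_eqI:
  assumes "ring R" "ideal I R" "x \<in> I +>\<^bsub>R\<^esub> f" "f \<in> carrier R"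
  shows "x \<in> carrier R" "I +>\<^bsub>R\<^esub> x = I +>\<^bsub>R\<^esub> f"
proof -
  interpret R: ring R by fact
  interpret I: ideal I R by fact
  have "x \<in> (\<Union>h\<in>I. {h \<oplus>\<^bsub>R\<^esub> f})" using assms(3) unfolding a_r_coset_def' .
  then obtain i where i: "i \<in> I" "x = i \<oplus>\<^bsub>R\<^esub> f" by (elim UN_E singletonE)
  then have ic: "i \<in> carrier R" using I.a_subset by blast
  then show xc: "x \<in> carrier R" using i(2) assms(4) by simp
  have "x \<ominus>\<^bsub>R\<^esub> f = i" using i ic assms(4) by (simp add: R.minus_eq R.a_assoc R.r_neg)
  then show "I +>\<^bsub>R\<^esub> x = I +>\<^bsub>R\<^esub> f"
    using R.quotient_eq_iff_same_a_r_cos[OF assms(2) xc assms(4)] i(1) by simp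
qed

lemma coset_carrier: "a \<in> carrier (R Quot I) \<longleftrightarrow> (\<exists>x\<in>carrier R. a = I +>\<^bsub>R\<^esub> x)"
  by (auto simp: FactRing_def A_RCOSETS_def')

lemma ring_extend_sel:
  "carrier (ring.extend Q x) = carrier Q" "mult (ring.extend Q x) = mult Q" "add (ring.extend Q x) = add Q"
  "one (ring.extend Q x) = one Q" "zero (ring.extend Q x) = zero Q"
  by (simp_all add: ring.defs)

lemma pair_ring_sel:
  "carrier (pair_ring S B) = {x. Poly_Mapping.keys x \<subseteq> carrier S \<times> carrier B}" "add (pair_ring S B) = (+)"
  "one (pair_ring S B) = frag_of (\<one>\<^bsub>S\<^esub>, \<one>\<^bsub>B\<^esub>)" "zero (pair_ring S B) = 0"
  by (simp_all add: pair_ring_def)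

lemma a_minus_pair_ring:
  assumes "ring S" "ring B" "x \<in> carrier (pair_ring S B)" "y \<in> carrier (pair_ring S B)"
  shows "x \<ominus>\<^bsub>pair_ring S B\<^esub> y = x - y"
proof -
  interpret P: ring "pair_ring S B" by (rule ring_pair_ring) fact+
  have "\<ominus>\<^bsub>pair_ring S B\<^esub> y = - y"
    using assms by (intro P.add.inv_equality) (auto simp: pair_ring_sel)
  then show ?thesis by (simp add: a_minus_def pair_ring_sel)
qed

section \<open>The presented algebra and its extension of scalars\<close>

context yh_params
begin

interpretation FF: ring FF by (rule ring_free_algebra[OF subring_RR])

definition "Irel = Idl\<^bsub>FF\<^esub> {a - b |a b. (a, b) \<in> yh_rels d m n}"
abbreviation "YY \<equiv> yokonuma_hecke d m n"
definition "\<pi> f = Irel +>\<^bsub>FF\<^esub> f"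

lemma rels_FC: "(a, b) \<in> yh_rels d m n \<Longrightarrow> a \<in> FC \<and> b \<in> FC"
proof -
  have X: "yX \<in> FC" "yXinv \<in> FC" by (auto intro: FC_gen simp: gens_mem)
  have G: "yg i \<in> FC" if "i \<in> {1..<n}" for i using that by (intro FC_gen) (simp add: gens_mem)
  have T: "yt j \<in> FC" if "j \<in> {1..n}" for j using that by (intro FC_gen) (simp add: gens_mem)
  have tr: "transpose i (i + 1) j \<in> {1..n}" if "i \<in> {1..<n}" "j \<in> {1..n}" for i j
    using that by (auto simp: transpose_def)
  have E: "yh_e d i \<in> FC" if "i \<in> {1..<n}" for i
    unfolding yh_e_def by (intro FC_closed(4) FC_scal FC_sum FC_power const_RR T) (use that in auto)
  have r: "qpow 1 - qpow (- 1) \<in> RR" using qpow_RR subring_setD(4)[OF subring_RR] by blast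
  have V: "prod_list (map (\<lambda>k. yX - scal (vvar k)) [1..<m + 1]) \<in> FC"
    using X by (intro FC_prod_list FC_diff FC_scal vvar_RR) auto
  note c = FC_closed(1-4) FC_power X G T E FC_scal[OF r] V tr
  assume "(a, b) \<in> yh_rels d m n"
  then show ?thesis
    unfolding yh_rels_def Un_iff mem_Collect_eq prod.inject insert_iff empty_iff
    by (elim disjE exE conjE; simp only:; intro conjI c; simp)
qed

lemma ideal_Irel: "ideal Irel FF"
  unfolding Irel_def
  by (rule FF.genideal_ideal) (auto simp: carrier_free_algebra dest!: rels_FC intro: FC_diff)

lemma YY_eq: "YY = ring.extend (FF Quot Irel) (module.fields (\<lambda>r U. \<Union>x\<in>U. (Irel +>\<^bsub>FF\<^esub> (r \<odot>\<^bsub>FF\<^esub> x))))"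
  by (simp add: yokonuma_hecke_def presented_algebra_def quot_algebra_def Irel_def RR_def Let_def)

lemma YY_smult: "r \<odot>\<^bsub>YY\<^esub> U = (\<Union>x\<in>U. \<pi> (scal r * x))"
  by (simp add: YY_eq ring.defs module.defs \<pi>_def) (simp add: free_algebra_def)

lemma ring_YY: "ring YY"
  unfolding YY_eq by (rule ring_extend[OF ideal.quotient_is_ring[OF ideal_Irel]])

lemma pi_hom: "\<pi> \<in> Ring.ring_hom FF YY"
  using ring_hom_extend_right[OF ideal.rcos_ring_hom[OF ideal_Irel]] unfolding YY_eq \<pi>_def .

lemma YY_carrier: "U \<in> carrier YY \<longleftrightarrow> (\<exists>f\<in>FC. U = \<pi> f)"
  by (simp add: YY_eq ring_extend_sel coset_carrier carrier_free_algebra \<pi>_def)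

lemma pi_rels: "(a, b) \<in> yh_rels d m n \<Longrightarrow> \<pi> a = \<pi> b"
proof -
  assume ab: "(a, b) \<in> yh_rels d m n"
  have s: "{a - b |a b. (a, b) \<in> yh_rels d m n} \<subseteq> carrier FF"
    by (auto simp: carrier_free_algebra dest!: rels_FC intro: FC_diff)
  have "a - b \<in> Irel" unfolding Irel_def using FF.genideal_self[OF s] ab by blast
  then show ?thesis
    using FF.quotient_eq_iff_same_a_r_cos[OF ideal_Irel, of a b] rels_FC[OF ab]
      a_minus_free_algebra[OF subring_RR, of a "yh_gens n" b]
    by (simp add: carrier_free_algebra \<pi>_def)
qed

lemma pi_mult: "f \<in> FC \<Longrightarrow> g \<in> FC \<Longrightarrow> \<pi> (f * g) = \<pi> f \<otimes>\<^bsub>YY\<^esub> \<pi> g"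
  and pi_add: "f \<in> FC \<Longrightarrow> g \<in> FC \<Longrightarrow> \<pi> (f + g) = \<pi> f \<oplus>\<^bsub>YY\<^esub> \<pi> g"
  and pi_one: "\<pi> 1 = \<one>\<^bsub>YY\<^esub>"
  using ring_hom_mult[OF pi_hom] ring_hom_add[OF pi_hom] ring_hom_one[OF pi_hom]
  by (simp_all add: carrier_free_algebra FF_sel)

lemma pi_smult:
  assumes "r \<in> RR" "f \<in> FC"
  shows "r \<odot>\<^bsub>YY\<^esub> \<pi> f = \<pi> (scal r * f)"
proof -
  have ring: "ring FF" by (rule FF.ring_axioms)
  have f: "f \<in> carrier FF" using assms by (simp add: carrier_free_algebra)
  have "\<pi> (scal r * x) = \<pi> (scal r * f)" if x: "x \<in> \<pi> f" for x
  proof -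
    have "x \<in> FC" "\<pi> x = \<pi> f"
      using coset_eqI[OF ring ideal_Irel x[unfolded \<pi>_def] f] by (simp_all add: carrier_free_algebra \<pi>_def)
    then show ?thesis using assms by (simp add: pi_mult FC_scal)
  qed
  moreover have "f \<in> \<pi> f"
  proof -
    interpret I: ideal Irel FF by (rule ideal_Irel)
    show ?thesis unfolding \<pi>_def by (rule I.a_rcos_self[OF f])
  qed
  ultimately show ?thesis unfolding YY_smult by (metis (no_types, lifting) SUP_eq_const empty_iff)
qed

abbreviation "CC \<equiv> ring_of_type_algebra :: complex ring"
abbreviation "PP \<equiv> pair_ring CC YY"

lemma ring_PP: "ring PP"
  by (rule ring_pair_ring[OF ring_type_algebra ring_YY])

interpretation YY: ring YY by (rule ring_YY)
interpretation PP: ring PP by (rule ring_PP)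

definition "Jrel = Idl\<^bsub>PP\<^esub> (tensor_rels (laurent_ring m) CC \<theta> YY)"
abbreviation "AA \<equiv> specialised_yokonuma_hecke d m n \<theta>"
definition "br s b = Jrel +>\<^bsub>PP\<^esub> frag_of (s, b)"

lemma PP_carrier: "x \<in> carrier PP \<longleftrightarrow> Poly_Mapping.keys x \<subseteq> UNIV \<times> carrier YY"
  by (simp add: pair_ring_sel type_algebra_sel)

lemma frag_of_PP: "b \<in> carrier YY \<Longrightarrow> frag_of (s, b) \<in> carrier PP"
  by (simp add: PP_carrier)

lemma PP_diff: "x \<in> carrier PP \<Longrightarrow> y \<in> carrier PP \<Longrightarrow> x - y \<in> carrier PP"
  using a_minus_pair_ring[OF ring_type_algebra ring_YY, of x y] PP.minus_closed[of x y] by simp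

lemma YY_smult_closed: "r \<in> RR \<Longrightarrow> b \<in> carrier YY \<Longrightarrow> r \<odot>\<^bsub>YY\<^esub> b \<in> carrier YY"
  unfolding YY_carrier by (metis pi_smult FC_scal FC_closed(4))

lemma tensor_rels_PP: "tensor_rels (laurent_ring m) CC \<theta> YY \<subseteq> carrier PP"
  unfolding tensor_rels_def RR_def[symmetric]
  by (auto intro!: PP_diff frag_of_PP YY_smult_closed simp: RR_def[symmetric])

lemma ideal_Jrel: "ideal Jrel PP"
  unfolding Jrel_def by (rule PP.genideal_ideal[OF tensor_rels_PP])

lemma AA_eq: "AA = ring.extend (PP Quot Jrel) (module.fields (\<lambda>s U. br s \<one>\<^bsub>YY\<^esub> \<otimes>\<^bsub>PP Quot Jrel\<^esub> U))"
  by (simp add: specialised_yokonuma_hecke_def base_change_def Jrel_def Let_def br_def)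

lemma ring_AA: "ring AA"
  unfolding AA_eq by (rule ring_extend[OF ideal.quotient_is_ring[OF ideal_Jrel]])

lemma AA_smult: "s \<odot>\<^bsub>AA\<^esub> U = br s \<one>\<^bsub>YY\<^esub> \<otimes>\<^bsub>AA\<^esub> U"
  by (simp add: AA_eq ring.defs module.defs)

interpretation AA: ring AA by (rule ring_AA)

lemma coset_hom: "(+>\<^bsub>PP\<^esub>) Jrel \<in> Ring.ring_hom PP AA"
  using ring_hom_extend_right[OF ideal.rcos_ring_hom[OF ideal_Jrel]] unfolding AA_eq .

lemma coset_PP_eq: "x \<in> carrier PP \<Longrightarrow> y \<in> carrier PP \<Longrightarrow> x - y \<in> Jrel \<Longrightarrow> Jrel +>\<^bsub>PP\<^esub> x = Jrel +>\<^bsub>PP\<^esub> y"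
  using PP.quotient_eq_iff_same_a_r_cos[OF ideal_Jrel, of x y] a_minus_pair_ring[OF ring_type_algebra ring_YY, of x y]
  by simp

lemma tensor_rels_Jrel: "x \<in> tensor_rels (laurent_ring m) CC \<theta> YY \<Longrightarrow> x \<in> Jrel"
  unfolding Jrel_def using PP.genideal_self[OF tensor_rels_PP] by blast

lemma br_closed: "b \<in> carrier YY \<Longrightarrow> br s b \<in> carrier AA"
  unfolding br_def using ring_hom_closed[OF coset_hom frag_of_PP] by blast

lemma br_mult: "b \<in> carrier YY \<Longrightarrow> b' \<in> carrier YY \<Longrightarrow> br s b \<otimes>\<^bsub>AA\<^esub> br s' b' = br (s * s') (b \<otimes>\<^bsub>YY\<^esub> b')"
  unfolding br_def
  by (simp add: ring_hom_mult[OF coset_hom, symmetric] frag_of_PP pmult_of[OF ring_type_algebra ring_YY] type_algebra_sel)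

lemma br_one: "br 1 \<one>\<^bsub>YY\<^esub> = \<one>\<^bsub>AA\<^esub>"
  unfolding br_def using ring_hom_one[OF coset_hom] by (simp add: pair_ring_sel type_algebra_sel)

lemma coset_frag_add:
  "b \<in> carrier YY \<Longrightarrow> b' \<in> carrier YY \<Longrightarrow> Jrel +>\<^bsub>PP\<^esub> (frag_of (s, b) + frag_of (s', b')) = br s b \<oplus>\<^bsub>AA\<^esub> br s' b'"
  unfolding br_def by (simp add: ring_hom_add[OF coset_hom, symmetric] frag_of_PP pair_ring_sel(2))

lemma frag_of_add_PP: "b \<in> carrier YY \<Longrightarrow> b' \<in> carrier YY \<Longrightarrow> frag_of (s, b) + frag_of (s', b') \<in> carrier PP"
  using PP.a_closed[OF frag_of_PP frag_of_PP] by (simp add: pair_ring_sel(2))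

lemma br_add_left: "b \<in> carrier YY \<Longrightarrow> br (s + s') b = br s b \<oplus>\<^bsub>AA\<^esub> br s' b"
proof -
  assume b: "b \<in> carrier YY"
  have "frag_of (s + s', b) - frag_of (s, b) - frag_of (s', b) \<in> tensor_rels (laurent_ring m) CC \<theta> YY"
    unfolding tensor_rels_def type_algebra_sel using b by blast
  then have "Jrel +>\<^bsub>PP\<^esub> frag_of (s + s', b) = Jrel +>\<^bsub>PP\<^esub> (frag_of (s, b) + frag_of (s', b))"
    by (intro coset_PP_eq frag_of_PP frag_of_add_PP b) (auto intro!: tensor_rels_Jrel simp: diff_diff_add)
  then show ?thesis unfolding coset_frag_add[OF b b] by (simp add: br_def)
qed

lemma br_add_right: "b \<in> carrier YY \<Longrightarrow> b' \<in> carrier YY \<Longrightarrow> br s (b \<oplus>\<^bsub>YY\<^esub> b') = br s b \<oplus>\<^bsub>AA\<^esub> br s b'"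
proof -
  assume b: "b \<in> carrier YY" "b' \<in> carrier YY"
  have "frag_of (s, b \<oplus>\<^bsub>YY\<^esub> b') - frag_of (s, b) - frag_of (s, b') \<in> tensor_rels (laurent_ring m) CC \<theta> YY"
    unfolding tensor_rels_def type_algebra_sel using b by blast
  then have "Jrel +>\<^bsub>PP\<^esub> frag_of (s, b \<oplus>\<^bsub>YY\<^esub> b') = Jrel +>\<^bsub>PP\<^esub> (frag_of (s, b) + frag_of (s, b'))"
    by (intro coset_PP_eq frag_of_PP frag_of_add_PP b YY.a_closed) (auto intro!: tensor_rels_Jrel simp: diff_diff_add)
  then show ?thesis unfolding coset_frag_add[OF b] by (simp add: br_def)
qed

lemma br_balance: "r \<in> RR \<Longrightarrow> b \<in> carrier YY \<Longrightarrow> br (s * \<theta> r) b = br s (r \<odot>\<^bsub>YY\<^esub> b)"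
proof -
  assume b: "r \<in> RR" "b \<in> carrier YY"
  have "frag_of (s * \<theta> r, b) - frag_of (s, r \<odot>\<^bsub>YY\<^esub> b) \<in> tensor_rels (laurent_ring m) CC \<theta> YY"
    unfolding tensor_rels_def type_algebra_sel using b unfolding RR_def by blast
  then show ?thesis
    unfolding br_def by (intro coset_PP_eq frag_of_PP b YY_smult_closed tensor_rels_Jrel)
qed

text \<open>Negatives are multiplications by the class of (-1, 1), so a property closed under sums
  and products will need no clause of its own for them.\<close>

lemma AA_induct [consumes 1, case_names br add minus]:
  assumes "U \<in> carrier AA" and br: "\<And>s b. b \<in> carrier YY \<Longrightarrow> P (br s b)"
    and add: "\<And>U V. U \<in> carrier AA \<Longrightarrow> V \<in> carrier AA \<Longrightarrow> P U \<Longrightarrow> P V \<Longrightarrow> P (U \<oplus>\<^bsub>AA\<^esub> V)"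
    and minus: "\<And>U. U \<in> carrier AA \<Longrightarrow> P U \<Longrightarrow> P (br (- 1) \<one>\<^bsub>YY\<^esub> \<otimes>\<^bsub>AA\<^esub> U)"
  shows "P U"
proof -
  obtain x where x: "x \<in> carrier PP" "U = Jrel +>\<^bsub>PP\<^esub> x"
    using assms(1) by (auto simp: AA_eq ring_extend_sel coset_carrier)
  have m1: "br (- 1) \<one>\<^bsub>YY\<^esub> = \<ominus>\<^bsub>AA\<^esub> \<one>\<^bsub>AA\<^esub>"
  proof -
    have "br 0 \<one>\<^bsub>YY\<^esub> \<oplus>\<^bsub>AA\<^esub> br 0 \<one>\<^bsub>YY\<^esub> = br 0 \<one>\<^bsub>YY\<^esub>"
      using br_add_left[of "\<one>\<^bsub>YY\<^esub>" 0 0] by simp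
    then have "br 0 \<one>\<^bsub>YY\<^esub> = \<zero>\<^bsub>AA\<^esub>" using br_closed[of "\<one>\<^bsub>YY\<^esub>" 0] by (simp add: AA.add.l_cancel_one)
    then have "br (- 1) \<one>\<^bsub>YY\<^esub> \<oplus>\<^bsub>AA\<^esub> \<one>\<^bsub>AA\<^esub> = \<zero>\<^bsub>AA\<^esub>"
      using br_add_left[of "\<one>\<^bsub>YY\<^esub>" "-1" 1] by (simp add: br_one)
    then show ?thesis using br_closed[of "\<one>\<^bsub>YY\<^esub>" "-1"] by (intro AA.minus_equality[symmetric]) simp_all
  qed
  have c: "Jrel +>\<^bsub>PP\<^esub> x \<in> carrier AA" if "x \<in> carrier PP" for x using ring_hom_closed[OF coset_hom that] .
  have sub: "Jrel +>\<^bsub>PP\<^esub> (a - b) = (Jrel +>\<^bsub>PP\<^esub> a) \<oplus>\<^bsub>AA\<^esub> br (- 1) \<one>\<^bsub>YY\<^esub> \<otimes>\<^bsub>AA\<^esub> (Jrel +>\<^bsub>PP\<^esub> b)"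
    if "a \<in> carrier PP" "b \<in> carrier PP" for a b
  proof -
    have "Jrel +>\<^bsub>PP\<^esub> a = (Jrel +>\<^bsub>PP\<^esub> (a - b)) \<oplus>\<^bsub>AA\<^esub> (Jrel +>\<^bsub>PP\<^esub> b)"
      using ring_hom_add[OF coset_hom PP_diff[OF that] that(2)] by (simp add: pair_ring_sel(2))
    then show ?thesis using c[OF PP_diff[OF that]] c[OF that(2)]
      by (simp add: m1 AA.l_minus AA.a_assoc AA.r_neg)
  qed
  have "Poly_Mapping.keys x \<subseteq> UNIV \<times> carrier YY" using x(1) by (simp add: PP_carrier)
  then have "x \<in> carrier PP \<and> P (Jrel +>\<^bsub>PP\<^esub> x)"
  proof (induction x rule: frag_induction)
    case zero
    let ?o = "frag_of (1, \<one>\<^bsub>YY\<^esub>)"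
    have o: "?o \<in> carrier PP" by (simp add: frag_of_PP)
    have P: "P (Jrel +>\<^bsub>PP\<^esub> ?o)" using br[of "\<one>\<^bsub>YY\<^esub>" 1] by (simp add: br_def)
    have "P (Jrel +>\<^bsub>PP\<^esub> (?o - ?o))" unfolding sub[OF o o] by (intro add minus c o AA.m_closed br_closed P) simp_all
    then show ?case by (simp add: PP_carrier)
  next
    case (one p)
    then show ?case using br[of "snd p" "fst p"] by (cases p) (auto simp: br_def PP_carrier)
  next
    case (diff a b)
    then have k: "a \<in> carrier PP" "b \<in> carrier PP" and P: "P (Jrel +>\<^bsub>PP\<^esub> a)" "P (Jrel +>\<^bsub>PP\<^esub> b)" by auto
    have "P (Jrel +>\<^bsub>PP\<^esub> (a - b))" unfolding sub[OF k] by (intro add minus c k AA.m_closed br_closed P) simp_all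
    then show ?case using PP_diff[OF k] by simp
  qed
  then have "P (Jrel +>\<^bsub>PP\<^esub> x)" ..
  then show ?thesis unfolding x(2) .
qed

end

section \<open>Generators and universal property of the specialised algebra\<close>

context yh_params
begin

interpretation YY: ring YY by (rule ring_YY)
interpretation PP: ring PP by (rule ring_PP)
interpretation AA: ring AA by (rule ring_AA)

definition "\<kappa> f = br 1 (\<pi> f)"

lemma pi_closed: "f \<in> FC \<Longrightarrow> \<pi> f \<in> carrier YY"
  by (auto simp: YY_carrier)

lemma kappa_add: "f \<in> FC \<Longrightarrow> g \<in> FC \<Longrightarrow> \<kappa> (f + g) = \<kappa> f \<oplus>\<^bsub>AA\<^esub> \<kappa> g"
  by (simp add: \<kappa>_def pi_add br_add_right pi_closed)

lemma kappa_mult: "f \<in> FC \<Longrightarrow> g \<in> FC \<Longrightarrow> \<kappa> (f * g) = \<kappa> f \<otimes>\<^bsub>AA\<^esub> \<kappa> g"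
  by (simp add: \<kappa>_def pi_mult br_mult pi_closed)

lemma kappa_closed: "f \<in> FC \<Longrightarrow> \<kappa> f \<in> carrier AA"
  by (simp add: \<kappa>_def br_closed pi_closed)

lemma kappa_scal: "r \<in> RR \<Longrightarrow> \<kappa> (scal r) = br (\<theta> r) \<one>\<^bsub>YY\<^esub>"
  using br_balance[of r "\<one>\<^bsub>YY\<^esub>" 1] pi_smult[of r 1] FC_closed(2)[of "yh_gens n"]
  by (simp add: \<kappa>_def pi_one[symmetric] pi_closed)

lemma kappa_rels: "(a, b) \<in> yh_rels d m n \<Longrightarrow> \<kappa> a = \<kappa> b"
  by (simp add: \<kappa>_def pi_rels)

lemma br_pi: "f \<in> FC \<Longrightarrow> br s (\<pi> f) = br s \<one>\<^bsub>YY\<^esub> \<otimes>\<^bsub>AA\<^esub> \<kappa> f"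
  by (simp add: \<kappa>_def br_mult pi_closed)

lemma br_central: "U \<in> carrier AA \<Longrightarrow> br s \<one>\<^bsub>YY\<^esub> \<otimes>\<^bsub>AA\<^esub> U = U \<otimes>\<^bsub>AA\<^esub> br s \<one>\<^bsub>YY\<^esub>"
proof (induction U rule: AA_induct)
  case (add U V)
  then show ?case using br_closed[of "\<one>\<^bsub>YY\<^esub>" s] by (simp add: AA.l_distr AA.r_distr)
next
  case (minus U)
  have c: "br s \<one>\<^bsub>YY\<^esub> \<in> carrier AA" "br (- 1) \<one>\<^bsub>YY\<^esub> \<in> carrier AA" by (simp_all add: br_closed)
  have "br s \<one>\<^bsub>YY\<^esub> \<otimes>\<^bsub>AA\<^esub> (br (- 1) \<one>\<^bsub>YY\<^esub> \<otimes>\<^bsub>AA\<^esub> U) = br (- 1) \<one>\<^bsub>YY\<^esub> \<otimes>\<^bsub>AA\<^esub> (br s \<one>\<^bsub>YY\<^esub> \<otimes>\<^bsub>AA\<^esub> U)"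
    using c minus(1) by (simp add: AA.m_assoc[symmetric] br_mult)
  then show ?case using c minus by (simp add: AA.m_assoc)
qed (simp add: br_mult mult.commute)

lemma AA_generated [consumes 1, case_names const add mult gen]:
  assumes U: "U \<in> carrier AA" and const: "\<And>s. P (br s \<one>\<^bsub>YY\<^esub>)"
    and add: "\<And>U V. U \<in> carrier AA \<Longrightarrow> V \<in> carrier AA \<Longrightarrow> P U \<Longrightarrow> P V \<Longrightarrow> P (U \<oplus>\<^bsub>AA\<^esub> V)"
    and mult: "\<And>U V. U \<in> carrier AA \<Longrightarrow> V \<in> carrier AA \<Longrightarrow> P U \<Longrightarrow> P V \<Longrightarrow> P (U \<otimes>\<^bsub>AA\<^esub> V)"
    and gen: "\<And>x. x \<in> yh_gens n \<Longrightarrow> P (\<kappa> (gen x))"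
  shows "P U"
proof -
  have single: "P (\<kappa> (Poly_Mapping.single (Word xs) r))" if "r \<in> RR" "xs \<in> lists (yh_gens n)" for r xs
    using that(2)
  proof (induction xs)
    case Nil
    have "\<kappa> (Poly_Mapping.single (Word []) r) = br (\<theta> r) \<one>\<^bsub>YY\<^esub>"
      using kappa_scal[OF that(1)] by (simp add: scal_def zero_word_def)
    then show ?case using const by simp
  next
    case (Cons x xs)
    have m: "gen x \<in> FC" "Poly_Mapping.single (Word xs) r \<in> FC"
      using Cons that(1) by (auto intro: FC_gen FC_closed(6))
    have "Poly_Mapping.single (Word (x # xs)) r = gen x * Poly_Mapping.single (Word xs) r"
      by (simp add: gen_def mult_single plus_word_def)
    then show ?case using mult[OF kappa_closed kappa_closed gen Cons.IH] Cons.hyps m by (simp add: kappa_mult)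
  qed
  have word: "P (\<kappa> f)" if "f \<in> FC" for f
    using subring_RR that
  proof (induction f rule: free_carrier_induct[consumes 2, case_names zero add single])
    case zero
    have "\<kappa> 0 = br (\<theta> 0) \<one>\<^bsub>YY\<^esub>" using kappa_scal[of 0] subring_setD(2)[OF subring_RR] by (simp add: scal_def)
    then show ?case using const by simp
  next
    case (add f g)
    then show ?case by (simp add: kappa_add kappa_closed assms(3))
  next
    case (single r w)
    then show ?case using \<open>\<And>xs r. r \<in> RR \<Longrightarrow> xs \<in> lists (yh_gens n) \<Longrightarrow> P (\<kappa> (Poly_Mapping.single (Word xs) r))\<close>[of r "letters w"] by simp
  qed
  from U show ?thesis
  proof (induction U rule: AA_induct)
    case (br s b)
    then obtain f where f: "f \<in> FC" "b = \<pi> f" by (auto simp: YY_carrier)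
    show ?case unfolding f(2) br_pi[OF f(1)] by (intro mult const word br_closed kappa_closed f(1)) simp
  next
    case (add U V)
    then show ?case by (intro assms(3))
  next
    case (minus U)
    then show ?case by (intro mult const br_closed) simp_all
  qed
qed

lemma universal_property:
  fixes \<gamma> :: "yh_gen \<Rightarrow> 'b::complex_algebra"
  assumes rel: "yh_relations d m n q v \<gamma>"
  shows "\<exists>H\<in>Ring.ring_hom AA (ring_of_type_algebra :: 'b ring).
    (\<forall>x\<in>yh_gens n. H (\<kappa> (gen x)) = \<gamma> x) \<and> (\<forall>s. H (br s \<one>\<^bsub>YY\<^esub>) = s \<star> 1)"
proof -
  \<comment> \<open>First stage: the map on the free algebra, semilinear along \<theta>; it kills
    the differences of related words because \<open>rel\<close> holds after specialisation.\<close>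
  define \<Psi> where "\<Psi> w r = \<theta> r \<star> prod_list (map \<gamma> (letters w))" for w :: "yh_gen word" and r
  interpret \<Psi>: monoid_algebra_hom RR \<Psi>
    by unfold_locales (simp_all add: subring_RR \<Psi>_def theta_add theta_mult cscale_add_left letters_plus mult.commute)
  define \<Phi> where "\<Phi> = lin_ext \<Psi>"
  have co: "f \<in> FC \<Longrightarrow> f \<in> coeffs_in RR" for f by (simp add: free_carrier_def)
  have \<Phi>_gen: "\<Phi> (gen x) = \<gamma> x" for x
    unfolding \<Phi>_def gen_def by (subst \<Psi>.lin_ext_single) (simp_all add: \<Psi>_def subring_setD(1)[OF subring_RR] theta_one)
  have \<Phi>_scal: "\<Phi> (scal r) = \<theta> r \<star> 1" if "r \<in> RR" for r
    unfolding \<Phi>_def scal_def by (subst \<Psi>.lin_ext_single) (simp_all add: \<Psi>_def that letters_zero)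
  interpret \<Phi>: yh_hom d m n \<theta> \<Phi>
    by unfold_locales (simp_all add: \<Phi>_def \<Psi>.lin_ext_add \<Psi>.lin_ext_mult co \<Phi>_scal[unfolded \<Phi>_def])
  have rels: "\<forall>(a, b)\<in>yh_rels d m n. \<Phi> a = \<Phi> b"
    unfolding \<Phi>.rels_iff \<Phi>_gen by (rule rel)
  have \<Phi>_hom: "\<Phi> \<in> Ring.ring_hom FF (ring_of_type_algebra :: 'b ring)"
    by (rule ring_hom_memI)
      (simp_all add: carrier_free_algebra FF_sel type_algebra_sel \<Phi>.K_mult \<Phi>.K_add \<Phi>.K_one)
  have S: "{a - b |a b. (a, b) \<in> yh_rels d m n} \<subseteq> carrier FF"
    by (auto simp: carrier_free_algebra dest!: rels_FC intro: FC_diff)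
  have "\<Phi> s = 0" if "s \<in> {a - b |a b. (a, b) \<in> yh_rels d m n}" for s
  proof -
    obtain a b where ab: "s = a - b" "(a, b) \<in> yh_rels d m n" using \<open>s \<in> _\<close> by blast
    then show ?thesis using rels rels_FC[OF ab(2)] by (auto simp: \<Phi>.K_diff)
  qed
  from ring_hom_factor[OF ring_free_algebra[OF subring_RR] S \<Phi>_hom this]
  obtain H1 where H1: "H1 \<in> Ring.ring_hom (FF Quot Irel) (ring_of_type_algebra :: 'b ring)"
    "\<And>f. f \<in> FC \<Longrightarrow> H1 (\<pi> f) = \<Phi> f"
    by (auto simp: Irel_def \<pi>_def carrier_free_algebra)
  have H1Y: "H1 \<in> Ring.ring_hom YY (ring_of_type_algebra :: 'b ring)"
    unfolding YY_eq by (rule ring_hom_extend[OF H1(1)])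
  have H1_mult: "H1 (a \<otimes>\<^bsub>YY\<^esub> b) = H1 a * H1 b" and H1_add: "H1 (a \<oplus>\<^bsub>YY\<^esub> b) = H1 a + H1 b"
    if "a \<in> carrier YY" "b \<in> carrier YY" for a b
    using ring_hom_mult[OF H1Y that] ring_hom_add[OF H1Y that] by (simp_all add: type_algebra_sel)
  have H1_one: "H1 \<one>\<^bsub>YY\<^esub> = 1" using ring_hom_one[OF H1Y] by (simp add: type_algebra_sel)
  have H1_smult: "H1 (r \<odot>\<^bsub>YY\<^esub> a) = \<theta> r \<star> H1 a" if r: "r \<in> RR" and a: "a \<in> carrier YY" for r a
  proof -
    obtain f where f: "f \<in> FC" "a = \<pi> f" using a by (auto simp: YY_carrier)
    then show ?thesis using r by (simp add: pi_smult H1(2) FC_closed(4) FC_scal \<Phi>.K_mult \<Phi>_scal)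
  qed
  \<comment> \<open>Second stage: the pair (s, b) goes to s times the image of b. The balancing
    relations are respected because \<open>H1\<close> is semilinear along \<theta>.\<close>
  define \<Psi>2 where "\<Psi>2 p i = of_int i * (fst p \<star> H1 (snd p))"
    for p :: "complex \<times> (yh_gen word \<Rightarrow>\<^sub>0 laurent) set" and i :: int
  interpret \<Psi>2: coeff_action UNIV \<Psi>2
    by unfold_locales (simp_all add: subring_set_def \<Psi>2_def distrib_right cscale_add_right)
  define \<Phi>2 where "\<Phi>2 = lin_ext \<Psi>2"
  have \<Phi>2_of: "\<Phi>2 (frag_of (s, b)) = s \<star> H1 b" for s b
    using \<Psi>2.lin_ext_single[of 1 "(s, b)"] by (simp add: \<Phi>2_def \<Psi>2_def)
  have \<Phi>2_add: "\<Phi>2 (x + y) = \<Phi>2 x + \<Phi>2 y" for x y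
    using \<Psi>2.lin_ext_add[of x y] by (simp add: \<Phi>2_def coeffs_in_def)
  have \<Phi>2_diff: "\<Phi>2 (x - y) = \<Phi>2 x - \<Phi>2 y" for x y
    using \<Phi>2_add[of "x - y" y] by (simp add: eq_diff_eq)
  have \<Phi>2_0: "\<Phi>2 0 = 0" by (simp add: \<Phi>2_def \<Psi>2.lin_ext_0)
  note pm = pmult_of[OF ring_type_algebra ring_YY] pmult_diff_right[OF ring_type_algebra ring_YY]
    pmult_diff_left[OF ring_type_algebra ring_YY] pmult_zero[OF ring_type_algebra ring_YY]
  have \<Phi>2_mult: "\<Phi>2 (x \<otimes>\<^bsub>PP\<^esub> y) = \<Phi>2 x * \<Phi>2 y" if "x \<in> carrier PP" "y \<in> carrier PP" for x y
    using that(1) unfolding PP_carrier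
  proof (induction x rule: frag_induction)
    case (one p)
    note p = one
    from that(2) show ?case unfolding PP_carrier
    proof (induction y rule: frag_induction)
      case (one p')
      then show ?case using p by (cases p; cases p') (auto simp: pm \<Phi>2_of H1_mult type_algebra_sel mult.commute)
    qed (simp_all add: pm \<Phi>2_diff \<Phi>2_0 right_diff_distrib)
  qed (simp_all add: pm \<Phi>2_diff \<Phi>2_0 left_diff_distrib)
  have \<Phi>2_hom: "\<Phi>2 \<in> Ring.ring_hom PP (ring_of_type_algebra :: 'b ring)"
    by (rule ring_hom_memI) (simp_all add: type_algebra_sel \<Phi>2_mult pair_ring_sel(2,3) \<Phi>2_add \<Phi>2_of H1_one)
  have "\<Phi>2 s = 0" if "s \<in> tensor_rels (laurent_ring m) CC \<theta> YY" for s
    using that unfolding tensor_rels_def RR_def[symmetric] type_algebra_sel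
    by (auto simp: \<Phi>2_diff \<Phi>2_of H1_add H1_smult cscale_distribs)
  from ring_hom_factor[OF ring_PP tensor_rels_PP \<Phi>2_hom this]
  obtain H where H: "H \<in> Ring.ring_hom (PP Quot Jrel) (ring_of_type_algebra :: 'b ring)"
    "\<And>x. x \<in> carrier PP \<Longrightarrow> H (Jrel +>\<^bsub>PP\<^esub> x) = \<Phi>2 x"
    by (auto simp: Jrel_def)
  have HA: "H \<in> Ring.ring_hom AA (ring_of_type_algebra :: 'b ring)"
    unfolding AA_eq by (rule ring_hom_extend[OF H(1)])
  have H_br: "H (br s b) = s \<star> H1 b" if "b \<in> carrier YY" for s b
    using H(2)[OF frag_of_PP[OF that]] by (simp add: br_def \<Phi>2_of)
  show ?thesis
  proof (intro bexI[OF _ HA] conjI ballI allI)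
    show "H (br s \<one>\<^bsub>YY\<^esub>) = s \<star> 1" for s by (simp add: H_br H1_one)
    show "H (\<kappa> (gen x)) = \<gamma> x" if "x \<in> yh_gens n" for x
      using FC_gen[OF that] by (simp add: \<kappa>_def H_br pi_closed H1(2) \<Phi>_gen)
  qed
qed

lemma v_nz:
  assumes "1 \<le> k" "k \<le> m"
  shows "v k \<noteq> 0"
proof -
  have "Poly_Mapping.single (Poly_Mapping.single k (- 1)) 1 \<in> RR" using assms by (auto simp: RR_iff)
  from theta_mult[OF vvar_RR[OF assms] this]
  have "v k * \<theta> (Poly_Mapping.single (Poly_Mapping.single k (- 1)) 1) = 1"
    by (simp add: v_def vvar_def mult_single single_add[symmetric] theta_one)
  then show ?thesis by auto
qed

text \<open>With t_j = 1 every e_i is 1, so g_i = q solves the quadratic relation, and X = v_k is a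
  root of its polynomial. These characters show that the algebra is non-zero and are what each
  obstruction is tested against.\<close>

lemma trivial_character:
  assumes "1 \<le> k" "k \<le> m"
  shows "yh_relations d m n q v (case_yh_gen (\<lambda>_. 1) (\<lambda>_. q) (v k) (inverse (v k)) :: yh_gen \<Rightarrow> complex)"
proof -
  have "yh_idem d (\<lambda>_. 1 :: complex) i = 1" for i
    using d_pos by (simp add: yh_idem_def cscale_complex_def)
  moreover have "(\<Prod>l\<leftarrow>[1..<m + 1]. v k - v l \<star> 1) = 0"
  proof (rule prod_list_zero_iff[THEN iffD2])
    have "k \<in> set [1..<m + 1]" using assms by auto
    then show "0 \<in> set (map (\<lambda>l. v k - v l \<star> 1) [1..<m + 1])"
      unfolding set_map by (rule image_eqI[rotated]) (simp add: cscale_complex_def)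
  qed
  ultimately show ?thesis
    using q_nz v_nz[OF assms] unfolding yh_relations_def
    by (simp add: cscale_complex_def power2_eq_square algebra_simps)
qed

end

section \<open>The specialised algebra as a type\<close>

definition main_claim :: "nat \<times> nat \<times> nat \<times> (laurent \<Rightarrow> complex) \<Rightarrow> bool" where
  "main_claim = (\<lambda>(d, m, n, \<theta>).
     (semisimple_ring (specialised_yokonuma_hecke d m n \<theta>) \<longleftrightarrow> \<theta> (ss_poly m n) \<noteq> 0) \<and>
     (split_semisimple (specialised_yokonuma_hecke d m n \<theta>) \<longleftrightarrow> \<theta> (ss_poly m n) \<noteq> 0))"

definition admissible :: "nat \<times> nat \<times> nat \<times> (laurent \<Rightarrow> complex) \<Rightarrow> bool" where
  "admissible = (\<lambda>(d, m, n, \<theta>). yh_params d m n \<theta>)"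

text \<open>Summing the coefficients is evaluation at the point where all variables are 1. Some
  admissible tuple is needed for the choice below to be meaningful.\<close>

lemma admissible_exists: "\<exists>p. admissible p"
proof -
  interpret monoid_algebra_hom UNIV "\<lambda>(k :: nat \<Rightarrow>\<^sub>0 int) (r :: complex). r"
    by unfold_locales (simp_all add: subring_set_def)
  have c: "f \<in> coeffs_in UNIV" for f :: laurent by (simp add: coeffs_in_def)
  have "yh_params 1 1 1 (lin_ext (\<lambda>k r. r))"
  proof
    show "lin_ext (\<lambda>k r. r) \<in> Ring.ring_hom (laurent_ring 1) (ring_of_type_algebra :: complex ring)"
      by (rule ring_hom_memI)
        (simp_all add: laurent_ring_def ring_of_type_algebra_def lin_ext_add lin_ext_mult c lin_ext_single flip: single_one)
    show "lin_ext (\<lambda>k r. r) (laurent_const c) = c" for c by (simp add: laurent_const_def lin_ext_single)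
  qed simp_all
  then have "admissible (1, 1, 1, lin_ext (\<lambda>k r. r))" by (simp add: admissible_def)
  then show ?thesis by blast
qed

text \<open>
  The theory of rings on type classes needs the algebra to be a type, which cannot depend on
  the parameters. As the statement is proved for all parameters at once, it suffices to consider
  parameters that violate it as soon as some parameters do.
\<close>

definition yh_choice :: "nat \<times> nat \<times> nat \<times> (laurent \<Rightarrow> complex)" where
  "yh_choice = (SOME p. admissible p \<and> ((\<exists>p'. admissible p' \<and> \<not> main_claim p') \<longrightarrow> \<not> main_claim p))"

lemma yh_choice: "admissible yh_choice" "main_claim yh_choice \<Longrightarrow> admissible p \<Longrightarrow> main_claim p"
proof -
  have "\<exists>p. admissible p \<and> ((\<exists>p'. admissible p' \<and> \<not> main_claim p') \<longrightarrow> \<not> main_claim p)"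
    using admissible_exists by blast
  from someI_ex[OF this] show "admissible yh_choice" "main_claim yh_choice \<Longrightarrow> admissible p \<Longrightarrow> main_claim p"
    unfolding yh_choice_def[symmetric] by blast+
qed

definition "d0 = fst yh_choice"
definition "m0 = fst (snd yh_choice)"
definition "n0 = fst (snd (snd yh_choice))"
definition "\<theta>0 = snd (snd (snd yh_choice))"

lemma yh_choice_eq: "yh_choice = (d0, m0, n0, \<theta>0)"
  by (simp add: d0_def m0_def n0_def \<theta>0_def)

interpretation Y0: yh_params d0 m0 n0 \<theta>0
  using yh_choice(1) unfolding yh_choice_eq admissible_def by simp

interpretation A0: ring Y0.AA by (rule Y0.ring_AA)
interpretation B0: ring Y0.YY by (rule Y0.ring_YY)

typedef yh_alg = "carrier Y0.AA"
  using A0.one_closed by blast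

lemma br_one_closed: "Y0.br s \<one>\<^bsub>Y0.YY\<^esub> \<in> carrier Y0.AA"
  by (simp add: Y0.br_closed)

text \<open>Required for the type class of rings with 0 different from 1; a character exists because
  m is positive.\<close>

lemma one_neq_zero_AA: "\<one>\<^bsub>Y0.AA\<^esub> \<noteq> \<zero>\<^bsub>Y0.AA\<^esub>"
proof -
  have "1 \<le> (1 :: nat)" "1 \<le> m0" using Y0.m_pos by auto
  from Y0.universal_property[OF Y0.trivial_character[OF this]]
  obtain H where H: "H \<in> Ring.ring_hom Y0.AA (ring_of_type_algebra :: complex ring)" by blast
  have "H \<zero>\<^bsub>Y0.AA\<^esub> = H \<zero>\<^bsub>Y0.AA\<^esub> + H \<zero>\<^bsub>Y0.AA\<^esub>"
    using ring_hom_add[OF H A0.zero_closed A0.zero_closed] by (simp add: type_algebra_sel)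
  then show ?thesis using ring_hom_one[OF H] by (auto simp: type_algebra_sel)
qed

instantiation yh_alg :: complex_algebra
begin

definition "0 = Abs_yh_alg \<zero>\<^bsub>Y0.AA\<^esub>"
definition "1 = Abs_yh_alg \<one>\<^bsub>Y0.AA\<^esub>"
definition "x + y = Abs_yh_alg (Rep_yh_alg x \<oplus>\<^bsub>Y0.AA\<^esub> Rep_yh_alg y)"
definition "x * y = Abs_yh_alg (Rep_yh_alg x \<otimes>\<^bsub>Y0.AA\<^esub> Rep_yh_alg y)"
definition "- x = Abs_yh_alg (\<ominus>\<^bsub>Y0.AA\<^esub> Rep_yh_alg x)"
definition "x - y = Abs_yh_alg (Rep_yh_alg x \<ominus>\<^bsub>Y0.AA\<^esub> Rep_yh_alg y)"
definition "c \<star> x = Abs_yh_alg (Y0.br c \<one>\<^bsub>Y0.YY\<^esub> \<otimes>\<^bsub>Y0.AA\<^esub> Rep_yh_alg x)"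

lemma Rep_simps:
  "Rep_yh_alg 0 = \<zero>\<^bsub>Y0.AA\<^esub>" "Rep_yh_alg 1 = \<one>\<^bsub>Y0.AA\<^esub>"
  "Rep_yh_alg (x + y) = Rep_yh_alg x \<oplus>\<^bsub>Y0.AA\<^esub> Rep_yh_alg y"
  "Rep_yh_alg (x * y) = Rep_yh_alg x \<otimes>\<^bsub>Y0.AA\<^esub> Rep_yh_alg y"
  "Rep_yh_alg (- x) = \<ominus>\<^bsub>Y0.AA\<^esub> Rep_yh_alg x"
  "Rep_yh_alg (x - y) = Rep_yh_alg x \<ominus>\<^bsub>Y0.AA\<^esub> Rep_yh_alg y"
  "Rep_yh_alg (c \<star> x) = Y0.br c \<one>\<^bsub>Y0.YY\<^esub> \<otimes>\<^bsub>Y0.AA\<^esub> Rep_yh_alg x"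
  unfolding zero_yh_alg_def one_yh_alg_def plus_yh_alg_def times_yh_alg_def uminus_yh_alg_def minus_yh_alg_def cscale_yh_alg_def
  using Rep_yh_alg br_one_closed by (simp_all add: Abs_yh_alg_inverse)

instance
proof
  fix x y z :: yh_alg and c c' :: complex
  note R = Rep_yh_alg[of x] Rep_yh_alg[of y] Rep_yh_alg[of z] br_one_closed
  note S = Rep_yh_alg_inject[symmetric] Rep_simps
  show "x * y * z = x * (y * z)" using R by (simp add: S A0.m_assoc)
  show "1 * x = x" "x * 1 = x" using R by (simp_all add: S)
  show "x + y + z = x + (y + z)" using R by (simp add: S A0.a_assoc)
  show "x + y = y + x" using R by (simp add: S A0.a_comm)
  show "0 + x = x" using R by (simp add: S)
  show "- x + x = 0" using R by (simp add: S A0.l_neg)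
  show "x - y = x + - y" using R by (simp add: S A0.minus_eq)
  show "(x + y) * z = x * z + y * z" using R by (simp add: S A0.l_distr)
  show "x * (y + z) = x * y + x * z" using R by (simp add: S A0.r_distr)
  show "(0 :: yh_alg) \<noteq> 1" using one_neq_zero_AA by (simp add: S)
  show "c \<star> (x + y) = c \<star> x + c \<star> y" using R by (simp add: S A0.r_distr)
  show "(c + c') \<star> x = c \<star> x + c' \<star> x" using R by (simp add: S Y0.br_add_left A0.l_distr)
  show "c \<star> c' \<star> x = (c * c') \<star> x" using R by (simp add: S A0.m_assoc[symmetric] Y0.br_mult)
  show "1 \<star> x = x" using R by (simp add: S Y0.br_one)
  show "(c \<star> x) * y = c \<star> (x * y)" using R by (simp add: S A0.m_assoc)
  show "x * (c \<star> y) = c \<star> (x * y)"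
    using R by (simp add: S A0.m_assoc[symmetric]) (simp add: Y0.br_central)
qed

end

interpretation model: algebra_model Y0.AA Rep_yh_alg
proof (rule algebra_model.intro)
  show "ring Y0.AA" by (rule Y0.ring_AA)
  show "bij_betw Rep_yh_alg UNIV (carrier Y0.AA)"
    by (rule bij_betwI'[OF _ Rep_yh_alg]) (auto simp: Rep_yh_alg_inject elim: Rep_yh_alg_cases)
qed (simp_all add: Rep_simps Y0.AA_smult)

definition K0 :: "(yh_gen word \<Rightarrow>\<^sub>0 laurent) \<Rightarrow> yh_alg" where
  "K0 f = Abs_yh_alg (Y0.\<kappa> f)"

lemma Rep_K0: "f \<in> Y0.FC \<Longrightarrow> Rep_yh_alg (K0 f) = Y0.\<kappa> f"
  by (simp add: K0_def Abs_yh_alg_inverse Y0.kappa_closed)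

interpretation K0: yh_hom d0 m0 n0 \<theta>0 K0
proof
  fix f g assume fg: "f \<in> Y0.FC" "g \<in> Y0.FC"
  show "K0 (f + g) = K0 f + K0 g" "K0 (f * g) = K0 f * K0 g"
    using fg by (simp_all add: Rep_yh_alg_inject[symmetric] Rep_simps Rep_K0 Y0.FC_closed Y0.kappa_add Y0.kappa_mult)
next
  fix r assume "r \<in> Y0.RR"
  then show "K0 (scal r) = \<theta>0 r \<star> 1"
    using br_one_closed by (simp add: Rep_yh_alg_inject[symmetric] Rep_simps Rep_K0 Y0.FC_scal Y0.kappa_scal)
qed

definition yh_elt :: "yh_gen \<Rightarrow> yh_alg" where
  "yh_elt x = K0 (gen x)"

lemma yh_elt_relations: "yh_relations d0 m0 n0 Y0.q Y0.v yh_elt"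
proof -
  have "\<forall>(a, b)\<in>yh_rels d0 m0 n0. K0 a = K0 b"
    by (auto simp: K0_def dest: Y0.kappa_rels)
  then show ?thesis unfolding K0.rels_iff yh_elt_def .
qed

lemma yh_alg_induct [case_names const add mult gen]:
  fixes a :: yh_alg
  assumes const: "\<And>c. P (c \<star> 1)" and add: "\<And>x y. P x \<Longrightarrow> P y \<Longrightarrow> P (x + y)"
    and mult: "\<And>x y. P x \<Longrightarrow> P y \<Longrightarrow> P (x * y)" and gen: "\<And>x. x \<in> yh_gens n0 \<Longrightarrow> P (yh_elt x)"
  shows "P a"
proof -
  have "P (Abs_yh_alg U)" if "U \<in> carrier Y0.AA" for U
    using that
  proof (induction U rule: Y0.AA_generated)
    case (const s)
    have "Abs_yh_alg (Y0.br s \<one>\<^bsub>Y0.YY\<^esub>) = s \<star> 1" using br_one_closed by (simp add: cscale_yh_alg_def Rep_simps)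
    then show ?case using assms(1) by simp
  next
    case (add U V)
    then have "Abs_yh_alg (U \<oplus>\<^bsub>Y0.AA\<^esub> V) = Abs_yh_alg U + Abs_yh_alg V" by (simp add: plus_yh_alg_def Abs_yh_alg_inverse)
    then show ?case using assms(2) add by simp
  next
    case (mult U V)
    then have "Abs_yh_alg (U \<otimes>\<^bsub>Y0.AA\<^esub> V) = Abs_yh_alg U * Abs_yh_alg V" by (simp add: times_yh_alg_def Abs_yh_alg_inverse)
    then show ?case using assms(3) mult by simp
  next
    case (gen x)
    then show ?case using assms(4) gen by (simp add: yh_elt_def K0_def)
  qed
  from this[OF Rep_yh_alg] show ?thesis by (simp add: Rep_yh_alg_inverse)
qed

locale alg_hom =
  fixes H :: "'a::complex_algebra \<Rightarrow> 'b::complex_algebra"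
  assumes H_add: "H (x + y) = H x + H y" and H_mult: "H (x * y) = H x * H y"
    and H_one: "H 1 = 1" and H_scale: "H (c \<star> x) = c \<star> H x"
begin

lemma H_zero: "H 0 = 0"
  using H_add[of 0 0] by simp

lemma H_diff: "H (x - y) = H x - H y"
  using H_add[of "x - y" y] by (simp add: eq_diff_eq)

lemma H_sum: "H (\<Sum>i\<in>I. f i) = (\<Sum>i\<in>I. H (f i))"
  by (induction I rule: infinite_finite_induct) (auto simp: H_add H_zero)

end

lemma yh_alg_hom:
  fixes \<gamma> :: "yh_gen \<Rightarrow> 'b::complex_algebra"
  assumes "yh_relations d0 m0 n0 Y0.q Y0.v \<gamma>"
  shows "\<exists>H :: yh_alg \<Rightarrow> 'b. alg_hom H \<and> (\<forall>x\<in>yh_gens n0. H (yh_elt x) = \<gamma> x)"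
proof -
  obtain H where H: "H \<in> Ring.ring_hom Y0.AA (ring_of_type_algebra :: 'b ring)"
    and g: "\<forall>x\<in>yh_gens n0. H (Y0.\<kappa> (gen x)) = \<gamma> x" and s: "\<forall>s. H (Y0.br s \<one>\<^bsub>Y0.YY\<^esub>) = s \<star> 1"
    using Y0.universal_property[OF assms] by blast
  have "alg_hom (\<lambda>a. H (Rep_yh_alg a))"
  proof
    fix x y :: yh_alg and c
    note R = Rep_yh_alg[of x] Rep_yh_alg[of y] br_one_closed
    show "H (Rep_yh_alg (x + y)) = H (Rep_yh_alg x) + H (Rep_yh_alg y)"
      using ring_hom_add[OF H R(1,2)] by (simp add: Rep_simps type_algebra_sel)
    show "H (Rep_yh_alg (x * y)) = H (Rep_yh_alg x) * H (Rep_yh_alg y)"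
      using ring_hom_mult[OF H R(1,2)] by (simp add: Rep_simps type_algebra_sel)
    show "H (Rep_yh_alg 1) = 1"
      using ring_hom_one[OF H] by (simp add: Rep_simps type_algebra_sel)
    show "H (Rep_yh_alg (c \<star> x)) = c \<star> H (Rep_yh_alg x)"
      using ring_hom_mult[OF H R(3,1), of c] s by (simp add: Rep_simps type_algebra_sel)
  qed
  moreover have "\<forall>x\<in>yh_gens n0. H (Rep_yh_alg (yh_elt x)) = \<gamma> x"
    using g by (simp add: yh_elt_def Rep_K0 Y0.FC_gen)
  ultimately show ?thesis by blast
qed

section \<open>Semisimplicity for non-vanishing P\<close>

text \<open>Both polynomials are monic of degree d and agree at the d roots. This makes t_j
  diagonalisable.\<close>

lemma roots_of_unity_lin:
  assumes "d > 0"
  shows "lin {z. z ^ d = 1} = Polynomial.monom 1 d - 1"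
proof (rule poly_eqI_degree_lead_coeff[of _ d _ "{z. z ^ d = 1}"])
  have fin: "finite {z :: complex. z ^ d = 1}" using assms by (intro finite_roots_unity) simp
  have deg: "degree (lin {z. z ^ d = 1}) = d" using degree_lin[OF fin] card_roots_unity_eq[OF assms] by simp
  then show "degree (lin {z. z ^ d = 1}) \<le> d" by simp
  show "degree (Polynomial.monom 1 d - 1 :: complex poly) \<le> d" by (intro degree_diff_le) (simp_all add: degree_monom_le)
  have "lead_coeff (lin {z. z ^ d = 1}) = 1" unfolding lin_def lead_coeff_prod by simp
  then show "poly.coeff (lin {z. z ^ d = 1}) d = poly.coeff (Polynomial.monom 1 d - 1) d" using assms deg by simp
  show "poly (lin {z. z ^ d = 1}) z = poly (Polynomial.monom 1 d - 1) z" if "z \<in> {z. z ^ d = 1}" for z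
    using that poly_lin_eq_0_iff[OF fin] by (simp add: poly_monom)
qed (simp add: card_roots_unity_eq[OF assms])

lemma peval_monom: "peval z (Polynomial.monom 1 k) = z ^ k"
  by (induction k) (simp_all add: monom_Suc monom_0)

lemma peval_prod_list: "peval z (prod_list (map f xs)) = prod_list (map (\<lambda>x. peval z (f x)) xs)"
  by (induction xs) simp_all

lemma lin_image: "distinct xs \<Longrightarrow> inj_on b (set xs) \<Longrightarrow> lin (b ` set xs) = prod_list (map (\<lambda>k. [:- b k, 1:]) xs)"
  by (simp add: lin_def prod.reindex prod.distinct_set_conv_list)

locale spectral =
  fixes B :: "complex set" and z :: "'a::complex_algebra"
  assumes finite_B: "finite B" and B_ne: "B \<noteq> {}" and ann: "peval z (lin B) = 0"
begin

lemma eigen: "b \<in> B \<Longrightarrow> z * peval z (lagr B b) = b \<star> peval z (lagr B b)"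
  using lagr_eigen[of B b z 1] finite_B ann by simp

lemma idem: "b \<in> B \<Longrightarrow> c \<in> B \<Longrightarrow> peval z (lagr B c) * peval z (lagr B b) = (if c = b then peval z (lagr B b) else 0)"
  using peval_eigen[OF eigen, of b "lagr B c"] finite_B by (auto simp: poly_lagr)

lemma total: "(\<Sum>b\<in>B. peval z (lagr B b)) = 1"
  using arg_cong[OF sum_lagr[OF finite_B B_ne], of "peval z"] by (simp add: peval_sum)

lemma expand: "z = (\<Sum>b\<in>B. b \<star> peval z (lagr B b))"
proof -
  have "z = z * (\<Sum>b\<in>B. peval z (lagr B b))" by (simp add: total)
  also have "\<dots> = (\<Sum>b\<in>B. b \<star> peval z (lagr B b))" unfolding sum_distrib_left by (intro sum.cong refl eigen)
  finally show ?thesis .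
qed

lemma power_eigen: "b \<in> B \<Longrightarrow> z ^ k * peval z (lagr B b) = b ^ k \<star> peval z (lagr B b)"
  by (induction k) (simp_all add: mult.assoc eigen mult.commute)

text \<open>X has an inverse among the generators of the algebra, but the weight setting is
  generated by X alone; this recovers the inverse from the spectral projections of X.\<close>

lemma inverse_expand:
  assumes "z' * z = 1" "0 \<notin> B"
  shows "z' = (\<Sum>b\<in>B. (1 / b) \<star> peval z (lagr B b))"
proof -
  have e: "z' * peval z (lagr B b) = (1 / b) \<star> peval z (lagr B b)" if "b \<in> B" for b
  proof -
    have "peval z (lagr B b) = z' * (z * peval z (lagr B b))" using assms(1) by (simp add: mult.assoc[symmetric])
    also have "\<dots> = b \<star> (z' * peval z (lagr B b))" by (simp add: eigen[OF that])
    finally have "(1 / b) \<star> peval z (lagr B b) = (1 / b) \<star> (b \<star> (z' * peval z (lagr B b)))" by simp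
    then show ?thesis using that assms(2) by auto
  qed
  have "z' = z' * (\<Sum>b\<in>B. peval z (lagr B b))" by (simp add: total)
  also have "\<dots> = (\<Sum>b\<in>B. (1 / b) \<star> peval z (lagr B b))" unfolding sum_distrib_left by (intro sum.cong refl e)
  finally show ?thesis .
qed

end

lemma closed_sum:
  fixes Q :: "'a::complex_algebra \<Rightarrow> bool"
  assumes "\<And>c. Q (c \<star> 1)" "\<And>a b. Q a \<Longrightarrow> Q b \<Longrightarrow> Q (a + b)" "\<And>i. i \<in> I \<Longrightarrow> Q (f i)"
  shows "Q (\<Sum>i\<in>I. f i)"
  using assms(3)
proof (induction I rule: infinite_finite_induct)
  case (insert x F)
  then show ?case using assms(2)[of "f x" "sum f F"] by simp
qed (use assms(1)[of 0] in simp_all)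

lemma closed_scale:
  fixes Q :: "'a::complex_algebra \<Rightarrow> bool"
  assumes "\<And>c. Q (c \<star> 1)" "\<And>a b. Q a \<Longrightarrow> Q b \<Longrightarrow> Q (a * b)" "Q a"
  shows "Q (c \<star> a)"
  using assms(2)[OF assms(1)[of c] assms(3)] by simp

lemma closed_peval:
  fixes Q :: "'a::complex_algebra \<Rightarrow> bool"
  assumes "\<And>c. Q (c \<star> 1)" "\<And>a b. Q a \<Longrightarrow> Q b \<Longrightarrow> Q (a + b)" "\<And>a b. Q a \<Longrightarrow> Q b \<Longrightarrow> Q (a * b)" "Q z"
  shows "Q (peval z f)"
proof (induction f)
  case 0
  show ?case using assms(1)[of 0] by simp
next
  case (pCons c f)
  then show ?case using assms by simp
qed

lemma (in generated_weight_setting) linked: "linked_idempotents wset eps"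
proof
  show "\<exists>c. eps w * (a * eps w) = c \<star> eps w" if "w \<in> wset" for w a by (rule eps_corner[OF that])
  show "\<exists>b. b * (eps w' * (a * eps w)) = eps w" if "w \<in> wset" "w' \<in> wset" "eps w' * (a * eps w) \<noteq> 0" for w w' a
    by (rule eps_link[OF that])
qed (simp_all add: finite_wset eps_eps sum_eps eps_nz)

lemma (in algebra_model) linked_idempotents_imp:
  assumes "linked_idempotents W (e :: 'w \<Rightarrow> 'a)"
  shows "semisimple_ring A \<and> split_semisimple A"
  using linked_idempotents_imp_semisimple[OF assms] matrix_units_imp_split linked_idempotents.matrix_units_exist[OF assms]
  by blast

text \<open>Positions start at 1; the value at 0 is a dummy equal to the one at 1.\<close>

primrec conj_seq :: "'a \<Rightarrow> (nat \<Rightarrow> 'a \<Rightarrow> 'a) \<Rightarrow> nat \<Rightarrow> 'a" where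
  "conj_seq z F 0 = z"
| "conj_seq z F (Suc i) = (if i = 0 then z else F i (conj_seq z F i))"

lemma conj_seq_Suc: "1 \<le> i \<Longrightarrow> conj_seq z F (Suc i) = F i (conj_seq z F i)"
  by simp

lemma affine_iterate: "((\<lambda>y. q ^ 2 * y + q) ^^ N) y = q ^ (2 * N) * y + q * (\<Sum>i<N. q ^ (2 * i))" for q y :: complex
proof (induction N)
  case (Suc N)
  have "(\<Sum>i<Suc N. q ^ (2 * i)) = 1 + q ^ 2 * (\<Sum>i<N. q ^ (2 * i))"
    unfolding sum.lessThan_Suc_shift by (simp add: sum_distrib_left power2_eq_square mult.assoc)
  then show ?case by (simp only: funpow.simps comp_apply Suc.IH) (simp add: algebra_simps power2_eq_square)
qed simp

lemma peval_conj:
  assumes "z' * u = u * z" "u * u' = 1" "peval z f = 0"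
  shows "peval z' f = 0"
proof -
  have "u * peval z f * u' = peval z' f * (u * u')" by (simp add: peval_intertwine[OF assms(1)[symmetric]] mult.assoc)
  then show ?thesis using assms by simp
qed

text \<open>The facts about the algebra that sufficiency needs. In \<open>v_sep\<close> the exponent
  is never negative, but s and k range over both orders; this matches the factors of P with
  exponents of either sign.\<close>

locale yh_generic =
  fixes d m n :: nat and q :: complex and v :: "nat \<Rightarrow> complex" and t g :: "nat \<Rightarrow> 'a::complex_algebra" and x x' :: 'a
    and \<gamma> :: "yh_gen \<Rightarrow> 'a"
  defines "\<gamma> \<equiv> case_yh_gen t g x x'"
  assumes d_pos: "d > 0" and n_pos: "n > 0" and m_pos: "m > 0"
    and q_nz: "q \<noteq> 0" and v_nz: "k \<in> {1..m} \<Longrightarrow> v k \<noteq> 0"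
    and rel: "yh_relations d m n q v \<gamma>"
    and gen: "\<And>Q a. \<lbrakk>\<And>c. Q (c \<star> 1); \<And>a b. Q a \<Longrightarrow> Q b \<Longrightarrow> Q (a + b); \<And>a b. Q a \<Longrightarrow> Q b \<Longrightarrow> Q (a * b);
      \<And>x. x \<in> yh_gens n \<Longrightarrow> Q (\<gamma> x)\<rbrakk> \<Longrightarrow> Q a"
    and q_int_nz: "\<lbrakk>1 \<le> k; k \<le> n\<rbrakk> \<Longrightarrow> (\<Sum>i<k. q ^ (2 * i)) \<noteq> 0"
    and v_sep: "\<lbrakk>s \<in> {1..m}; k \<in> {1..m}; s \<noteq> k; l < n\<rbrakk> \<Longrightarrow> q ^ (2 * l) * v s \<noteq> v k"
begin

lemma rels:
  "\<lbrakk>i \<in> {1..<n}; j \<in> {1..<n}; \<bar>int i - int j\<bar> > 1\<rbrakk> \<Longrightarrow> g i * g j = g j * g i"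
  "\<lbrakk>1 \<le> i; Suc i < n\<rbrakk> \<Longrightarrow> g i * (g (Suc i) * g i) = g (Suc i) * (g i * g (Suc i))"
  "\<lbrakk>i \<in> {1..n}; j \<in> {1..n}\<rbrakk> \<Longrightarrow> t i * t j = t j * t i"
  "\<lbrakk>1 \<le> i; i < n; j \<in> {1..n}\<rbrakk> \<Longrightarrow> t j * g i = g i * t (transpose i (Suc i) j)"
  "j \<in> {1..n} \<Longrightarrow> t j ^ d = 1"
  "\<lbrakk>1 \<le> i; i < n\<rbrakk> \<Longrightarrow> g i * g i = 1 + (q - inverse q) \<star> (yh_idem d t i * g i)"
  "x * x' = 1" "x' * x = 1"
  "1 < n \<Longrightarrow> x * (g (Suc 0) * (x * g (Suc 0))) = g (Suc 0) * (x * (g (Suc 0) * x))"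
  "\<lbrakk>2 \<le> i; i < n\<rbrakk> \<Longrightarrow> x * g i = g i * x"
  "j \<in> {1..n} \<Longrightarrow> x * t j = t j * x"
  "prod_list (map (\<lambda>k. x - v k \<star> 1) [1..<m + 1]) = 0"
  using rel unfolding yh_relations_def \<gamma>_def Let_def
  by (simp_all add: mult.assoc power2_eq_square)

definition "Cd = {z :: complex. z ^ d = 1}"
definition "p j c = peval (t j) (lagr Cd c)"
definition "V = v ` {1..m}"
definition "h = q - inverse q"

lemma finite_Cd: "finite Cd"
  unfolding Cd_def using d_pos by (intro finite_roots_unity) simp

lemma v_inj: "inj_on v {1..m}"
proof (rule inj_onI, rule ccontr)
  fix a b assume "a \<in> {1..m}" "b \<in> {1..m}" "v a = v b" "a \<noteq> b"
  then show False using v_sep[of a b 0] n_pos by simp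
qed

lemma spectral_t: "j \<in> {1..n} \<Longrightarrow> spectral Cd (t j)"
proof
  show "finite Cd" by (rule finite_Cd)
  show "Cd \<noteq> {}" by (auto simp: Cd_def intro!: exI[of _ 1])
  assume "j \<in> {1..n}"
  then show "peval (t j) (lin Cd) = 0"
    using peval_add[of "t j" "Polynomial.monom 1 d" "- 1"] peval_minus[of "t j" 1]
    by (simp add: Cd_def roots_of_unity_lin[OF d_pos] peval_monom rels)
qed

lemma spectral_x: "spectral V x"
proof
  show "finite V" by (simp add: V_def)
  show "V \<noteq> {}" using m_pos by (auto simp: V_def)
  have "lin V = prod_list (map (\<lambda>k. [:- v k, 1:]) [1..<m + 1])"
    using lin_image[of "[1..<m + 1]" v] v_inj by (simp add: V_def atLeastLessThanSuc_atLeastAtMost del: upt_Suc)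
  then show "peval x (lin V) = 0"
    using rels(12) by (simp add: peval_prod_list del: upt_Suc)
qed

lemma V_nz: "0 \<notin> V"
  using v_nz by (auto simp: V_def)

text \<open>Expand both powers in spectral projections. The average over s of (c/c')^s, for two d-th
  roots of unity, is 1 if they agree and 0 otherwise.\<close>

lemma idem_eq:
  assumes i: "1 \<le> i" "i < n"
  shows "yh_idem d t i = (\<Sum>c\<in>Cd. p i c * p (Suc i) c)"
proof -
  interpret a: spectral Cd "t i" using i by (intro spectral_t) auto
  interpret b: spectral Cd "t (Suc i)" using i by (intro spectral_t) auto
  have pb: "p i c * t (Suc i) = t (Suc i) * p i c" for c
    unfolding p_def by (rule peval_intertwine[symmetric]) (use i rels(3)[of i "Suc i"] in auto)
  have pb_pow: "p i c * t (Suc i) ^ k = t (Suc i) ^ k * p i c" for c k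
    by (induction k) (simp_all add: mult.assoc pb mult_assoc_rule[OF pb])
  have tm: "t i ^ s * t (Suc i) ^ (d - s) = (\<Sum>c\<in>Cd. \<Sum>c'\<in>Cd. (c ^ s * c' ^ (d - s)) \<star> (p i c * p (Suc i) c'))" for s
  proof -
    have "t i ^ s * t (Suc i) ^ (d - s) = t i ^ s * (\<Sum>c\<in>Cd. p i c) * (t (Suc i) ^ (d - s) * (\<Sum>c'\<in>Cd. p (Suc i) c'))"
      by (simp add: p_def a.total b.total)
    also have "\<dots> = (\<Sum>c\<in>Cd. c ^ s \<star> p i c) * (\<Sum>c'\<in>Cd. c' ^ (d - s) \<star> p (Suc i) c')"
      unfolding sum_distrib_left p_def by (simp add: a.power_eigen b.power_eigen)
    finally show ?thesis by (simp add: sum_product mult.commute)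
  qed
  have orth: "(1 / of_nat d) * (\<Sum>s<d. c ^ s * c' ^ (d - s)) = (if c = c' then 1 else 0)" if "c \<in> Cd" "c' \<in> Cd" for c c'
  proof (cases "c = c'")
    case True
    have "c ^ s * c' ^ (d - s) = 1" if "s < d" for s
      using that \<open>c \<in> Cd\<close> True by (simp add: Cd_def flip: power_add)
    then show ?thesis using True d_pos by simp
  next
    case False
    have nz: "c' \<noteq> 0" using \<open>c' \<in> Cd\<close> d_pos by (auto simp: Cd_def zero_power)
    have "c ^ s * c' ^ (d - s) = (c / c') ^ s" if "s < d" for s
    proof -
      have "c' ^ (d - s) = c' ^ d / c' ^ s" using that nz by (intro power_diff) auto
      also have "c' ^ d = 1" using \<open>c' \<in> Cd\<close> by (simp add: Cd_def)
      finally show ?thesis by (simp add: power_divide)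
    qed
    then have "(\<Sum>s<d. c ^ s * c' ^ (d - s)) = (\<Sum>s<d. (c / c') ^ s)" by simp
    also have "\<dots> = 0"
    proof -
      have "c / c' \<noteq> 1" "(c / c') ^ d = 1" using that False nz by (simp_all add: Cd_def power_divide)
      then show ?thesis by (simp add: geometric_sum)
    qed
    finally show ?thesis using False by simp
  qed
  have "yh_idem d t i = (1 / of_nat d) \<star> (\<Sum>s<d. \<Sum>c\<in>Cd. \<Sum>c'\<in>Cd. (c ^ s * c' ^ (d - s)) \<star> (p i c * p (Suc i) c'))"
    unfolding yh_idem_def by (simp add: tm)
  also have "\<dots> = (\<Sum>c\<in>Cd. \<Sum>c'\<in>Cd. ((1 / of_nat d) * (\<Sum>s<d. c ^ s * c' ^ (d - s))) \<star> (p i c * p (Suc i) c'))"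
    unfolding cscale_cscale[symmetric] cscale_sum_left cscale_sum_right
    by (subst sum.swap, rule sum.cong[OF refl], subst sum.swap, rule refl)
  also have "\<dots> = (\<Sum>c\<in>Cd. \<Sum>c'\<in>Cd. if c = c' then p i c * p (Suc i) c' else 0)"
    by (intro sum.cong refl) (simp only: orth if_distrib[of "\<lambda>c. c \<star> _"] cscale_one cscale_zero_left cong: if_cong)
  finally show ?thesis by (simp add: finite_Cd)
qed

lemma p_comm: "\<lbrakk>i \<in> {1..n}; j \<in> {1..n}\<rbrakk> \<Longrightarrow> p i c * p j c' = p j c' * p i c"
  unfolding p_def by (intro peval_intertwine peval_intertwine[symmetric] rels)

lemma p_g: "\<lbrakk>1 \<le> i; i < n; j \<in> {1..n}\<rbrakk> \<Longrightarrow> p j c * g i = g i * p (transpose i (Suc i) j) c"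
  unfolding p_def by (intro peval_intertwine[symmetric] rels(4)[symmetric])

lemma p_x: "j \<in> {1..n} \<Longrightarrow> x * p j c = p j c * x"
  unfolding p_def by (rule peval_intertwine) (simp add: rels)

lemma hecke: "colored_hecke n h Cd p g"
proof
  fix i c c' assume "i \<in> {1..n}" "c \<in> Cd" "c' \<in> Cd"
  then show "p i c * p i c' = (if c = c' then p i c else 0)"
    using spectral.idem[OF spectral_t] by (simp add: p_def)
next
  fix i assume "i \<in> {1..n}"
  then show "(\<Sum>c\<in>Cd. p i c) = 1" unfolding p_def by (intro spectral.total spectral_t)
next
  fix i j assume "1 \<le> i" "Suc i < j" "j < n"
  then show "g i * g j = g j * g i" by (intro rels(1)) auto
next
  fix i assume i: "1 \<le> i" "i < n"
  show "g i * g i = 1 + h \<star> ((\<Sum>c\<in>Cd. p i c * p (Suc i) c) * g i)"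
    unfolding h_def idem_eq[OF i, symmetric] by (rule rels(6)[OF i])
next
  fix i j c c' assume "i \<in> {1..n}" "j \<in> {1..n}"
  then show "p i c * p j c' = p j c' * p i c" by (rule p_comm)
next
  fix i j c assume "1 \<le> i" "i < n" "j \<in> {1..n}"
  then show "p j c * g i = g i * p (transpose i (Suc i) j) c" by (rule p_g)
next
  show "finite Cd" by (rule finite_Cd)
next
  fix i assume "1 \<le> i" "Suc i < n"
  then show "g i * (g (Suc i) * g i) = g (Suc i) * (g i * g (Suc i))" by (rule rels(2))
qed

lemma closed_gens:
  assumes "\<And>c. Q (c \<star> 1)" "\<And>a b. Q a \<Longrightarrow> Q b \<Longrightarrow> Q (a + b)" "\<And>a b. Q a \<Longrightarrow> Q b \<Longrightarrow> Q (a * b)"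
    and gi: "\<And>i. 1 \<le> i \<Longrightarrow> i < n \<Longrightarrow> Q (g i)" and pj: "\<And>j c. j \<in> {1..n} \<Longrightarrow> c \<in> Cd \<Longrightarrow> Q (p j c)" and xx: "Q x"
  shows "Q a"
proof (rule gen[of Q], rule assms(1), erule (1) assms(2), erule (1) assms(3))
  have t: "Q (t j)" if j: "j \<in> {1..n}" for j
    by (subst spectral.expand[OF spectral_t[OF j]])
      (rule closed_sum[of Q], rule assms(1), erule (1) assms(2), rule closed_scale[of Q], rule assms(1), erule (1) assms(3),
        rule pj[OF j, unfolded p_def])
  have x': "Q x'"
    by (subst spectral.inverse_expand[OF spectral_x rels(8) V_nz])
      (rule closed_sum[of Q], rule assms(1), erule (1) assms(2), rule closed_scale[of Q], rule assms(1), erule (1) assms(3),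
        rule closed_peval[of Q], rule assms(1), erule (1) assms(2), erule (1) assms(3), rule xx)
  fix y assume y: "y \<in> yh_gens n"
  show "Q (\<gamma> y)"
  proof (cases y)
    case (GT j)
    then show ?thesis using y t[of j] by (simp add: yh_gens_def \<gamma>_def image_iff)
  next
    case (GG i)
    then show ?thesis using y gi[of i] by (simp add: yh_gens_def \<gamma>_def image_iff)
  qed (simp_all add: \<gamma>_def xx x')
qed

text \<open>Colours are the d-th roots of unity, and the weight calculus is applied to Y_1 = (X -
  1)/h, with roots (v_k - 1)/h.\<close>

lemma linked_nonzero:
  assumes h0: "h \<noteq> 0"
  shows "\<exists>(W :: (nat \<Rightarrow> complex \<times> complex) set) (e :: _ \<Rightarrow> 'a). linked_idempotents W e"
proof -
  define Y where "Y = conj_seq ((1 / h) \<star> (x - 1)) (\<lambda>i y. g i * (y * g i) + 1 \<star> ((\<Sum>c\<in>Cd. p i c * p (Suc i) c) * g i))"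
  define Rt where "Rt = (\<lambda>k. (v k - 1) / h) ` {1..m}"
  have Y1: "Y (Suc 0) = (1 / h) \<star> (x - 1)" by (simp add: Y_def)
  have YS: "Y (Suc i) = g i * (Y i * g i) + 1 \<star> ((\<Sum>c\<in>Cd. p i c * p (Suc i) c) * g i)" if "1 \<le> i" for i
    unfolding Y_def by (rule conj_seq_Suc[OF that])
  have x_Y: "x = 1 + h \<star> Y (Suc 0)" using h0 by (simp add: Y1)
  have Y_of_x: "Y (Suc 0) * a = a * Y (Suc 0)" if "x * a = a * x" for a
    using that by (simp add: Y1 algebra_simps)
  have Y12: "Y (Suc 0) * Y 2 = Y 2 * Y (Suc 0)" if n1: "1 < n"
  proof (rule Y_of_x)
    \<comment> \<open>Up to the factor h, Y_2 is g_1 X g_1 - 1, and X commutes with g_1 X g_1 by a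
      defining relation; since h is not 0, it can be cancelled.\<close>
    have "h \<star> Y 2 = g 1 * ((h \<star> Y (Suc 0)) * g 1) + h \<star> ((\<Sum>c\<in>Cd. p 1 c * p 2 c) * g 1)"
      using YS[of 1] by (simp add: numeral_2_eq_2 cscale_add_right)
    also have "h \<star> Y (Suc 0) = x - 1" using x_Y by simp
    also have "h \<star> ((\<Sum>c\<in>Cd. p 1 c * p 2 c) * g 1) = g 1 * g 1 - 1" using colored_hecke.g_quad[OF hecke, of 1] n1 by (simp add: numeral_2_eq_2)
    finally have e: "h \<star> Y 2 = g 1 * (x * g 1) - 1" by (simp add: algebra_simps)
    have "x * (h \<star> Y 2) = (h \<star> Y 2) * x"
      unfolding e using rels(9)[OF n1] by (simp add: algebra_simps)
    then have "h \<star> (x * Y 2 - Y 2 * x) = 0" by (simp add: cscale_diff_right)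
    then show "x * Y 2 = Y 2 * x" using h0 by simp
  qed
  interpret generated_weight_setting n h Cd p g "\<lambda>i j. \<Sum>c\<in>Cd. p i c * p j c" Y q Rt "\<lambda>y. q\<^sup>2 * y + q" "\<lambda>y. (y - q) / q\<^sup>2"
  proof (intro generated_weight_setting.intro weight_setting.intro jucys_murphy.intro jucys_murphy_axioms.intro
      weight_setting_axioms.intro generated_weight_setting_axioms.intro)
    show "colored_hecke n h Cd p g" by (rule hecke)
    show "Y (Suc 0) * p j c = p j c * Y (Suc 0)" if "j \<in> {1..n}" for j c by (rule Y_of_x[OF p_x[OF that]])
    show "Y (Suc 0) * g i = g i * Y (Suc 0)" if "2 \<le> i" "i < n" for i by (rule Y_of_x[OF rels(10)[OF that]])
    show "Y (Suc i) = g i * (Y i * g i) + 1 \<star> ((\<Sum>c\<in>Cd. p i c * p (Suc i) c) * g i)" if "1 \<le> i" for i by (rule YS[OF that])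
    show "Y (Suc 0) * Y 2 = Y 2 * Y (Suc 0)" if "1 < n" by (rule Y12[OF that])
    show "0 < n" by (rule n_pos) show "q \<noteq> 0" by (rule q_nz) show "h = q - inverse q" by (rule h_def)
    show "finite Rt" by (simp add: Rt_def)
    show "\<exists>z. z * (1 + h \<star> Y (Suc 0)) = 1" unfolding x_Y[symmetric] using rels(8) by blast
    show "(\<Sum>i<k. q ^ (2 * i)) \<noteq> 0" if "1 \<le> k" "k \<le> n" for k by (rule q_int_nz[OF that])
    show "peval (Y (Suc 0)) (lin Rt) = 0"
    proof -
      have "inj_on (\<lambda>k. (v k - 1) / h) (set [1..<m + 1])"
      proof (rule inj_onI)
        fix a b assume ab: "a \<in> set [1..<m + 1]" "b \<in> set [1..<m + 1]" "(v a - 1) / h = (v b - 1) / h"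
        from ab(3) have "v a = v b" using h0 by simp
        moreover have "a \<in> {1..m}" "b \<in> {1..m}" using ab(1,2) by auto
        ultimately show "a = b" by (rule inj_onD[OF v_inj])
      qed
      from lin_image[OF _ this] have L: "lin Rt = prod_list (map (\<lambda>k. [:- ((v k - 1) / h), 1:]) [1..<m + 1])"
        by (simp add: Rt_def atLeastLessThanSuc_atLeastAtMost del: upt_Suc)
      have f: "peval (Y (Suc 0)) [:- ((v k - 1) / h), 1:] = (1 / h) \<star> (x - v k \<star> 1)" for k
      proof -
        have "peval (Y (Suc 0)) [:- ((v k - 1) / h), 1:] = Y (Suc 0) - ((v k - 1) / h) \<star> 1" by simp
        also have "\<dots> = (1 / h) \<star> (x - v k \<star> 1)"
          unfolding Y1 cscale_diff_right cscale_cscale diff_divide_distrib cscale_diff_left by simp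
        finally show ?thesis .
      qed
      have "prod_list (map (\<lambda>k. (1 / h) \<star> (x - v k \<star> 1)) ks) = (1 / h) ^ length ks \<star> prod_list (map (\<lambda>k. x - v k \<star> 1) ks)" for ks
        by (induction ks) (simp_all add: mult.commute)
      then show ?thesis unfolding L peval_prod_list f using rels(12) by simp
    qed
    \<comment> \<open>In terms of 1 + h y, a step of \<sigma> is multiplication by q^2, so equality
      would mean q^(2N) v_s = v_k. Separation leaves s = k, hence q^(2N) = 1, which the N-th quantum
      integer forbids.\<close>
    show "((\<lambda>y. q\<^sup>2 * y + q) ^^ N) y \<noteq> y'" if yy: "y \<in> Rt" "y' \<in> Rt" and N: "1 \<le> N" "N < n" for y y' N
    proof
      assume eq: "((\<lambda>y. q\<^sup>2 * y + q) ^^ N) y = y'"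
      obtain s k where s: "s \<in> {1..m}" "y = (v s - 1) / h" and k: "k \<in> {1..m}" "y' = (v k - 1) / h"
        using yy by (auto simp: Rt_def)
      have hq: "h * q = q ^ 2 - 1" using q_nz by (simp add: h_def field_simps power2_eq_square)
      have S: "(q ^ 2 - 1) * (\<Sum>i<N. q ^ (2 * i)) = q ^ (2 * N) - 1"
        using power_diff_1_eq[of "q ^ 2" N] by (simp add: power_mult)
      have "1 + h * y' = 1 + q ^ (2 * N) * (h * y) + (h * q) * (\<Sum>i<N. q ^ (2 * i))"
        unfolding eq[symmetric] affine_iterate by (simp add: algebra_simps)
      also have "\<dots> = q ^ (2 * N) * (1 + h * y)" unfolding hq S by (simp add: algebra_simps)
      finally have "q ^ (2 * N) * v s = v k" using s k h0 by simp
      then have "s = k" using v_sep[OF s(1) k(1) _ N(2)] by blast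
      then have "q ^ (2 * N) = 1" using \<open>q ^ (2 * N) * v s = v k\<close> v_nz[OF s(1)] by simp
      moreover have "(\<Sum>i<N. q ^ (2 * i)) \<noteq> 0" using q_int_nz N by simp
      ultimately show False using S hq h0 q_nz by auto
    qed
  next
    fix Q a assume Q: "\<And>c. Q (c \<star> 1)" "\<And>a b. Q a \<Longrightarrow> Q b \<Longrightarrow> Q (a + b)" "\<And>a b. Q a \<Longrightarrow> Q b \<Longrightarrow> Q (a * b)"
      "\<And>i. 1 \<le> i \<Longrightarrow> i < n \<Longrightarrow> Q (g i)" "\<And>j c. j \<in> {1..n} \<Longrightarrow> c \<in> Cd \<Longrightarrow> Q (p j c)" "Q (Y (Suc 0))"
    have x: "Q x"
      by (subst x_Y) (rule Q(2), use Q(1)[of 1] in simp, rule closed_scale[of Q], rule Q(1), erule (1) Q(3), rule Q(6))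
    show "Q a" by (rule closed_gens[of Q]) (rule Q(1), erule (1) Q(2), erule (1) Q(3), erule (1) Q(4), erule (1) Q(5), rule x)
  qed simp_all
  show ?thesis using linked by blast
qed

text \<open>Now every g_i is an involution, so the conjugates Z_j of X (the recursion with \<kappa>
  = 0) are all diagonalisable with the eigenvalues of X and are permuted by the g_i. Their
  projections refine the colours; what remains is a coloured symmetric group.\<close>

lemma linked_zero:
  assumes h0: "h = 0"
  shows "\<exists>(W :: (nat \<Rightarrow> (complex \<times> complex) \<times> complex) set) (e :: _ \<Rightarrow> 'a). linked_idempotents W e"
proof -
  define Z where "Z = conj_seq x (\<lambda>i y. g i * (y * g i) + 0 \<star> ((\<Sum>c\<in>Cd. p i c * p (Suc i) c) * g i))"
  have Z1: "Z (Suc 0) = x" by (simp add: Z_def)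
  have ZS: "Z (Suc i) = g i * (Z i * g i) + 0 \<star> ((\<Sum>c\<in>Cd. p i c * p (Suc i) c) * g i)" if "1 \<le> i" for i
    unfolding Z_def by (rule conj_seq_Suc[OF that])
  interpret Z: jucys_murphy n h Cd p g "\<lambda>i j. \<Sum>c\<in>Cd. p i c * p j c" 0 Z
  proof (intro jucys_murphy.intro jucys_murphy_axioms.intro)
    show "colored_hecke n h Cd p g" by (rule hecke)
    show "Z (Suc 0) * p j c = p j c * Z (Suc 0)" if "j \<in> {1..n}" for j c unfolding Z1 by (rule p_x[OF that])
    show "Z (Suc 0) * g i = g i * Z (Suc 0)" if "2 \<le> i" "i < n" for i unfolding Z1 by (rule rels(10)[OF that])
    show "Z (Suc i) = g i * (Z i * g i) + 0 \<star> ((\<Sum>c\<in>Cd. p i c * p (Suc i) c) * g i)" if "1 \<le> i" for i by (rule ZS[OF that])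
    show "Z (Suc 0) * Z 2 = Z 2 * Z (Suc 0)" if "1 < n"
      using ZS[of 1] rels(9)[OF that] by (simp add: Z1 numeral_2_eq_2 mult.assoc)
  qed simp_all
  have gg: "g i * g i = 1" if "1 \<le> i" "i < n" for i using Z.g_quad[OF that] by (simp add: h0)
  have Zg: "Z j * g i = g i * Z (transpose i (Suc i) j)" if i: "1 \<le> i" "i < n" and j: "j \<in> {1..n}" for i j
  proof -
    have e: "Z (Suc i) = g i * (Z i * g i)" using ZS[OF i(1)] by simp
    consider "j = i" | "j = Suc i" | "j \<noteq> i" "j \<noteq> Suc i" by blast
    then show ?thesis
    proof cases
      case 1
      then show ?thesis by (simp add: e mult_assoc_rule[OF gg[OF i]])
    next
      case 2
      then show ?thesis by (simp add: e mult.assoc gg[OF i])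
    next
      case 3
      then show ?thesis using Z.Z_g[of j i] i j by (simp add: transpose_def)
    qed
  qed
  have spec: "spectral V (Z j)" if "j \<in> {1..n}" for j
  proof -
    have "peval (Z j) (lin V) = 0" if "1 \<le> j" "j \<le> n" using that
    proof (induction j rule: nat_induct_at_least)
      case base
      then show ?case using spectral.ann[OF spectral_x] by (simp add: Z1)
    next
      case (Suc i)
      have "Z (Suc i) * g i = g i * Z i" using Zg[of i "Suc i"] Suc by simp
      from peval_conj[OF this gg] show ?case using Suc by simp
    qed
    then show ?thesis using that spectral.finite_B[OF spectral_x] spectral.B_ne[OF spectral_x] by (simp add: spectral_def)
  qed
  define L where "L j w = peval (Z j) (lagr V w)" for j w
  have LL: "L i w * L j w' = L j w' * L i w" if "i \<in> {1..n}" "j \<in> {1..n}" for i j w w'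
    unfolding L_def using that by (intro peval_intertwine peval_intertwine[symmetric] Z.Z_commute) auto
  have pL: "L i w * p j c = p j c * L i w" if "i \<in> {1..n}" "j \<in> {1..n}" "c \<in> Cd" for i j c w
    unfolding L_def using that by (intro peval_intertwine[symmetric] Z.Z_p[symmetric]) auto
  have Lg: "L j w * g i = g i * L (transpose i (Suc i) j) w" if "1 \<le> i" "i < n" "j \<in> {1..n}" for i j w
    unfolding L_def by (rule peval_intertwine[OF Zg[OF that, symmetric], symmetric])
  have tr: "transpose i (Suc i) j \<in> {1..n}" if "1 \<le> i" "i < n" "j \<in> {1..n}" for i j
    using that by (auto simp: transpose_def)
  define pp where "pp j cw = p j (fst cw) * L j (snd cw)" for j and cw :: "complex \<times> complex"
  have hecke2: "colored_hecke n h (Cd \<times> V) pp g"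
  proof
    show "finite (Cd \<times> V)" using finite_Cd spectral.finite_B[OF spectral_x] by simp
  next
    fix i j c c' assume a: "i \<in> {1..n}" "j \<in> {1..n}" "c \<in> Cd \<times> V" "c' \<in> Cd \<times> V"
    have c: "fst c \<in> Cd" "fst c' \<in> Cd" using a by auto
    have "pp i c * pp j c' = p i (fst c) * p j (fst c') * (L i (snd c) * L j (snd c'))"
      using pL[OF a(1,2) c(2)] by (simp add: pp_def mult.assoc mult_assoc_rule[OF pL[OF a(1,2) c(2)]])
    also have "\<dots> = p j (fst c') * p i (fst c) * (L j (snd c') * L i (snd c))"
      using p_comm[OF a(1,2)] LL[OF a(1,2)] by simp
    also have "\<dots> = pp j c' * pp i c"
      by (simp add: pp_def mult.assoc mult_assoc_rule[OF pL[OF a(2,1) c(1)]])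
    finally show "pp i c * pp j c' = pp j c' * pp i c" .
  next
    fix i c c' assume a: "i \<in> {1..n}" "c \<in> Cd \<times> V" "c' \<in> Cd \<times> V"
    have c: "fst c \<in> Cd" "fst c' \<in> Cd" "snd c \<in> V" "snd c' \<in> V" using a by auto
    have "pp i c * pp i c' = p i (fst c) * p i (fst c') * (L i (snd c) * L i (snd c'))"
      by (simp add: pp_def mult.assoc mult_assoc_rule[OF pL[OF a(1) a(1) c(2)]])
    then show "pp i c * pp i c' = (if c = c' then pp i c else 0)"
      using Z.p_idem[OF a(1) c(1,2)] spectral.idem[OF spec[OF a(1)] c(4,3), folded L_def] by (auto simp: pp_def prod_eq_iff)
  next
    fix i assume i: "i \<in> {1..n}"
    have "(\<Sum>c\<in>Cd \<times> V. pp i c) = (\<Sum>c\<in>Cd. p i c) * (\<Sum>w\<in>V. L i w)"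
      by (simp add: pp_def sum_product sum.cartesian_product case_prod_unfold)
    then show "(\<Sum>c\<in>Cd \<times> V. pp i c) = 1" using Z.p_sum[OF i] spectral.total[OF spec[OF i], folded L_def] by simp
  next
    fix i j c assume a: "1 \<le> i" "i < n" "j \<in> {1..n}"
    show "pp j c * g i = g i * pp (transpose i (Suc i) j) c"
      by (simp add: pp_def mult.assoc Lg[OF a] mult_assoc_rule[OF p_g[OF a]])
  next
    fix i j assume "1 \<le> i" "Suc i < j" "j < n"
    then show "g i * g j = g j * g i" by (rule Z.g_far)
  next
    fix i assume "1 \<le> i" "Suc i < n"
    then show "g i * (g (Suc i) * g i) = g (Suc i) * (g i * g (Suc i))" by (rule Z.g_braid)
  next
    fix i assume "1 \<le> i" "i < n"
    then show "g i * g i = 1 + h \<star> ((\<Sum>c\<in>Cd \<times> V. pp i c * pp (Suc i) c) * g i)" by (simp add: h0 gg)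
  qed
  \<comment> \<open>X has been absorbed into the colours, so the additive Jucys--Murphy elements
    start at 0. The only root is 0, and its iterates are q times quantum integers.\<close>
  define Y where "Y = conj_seq 0 (\<lambda>i y. g i * (y * g i) + 1 \<star> ((\<Sum>c\<in>Cd \<times> V. pp i c * pp (Suc i) c) * g i))"
  have Y1: "Y (Suc 0) = 0" by (simp add: Y_def)
  have YS: "Y (Suc i) = g i * (Y i * g i) + 1 \<star> ((\<Sum>c\<in>Cd \<times> V. pp i c * pp (Suc i) c) * g i)" if "1 \<le> i" for i
    unfolding Y_def by (rule conj_seq_Suc[OF that])
  have sumQ: "(\<Sum>c\<in>Cd \<times> V. f (snd c) \<star> pp 1 c) = (\<Sum>w\<in>V. f w \<star> L 1 w)" for f :: "complex \<Rightarrow> complex"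
  proof -
    have "(\<Sum>c\<in>Cd \<times> V. f (snd c) \<star> pp 1 c) = (\<Sum>c\<in>Cd. p 1 c) * (\<Sum>w\<in>V. f w \<star> L 1 w)"
      by (simp add: pp_def sum_product sum.cartesian_product case_prod_unfold)
    then show ?thesis using Z.p_sum[of 1] n_pos by simp
  qed
  interpret generated_weight_setting n h "Cd \<times> V" pp g "\<lambda>i j. \<Sum>c\<in>Cd \<times> V. pp i c * pp j c" Y q "{0}" "\<lambda>y. q\<^sup>2 * y + q" "\<lambda>y. (y - q) / q\<^sup>2"
  proof (intro generated_weight_setting.intro weight_setting.intro jucys_murphy.intro jucys_murphy_axioms.intro
      weight_setting_axioms.intro generated_weight_setting_axioms.intro)
    show "colored_hecke n h (Cd \<times> V) pp g" by (rule hecke2)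
    show "Y (Suc i) = g i * (Y i * g i) + 1 \<star> ((\<Sum>c\<in>Cd \<times> V. pp i c * pp (Suc i) c) * g i)" if "1 \<le> i" for i by (rule YS[OF that])
    show "0 < n" by (rule n_pos) show "q \<noteq> 0" by (rule q_nz) show "h = q - inverse q" by (rule h_def)
    show "\<exists>z. z * (1 + h \<star> Y (Suc 0)) = 1" by (simp add: h0)
    show "(\<Sum>i<k. q ^ (2 * i)) \<noteq> 0" if "1 \<le> k" "k \<le> n" for k by (rule q_int_nz[OF that])
    show "((\<lambda>y. q\<^sup>2 * y + q) ^^ N) y \<noteq> y'" if "y \<in> {0}" "y' \<in> {0}" "1 \<le> N" "N < n" for y y' N
      using that q_int_nz[of N] q_nz unfolding affine_iterate by simp
    show "peval (Y (Suc 0)) (lin {0}) = 0" by (simp add: Y1 lin_def)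
  next
    fix Q a assume Q: "\<And>c. Q (c \<star> 1)" "\<And>a b. Q a \<Longrightarrow> Q b \<Longrightarrow> Q (a + b)" "\<And>a b. Q a \<Longrightarrow> Q b \<Longrightarrow> Q (a * b)"
      "\<And>i. 1 \<le> i \<Longrightarrow> i < n \<Longrightarrow> Q (g i)" "\<And>j c. j \<in> {1..n} \<Longrightarrow> c \<in> Cd \<times> V \<Longrightarrow> Q (pp j c)" "Q (Y (Suc 0))"
    have "x = (\<Sum>c\<in>Cd \<times> V. snd c \<star> pp 1 c)"
      unfolding sumQ[of "\<lambda>w. w"] L_def using spectral.expand[OF spectral_x] by (simp only: Z1 One_nat_def)
    moreover have "Q (\<Sum>c\<in>Cd \<times> V. snd c \<star> pp 1 c)"
      by (rule closed_sum[of Q], rule Q(1), erule (1) Q(2), rule closed_scale[of Q], rule Q(1), erule (1) Q(3), rule Q(5))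
        (use n_pos in auto)
    ultimately have x: "Q x" by simp
    have p: "Q (p j c)" if j: "j \<in> {1..n}" and c: "c \<in> Cd" for j c
    proof -
      have "p j c = (\<Sum>w\<in>V. pp j (c, w))"
        using spectral.total[OF spec[OF j], folded L_def] by (simp add: pp_def flip: sum_distrib_left)
      moreover have "Q (\<Sum>w\<in>V. pp j (c, w))"
        by (rule closed_sum[of Q], rule Q(1), erule (1) Q(2), rule Q(5)) (use j c in auto)
      ultimately show ?thesis by simp
    qed
    show "Q a" by (rule closed_gens[of Q]) (rule Q(1), erule (1) Q(2), erule (1) Q(3), erule (1) Q(4), erule (1) p, rule x)
  qed (simp_all add: Y1)
  show ?thesis using linked by blast
qed

theorem semisimple_and_split:
  assumes "algebra_model A (rep :: 'a \<Rightarrow> 'x)"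
  shows "semisimple_ring A \<and> split_semisimple A"
  proof (cases "h = 0")
  case True
  then show ?thesis using algebra_model.linked_idempotents_imp[OF assms] linked_zero by blast
next
  case False
  then show ?thesis using algebra_model.linked_idempotents_imp[OF assms] linked_nonzero by blast
qed

end

section \<open>Necessity: consequences of semisimplicity for characters and representations\<close>

lemma character_idempotent:
  fixes \<chi> :: "'a::complex_algebra \<Rightarrow> complex"
  assumes dec: "one_decomposes TYPE('a)" and hom: "alg_hom \<chi>"
  shows "\<exists>e. \<chi> e \<noteq> 0 \<and> (\<forall>a. a * e = \<chi> a \<star> e)"
proof -
  interpret alg_hom \<chi> by (rule hom)
  obtain I and e :: "nat \<Rightarrow> 'a" where e: "(\<Sum>i\<in>I. e i) = 1"
    "\<And>i b. i \<in> I \<Longrightarrow> b * e i \<noteq> 0 \<Longrightarrow> \<exists>a. a * (b * e i) = e i"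
    using dec unfolding one_decomposes_def by blast
  have "(\<Sum>i\<in>I. \<chi> (e i)) = 1" using H_one by (simp add: H_sum[symmetric] e(1))
  then obtain i where i: "i \<in> I" "\<chi> (e i) \<noteq> 0" by (metis sum.neutral zero_neq_one)
  \<comment> \<open>If b e_i were non-zero it could be multiplied back to e_i, on which \<chi> does
    not vanish. So \<chi> is realised by a left ideal, not only as a quotient.\<close>
  have kill: "b * e i = 0" if "\<chi> b = 0" for b
  proof (rule ccontr)
    assume "b * e i \<noteq> 0"
    then obtain a where "a * (b * e i) = e i" using e(2)[OF i(1)] by blast
    then have "\<chi> a * (\<chi> b * \<chi> (e i)) = \<chi> (e i)" by (simp only: H_mult[symmetric])
    then show False using that i(2) by simp
  qed
  have "a * e i = \<chi> a \<star> e i" for a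
    using kill[of "a - \<chi> a \<star> 1"] by (simp add: H_diff H_scale H_one cscale_complex_def algebra_simps)
  then show ?thesis using i(2) by blast
qed

text \<open>The assumptions give H x H a H x = \<chi>(a) \<chi>(x) H x = 0 for all a. Each non-zero
  x e_i satisfies x e_i = x a x e_i for some a, so its image vanishes, and the x e_i add up to
  x.\<close>

lemma nilpotent_image:
  fixes \<chi> :: "'a::complex_algebra \<Rightarrow> complex" and H :: "'a \<Rightarrow> 'b::complex_algebra"
  assumes dec: "one_decomposes TYPE('a)" and H: "alg_hom H"
    and x: "\<And>a. H a * H x = \<chi> a \<star> H x" "\<chi> x = 0"
  shows "H x = 0"
proof -
  interpret H: alg_hom H by (rule H)
  obtain I and e :: "nat \<Rightarrow> 'a" where e: "(\<Sum>i\<in>I. e i) = 1"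
    "\<And>i b. i \<in> I \<Longrightarrow> b * e i \<noteq> 0 \<Longrightarrow> \<exists>a. a * (b * e i) = e i"
    using dec unfolding one_decomposes_def by blast
  have "H (x * e i) = 0" if i: "i \<in> I" for i
  proof (cases "x * e i = 0")
    case False
    then obtain a where a: "a * (x * e i) = e i" using e(2)[OF i] by blast
    then have "H (x * e i) = H x * (H a * H x) * H (e i)" by (simp add: H.H_mult[symmetric] mult.assoc)
    also have "\<dots> = 0" by (simp add: x)
    finally show ?thesis .
  qed (simp add: H.H_zero)
  then have "(\<Sum>i\<in>I. H (x * e i)) = 0" by simp
  then show ?thesis by (simp add: H.H_sum[symmetric] sum_distrib_left[symmetric] e(1))
qed

definition linear_map :: "(('x \<Rightarrow> complex) \<Rightarrow> 'y \<Rightarrow> complex) \<Rightarrow> bool" where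
  "linear_map f \<longleftrightarrow> (\<forall>x y. f (\<lambda>i. x i + y i) = (\<lambda>i. f x i + f y i)) \<and> (\<forall>c x. f (\<lambda>i. c * x i) = (\<lambda>i. c * f x i))"

text \<open>Endomorphisms of a function space as a type, so that representations are homomorphisms
  between instances of one class. No finiteness of the index type is demanded, so lists can serve as
  indices.\<close>

typedef 'x operator = "{f :: ('x \<Rightarrow> complex) \<Rightarrow> 'x \<Rightarrow> complex. linear_map f}"
  morphisms app Operator
  by (rule exI[of _ "\<lambda>x. x"]) (simp add: linear_map_def)

lemma app_add: "app f (\<lambda>i. x i + y i) = (\<lambda>i. app f x i + app f y i)"
  and app_scale: "app f (\<lambda>i. c * x i) = (\<lambda>i. c * app f x i)"
  using app[of f] by (simp_all add: linear_map_def)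

lemma operator_eqI: "(\<And>F. app f F = app g F) \<Longrightarrow> f = g"
  by (metis app_inject ext)

instantiation operator :: (type) complex_algebra
begin

definition "0 = Operator (\<lambda>x i. 0)"
definition "1 = Operator (\<lambda>x. x)"
definition "f + g = Operator (\<lambda>x i. app f x i + app g x i)"
definition "f - g = Operator (\<lambda>x i. app f x i - app g x i)"
definition "- f = Operator (\<lambda>x i. - app f x i)"
definition "f * g = Operator (\<lambda>x. app f (app g x))"
definition "c \<star> f = Operator (\<lambda>x i. c * app f x i)"

lemma app_simps:
  "app 0 F = (\<lambda>a. 0)" "app 1 F = F" "app (f + g) F = (\<lambda>a. app f F a + app g F a)"
  "app (f - g) F = (\<lambda>a. app f F a - app g F a)" "app (- f) F = (\<lambda>a. - app f F a)"
  "app (f * g) F = app f (app g F)" "app (c \<star> f) F = (\<lambda>a. c * app f F a)"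
  unfolding zero_operator_def one_operator_def plus_operator_def minus_operator_def uminus_operator_def
    times_operator_def cscale_operator_def
  by (subst Operator_inverse; simp add: linear_map_def app_add app_scale algebra_simps)+

instance
proof
  show "(0 :: 'a operator) \<noteq> 1"
  proof
    assume "(0 :: 'a operator) = 1"
    then have "app 0 (\<lambda>_. 1) undefined = app (1 :: 'a operator) (\<lambda>_. 1) undefined" by simp
    then show False by (simp add: app_simps)
  qed
qed (rule operator_eqI; simp add: app_simps app_add app_scale algebra_simps)+

end

lemma app_sum: "app (\<Sum>i\<in>I. f i) F = (\<lambda>a. \<Sum>i\<in>I. app (f i) F a)"
  by (induction I rule: infinite_finite_induct) (simp_all add: app_simps)

text \<open>When the t_j act by 1, each e_i is 1, and the relations that remain are those of the
  Ariki--Koike algebra.\<close>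

lemma yh_relations_trivial_t:
  fixes T :: "nat \<Rightarrow> 'a::complex_algebra"
  assumes d: "d > 0"
    and far: "\<And>i j. \<lbrakk>1 \<le> i; Suc i < j; j < n\<rbrakk> \<Longrightarrow> T i * T j = T j * T i"
    and braid: "\<And>i. \<lbrakk>1 \<le> i; Suc i < n\<rbrakk> \<Longrightarrow> T i * T (Suc i) * T i = T (Suc i) * T i * T (Suc i)"
    and quad: "\<And>i. \<lbrakk>1 \<le> i; i < n\<rbrakk> \<Longrightarrow> T i * T i = 1 + (q - inverse q) \<star> T i"
    and inv: "x * x' = 1" "x' * x = 1"
    and refl_eq: "1 < n \<Longrightarrow> x * T (Suc 0) * x * T (Suc 0) = T (Suc 0) * x * T (Suc 0) * x"
    and x_T: "\<And>i. \<lbrakk>2 \<le> i; i < n\<rbrakk> \<Longrightarrow> x * T i = T i * x"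
    and poly: "peval x (prod_list (map (\<lambda>k. [:- v k, 1:]) [1..<m + 1])) = 0"
  shows "yh_relations d m n q v (case_yh_gen (\<lambda>_. 1) T x x')"
proof -
  have e: "yh_idem d (\<lambda>_. 1 :: 'a) i = 1" for i
  proof -
    have "(of_nat d :: 'a) = of_nat d \<star> 1" for d by (induction d) (simp_all add: cscale_add_left)
    then show ?thesis using d by (simp add: yh_idem_def)
  qed
  have p: "prod_list (map (\<lambda>k. x - v k \<star> 1) [1..<m + 1]) = 0"
    using poly by (simp add: peval_prod_list del: upt_Suc)
  have far': "T i * T j = T j * T i" if "i \<in> {1..<n} \<and> j \<in> {1..<n} \<and> \<bar>int i - int j\<bar> > 1" for i j
    using far[of i j] far[of j i] that by (cases "i < j") auto
  show ?thesis
    unfolding yh_relations_def Let_def yh_gen.case e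
    by (intro conjI allI impI far' p inv)
      (use braid quad refl_eq x_T in \<open>simp_all add: power2_eq_square\<close>)
qed

lemma prod_list_dvd: "k \<in> set ks \<Longrightarrow> f k dvd prod_list (map f ks)" for f :: "_ \<Rightarrow> complex poly"
  by (induction ks) (auto intro: dvd_mult)

text \<open>The indices must differ, not the factors: for two equal parameters this produces the
  square of a linear factor.\<close>

lemma prod_list_dvd2:
  fixes f :: "'k \<Rightarrow> complex poly"
  assumes "s \<in> set ks" "t \<in> set ks" "s \<noteq> t"
  shows "f s * f t dvd prod_list (map f ks)"
  using assms(1,2)
proof (induction ks)
  case (Cons k ks)
  consider "s = k" "t \<in> set ks" | "t = k" "s \<in> set ks" | "s \<in> set ks" "t \<in> set ks" using Cons.prems assms(3) by auto
  then show ?case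
  proof cases
    case 1 then show ?thesis using prod_list_dvd[of t ks f] by (simp add: mult_dvd_mono)
  next
    case 2 then show ?thesis using prod_list_dvd[of s ks f] by (simp add: mult.commute mult_dvd_mono)
  next
    case 3 then show ?thesis using Cons.IH by simp
  qed
qed simp

lemma peval_dvd_zero: "f dvd g \<Longrightarrow> peval x f = 0 \<Longrightarrow> peval x g = 0"
  by (auto simp: dvd_def)

lemma eigen_extend:
  fixes H :: "yh_alg \<Rightarrow> 'b::complex_algebra" and \<chi> :: "yh_alg \<Rightarrow> complex"
  assumes H: "alg_hom H" and \<chi>: "alg_hom \<chi>"
    and gens: "\<And>x. x \<in> yh_gens n0 \<Longrightarrow> H (yh_elt x) * z = \<chi> (yh_elt x) \<star> z"
  shows "H a * z = \<chi> a \<star> z"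
proof -
  interpret H: alg_hom H by (rule H)
  interpret \<chi>: alg_hom \<chi> by (rule \<chi>)
  show ?thesis
  proof (induction a rule: yh_alg_induct)
    case (mult x y)
    then show ?case by (simp add: H.H_mult \<chi>.H_mult mult.assoc) (simp add: mult.commute)
  qed (simp_all add: H.H_scale H.H_one H.H_add \<chi>.H_scale \<chi>.H_one \<chi>.H_add cscale_complex_def distrib_right cscale_add_left gens)
qed

lemma inverse_eigen:
  fixes z :: "'b::complex_algebra"
  assumes "x' * x = 1" "x * z = c \<star> z" "c \<noteq> 0"
  shows "x' * z = inverse c \<star> z"
proof -
  have "z = x' * (x * z)" using assms(1) by (simp add: mult.assoc[symmetric])
  then have "z = c \<star> (x' * z)" by (simp add: assms(2))
  then have "inverse c \<star> z = inverse c \<star> (c \<star> (x' * z))" by (rule arg_cong)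
  then show ?thesis using assms(3) by simp
qed

lemma gens_cases:
  assumes "x \<in> yh_gens n"
  obtains (T) j where "x = GT j" "j \<in> {1..n}" | (G) i where "x = GG i" "1 \<le> i" "i < n" | (X) "x = GX" | (Xinv) "x = GXinv"
  using assms by (auto simp: yh_gens_def)

text \<open>On the two-dimensional space of functions on bool take X = v + N with N^2 = 0 and let
  the g_i act by q. The doubled root permits this. Then X - v maps to N, and
  \<open>nilpotent_image\<close> would force N = 0.\<close>

lemma v_distinct:
  assumes dec: "one_decomposes TYPE(yh_alg)" and st: "s \<in> {1..m0}" "t \<in> {1..m0}" "s \<noteq> t"
  shows "Y0.v s \<noteq> Y0.v t"
proof
  assume eq: "Y0.v s = Y0.v t"
  define v where "v = Y0.v s"
  have v0: "v \<noteq> 0" unfolding v_def using st by (intro Y0.v_nz) auto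
  have q0: "Y0.q \<noteq> 0" by (rule Y0.q_nz)
  define N :: "bool operator" where "N = Operator (\<lambda>F b. if b then F False else 0)"
  have appN: "app N F = (\<lambda>b. if b then F False else 0)" for F
    unfolding N_def by (subst Operator_inverse) (auto simp: linear_map_def)
  have NN: "N * N = 0" by (rule operator_eqI) (simp add: app_simps appN)
  have N0: "N \<noteq> 0"
  proof
    assume "N = 0"
    then have "app N (\<lambda>_. 1) True = app 0 (\<lambda>_. 1) True" by simp
    then show False by (simp add: app_simps appN)
  qed
  have vv: "v * (inverse v * inverse v) = inverse v" using v0 by simp
  define x where "x = v \<star> 1 + N"
  \<comment> \<open>The geometric series for (v + N)^(-1) stops after the linear term.\<close>
  define x' where "x' = inverse v \<star> 1 - (inverse v * inverse v) \<star> N"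
  have "peval x ([:- v, 1:] * [:- v, 1:]) = 0"
    by (simp only: peval_mult) (simp add: x_def NN)
  moreover have "[:- v, 1:] * [:- v, 1:] dvd prod_list (map (\<lambda>k. [:- Y0.v k, 1:]) [1..<m0 + 1])"
    using prod_list_dvd2[of s "[1..<m0 + 1]" t "\<lambda>k. [:- Y0.v k, 1:]"] st eq by (auto simp: v_def simp del: upt_Suc)
  ultimately have poly: "peval x (prod_list (map (\<lambda>k. [:- Y0.v k, 1:]) [1..<m0 + 1])) = 0" by (rule peval_dvd_zero[rotated])
  have "yh_relations d0 m0 n0 Y0.q Y0.v (case_yh_gen (\<lambda>_. 1) (\<lambda>_. Y0.q \<star> 1) x x')"
  proof (rule yh_relations_trivial_t[OF Y0.d_pos])
    show "(Y0.q \<star> 1) * (Y0.q \<star> 1) = 1 + (Y0.q - inverse Y0.q) \<star> (Y0.q \<star> 1 :: bool operator)"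
      using q0 by (simp add: cscale_diff_left algebra_simps)
    show "x * x' = 1" "x' * x = 1"
      using v0 by (simp_all add: x_def x'_def algebra_simps cscale_distribs NN vv)
    show "peval x (prod_list (map (\<lambda>k. [:- Y0.v k, 1:]) [1..<m0 + 1])) = 0" by (rule poly)
  qed simp_all
  from yh_alg_hom[OF this] obtain H :: "yh_alg \<Rightarrow> bool operator" where H: "alg_hom H"
    and Hg: "\<And>y. y \<in> yh_gens n0 \<Longrightarrow> H (yh_elt y) = case_yh_gen (\<lambda>_. 1) (\<lambda>_. Y0.q \<star> 1) x x' y" by blast
  have "1 \<le> s" "s \<le> m0" using st by auto
  from yh_alg_hom[OF Y0.trivial_character[OF this]] obtain \<chi> :: "yh_alg \<Rightarrow> complex" where \<chi>: "alg_hom \<chi>"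
    and \<chi>g: "\<And>y. y \<in> yh_gens n0 \<Longrightarrow> \<chi> (yh_elt y) = case_yh_gen (\<lambda>_. 1) (\<lambda>_. Y0.q) v (inverse v) y"
    unfolding v_def by blast
  interpret H: alg_hom H by (rule H)
  interpret \<chi>: alg_hom \<chi> by (rule \<chi>)
  have xN: "x * N = v \<star> N" by (simp add: x_def distrib_right NN)
  have "x' * x = 1" using v0 by (simp add: x_def x'_def algebra_simps cscale_distribs NN vv)
  note x'N = inverse_eigen[OF this xN v0]
  have X: "GX \<in> yh_gens n0" by (simp add: yh_gens_def)
  have N_eq: "H (yh_elt GX - v \<star> 1) = N" using Hg[OF X] by (simp add: H.H_diff H.H_scale H.H_one x_def)
  have "H (yh_elt GX - v \<star> 1) = 0"
  proof (rule nilpotent_image[OF dec H])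
    show "\<chi> (yh_elt GX - v \<star> 1) = 0" using \<chi>g[OF X] by (simp add: \<chi>.H_diff \<chi>.H_scale \<chi>.H_one cscale_complex_def)
    show "H a * H (yh_elt GX - v \<star> 1) = \<chi> a \<star> H (yh_elt GX - v \<star> 1)" for a
      unfolding N_eq
    proof (rule eigen_extend[OF H \<chi>])
      fix y assume "y \<in> yh_gens n0"
      then show "H (yh_elt y) * N = \<chi> (yh_elt y) \<star> N"
        unfolding Hg[OF \<open>y \<in> yh_gens n0\<close>] \<chi>g[OF \<open>y \<in> yh_gens n0\<close>] by (cases y) (simp_all add: xN x'N)
    qed
  qed
  then show False using N_eq N0 by simp
qed

section \<open>Representations on words\<close>

text \<open>
  Positions in words are counted from 0, so that \<open>swap_op q i\<close> is the action of \<open>g\<^sub>i\<^sub>+\<^sub>1\<close>. In \<open>x_op\<close> the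
  letter \<open>True\<close> stands for the parameter w and \<open>False\<close> for u; the operator is triangular with respect
  to the first letter, and its off-diagonal part is forced by \<open>X\<^sub>2 = g\<^sub>1 X g\<^sub>1\<close> commuting with X.
\<close>

fun swap_op :: "complex \<Rightarrow> nat \<Rightarrow> ('l::linorder list \<Rightarrow> complex) \<Rightarrow> 'l list \<Rightarrow> complex" where
  "swap_op q 0 F (x # y # r) = (if x = y then q * F (x # y # r)
     else if y < x then F (y # x # r) + (q - inverse q) * F (x # y # r) else F (y # x # r))"
| "swap_op q 0 F [x] = 0"
| "swap_op q 0 F [] = 0"
| "swap_op q (Suc i) F (x # r) = swap_op q i (\<lambda>r. F (x # r)) r"
| "swap_op q (Suc i) F [] = 0"

text \<open>A sum over the letters True, each replaced by False in turn, with a factor q or 1/q for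
  every letter in front of it. This is a root vector of quantum sl_2 acting on a tensor power, which
  is why it commutes with \<open>swap_op\<close>.\<close>

fun shift_op :: "complex \<Rightarrow> (bool list \<Rightarrow> complex) \<Rightarrow> bool list \<Rightarrow> complex" where
  "shift_op q G [] = 0"
| "shift_op q G (b # r) = (if b then G (False # r) else 0) + (if b then q else inverse q) * shift_op q (\<lambda>r. G (b # r)) r"

fun x_op :: "complex \<Rightarrow> complex \<Rightarrow> complex \<Rightarrow> (bool list \<Rightarrow> complex) \<Rightarrow> bool list \<Rightarrow> complex" where
  "x_op q u w F [] = u * F []"
| "x_op q u w F (b # r) = (if b then w * F (True # r)
     else u * F (False # r) - (q - inverse q) * w * shift_op q (\<lambda>r. F (True # r)) r)"

text \<open>The sum over the words of length k with exactly l letters False, each weighted by q to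
  the number of pairs with True before False. This linear form will exhibit the character as a
  quotient of the representation on words.\<close>

fun shuffle_sum :: "complex \<Rightarrow> nat \<Rightarrow> nat \<Rightarrow> (bool list \<Rightarrow> complex) \<Rightarrow> complex" where
  "shuffle_sum q 0 l F = (if l = 0 then F [] else 0)"
| "shuffle_sum q (Suc k) l F = (if l = 0 then 0 else shuffle_sum q k (l - 1) (\<lambda>r. F (False # r)))
     + q ^ l * shuffle_sum q k l (\<lambda>r. F (True # r))"

lemma inverse_cancel: "q \<noteq> 0 \<Longrightarrow> q * (inverse q * z) = (z :: complex)" "q \<noteq> 0 \<Longrightarrow> inverse q * (q * z) = z"
  by simp_all

lemma swap_op_add: "swap_op q i (\<lambda>a. F a + G a) xs = swap_op q i F xs + swap_op q i G xs"
proof (induction q i F xs arbitrary: G rule: swap_op.induct)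
  case (1 q F x y r)
  then show ?case by (simp add: algebra_simps)
qed simp_all

lemma swap_op_scale: "swap_op q i (\<lambda>a. c * F a) xs = c * swap_op q i F xs"
  by (induction q i F xs rule: swap_op.induct) (auto simp: algebra_simps)

lemma swap_op_diff: "swap_op q i (\<lambda>a. F a - G a) xs = swap_op q i F xs - swap_op q i G xs"
  using swap_op_add[of q i F "\<lambda>a. - 1 * G a" xs] swap_op_scale[of q i "- 1" G xs] by simp

lemma swap_op_cong: "(\<And>ys. length ys = length xs \<Longrightarrow> F ys = G ys) \<Longrightarrow> swap_op q i F xs = swap_op q i G xs"
  by (induction q i F xs arbitrary: G rule: swap_op.induct) simp_all

lemma swap_op_quad:
  assumes "q \<noteq> 0" "Suc i < length xs"
  shows "swap_op q i (swap_op q i F) xs = F xs + (q - inverse q) * swap_op q i F xs"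
  using assms(2)
proof (induction i arbitrary: F xs)
  case 0
  then obtain x y r where xs: "xs = x # y # r" by (metis Suc_length_conv less_nat_zero_code list.exhaust list.size(3) length_Cons not_less_eq)
  show ?case unfolding xs using assms(1) by (cases x y rule: linorder_cases) (auto simp: algebra_simps)
next
  case (Suc i)
  then obtain x r where xs: "xs = x # r" by (cases xs) auto
  show ?case using Suc.IH[of r "\<lambda>r. F (x # r)"] Suc.prems by (simp add: xs)
qed

lemma swap_op_braid:
  assumes "q \<noteq> 0" "Suc (Suc i) < length xs"
  shows "swap_op q i (swap_op q (Suc i) (swap_op q i F)) xs = swap_op q (Suc i) (swap_op q i (swap_op q (Suc i) F)) xs"
  using assms(2)
proof (induction i arbitrary: F xs)
  case 0
  then obtain x y z r where xs: "xs = x # y # z # r"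
    by (cases xs; cases "tl xs"; cases "tl (tl xs)") auto
  show ?case unfolding xs using assms(1)
    by (cases x y rule: linorder_cases; cases y z rule: linorder_cases; cases x z rule: linorder_cases)
      (auto simp: algebra_simps inverse_cancel)
next
  case (Suc i)
  then obtain x r where xs: "xs = x # r" by (cases xs) auto
  show ?case using Suc.IH[of r "\<lambda>r. F (x # r)"] Suc.prems by (simp add: xs)
qed

lemma swap_op_far:
  assumes "Suc i < j" "Suc j < length xs"
  shows "swap_op q i (swap_op q j F) xs = swap_op q j (swap_op q i F) xs"
  using assms
proof (induction i arbitrary: F xs j)
  case 0
  then obtain x y r where xs: "xs = x # y # r" by (cases xs; cases "tl xs") auto
  obtain k where j: "j = Suc (Suc k)" using 0 by (metis Suc_lessE less_imp_Suc_add add_Suc_right)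
  show ?case unfolding xs j
    by (cases x y rule: linorder_cases) (auto simp: swap_op_add swap_op_scale)
next
  case (Suc i)
  then obtain x r where xs: "xs = x # r" by (cases xs) auto
  obtain k where j: "j = Suc k" using Suc.prems by (cases j) auto
  show ?case using Suc.IH[of k r "\<lambda>r. F (x # r)"] Suc.prems by (simp add: xs j)
qed

lemma swap_op_zero: "swap_op q i (\<lambda>a. 0) xs = 0"
  using swap_op_scale[of q i 0 "\<lambda>a. 0" xs] by simp

lemma shift_op_add: "shift_op q (\<lambda>a. F a + G a) xs = shift_op q F xs + shift_op q G xs"
  by (induction q F xs arbitrary: G rule: shift_op.induct) (simp_all add: distrib_left)

lemma shift_op_scale: "shift_op q (\<lambda>a. c * F a) xs = c * shift_op q F xs"
  by (induction q F xs rule: shift_op.induct) (auto simp: algebra_simps)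

lemma shift_op_diff: "shift_op q (\<lambda>a. F a - G a) xs = shift_op q F xs - shift_op q G xs"
  using shift_op_add[of q F "\<lambda>a. - 1 * G a" xs] shift_op_scale[of q "- 1" G xs] by simp

lemma shift_op_cong: "(\<And>ys. length ys = length xs \<Longrightarrow> F ys = G ys) \<Longrightarrow> shift_op q F xs = shift_op q G xs"
  by (induction q F xs arbitrary: G rule: shift_op.induct) simp_all

lemmas op_linear = swap_op_zero swap_op_add swap_op_scale swap_op_diff shift_op_add shift_op_scale shift_op_diff

text \<open>Needed for X to commute with the generators g_2, g_3, ..., which leave the first letter
  alone.\<close>

lemma shift_op_swap_op:
  assumes q: "q \<noteq> 0" and "Suc i < length xs"
  shows "shift_op q (swap_op q i G) xs = swap_op q i (shift_op q G) xs"
  using assms(2)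
proof (induction i arbitrary: G xs)
  case 0
  then obtain x y r where xs: "xs = x # y # r" by (cases xs; cases "tl xs") auto
  show ?case unfolding xs using q by (cases x; cases y) (simp_all add: op_linear algebra_simps)
next
  case (Suc i)
  then obtain x r where xs: "xs = x # r" by (cases xs) auto
  show ?case using Suc.IH[of r "\<lambda>r. G (x # r)"] Suc.prems by (simp add: xs op_linear)
qed

lemma x_op_swap_op:
  assumes q: "q \<noteq> 0" and "Suc (Suc i) < length xs"
  shows "x_op q u w (swap_op q (Suc i) F) xs = swap_op q (Suc i) (x_op q u w F) xs"
proof -
  obtain b r where xs: "xs = b # r" using assms(2) by (cases xs) auto
  have "Suc i < length r" using assms(2) by (simp add: xs)
  from shift_op_swap_op[OF q this] show ?thesis by (simp add: xs op_linear)
qed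

lemma x_op_braid:
  assumes q: "q \<noteq> 0" and "Suc 0 < length xs"
  shows "x_op q u w (swap_op q 0 (x_op q u w (swap_op q 0 F))) xs = swap_op q 0 (x_op q u w (swap_op q 0 (x_op q u w F))) xs"
proof -
  obtain x y r where xs: "xs = x # y # r" using assms(2) by (cases xs; cases "tl xs") auto
  define p where "p = inverse q"
  have p: "q * (p * z) = z" "p * (q * z) = z" "p * q = 1" "q * p = 1" for z using q by (simp_all add: p_def)
  show ?thesis unfolding xs by (cases x; cases y) (simp_all add: op_linear algebra_simps p flip: p_def)
qed

lemma x_op_linear:
  "x_op q u w (\<lambda>a. F a + G a) xs = x_op q u w F xs + x_op q u w G xs"
  "x_op q u w (\<lambda>a. c * F a) xs = c * x_op q u w F xs"
  by (cases xs; simp add: op_linear algebra_simps)+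

lemma x_op_cong: "(\<And>ys. length ys = length xs \<Longrightarrow> F ys = G ys) \<Longrightarrow> x_op q u w F xs = x_op q u w G xs"
  by (cases xs) (auto intro!: shift_op_cong arg_cong2[where f = "(*)"])

lemma x_op_quad: "x_op q u w (x_op q u w F) xs = (u + w) * x_op q u w F xs - u * w * F xs"
  by (cases xs) (auto simp: op_linear algebra_simps)

lemma shuffle_sum_add: "shuffle_sum q k l (\<lambda>a. F a + G a) = shuffle_sum q k l F + shuffle_sum q k l G"
  by (induction k arbitrary: l F G) (auto simp: algebra_simps)

lemma shuffle_sum_scale: "shuffle_sum q k l (\<lambda>a. c * F a) = c * shuffle_sum q k l F"
  by (induction k arbitrary: l F) (auto simp: algebra_simps)

lemma shuffle_sum_diff: "shuffle_sum q k l (\<lambda>a. F a - G a) = shuffle_sum q k l F - shuffle_sum q k l G"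
  using shuffle_sum_add[of q k l F "\<lambda>a. - 1 * G a"] shuffle_sum_scale[of q k l "- 1" G] by simp

lemma shuffle_sum_cong: "(\<And>ys. length ys = k \<Longrightarrow> F ys = G ys) \<Longrightarrow> shuffle_sum q k l F = shuffle_sum q k l G"
proof (induction k arbitrary: l F G)
  case (Suc k)
  have "shuffle_sum q k l' (\<lambda>r. F (b # r)) = shuffle_sum q k l' (\<lambda>r. G (b # r))" for l' b
    by (rule Suc.IH) (simp add: Suc.prems)
  then show ?case by simp
qed simp

lemmas shuffle_linear = shuffle_sum_add shuffle_sum_scale shuffle_sum_diff

lemma shuffle_sum_zero: "(\<And>ys. length ys = k \<Longrightarrow> F ys = 0) \<Longrightarrow> shuffle_sum q k l F = 0"
  using shuffle_sum_cong[of k F "\<lambda>a. 0 * F a" q l] by (simp only: shuffle_sum_scale) simp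

lemma shuffle_sum_swap_op:
  assumes q: "q \<noteq> 0" and "Suc i < k"
  shows "shuffle_sum q k l (swap_op q i F) = q * shuffle_sum q k l F"
  using assms(2)
proof (induction i arbitrary: k l F)
  case 0
  then obtain k' where k: "k = Suc (Suc k')" by (metis less_imp_Suc_add add_Suc_right plus_1_eq_Suc add.commute)
  consider "l = 0" | "l = 1" | l' where "l = Suc (Suc l')" by (metis One_nat_def old.nat.exhaust)
  then show ?case
    unfolding k using q by cases (simp_all add: shuffle_linear algebra_simps)
next
  case (Suc i)
  then obtain k' where k: "k = Suc k'" by (cases k) auto
  then show ?case using Suc by (simp add: algebra_simps)
qed

text \<open>The symmetric quantum integer (q^l - q^(-l))/(q - 1/q), given by a recursion that
  remains valid for q^2 = 1.\<close>

primrec quantum_int :: "complex \<Rightarrow> nat \<Rightarrow> complex" where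
  "quantum_int q 0 = 0"
| "quantum_int q (Suc l) = inverse q * quantum_int q l + q ^ l"

lemma quantum_int_eq: "q \<noteq> 0 \<Longrightarrow> (q - inverse q) * quantum_int q l = q ^ l - inverse q ^ l"
proof (induction l)
  case (Suc l)
  have "(q - inverse q) * quantum_int q (Suc l) = inverse q * ((q - inverse q) * quantum_int q l) + (q - inverse q) * q ^ l"
    by (simp add: algebra_simps)
  also have "\<dots> = q ^ Suc l - inverse q ^ Suc l"
    unfolding Suc.IH[OF Suc.prems] by (simp add: algebra_simps)
  finally show ?case .
qed simp

text \<open>Turning a True into False leads from words with l + 1 letters False to words with l of
  them when read in the argument of G; summing the weights over the possible letters gives the
  quantum integer.\<close>

lemma shuffle_sum_shift_op: "q \<noteq> 0 \<Longrightarrow> shuffle_sum q k l (shift_op q G) = quantum_int q (Suc l) * shuffle_sum q k (Suc l) G"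
proof (induction k arbitrary: l G)
  case (Suc k)
  show ?case
  proof (cases l)
    case 0
    then show ?thesis using Suc by (simp add: shuffle_linear algebra_simps)
  next
    case (Suc l')
    then show ?thesis using Suc.IH[of l'] Suc.IH[of l] Suc.prems by (simp add: shuffle_linear algebra_simps)
  qed
qed simp

text \<open>On words beginning with True the coefficient is q^l w minus (q - 1/q) [l] w, that is
  q^(-l) w. It equals u q^l exactly by the assumed relation between w and u.\<close>

lemma shuffle_sum_x_op:
  assumes q: "q \<noteq> 0" and w: "w = q ^ (2 * l) * u" and k: "k > 0"
  shows "shuffle_sum q k l (x_op q u w F) = u * shuffle_sum q k l F"
proof -
  obtain k' where k': "k = Suc k'" using k by (cases k) auto
  show ?thesis
  proof (cases l)
    case 0
    then show ?thesis using w by (simp add: k' shuffle_linear algebra_simps)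
  next
    case (Suc l')
    let ?B = "shuffle_sum q k' l (\<lambda>r. F (True # r))"
    have "shuffle_sum q k l (x_op q u w F) = u * shuffle_sum q k' l' (\<lambda>r. F (False # r))
        - ((q - inverse q) * quantum_int q l) * w * ?B + q ^ l * w * ?B"
      using q by (simp add: k' Suc shuffle_linear shuffle_sum_shift_op del: quantum_int.simps)
    also have "\<dots> = u * shuffle_sum q k' l' (\<lambda>r. F (False # r)) + inverse q ^ l * w * ?B"
      unfolding quantum_int_eq[OF q] by (simp add: algebra_simps)
    also have "inverse q ^ l * w = u * q ^ l"
    proof -
      have "q ^ (2 * l) = q ^ l * q ^ l" by (simp add: mult_2 power_add)
      then show ?thesis using q by (simp add: w power_inverse)
    qed
    finally show ?thesis by (simp add: k' Suc algebra_simps)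
  qed
qed

text \<open>This word has no True before a False, so its weight is 1 whatever q is; the linear form
  is therefore non-zero.\<close>

lemma shuffle_sum_indicator:
  "l \<le> k \<Longrightarrow> shuffle_sum q k l (\<lambda>xs. if xs = replicate l False @ replicate (k - l) True then 1 else 0) = 1"
proof (induction k arbitrary: l)
  case (Suc k)
  show ?case
  proof (cases l)
    case 0
    then show ?thesis using Suc.IH[of 0] by simp
  next
    case (Suc l')
    have "shuffle_sum q k l (\<lambda>r. 0) = 0" by (rule shuffle_sum_zero) simp
    then show ?thesis using Suc Suc.IH[of l'] Suc.prems by simp
  qed
qed simp

lemma shuffle_sum_vanish:
  assumes "l < k" "\<And>xs. length xs = k \<Longrightarrow> True \<in> set xs \<Longrightarrow> F xs = 0"
  shows "shuffle_sum q k l F = 0"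
  using assms
proof (induction k arbitrary: l F)
  case (Suc k)
  have "shuffle_sum q k l (\<lambda>r. F (True # r)) = 0" by (rule shuffle_sum_zero) (simp add: Suc.prems)
  moreover have "shuffle_sum q k (l - 1) (\<lambda>r. F (False # r)) = 0" if "l \<noteq> 0"
    using Suc.prems that by (intro Suc.IH) auto
  ultimately show ?case by simp
qed simp

text \<open>The value at a word beginning with False, True is 1/q times the value at the word with
  these letters exchanged, which begins with True. So after a leading False is stripped, the same
  hypotheses hold for shorter words.\<close>

lemma swap_eigen_vanish:
  assumes q: "q \<noteq> 0" and swap: "\<And>i xs. Suc i < n \<Longrightarrow> length xs = n \<Longrightarrow> swap_op q i F xs = q * F xs"
    and first: "\<And>r. length (True # r) = n \<Longrightarrow> F (True # r) = 0"
  shows "length xs = n \<Longrightarrow> True \<in> set xs \<Longrightarrow> F xs = 0"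
  using swap first
proof (induction n arbitrary: F xs)
  case (Suc n)
  obtain b r where xs: "xs = b # r" "length r = n" using Suc.prems(1) by (cases xs) auto
  show ?case
  proof (cases b)
    case True
    then show ?thesis using Suc.prems(4)[of r] xs by simp
  next
    case False
    have "F (False # r) = 0"
    proof (rule Suc.IH[of r "\<lambda>r. F (False # r)"])
      show "length r = n" "True \<in> set r" using xs Suc.prems(2) False by auto
      show "swap_op q i (\<lambda>r. F (False # r)) ys = q * F (False # ys)" if "Suc i < n" "length ys = n" for i ys
        using Suc.prems(3)[of "Suc i" "False # ys"] that by simp
      show "F (False # True # ys) = 0" if "length (True # ys) = n" for ys
        using Suc.prems(3)[of 0 "False # True # ys"] Suc.prems(4)[of "False # ys"] that q by simp
    qed
    then show ?thesis using xs False by simp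
  qed
qed simp

text \<open>The space consists of functions on lists of all lengths. Off length n the operator is
  the scalar q, a root of the quadratic relation, so the relations hold everywhere.\<close>

definition word_T :: "complex \<Rightarrow> nat \<Rightarrow> nat \<Rightarrow> 'l::linorder list operator" where
  "word_T q n i = Operator (\<lambda>F xs. if length xs = n then swap_op q (i - 1) F xs else q * F xs)"

lemma app_word_T: "app (word_T q n i) F = (\<lambda>xs. if length xs = n then swap_op q (i - 1) F xs else q * F xs)"
  unfolding word_T_def
  by (subst Operator_inverse) (auto simp: linear_map_def op_linear algebra_simps)

lemma swap_word_T: "length xs = n \<Longrightarrow> swap_op q i (app (word_T q n j) F) xs = swap_op q i (swap_op q (j - 1) F) xs"
  by (rule swap_op_cong) (simp add: app_word_T)

lemma swap2_word_T: "length xs = n \<Longrightarrow>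
    swap_op q i (app (word_T q n j) (app (word_T q n k) F)) xs = swap_op q i (swap_op q (j - 1) (swap_op q (k - 1) F)) xs"
  by (rule swap_op_cong) (simp add: app_word_T[of _ _ j] swap_word_T)

lemma word_T_relations:
  assumes q: "q \<noteq> 0"
  shows "\<lbrakk>1 \<le> i; Suc i < j; j < n\<rbrakk> \<Longrightarrow> word_T q n i * word_T q n j = (word_T q n j * word_T q n i :: 'l::linorder list operator)"
    and "\<lbrakk>1 \<le> i; Suc i < n\<rbrakk> \<Longrightarrow> word_T q n i * word_T q n (Suc i) * word_T q n i
      = (word_T q n (Suc i) * word_T q n i * word_T q n (Suc i) :: 'l list operator)"
    and "\<lbrakk>1 \<le> i; i < n\<rbrakk> \<Longrightarrow> word_T q n i * word_T q n i = 1 + (q - inverse q) \<star> (word_T q n i :: 'l list operator)"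
proof -
  show "word_T q n i * word_T q n j = (word_T q n j * word_T q n i :: 'l list operator)" if "1 \<le> i" "Suc i < j" "j < n"
  proof (rule operator_eqI, rule ext)
    fix F xs
    show "app (word_T q n i * word_T q n j) F xs = app (word_T q n j * word_T q n i) F xs"
      using swap_op_far[of "i - 1" "j - 1" xs q F] that unfolding app_simps
      by (cases "length xs = n") (simp_all add: app_word_T[of _ _ _ "app _ _"] swap_word_T, simp add: app_word_T)
  qed
  show "word_T q n i * word_T q n (Suc i) * word_T q n i = (word_T q n (Suc i) * word_T q n i * word_T q n (Suc i) :: 'l list operator)"
    if i1: "1 \<le> i" "Suc i < n"
  proof (rule operator_eqI, rule ext)
    fix F and xs :: "'l list"
    obtain k where i: "i = Suc k" using i1 by (cases i) auto
    show "app (word_T q n i * word_T q n (Suc i) * word_T q n i) F xs = app (word_T q n (Suc i) * word_T q n i * word_T q n (Suc i)) F xs"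
    proof (cases "length xs = n")
      case True
      have T: "app (word_T q n j) G xs = swap_op q (j - 1) G xs" for j and G :: "'l list \<Rightarrow> complex"
        using True by (simp add: app_word_T)
      show ?thesis using swap_op_braid[OF q, of k xs F] i1 True by (simp add: app_simps T swap2_word_T i)
    next
      case False
      then show ?thesis by (simp add: app_simps app_word_T)
    qed
  qed
  show "word_T q n i * word_T q n i = 1 + (q - inverse q) \<star> (word_T q n i :: 'l list operator)" if "1 \<le> i" "i < n"
  proof (rule operator_eqI, rule ext)
    fix F xs
    show "app (word_T q n i * word_T q n i) F xs = app (1 + (q - inverse q) \<star> word_T q n i) F xs"
      using swap_op_quad[OF q, of "i - 1" xs F] that q unfolding app_simps
      by (cases "length xs = n") (simp_all add: app_word_T[of _ _ _ "app _ _"] swap_word_T, simp_all add: app_word_T algebra_simps)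
  qed
qed

text \<open>Off length n the operator is the scalar u, one of its two eigenvalues.\<close>

definition word_X :: "complex \<Rightarrow> nat \<Rightarrow> complex \<Rightarrow> complex \<Rightarrow> bool list operator" where
  "word_X q n u w = Operator (\<lambda>F xs. if length xs = n then x_op q u w F xs else u * F xs)"

lemma app_word_X: "app (word_X q n u w) F = (\<lambda>xs. if length xs = n then x_op q u w F xs else u * F xs)"
  unfolding word_X_def
  by (subst Operator_inverse) (auto simp: linear_map_def x_op_linear algebra_simps)

lemma swap_word_X: "length xs = n \<Longrightarrow> swap_op q i (app (word_X q n u w) F) xs = swap_op q i (x_op q u w F) xs"
  by (rule swap_op_cong) (simp add: app_word_X)

lemma x_word_T: "length xs = n \<Longrightarrow> x_op q u w (app (word_T q n i) F) xs = x_op q u w (swap_op q (i - 1) F) xs"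
  by (rule x_op_cong) (simp add: app_word_T)

lemma x_word_X: "length xs = n \<Longrightarrow> x_op q u w (app (word_X q n u w) F) xs = x_op q u w (x_op q u w F) xs"
  by (rule x_op_cong) (simp add: app_word_X)

lemma word_X_relations:
  assumes q: "q \<noteq> 0"
  shows "1 < n \<Longrightarrow> word_X q n u w * word_T q n 1 * word_X q n u w * word_T q n 1
      = word_T q n 1 * word_X q n u w * word_T q n 1 * word_X q n u w"
    and "\<lbrakk>2 \<le> i; i < n\<rbrakk> \<Longrightarrow> word_X q n u w * word_T q n i = word_T q n i * word_X q n u w"
    and "word_X q n u w * word_X q n u w = (u + w) \<star> word_X q n u w - (u * w) \<star> 1"
proof -
  show "word_X q n u w * word_T q n 1 * word_X q n u w * word_T q n 1 = word_T q n 1 * word_X q n u w * word_T q n 1 * word_X q n u w"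
    if n: "1 < n"
  proof (rule operator_eqI, rule ext)
    fix F :: "bool list \<Rightarrow> complex" and xs
    let ?T = "word_T q n 1" and ?X = "word_X q n u w"
    show "app (?X * ?T * ?X * ?T) F xs = app (?T * ?X * ?T * ?X) F xs"
    proof (cases "length xs = n")
      case True
      have 1: "swap_op q 0 (app ?X (app ?T F)) ys = swap_op q 0 (x_op q u w (swap_op q 0 F)) ys" if "length ys = n" for ys
        by (rule swap_op_cong) (use that in \<open>simp add: app_word_X x_word_T\<close>)
      have 2: "x_op q u w (app ?T (app ?X F)) ys = x_op q u w (swap_op q 0 (x_op q u w F)) ys" if "length ys = n" for ys
        by (rule x_op_cong) (use that in \<open>simp add: app_word_T[of _ _ _ "app _ _"] swap_word_X\<close>)
      have X: "app ?X G ys = x_op q u w G ys" and T: "app ?T G ys = swap_op q 0 G ys" if "length ys = n" for G ys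
        using that by (simp_all add: app_word_X app_word_T)
      have "app ?X (app ?T (app ?X (app ?T F))) xs = x_op q u w (swap_op q 0 (x_op q u w (swap_op q 0 F))) xs"
        unfolding X[OF True] by (rule x_op_cong) (simp only: True T 1)
      moreover have "app ?T (app ?X (app ?T (app ?X F))) xs = swap_op q 0 (x_op q u w (swap_op q 0 (x_op q u w F))) xs"
        unfolding T[OF True] by (rule swap_op_cong) (simp only: True X 2)
      ultimately show ?thesis unfolding app_simps using x_op_braid[OF q, of xs u w F] True n by simp
    next
      case False
      then show ?thesis unfolding app_simps by (simp add: app_word_T app_word_X)
    qed
  qed
  show "word_X q n u w * word_T q n i = word_T q n i * word_X q n u w" if i2: "2 \<le> i" "i < n"
  proof (rule operator_eqI, rule ext)
    fix F :: "bool list \<Rightarrow> complex" and xs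
    obtain k where i: "i = Suc (Suc k)" using i2 by (metis add_2_eq_Suc le_Suc_ex)
    show "app (word_X q n u w * word_T q n i) F xs = app (word_T q n i * word_X q n u w) F xs"
      using x_op_swap_op[OF q, of k xs u w F] i2 unfolding app_simps i
      by (cases "length xs = n") (simp_all add: app_word_T[of _ _ _ "app _ _"] app_word_X[of _ _ _ _ "app _ _"] swap_word_X x_word_T, simp add: app_word_T app_word_X)
  qed
  show "word_X q n u w * word_X q n u w = (u + w) \<star> word_X q n u w - (u * w) \<star> 1"
  proof (rule operator_eqI, rule ext)
    fix F :: "bool list \<Rightarrow> complex" and xs
    show "app (word_X q n u w * word_X q n u w) F xs = app ((u + w) \<star> word_X q n u w - (u * w) \<star> 1) F xs"
      unfolding app_simps using x_op_quad[of q u w F xs]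
      by (cases "length xs = n") (simp_all add: app_word_X[of _ _ _ _ "app _ _"] x_word_X, simp_all add: app_word_X algebra_simps)
  qed
qed

text \<open>Semisimplicity would lift the quotient to an eigenvector \<xi> on which the linear form
  does not vanish. The X-eigenvalue u makes \<xi> vanish on words beginning with True, for which u
  and w must differ; this is why \<open>v_distinct\<close> comes first. The g-eigenvalues spread
  this to all words containing True. As l < n, the form sees only such words.\<close>

lemma v_separated:
  assumes dec: "one_decomposes TYPE(yh_alg)" and sk: "s \<in> {1..m0}" "k \<in> {1..m0}" "s \<noteq> k" and l: "l < n0"
  shows "Y0.q ^ (2 * l) * Y0.v s \<noteq> Y0.v k"
proof
  assume eq: "Y0.q ^ (2 * l) * Y0.v s = Y0.v k"
  define q u w where "q = Y0.q" and "u = Y0.v s" and "w = Y0.v k"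
  have w: "w = q ^ (2 * l) * u" using eq by (simp add: q_def u_def w_def)
  have uw: "u \<noteq> w" using v_distinct[OF dec sk] by (simp add: u_def w_def)
  have u0: "u \<noteq> 0" and w0: "w \<noteq> 0" unfolding u_def w_def using sk Y0.v_nz by auto
  have q0: "q \<noteq> 0" unfolding q_def by (rule Y0.q_nz)
  have n: "n0 > 0" by (rule Y0.n_pos)
  let ?T = "word_T q n0 :: nat \<Rightarrow> bool list operator" and ?X = "word_X q n0 u w"
  define X' where "X' = (1 / (u * w)) \<star> ((u + w) \<star> 1 - ?X)"
  have XX: "?X * ?X = (u + w) \<star> ?X - (u * w) \<star> 1" by (rule word_X_relations(3)[OF q0])
  have inv: "?X * X' = 1" "X' * ?X = 1"
    using u0 w0 by (simp_all add: X'_def algebra_simps XX)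
  have "peval ?X ([:- u, 1:] * [:- w, 1:]) = 0"
    by (simp only: peval_mult) (simp add: algebra_simps XX cscale_distribs)
  moreover have "[:- u, 1:] * [:- w, 1:] dvd prod_list (map (\<lambda>k. [:- Y0.v k, 1:]) [1..<m0 + 1])"
    using prod_list_dvd2[of s "[1..<m0 + 1]" k "\<lambda>k. [:- Y0.v k, 1:]"] sk by (auto simp: u_def w_def simp del: upt_Suc)
  ultimately have poly: "peval ?X (prod_list (map (\<lambda>k. [:- Y0.v k, 1:]) [1..<m0 + 1])) = 0" by (rule peval_dvd_zero[rotated])
  have "yh_relations d0 m0 n0 Y0.q Y0.v (case_yh_gen (\<lambda>_. 1) ?T ?X X')"
    unfolding q_def[symmetric]
  proof (rule yh_relations_trivial_t[OF Y0.d_pos])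
    show "?X * ?T (Suc 0) * ?X * ?T (Suc 0) = ?T (Suc 0) * ?X * ?T (Suc 0) * ?X" if "1 < n0"
      using word_X_relations(1)[OF q0 that, of u w] by simp
  qed (fact word_T_relations[OF q0] inv poly word_X_relations(2)[OF q0])+
  from yh_alg_hom[OF this] obtain H :: "yh_alg \<Rightarrow> bool list operator" where H: "alg_hom H"
    and Hg: "\<And>y. y \<in> yh_gens n0 \<Longrightarrow> H (yh_elt y) = case_yh_gen (\<lambda>_. 1) ?T ?X X' y" by blast
  have "1 \<le> s" "s \<le> m0" using sk by auto
  from yh_alg_hom[OF Y0.trivial_character[OF this]] obtain \<chi> :: "yh_alg \<Rightarrow> complex" where \<chi>: "alg_hom \<chi>"
    and \<chi>g: "\<And>y. y \<in> yh_gens n0 \<Longrightarrow> \<chi> (yh_elt y) = case_yh_gen (\<lambda>_. 1) (\<lambda>_. q) u (inverse u) y"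
    unfolding q_def u_def by blast
  interpret H: alg_hom H by (rule H)
  interpret \<chi>: alg_hom \<chi> by (rule \<chi>)
  \<comment> \<open>This form intertwines the representation H with the character \<chi>; it is
    checked on generators and extended by \<open>yh_alg_induct\<close>.\<close>
  let ?lam = "shuffle_sum q n0 l"
  have lamT: "?lam (app (?T i) F) = q * ?lam F" if "1 \<le> i" "i < n0" for i F
  proof -
    have "?lam (app (?T i) F) = ?lam (swap_op q (i - 1) F)" by (rule shuffle_sum_cong) (simp add: app_word_T)
    then show ?thesis using shuffle_sum_swap_op[OF q0, of "i - 1" n0 l F] that by simp
  qed
  have lamX: "?lam (app ?X F) = u * ?lam F" for F
  proof -
    have "?lam (app ?X F) = ?lam (x_op q u w F)" by (rule shuffle_sum_cong) (simp add: app_word_X)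
    then show ?thesis using shuffle_sum_x_op[OF q0 w n] by simp
  qed
  have lamX': "?lam (app X' F) = inverse u * ?lam F" for F
  proof -
    have "app ?X (app X' F) = F" using inv(1) by (metis app_simps(2,6))
    then show ?thesis using lamX[of "app X' F"] u0 by (simp add: field_simps)
  qed
  have lam: "?lam (app (H a) F) = \<chi> a * ?lam F" for a F
  proof (induction a arbitrary: F rule: yh_alg_induct)
    case (gen y)
    then show ?case unfolding Hg[OF gen] \<chi>g[OF gen]
      by (cases rule: gens_cases) (simp_all add: app_simps lamT lamX lamX')
  qed (simp_all add: H.H_scale H.H_one H.H_add H.H_mult \<chi>.H_scale \<chi>.H_one \<chi>.H_add \<chi>.H_mult app_simps
      cscale_complex_def shuffle_linear distrib_right mult.assoc)
  obtain e where e: "\<chi> e \<noteq> 0" "\<And>a. a * e = \<chi> a \<star> e" using character_idempotent[OF dec \<chi>] by blast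
  \<comment> \<open>A test function on which the form takes the value 1, so that the form takes the
    value \<chi>(e) on \<xi>.\<close>
  define F0 where "F0 = (\<lambda>xs. if xs = replicate l False @ replicate (n0 - l) True then 1 else 0 :: complex)"
  define \<xi> where "\<xi> = app (H e) F0"
  have act: "app (H a) \<xi> = (\<lambda>xs. \<chi> a * \<xi> xs)" for a
  proof -
    have "app (H a) \<xi> = app (H (a * e)) F0" by (simp add: \<xi>_def H.H_mult app_simps)
    then show ?thesis by (simp add: e(2) H.H_scale app_simps \<xi>_def)
  qed
  have swap: "swap_op q i \<xi> xs = q * \<xi> xs" if i: "Suc i < n0" and xs: "length xs = n0" for i xs
  proof -
    have g: "GG (Suc i) \<in> yh_gens n0" using i by (simp add: yh_gens_def)
    show ?thesis using fun_cong[OF act[of "yh_elt (GG (Suc i))"], of xs] xs by (simp add: Hg[OF g] \<chi>g[OF g] app_word_T)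
  qed
  have first: "\<xi> (True # r) = 0" if "length (True # r) = n0" for r
  proof -
    have g: "GX \<in> yh_gens n0" by (simp add: yh_gens_def)
    have "w * \<xi> (True # r) = u * \<xi> (True # r)"
      using fun_cong[OF act[of "yh_elt GX"], of "True # r"] that by (simp add: Hg[OF g] \<chi>g[OF g] app_word_X)
    then show ?thesis using uw by simp
  qed
  have "?lam \<xi> = 0"
    by (rule shuffle_sum_vanish[OF l]) (rule swap_eigen_vanish[OF q0 swap first])
  moreover have "?lam \<xi> = \<chi> e" unfolding \<xi>_def lam using shuffle_sum_indicator[of l n0 q] l by (simp add: F0_def)
  ultimately show False using e(1) by simp
qed

section \<open>The q-symmetrizer and the quantum factorial\<close>

primrec descending :: "(nat \<Rightarrow> 'a::monoid_mult) \<Rightarrow> nat \<Rightarrow> nat \<Rightarrow> 'a" where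
  "descending g k 0 = 1"
| "descending g k (Suc l) = g (k - l) * descending g k l"

text \<open>For braid generators this is the sum of q^length(w) g_w over the symmetric group on k
  letters, factored along the chain of its standard subgroups; \<open>descending\<close> runs
  through the coset representatives.\<close>

primrec symmetrizer :: "complex \<Rightarrow> (nat \<Rightarrow> 'a::complex_algebra) \<Rightarrow> nat \<Rightarrow> 'a" where
  "symmetrizer q g 0 = 1"
| "symmetrizer q g (Suc k) = (\<Sum>l\<le>k. q ^ l \<star> descending g k l) * symmetrizer q g k"

lemma (in alg_hom) H_descending: "H (descending g k l) = descending (\<lambda>i. H (g i)) k l"
  by (induction l) (simp_all add: H_one H_mult)

lemma (in alg_hom) H_symmetrizer: "H (symmetrizer q g k) = symmetrizer q (\<lambda>i. H (g i)) k"
  by (induction k) (simp_all add: H_one H_mult H_sum H_scale H_descending)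

lemma descending_cong: "l \<le> k \<Longrightarrow> (\<And>i. 1 \<le> i \<Longrightarrow> i \<le> k \<Longrightarrow> g i = g' i) \<Longrightarrow> descending g k l = descending g' k l"
  by (induction l) simp_all

lemma symmetrizer_cong: "(\<And>i. 1 \<le> i \<Longrightarrow> i < k \<Longrightarrow> g i = g' i) \<Longrightarrow> symmetrizer q g k = symmetrizer q g' k"
proof (induction k)
  case (Suc k)
  have "descending g k l = descending g' k l" if "l \<le> k" for l by (rule descending_cong[OF that]) (simp add: Suc.prems)
  then show ?case using Suc by simp
qed simp

text \<open>The value at the character g_i = q is the Poincare polynomial at q^2, that is, the first
  factor of P.\<close>

lemma symmetrizer_const: "symmetrizer q (\<lambda>_. q) k = (\<Prod>j=1..k. \<Sum>i<j. q ^ (2 * i))"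
proof (induction k)
  case (Suc k)
  have d: "descending (\<lambda>_. q) k l = q ^ l" for l by (induction l) simp_all
  have "(\<Sum>l\<le>k. q ^ l \<star> descending (\<lambda>_. q) k l) = (\<Sum>i<Suc k. q ^ (2 * i))"
    unfolding d lessThan_Suc_atMost by (simp add: cscale_complex_def mult_2 flip: power_add)
  then show ?case using Suc by (simp add: mult.commute)
qed simp

locale braid_generators =
  fixes n :: nat and q :: complex and g :: "nat \<Rightarrow> 'a::complex_algebra"
  assumes q0: "q \<noteq> 0"
    and far: "\<lbrakk>1 \<le> i; Suc i < j; j < n\<rbrakk> \<Longrightarrow> g i * g j = g j * g i"
    and braid: "\<lbrakk>1 \<le> i; Suc i < n\<rbrakk> \<Longrightarrow> g i * g (Suc i) * g i = g (Suc i) * g i * g (Suc i)"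
    and quad: "\<lbrakk>1 \<le> i; i < n\<rbrakk> \<Longrightarrow> g i * g i = 1 + (q - inverse q) \<star> g i"
begin

lemma descending_commute: "\<lbrakk>1 \<le> i; i + l < k; k < n\<rbrakk> \<Longrightarrow> g i * descending g k l = descending g k l * g i"
proof (induction l)
  case (Suc l)
  have f: "g i * g (k - l) = g (k - l) * g i" by (rule far) (use Suc.prems in auto)
  show ?case using Suc by (simp add: mult_assoc_rule[OF f] mult.assoc)
qed simp

lemma descending_shift:
  "\<lbrakk>l \<le> k; k < n; k < i + l - 1; i \<le> k\<rbrakk> \<Longrightarrow> g i * descending g k l = descending g k l * g (i - 1)"
proof (induction l)
  case (Suc l)
  show ?case
  proof (cases "k < i + l - 1")
    case True
    have f: "g (k - l) * g i = g i * g (k - l)" by (rule far) (use True Suc.prems in auto)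
    show ?thesis using Suc True by (simp add: mult_assoc_rule[OF f[symmetric]] mult.assoc)
  next
    case False
    then obtain l' where l: "l = Suc l'" "i = k - l'" using Suc.prems by (cases l) auto
    define j where "j = k - Suc l'"
    have j: "1 \<le> j" "k - l' = Suc j" "Suc j < n" "i = Suc j" "k - Suc l' = j" using Suc.prems l by (auto simp: j_def)
    have c: "g j * descending g k l' = descending g k l' * g j"
      by (rule descending_commute) (use j Suc.prems l in auto)
    have "g i * descending g k (Suc l) = g (Suc j) * g j * g (Suc j) * descending g k l'"
      by (simp add: l j mult.assoc)
    also have "\<dots> = g j * g (Suc j) * (g j * descending g k l')"
      unfolding braid[OF j(1,3), symmetric] by (simp add: mult.assoc)
    also have "\<dots> = descending g k (Suc l) * g (i - 1)"
      unfolding c by (simp add: l j mult.assoc)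
    finally show ?thesis .
  qed
qed simp

text \<open>Multiplication by g_i acts on the coset representatives. Those of length k - i and k - i
  + 1 form a pair on which the quadratic relation yields the eigenvalue q; through every other one
  g_i passes, as g_i or as g_(i-1), and is absorbed by the smaller symmetrizer.\<close>

lemma symmetrizer_eigen: "\<lbrakk>k \<le> n; 1 \<le> i; i < k\<rbrakk> \<Longrightarrow> g i * symmetrizer q g k = q \<star> symmetrizer q g k"
proof (induction k arbitrary: i)
  case (Suc k)
  let ?x = "symmetrizer q g k" and ?P = "descending g k"
  let ?f = "\<lambda>l. q ^ l \<star> (?P l * ?x)"
  define a where "a = k - i"
  have a: "Suc a \<le> k" "k - a = i" using Suc.prems by (auto simp: a_def)
  have IH: "g j * ?x = q \<star> ?x" if "1 \<le> j" "j < k" for j using Suc that by simp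
  have rest: "g i * ?f l = q \<star> ?f l" if "l \<le> k" "l \<noteq> a" "l \<noteq> Suc a" for l
  proof (cases "l < a")
    case True
    have "g i * ?P l = ?P l * g i" by (rule descending_commute) (use True Suc.prems in \<open>auto simp: a_def\<close>)
    then show ?thesis using IH[of i] True Suc.prems by (simp add: mult_assoc_rule a_def mult.assoc mult.commute)
  next
    case False
    then have l: "Suc a < l" using that by simp
    have "g i * ?P l = ?P l * g (i - 1)" by (rule descending_shift) (use l that Suc.prems in \<open>auto simp: a_def\<close>)
    then show ?thesis using IH[of "i - 1"] l that Suc.prems by (simp add: mult_assoc_rule a_def mult.assoc mult.commute)
  qed
  have pair: "g i * (?f a + ?f (Suc a)) = q \<star> (?f a + ?f (Suc a))"
  proof -
    have gi: "g i * ?P a = ?P (Suc a)" by (simp add: a)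
    have gg: "g i * ?P (Suc a) = ?P a + (q - inverse q) \<star> ?P (Suc a)"
      using quad[of i] Suc.prems by (simp add: a mult.assoc[symmetric] distrib_right)
    have "g i * (?f a + ?f (Suc a)) = q ^ a \<star> (?P (Suc a) * ?x) + q ^ Suc a \<star> ((?P a + (q - inverse q) \<star> ?P (Suc a)) * ?x)"
      by (simp only: distrib_left cscale_mult_right mult.assoc[symmetric] gi gg)
    also have "\<dots> = q ^ Suc a \<star> (?P a * ?x) + (q ^ a + q ^ Suc a * (q - inverse q)) \<star> (?P (Suc a) * ?x)"
      by (simp add: distrib_right cscale_add_right cscale_add_left del: descending.simps)
    also have "q ^ a + q ^ Suc a * (q - inverse q) = q * q ^ Suc a" using q0 by (simp add: algebra_simps)
    finally show ?thesis by (simp add: cscale_add_right del: descending.simps)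
  qed
  have split: "(\<Sum>l\<le>k. ?f l) = ?f a + ?f (Suc a) + (\<Sum>l\<in>{..k} - {a, Suc a}. ?f l)"
    using a(1) by (subst sum.subset_diff[of "{a, Suc a}"]) (auto simp: add.commute)
  have "symmetrizer q g (Suc k) = (\<Sum>l\<le>k. ?f l)" by (simp add: sum_distrib_right)
  moreover have "g i * (\<Sum>l\<le>k. ?f l) = q \<star> (\<Sum>l\<le>k. ?f l)"
  proof -
    have r: "g i * (\<Sum>l\<in>{..k} - {a, Suc a}. ?f l) = q \<star> (\<Sum>l\<in>{..k} - {a, Suc a}. ?f l)"
      unfolding sum_distrib_left cscale_sum_right by (rule sum.cong[OF refl], rule rest) auto
    show ?thesis
      by (simp only: split distrib_left[of "g i" "?f a + ?f (Suc a)"] pair r cscale_add_right)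
  qed
  ultimately show ?case by simp
qed simp

end

lemma swap_op_nth:
  "Suc i < length xs \<Longrightarrow> swap_op q i F xs = (if xs ! i = xs ! Suc i then q * F xs
     else (if xs ! Suc i < xs ! i then (q - inverse q) * F xs else 0) + F (xs[i := xs ! Suc i, Suc i := xs ! i]))"
proof (induction i arbitrary: F xs)
  case 0
  then obtain x y r where xs: "xs = x # y # r" by (cases xs; cases "tl xs") auto
  show ?case by (simp add: xs)
next
  case (Suc i)
  then obtain x r where xs: "xs = x # r" by (cases xs) auto
  show ?case using Suc.IH[of r "\<lambda>r. F (x # r)"] Suc.prems by (simp add: xs)
qed

context
  fixes q :: complex and n :: nat
begin

text \<open>Generators with index below k rearrange only the positions below k, counted from 0;
  starting from the indicator of the identity word, the support stays in this form.\<close>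

definition fixed_beyond :: "nat \<Rightarrow> (nat list \<Rightarrow> complex) set" where
  "fixed_beyond k = {F. \<forall>xs p. length xs = n \<longrightarrow> k \<le> p \<longrightarrow> p < n \<longrightarrow> xs ! p \<noteq> p \<longrightarrow> F xs = 0}"

lemma fixed_beyondD: "F \<in> fixed_beyond k \<Longrightarrow> length xs = n \<Longrightarrow> k \<le> p \<Longrightarrow> p < n \<Longrightarrow> xs ! p \<noteq> p \<Longrightarrow> F xs = 0"
  by (auto simp: fixed_beyond_def)

lemma word_T_fixed_beyond:
  assumes F: "F \<in> fixed_beyond k" and i: "1 \<le> i" "i < k" "k \<le> n"
  shows "app (word_T q n i) F \<in> fixed_beyond k"
  unfolding fixed_beyond_def
proof (intro CollectI allI impI)
  fix xs p assume xs: "length xs = n" and p: "k \<le> p" "p < n" "xs ! p \<noteq> p"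
  have F0: "F xs = 0" using fixed_beyondD[OF F xs p] .
  have "F (xs[i - 1 := xs ! Suc (i - 1), Suc (i - 1) := xs ! (i - 1)]) = 0"
    by (rule fixed_beyondD[OF F _ p(1,2)]) (use xs p i in auto)
  then show "app (word_T q n i) F xs = 0"
    using xs i F0 by (simp add: app_word_T swap_op_nth)
qed

lemma descending_fixed_beyond:
  "\<lbrakk>F \<in> fixed_beyond (Suc k); l \<le> k; Suc k \<le> n\<rbrakk> \<Longrightarrow> app (descending (word_T q n) k l) F \<in> fixed_beyond (Suc k)"
  by (induction l) (simp_all add: app_simps word_T_fixed_beyond)

text \<open>Each generator is evaluated where the letters are in ascending order, so it only
  exchanges them. The small letter travels to position k, where F admits nothing but the letter
  k.\<close>

lemma descending_vanish:
  assumes F: "F \<in> fixed_beyond k" and k: "k < n"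
  shows "\<lbrakk>l \<le> k; length xs = n; xs ! (k - l) < k; xs ! (k - l) \<le> k - l; \<And>p. k - l < p \<Longrightarrow> p < n \<Longrightarrow> xs ! p = p\<rbrakk>
    \<Longrightarrow> app (descending (word_T q n) k l) F xs = 0"
proof (induction l arbitrary: xs)
  case 0
  then show ?case using fixed_beyondD[OF F, of xs k] k by (simp add: app_simps)
next
  case (Suc l)
  define i where "i = k - Suc l"
  have i: "k - l = Suc i" "i = k - Suc l" "Suc i < n" using Suc.prems(1) k by (auto simp: i_def)
  let ?ys = "xs[i := xs ! Suc i, Suc i := xs ! i]"
  have "app (descending (word_T q n) k l) F ?ys = 0"
  proof (rule Suc.IH)
    show "?ys ! p = p" if "k - l < p" "p < n" for p using Suc.prems(5)[of p] that i by (simp add: i(1))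
  qed (use Suc.prems i in \<open>auto\<close>)
  moreover have "xs ! i < xs ! Suc i" using Suc.prems(4) Suc.prems(5)[of "Suc i"] i by simp
  ultimately show ?case
    using Suc.prems(2) i by (simp add: app_simps app_word_T swap_op_nth)
qed

text \<open>At the identity word only the coset representative 1 contributes, so the value stays 1
  for every q, even when the quantum factorial vanishes.\<close>

lemma symmetrizer_nonzero:
  defines "F0 \<equiv> \<lambda>xs. if xs = [0..<n] then 1 else 0"
  shows "k \<le> n \<Longrightarrow> app (symmetrizer q (word_T q n) k) F0 \<in> fixed_beyond k \<and> app (symmetrizer q (word_T q n) k) F0 [0..<n] = 1"
proof (induction k)
  case 0
  show ?case by (auto simp: fixed_beyond_def app_simps F0_def)
next
  case (Suc k)
  let ?G = "app (symmetrizer q (word_T q n) k) F0"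
  have G: "?G \<in> fixed_beyond k" "?G [0..<n] = 1" and k: "k < n" using Suc by auto
  have G': "?G \<in> fixed_beyond (Suc k)"
    unfolding fixed_beyond_def
  proof (intro CollectI allI impI)
    fix xs p assume "length xs = n" "Suc k \<le> p" "p < n" "xs ! p \<noteq> p"
    then show "?G xs = 0" using fixed_beyondD[OF G(1), of xs p] by simp
  qed
  have eq: "app (symmetrizer q (word_T q n) (Suc k)) F0 = (\<lambda>xs. \<Sum>l\<le>k. q ^ l * app (descending (word_T q n) k l) ?G xs)"
    by (simp add: app_simps app_sum)
  have "app (symmetrizer q (word_T q n) (Suc k)) F0 \<in> fixed_beyond (Suc k)"
    unfolding eq fixed_beyond_def
  proof (intro CollectI allI impI sum.neutral ballI)
    fix xs p l assume "length xs = n" "Suc k \<le> p" "p < n" "xs ! p \<noteq> p" "l \<in> {..k}"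
    then show "q ^ l * app (descending (word_T q n) k l) ?G xs = 0"
      using fixed_beyondD[OF descending_fixed_beyond[OF G', of l], of xs p] k by simp
  qed
  moreover have "app (symmetrizer q (word_T q n) (Suc k)) F0 [0..<n] = 1"
  proof -
    have z: "app (descending (word_T q n) k l) ?G [0..<n] = 0" if "l \<in> {..k} - {0}" for l
      by (rule descending_vanish[OF G(1) k]) (use that k in auto)
    have "(\<Sum>l\<le>k. q ^ l * app (descending (word_T q n) k l) ?G [0..<n]) = q ^ 0 * app (descending (word_T q n) k 0) ?G [0..<n]"
      by (subst sum.remove[of _ 0]) (simp_all add: z)
    then show ?thesis unfolding eq using G(2) by (simp add: app_simps)
  qed
  ultimately show ?case by blast
qed

end

text \<open>If the quantum factorial vanished, so would \<chi> on the symmetrizer, and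
  \<open>nilpotent_image\<close> would make it act by 0 on words in n distinct letters. X may act by
  the scalar v_1 here, because only the g_i matter.\<close>

lemma quantum_factorial_nonzero:
  assumes dec: "one_decomposes TYPE(yh_alg)"
  shows "(\<Prod>j=1..n0. \<Sum>i<j. Y0.q ^ (2 * i)) \<noteq> 0"
proof
  assume zero: "(\<Prod>j=1..n0. \<Sum>i<j. Y0.q ^ (2 * i)) = 0"
  define q u where "q = Y0.q" and "u = Y0.v 1"
  have m: "1 \<le> (1 :: nat)" "1 \<le> m0" using Y0.m_pos by auto
  have u0: "u \<noteq> 0" unfolding u_def using m by (intro Y0.v_nz)
  have q0: "q \<noteq> 0" unfolding q_def by (rule Y0.q_nz)
  let ?T = "word_T q n0 :: nat \<Rightarrow> nat list operator"
  have "peval (u \<star> 1 :: nat list operator) [:- u, 1:] = 0" by simp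
  moreover have "[:- u, 1:] dvd prod_list (map (\<lambda>k. [:- Y0.v k, 1:]) [1..<m0 + 1])"
    unfolding u_def by (rule prod_list_dvd[of 1]) (use m in auto)
  ultimately have poly: "peval (u \<star> 1 :: nat list operator) (prod_list (map (\<lambda>k. [:- Y0.v k, 1:]) [1..<m0 + 1])) = 0"
    by (rule peval_dvd_zero[rotated])
  have "yh_relations d0 m0 n0 Y0.q Y0.v (case_yh_gen (\<lambda>_. 1) ?T (u \<star> 1) (inverse u \<star> 1))"
    unfolding q_def[symmetric]
  proof (rule yh_relations_trivial_t[OF Y0.d_pos])
    show "(u \<star> 1) * (inverse u \<star> 1) = (1 :: nat list operator)" "(inverse u \<star> 1) * (u \<star> 1) = (1 :: nat list operator)"
      using u0 by simp_all
  qed (fact word_T_relations[OF q0] poly | simp)+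
  from yh_alg_hom[OF this] obtain H :: "yh_alg \<Rightarrow> nat list operator" where H: "alg_hom H"
    and Hg: "\<And>y. y \<in> yh_gens n0 \<Longrightarrow> H (yh_elt y) = case_yh_gen (\<lambda>_. 1) ?T (u \<star> 1) (inverse u \<star> 1) y" by blast
  from yh_alg_hom[OF Y0.trivial_character[OF m]] obtain \<chi> :: "yh_alg \<Rightarrow> complex" where \<chi>: "alg_hom \<chi>"
    and \<chi>g: "\<And>y. y \<in> yh_gens n0 \<Longrightarrow> \<chi> (yh_elt y) = case_yh_gen (\<lambda>_. 1) (\<lambda>_. q) u (inverse u) y"
    unfolding q_def u_def by blast
  interpret H: alg_hom H by (rule H)
  interpret \<chi>: alg_hom \<chi> by (rule \<chi>)
  interpret T: braid_generators n0 q ?T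
    by unfold_locales (fact q0 word_T_relations[OF q0])+
  define x where "x = symmetrizer q (\<lambda>i. yh_elt (GG i)) n0"
  have g: "GG i \<in> yh_gens n0" if "1 \<le> i" "i < n0" for i using that by (simp add: yh_gens_def)
  have Hx: "H x = symmetrizer q ?T n0"
    unfolding x_def H.H_symmetrizer by (rule symmetrizer_cong) (simp add: Hg[OF g])
  have "\<chi> x = symmetrizer q (\<lambda>_. q) n0"
    unfolding x_def \<chi>.H_symmetrizer by (rule symmetrizer_cong) (simp add: \<chi>g[OF g])
  then have \<chi>x: "\<chi> x = 0" using zero by (simp add: symmetrizer_const q_def)
  have "H x = 0"
  proof (rule nilpotent_image[OF dec H])
    show "\<chi> x = 0" by (rule \<chi>x)
    show "H a * H x = \<chi> a \<star> H x" for a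
    proof (rule eigen_extend[OF H \<chi>])
      fix y assume y: "y \<in> yh_gens n0"
      then show "H (yh_elt y) * H x = \<chi> (yh_elt y) \<star> H x"
        unfolding Hg[OF y] \<chi>g[OF y] Hx
        by (cases rule: gens_cases) (simp_all add: T.symmetrizer_eigen)
    qed
  qed
  then have "app (symmetrizer q ?T n0) (\<lambda>xs. if xs = [0..<n0] then 1 else 0) [0..<n0] = 0"
    unfolding Hx by (simp add: app_simps)
  then show False using symmetrizer_nonzero[of n0 n0 q] by simp
qed

section \<open>Evaluation of P under \<theta>\<close>

context yh_params
begin

lemma RR_sum: "(\<And>i. i \<in> I \<Longrightarrow> f i \<in> RR) \<Longrightarrow> (\<Sum>i\<in>I. f i) \<in> RR"
  and RR_prod: "(\<And>i. i \<in> I \<Longrightarrow> f i \<in> RR) \<Longrightarrow> (\<Prod>i\<in>I. f i) \<in> RR"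
  by (induction I rule: infinite_finite_induct) (auto intro: subring_setD[OF subring_RR])

lemma theta_sum: "(\<And>i. i \<in> I \<Longrightarrow> f i \<in> RR) \<Longrightarrow> \<theta> (\<Sum>i\<in>I. f i) = (\<Sum>i\<in>I. \<theta> (f i))"
  by (induction I rule: infinite_finite_induct) (auto simp: theta_zero theta_add RR_sum)

lemma theta_prod: "(\<And>i. i \<in> I \<Longrightarrow> f i \<in> RR) \<Longrightarrow> \<theta> (\<Prod>i\<in>I. f i) = (\<Prod>i\<in>I. \<theta> (f i))"
  by (induction I rule: infinite_finite_induct) (auto simp: theta_one theta_mult RR_prod)

lemma theta_qpow: "\<theta> (qpow (int k)) = q ^ k" and theta_qpow_neg: "\<theta> (qpow (- int k)) = inverse (q ^ k)"
proof -
  show p: "\<theta> (qpow (int k)) = q ^ k"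
  proof (induction k)
    case (Suc k)
    have "qpow (int (Suc k)) = qpow 1 * qpow (int k)" by (simp add: qpow_add[symmetric])
    then show ?case using Suc by (simp add: theta_mult qpow_RR q_def)
  qed (simp add: qpow_0 theta_one)
  have "\<theta> (qpow (- int k)) * q ^ k = 1"
    unfolding p[symmetric] by (simp add: theta_mult[symmetric] qpow_RR qpow_add[symmetric] qpow_0 theta_one)
  then show "\<theta> (qpow (- int k)) = inverse (q ^ k)" by (metis inverse_unique mult.commute)
qed

lemma theta_ss_poly:
  "\<theta> (ss_poly m n) = (\<Prod>k=1..n. \<Sum>i<k. q ^ (2 * i)) *
     (\<Prod>(s, t)\<in>{(s, t). 1 \<le> s \<and> s < t \<and> t \<le> m}. \<Prod>l\<in>{- int n<..<int n}. \<theta> (qpow (2 * l)) * v s - v t)"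
proof -
  let ?P = "{(s, t). 1 \<le> s \<and> s < t \<and> t \<le> m}"
  have 1: "qpow (2 * int i) \<in> RR" for i by (rule qpow_RR)
  have 2: "qpow (2 * l) * vvar s - vvar t \<in> RR" and 3: "\<theta> (qpow (2 * l) * vvar s - vvar t) = \<theta> (qpow (2 * l)) * v s - v t"
    if "(s, t) \<in> ?P" for s t l
  proof -
    have v: "vvar s \<in> RR" "vvar t \<in> RR" using that by (auto intro: vvar_RR)
    have m: "qpow (2 * l) * vvar s \<in> RR" using v qpow_RR subring_setD(3)[OF subring_RR] by blast
    show "qpow (2 * l) * vvar s - vvar t \<in> RR" using m v subring_setD(4)[OF subring_RR] by blast
    show "\<theta> (qpow (2 * l) * vvar s - vvar t) = \<theta> (qpow (2 * l)) * v s - v t"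
      using m v by (simp add: theta_diff theta_mult qpow_RR v_def)
  qed
  let ?A = "\<Prod>k=1..n. \<Sum>i<k. qpow (2 * int i)"
  let ?B = "\<Prod>(s, t)\<in>?P. \<Prod>l\<in>{- int n<..<int n}. qpow (2 * l) * vvar s - vvar t"
  have A: "?A \<in> RR" by (intro RR_prod RR_sum 1)
  have B: "?B \<in> RR" using 2 by (intro RR_prod) (auto intro!: RR_prod)
  have "\<theta> ?A = (\<Prod>k=1..n. \<Sum>i<k. q ^ (2 * i))"
    using theta_qpow[of "2 * _"] by (subst theta_prod, intro RR_sum 1) (simp add: theta_sum 1)
  moreover have "\<theta> ?B = (\<Prod>(s, t)\<in>?P. \<Prod>l\<in>{- int n<..<int n}. \<theta> (qpow (2 * l)) * v s - v t)"
  proof -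
    have "\<theta> ?B = (\<Prod>st\<in>?P. \<theta> (case st of (s, t) \<Rightarrow> \<Prod>l\<in>{- int n<..<int n}. qpow (2 * l) * vvar s - vvar t))"
      using 2 by (intro theta_prod) (auto intro!: RR_prod)
    also have "\<dots> = (\<Prod>(s, t)\<in>?P. \<Prod>l\<in>{- int n<..<int n}. \<theta> (qpow (2 * l)) * v s - v t)"
    proof (rule prod.cong[OF refl])
      fix st assume st: "st \<in> ?P"
      obtain s t where e: "st = (s, t)" by (cases st)
      show "\<theta> (case st of (s, t) \<Rightarrow> \<Prod>l\<in>{- int n<..<int n}. qpow (2 * l) * vvar s - vvar t)
          = (case st of (s, t) \<Rightarrow> \<Prod>l\<in>{- int n<..<int n}. \<theta> (qpow (2 * l)) * v s - v t)"
        unfolding e prod.case using 2 3 st[unfolded e] by (subst theta_prod) auto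
    qed
    finally show ?thesis .
  qed
  ultimately show ?thesis unfolding ss_poly_def theta_mult[OF A B] by simp
qed

text \<open>A factor with negative exponent for s < t says the same as one with positive exponent
  for the exchanged pair. This puts P into the form in which both directions use it.\<close>

lemma theta_ss_poly_nonzero_iff:
  "\<theta> (ss_poly m n) \<noteq> 0 \<longleftrightarrow> (\<Prod>k=1..n. \<Sum>i<k. q ^ (2 * i)) \<noteq> 0 \<and>
     (\<forall>s\<in>{1..m}. \<forall>t\<in>{1..m}. \<forall>l<n. s \<noteq> t \<longrightarrow> q ^ (2 * l) * v s \<noteq> v t)"
proof -
  let ?P = "{(s, t). 1 \<le> s \<and> s < t \<and> t \<le> m}"
  have "?P \<subseteq> {1..m} \<times> {1..m}" by auto
  then have fin: "finite ?P" by (rule finite_subset) simp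
  have pos: "\<theta> (qpow (2 * int l)) = q ^ (2 * l)" and neg: "\<theta> (qpow (2 * - int l)) = inverse (q ^ (2 * l))" for l
    using theta_qpow[of "2 * l"] theta_qpow_neg[of "2 * l"] by simp_all
  have "(\<Prod>(s, t)\<in>?P. \<Prod>l\<in>{- int n<..<int n}. \<theta> (qpow (2 * l)) * v s - v t) \<noteq> 0
      \<longleftrightarrow> (\<forall>(s, t)\<in>?P. \<forall>l\<in>{- int n<..<int n}. \<theta> (qpow (2 * l)) * v s \<noteq> v t)"
    using fin by (auto simp: prod_zero_iff)
  also have "\<dots> \<longleftrightarrow> (\<forall>s\<in>{1..m}. \<forall>t\<in>{1..m}. \<forall>l<n. s \<noteq> t \<longrightarrow> q ^ (2 * l) * v s \<noteq> v t)"
  proof (intro iffI ballI allI impI)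
    fix s t l assume a: "\<forall>(s, t)\<in>?P. \<forall>l\<in>{- int n<..<int n}. \<theta> (qpow (2 * l)) * v s \<noteq> v t"
      and st: "s \<in> {1..m}" "t \<in> {1..m}" "l < n" "s \<noteq> t"
    show "q ^ (2 * l) * v s \<noteq> v t"
    proof (cases "s < t")
      case True
      then have "(s, t) \<in> ?P" "int l \<in> {- int n<..<int n}" using st by auto
      then have "\<theta> (qpow (2 * int l)) * v s \<noteq> v t" using a by fast
      then show ?thesis unfolding pos .
    next
      case False
      then have "(t, s) \<in> ?P" "- int l \<in> {- int n<..<int n}" using st by auto
      then have "\<theta> (qpow (2 * - int l)) * v t \<noteq> v s" using a by fast
      then show ?thesis unfolding neg using q_nz by (auto simp: field_simps)
    qed
  next
    fix st assume a: "\<forall>s\<in>{1..m}. \<forall>t\<in>{1..m}. \<forall>l<n. s \<noteq> t \<longrightarrow> q ^ (2 * l) * v s \<noteq> v t" and st: "st \<in> ?P"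
    obtain s t where e: "st = (s, t)" by (cases st)
    have s: "s \<in> {1..m}" "t \<in> {1..m}" "s \<noteq> t" using st e by auto
    have "\<theta> (qpow (2 * z)) * v s \<noteq> v t" if z: "z \<in> {- int n<..<int n}" for z
    proof (cases z rule: int_cases2)
      case (nonneg l)
      then have "l < n" using z by simp
      then have "q ^ (2 * l) * v s \<noteq> v t" using a[rule_format, OF s(1,2)] s(3) by simp
      then show ?thesis unfolding nonneg pos .
    next
      case (nonpos l)
      have l: "l < n" using z unfolding nonpos by simp
      have ts: "t \<noteq> s" using s(3) by (rule not_sym)
      have ne: "q ^ (2 * l) * v t \<noteq> v s" by (rule a[rule_format, OF s(2) s(1) l ts])
      show ?thesis
        unfolding nonpos neg
      proof
        assume "inverse (q ^ (2 * l)) * v s = v t"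
        then have "q ^ (2 * l) * v t = q ^ (2 * l) * (inverse (q ^ (2 * l)) * v s)" by simp
        also have "\<dots> = v s" using q_nz by (simp add: mult.assoc[symmetric])
        finally show False using ne by contradiction
      qed
    qed
    then show "case st of (s, t) \<Rightarrow> \<forall>l\<in>{- int n<..<int n}. \<theta> (qpow (2 * l)) * v s \<noteq> v t" unfolding e by simp
  qed
  finally show ?thesis unfolding theta_ss_poly by simp
qed

end

text \<open>The implications close up for both notions at once: a non-zero value of P gives both,
  either of them gives \<open>one_decomposes\<close>, and that gives back the non-zero
  value.\<close>

lemma main_claim_choice: "main_claim yh_choice"
proof -
  define A where "A = specialised_yokonuma_hecke d0 m0 n0 \<theta>0"
  have model: "algebra_model A Rep_yh_alg" unfolding A_def by (rule model.algebra_model_axioms)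
  define x x' where "x = yh_elt GX" and "x' = yh_elt GXinv"
  define t g where "t = (\<lambda>j. yh_elt (GT j))" and "g = (\<lambda>i. yh_elt (GG i))"
  have \<gamma>: "case_yh_gen t g x x' = yh_elt"
    by (rule ext) (simp add: t_def g_def x_def x'_def split: yh_gen.split)
  have "semisimple_ring A \<and> split_semisimple A" if nz: "\<theta>0 (ss_poly m0 n0) \<noteq> 0"
  proof -
    note P = nz[unfolded Y0.theta_ss_poly_nonzero_iff]
    have "yh_generic d0 m0 n0 Y0.q Y0.v t g x x'"
    proof (rule yh_generic.intro, unfold \<gamma>)
      show "(\<Sum>i<k. Y0.q ^ (2 * i)) \<noteq> 0" if "1 \<le> k" "k \<le> n0" for k
        using P that by (auto simp: prod_zero_iff)
      show "Y0.q ^ (2 * l) * Y0.v s \<noteq> Y0.v k" if "s \<in> {1..m0}" "k \<in> {1..m0}" "s \<noteq> k" "l < n0" for s k l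
        using P that by blast
      show "Y0.v k \<noteq> 0" if "k \<in> {1..m0}" for k using that Y0.v_nz by simp
      show "yh_relations d0 m0 n0 Y0.q Y0.v yh_elt" by (rule yh_elt_relations)
      show "Q a" if "\<And>c. Q (c \<star> 1)" "\<And>a b. Q a \<Longrightarrow> Q b \<Longrightarrow> Q (a + b)" "\<And>a b. Q a \<Longrightarrow> Q b \<Longrightarrow> Q (a * b)"
        "\<And>x. x \<in> yh_gens n0 \<Longrightarrow> Q (yh_elt x)" for Q a
        using that by (rule yh_alg_induct)
    qed (fact Y0.d_pos Y0.n_pos Y0.m_pos Y0.q_nz)+
    then show ?thesis by (rule yh_generic.semisimple_and_split[OF _ model])
  qed
  moreover have "\<theta>0 (ss_poly m0 n0) \<noteq> 0" if "one_decomposes TYPE(yh_alg)"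
    unfolding Y0.theta_ss_poly_nonzero_iff
    using quantum_factorial_nonzero[OF that] v_separated[OF that] by blast
  moreover have "one_decomposes TYPE(yh_alg)" if "semisimple_ring A \<or> split_semisimple A"
    using that algebra_model.semisimple_imp_one_decomposes[OF model] algebra_model.split_imp_one_decomposes[OF model] by blast
  ultimately show ?thesis unfolding yh_choice_eq main_claim_def A_def[symmetric] prod.case by blast
qed

theorem proposition4p7:
  fixes d n m :: nat and \<theta> :: "laurent \<Rightarrow> complex"
  assumes "d > 0" and "n > 0" and "m > 0"
    and "\<theta> \<in> Ring.ring_hom (laurent_ring m) (ring_of_type_algebra :: complex ring)"
    and "\<And>c. \<theta> (laurent_const c) = c"
  shows "(semisimple_ring (specialised_yokonuma_hecke d m n \<theta>) \<longleftrightarrow> \<theta> (ss_poly m n) \<noteq> 0) \<and>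
         (split_semisimple (specialised_yokonuma_hecke d m n \<theta>) \<longleftrightarrow> \<theta> (ss_poly m n) \<noteq> 0)"
proof -
  have "admissible (d, m, n, \<theta>)" using assms by (simp add: admissible_def yh_params_def)
  from yh_choice(2)[OF main_claim_choice this] show ?thesis by (simp only: main_claim_def prod.case)
qed

end
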